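(* Let $(M,g)$ be a connected $n$-dimensional irreducible locally symmetric space. If the curvature operator of the second kind of $(M,g)$ is $N$-nonnegative or $N$-nonpositive for some real number $N<\frac{3n}{2}\,\frac{n+2}{n+4}$, then $(M,g)$ has constant curvature.
   Context: Completeness of manifolds is not assumed. Locally symmetric means $\nabla R=0$; irreducible means that the restricted holonomy group (parallel transports along contractible loops at a point $q$) acts irreducibly on $T_qM$. Curvature convention: in a local orthonormal frame $e_1,\dots,e_n$, the components $R_{ijkl}$ of the curvature tensor are normalized so that $R_{ijij}$ is the sectional curvature of the plane spanned by $e_i,e_j$ ($i\ne j$). On symmetric $(0,2)$-tensors at a point define the self-adjoint operator $\overline{R}$ by $(\overline{R}(h))_{ij}=\sum_{k,l}R_{iklj}h_{kl}$. The curvature operator of the second kind is the self-adjoint operator $\mathcal{R}=\mathrm{pr}\circ\overline{R}$ on the space $S_0^2(TM)$ of trace-free symmetric $(0,2)$-tensors at the point, where $\mathrm{pr}$ is the orthogonal projection onto $S^2_0(TM)$; equivalently $\mathcal{R}(h)=\overline{R}(h)+g(\mathrm{Ric},h)\frac{g}{n}$. Let $d=\dim S_0^2(TM)=\frac12(n-1)(n+2)$ (with $n\ge 2$), and let $\lambda_1\le\dots\le\lambda_d$ be the eigenvalues of $\mathcal{R}$ at a point. For real $1\le k\le d$, $\mathcal{R}$ is $k$-nonnegative if at every point $\lambda_1+\dots+\lambda_{\lfloor k\rfloor}+(k-\lfloor k\rfloor)\lambda_{\lfloor k\rfloor+1}\ge 0$ (the last term is omitted if $k$ is an integer), and $k$-nonpositive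 if $-\mathcal{R}$ is $k$-nonnegative. *)

theory Defs
  imports "HOL-Analysis.Analysis"
begin

section \<open>Smooth maps and atlases\<close>

definition partial_deriv ::
  "'n::finite \<Rightarrow> (real^'n \<Rightarrow> 'b::real_normed_vector) \<Rightarrow> real^'n \<Rightarrow> 'b" where
  "partial_deriv i f x = frechet_derivative f (at x) (axis i 1)"

text \<open>Meaningful for open \<open>S\<close> only, since the derivatives are taken in the full space.\<close>

primrec Ck_on :: "nat \<Rightarrow> (real^'n::finite) set \<Rightarrow> (real^'n \<Rightarrow> 'b::real_normed_vector) \<Rightarrow> bool" where
  "Ck_on 0 S f \<longleftrightarrow> continuous_on S f"
| "Ck_on (Suc k) S f \<longleftrightarrow>
     (\<forall>x\<in>S. f differentiable (at x)) \<and> (\<forall>i. Ck_on k S (partial_deriv i f))"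

definition smooth_on :: "(real^'n::finite) set \<Rightarrow> (real^'n \<Rightarrow> 'b::real_normed_vector) \<Rightarrow> bool" where
  "smooth_on S f \<longleftrightarrow> (\<forall>k. Ck_on k S f)"

text \<open>A chart is a pair of an open domain and a coordinate map, whose values outside the domain
  are irrelevant.\<close>

type_synonym ('m, 'n) chart = "'m set \<times> ('m \<Rightarrow> real^'n)"

definition is_chart :: "('m::topological_space, 'n::finite) chart \<Rightarrow> bool" where
  "is_chart c \<longleftrightarrow> open (fst c) \<and> open (snd c ` fst c) \<and>
     (\<exists>\<psi>. homeomorphism (fst c) (snd c ` fst c) (snd c) \<psi>)"

definition transition :: "('m, 'n::finite) chart \<Rightarrow> ('m, 'n) chart \<Rightarrow> real^'n \<Rightarrow> real^'n" where
  "transition c c' = snd c' \<circ> inv_into (fst c) (snd c)"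

definition smooth_atlas :: "('m::topological_space, 'n::finite) chart set \<Rightarrow> bool" where
  "smooth_atlas A \<longleftrightarrow> (\<forall>c\<in>A. is_chart c) \<and>
     (\<forall>c\<in>A. \<forall>c'\<in>A. smooth_on (snd c ` (fst c \<inter> fst c')) (transition c c'))"

definition manifold_carrier :: "('m, 'n::finite) chart set \<Rightarrow> 'm set" where
  "manifold_carrier A = (\<Union>c\<in>A. fst c)"

text \<open>Tensors are given by their components in the charts. A metric is a family \<open>g\<close> assigning to
  each chart \<open>c\<close> the Gram matrix \<open>g c x\<close> of the coordinate vector fields at the point with
  coordinates \<open>x\<close>; the components in different charts are related by the tensor transformation
  law.\<close>

type_synonym 'n metric = "real^'n \<Rightarrow> real^'n^'n"

definition inner_at :: "'n::finite metric \<Rightarrow> real^'n \<Rightarrow> real^'n \<Rightarrow> real^'n \<Rightarrow> real" where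
  "inner_at G x u v = u \<bullet> (G x *v v)"

definition riemannian_metric ::
  "('m::topological_space, 'n::finite) chart set \<Rightarrow> (('m, 'n) chart \<Rightarrow> 'n metric) \<Rightarrow> bool" where
  "riemannian_metric A g \<longleftrightarrow> (\<forall>c\<in>A.
     smooth_on (snd c ` fst c) (g c) \<and>
     (\<forall>x\<in>snd c ` fst c. transpose (g c x) = g c x \<and> (\<forall>v. v \<noteq> 0 \<longrightarrow> inner_at (g c) x v v > 0)) \<and>
     (\<forall>c'\<in>A. \<forall>x\<in>snd c ` (fst c \<inter> fst c').
        \<forall>u v. inner_at (g c) x u v =
          inner_at (g c') (transition c c' x)
            (frechet_derivative (transition c c') (at x) u)
            (frechet_derivative (transition c c') (at x) v)))"

section \<open>Levi-Civita connection and curvature in a chart\<close>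

text \<open>\<open>christoffel G x k i j\<close> is $\Gamma^k_{ij}$.\<close>

definition christoffel :: "'n::finite metric \<Rightarrow> real^'n \<Rightarrow> 'n \<Rightarrow> 'n \<Rightarrow> 'n \<Rightarrow> real" where
  "christoffel G x k i j = (1/2) * (\<Sum>l\<in>UNIV. matrix_inv (G x) $ k $ l *
     (partial_deriv i (\<lambda>y. G y $ j $ l) x + partial_deriv j (\<lambda>y. G y $ i $ l) x
      - partial_deriv l (\<lambda>y. G y $ i $ j) x))"

text \<open>\<open>curv_vec G x i j l m\<close> is the \<open>m\<close>-th component of
  $R(\partial_i,\partial_j)\partial_l =
   \nabla_i\nabla_j\partial_l - \nabla_j\nabla_i\partial_l$.\<close>

definition curv_vec :: "'n::finite metric \<Rightarrow> real^'n \<Rightarrow> 'n \<Rightarrow> 'n \<Rightarrow> 'n \<Rightarrow> 'n \<Rightarrow> real" where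
  "curv_vec G x i j l m =
     partial_deriv i (\<lambda>y. christoffel G y m j l) x - partial_deriv j (\<lambda>y. christoffel G y m i l) x
     + (\<Sum>p\<in>UNIV. christoffel G x m i p * christoffel G x p j l
               - christoffel G x m j p * christoffel G x p i l)"

text \<open>$R_{ijkl} = g(R(\partial_i,\partial_j)\partial_l,\partial_k)$, so that $R_{ijij}$ is the
  sectional curvature in an orthonormal frame.\<close>

definition curv :: "'n::finite metric \<Rightarrow> real^'n \<Rightarrow> 'n \<Rightarrow> 'n \<Rightarrow> 'n \<Rightarrow> 'n \<Rightarrow> real" where
  "curv G x i j k l = (\<Sum>m\<in>UNIV. G x $ k $ m * curv_vec G x i j l m)"

definition curv_form ::
  "'n::finite metric \<Rightarrow> real^'n \<Rightarrow> real^'n \<Rightarrow> real^'n \<Rightarrow> real^'n \<Rightarrow> real^'n \<Rightarrow> real" where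
  "curv_form G x u v w z = (\<Sum>i\<in>UNIV. \<Sum>j\<in>UNIV. \<Sum>k\<in>UNIV. \<Sum>l\<in>UNIV.
     curv G x i j k l * (u $ i) * (v $ j) * (w $ k) * (z $ l))"

text \<open>\<open>nabla_curv G x m i j k l\<close> is $(\nabla_m R)_{ijkl}$.\<close>

definition nabla_curv ::
  "'n::finite metric \<Rightarrow> real^'n \<Rightarrow> 'n \<Rightarrow> 'n \<Rightarrow> 'n \<Rightarrow> 'n \<Rightarrow> 'n \<Rightarrow> real" where
  "nabla_curv G x m i j k l =
     partial_deriv m (\<lambda>y. curv G y i j k l) x
     - (\<Sum>p\<in>UNIV. christoffel G x p m i * curv G x p j k l + christoffel G x p m j * curv G x i p k l
               + christoffel G x p m k * curv G x i j p l + christoffel G x p m l * curv G x i j k p)"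

definition locally_symmetric ::
  "('m, 'n::finite) chart set \<Rightarrow> (('m, 'n) chart \<Rightarrow> 'n metric) \<Rightarrow> bool" where
  "locally_symmetric A g \<longleftrightarrow>
     (\<forall>c\<in>A. \<forall>x\<in>snd c ` fst c. \<forall>m i j k l. nabla_curv (g c) x m i j k l = 0)"

definition sectional_curvature :: "'n::finite metric \<Rightarrow> real^'n \<Rightarrow> real^'n \<Rightarrow> real^'n \<Rightarrow> real" where
  "sectional_curvature G x u v =
     curv_form G x u v u v / (inner_at G x u u * inner_at G x v v - (inner_at G x u v)\<^sup>2)"

definition constant_curvature ::
  "('m, 'n::finite) chart set \<Rightarrow> (('m, 'n) chart \<Rightarrow> 'n metric) \<Rightarrow> bool" where
  "constant_curvature A g \<longleftrightarrow> (\<exists>\<kappa>. \<forall>c\<in>A. \<forall>x\<in>snd c ` fst c. \<forall>u v.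
     u \<noteq> v \<and> independent {u, v} \<longrightarrow> sectional_curvature (g c) x u v = \<kappa>)"

section \<open>Parallel transport and restricted holonomy\<close>

definition segments :: "real set \<Rightarrow> (real \<times> real) set" where
  "segments S = {(a, b). a \<in> S \<and> b \<in> S \<and> a < b \<and> {a<..<b} \<inter> S = {}}"

text \<open>Curves that are \<open>C\<^sup>1\<close> on each closed segment of the subdivision \<open>S\<close> of \<open>[0,1]\<close>.\<close>

definition C1_curve_subdiv ::
  "('m::topological_space, 'n::finite) chart set \<Rightarrow> real set \<Rightarrow> (real \<Rightarrow> 'm) \<Rightarrow> bool" where
  "C1_curve_subdiv A S \<gamma> \<longleftrightarrow>
     path \<gamma> \<and> path_image \<gamma> \<subseteq> manifold_carrier A \<and> finite S \<and> {0, 1} \<subseteq> S \<and> S \<subseteq> {0..1} \<and>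
     (\<forall>c\<in>A. \<forall>(a, b)\<in>segments S.
        (\<forall>t\<in>{a..b} \<inter> \<gamma> -` fst c. (snd c \<circ> \<gamma>) differentiable (at t within {a..b})) \<and>
        continuous_on ({a..b} \<inter> \<gamma> -` fst c)
          (\<lambda>t. vector_derivative (snd c \<circ> \<gamma>) (at t within {a..b})))"

text \<open>\<open>V c t\<close> is the coordinate representation in \<open>c\<close> of a tangent vector at \<open>\<gamma> t\<close>. At interior
  points of \<open>S\<close> the equation is imposed one-sidedly from both sides, so \<open>V\<close> is continuous there.\<close>

definition parallel_along ::
  "('m, 'n::finite) chart set \<Rightarrow> (('m, 'n) chart \<Rightarrow> 'n metric) \<Rightarrow> real set \<Rightarrow> (real \<Rightarrow> 'm)
     \<Rightarrow> (('m, 'n) chart \<Rightarrow> real \<Rightarrow> real^'n) \<Rightarrow> bool" where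
  "parallel_along A g S \<gamma> V \<longleftrightarrow>
     (\<forall>c\<in>A. \<forall>c'\<in>A. \<forall>t\<in>{0..1} \<inter> \<gamma> -` (fst c \<inter> fst c').
        V c' t = frechet_derivative (transition c c') (at (snd c (\<gamma> t))) (V c t)) \<and>
     (\<forall>c\<in>A. \<forall>(a, b)\<in>segments S. \<forall>t\<in>{a..b} \<inter> \<gamma> -` fst c.
        (V c has_vector_derivative
          (\<chi> k. - (\<Sum>i\<in>UNIV. \<Sum>j\<in>UNIV. christoffel (g c) (snd c (\<gamma> t)) k i j *
             vector_derivative (snd c \<circ> \<gamma>) (at t within {a..b}) $ i * V c t $ j)))
        (at t within {a..b}))"

text \<open>Parallel transports along contractible loops at \<open>q\<close>, acting on the tangent space at \<open>q\<close> in
  the coordinates of the chart \<open>c\<close>.\<close>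

definition restricted_holonomy ::
  "('m::topological_space, 'n::finite) chart set \<Rightarrow> (('m, 'n) chart \<Rightarrow> 'n metric)
     \<Rightarrow> ('m, 'n) chart \<Rightarrow> 'm \<Rightarrow> (real^'n \<Rightarrow> real^'n) set" where
  "restricted_holonomy A g c q = {P. \<exists>\<gamma> S.
     C1_curve_subdiv A S \<gamma> \<and> pathstart \<gamma> = q \<and> pathfinish \<gamma> = q \<and>
     homotopic_paths (manifold_carrier A) \<gamma> (\<lambda>_. q) \<and>
     (\<forall>v. \<exists>V. parallel_along A g S \<gamma> V \<and> V c 0 = v \<and> V c 1 = P v)}"

definition irreducible_manifold ::
  "('m::topological_space, 'n::finite) chart set \<Rightarrow> (('m, 'n) chart \<Rightarrow> 'n metric) \<Rightarrow> bool" where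
  "irreducible_manifold A g \<longleftrightarrow> (\<forall>c\<in>A. \<forall>q\<in>fst c. \<forall>W. subspace W \<and>
     (\<forall>P\<in>restricted_holonomy A g c q. P ` W \<subseteq> W) \<longrightarrow> W = {0} \<or> W = UNIV)"

section \<open>Curvature operator of the second kind\<close>

definition orthonormal_frame :: "'n::finite metric \<Rightarrow> real^'n \<Rightarrow> ('n \<Rightarrow> real^'n) \<Rightarrow> bool" where
  "orthonormal_frame G x e \<longleftrightarrow> (\<forall>i j. inner_at G x (e i) (e j) = (if i = j then 1 else 0))"

text \<open>Symmetric tensors are represented by their component matrices in an orthonormal frame; the
  induced inner product is then the standard one on matrices.\<close>

definition tracefree_sym :: "(real^'n^'n::finite) set" where
  "tracefree_sym = {h. transpose h = h \<and> trace h = 0}"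

definition orth_proj :: "'a::real_inner set \<Rightarrow> 'a \<Rightarrow> 'a" where
  "orth_proj S h = (THE y. y \<in> S \<and> (\<forall>s\<in>S. orthogonal (h - y) s))"

definition R_bar :: "'n::finite metric \<Rightarrow> real^'n \<Rightarrow> ('n \<Rightarrow> real^'n) \<Rightarrow> real^'n^'n \<Rightarrow> real^'n^'n" where
  "R_bar G x e h =
     (\<chi> i j. \<Sum>k\<in>UNIV. \<Sum>l\<in>UNIV. curv_form G x (e i) (e k) (e l) (e j) * h $ k $ l)"

definition curv_op_second ::
  "'n::finite metric \<Rightarrow> real^'n \<Rightarrow> ('n \<Rightarrow> real^'n) \<Rightarrow> real^'n^'n \<Rightarrow> real^'n^'n" where
  "curv_op_second G x e h = orth_proj tracefree_sym (R_bar G x e h)"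

text \<open>Increasing list of the eigenvalues, with multiplicity, of a self-adjoint operator \<open>T\<close> on the
  subspace \<open>S\<close>.\<close>

definition eigenvalue_list :: "'a::euclidean_space set \<Rightarrow> ('a \<Rightarrow> 'a) \<Rightarrow> real list" where
  "eigenvalue_list S T =
     (THE ls. sorted ls \<and> (\<forall>\<mu>. count_list ls \<mu> = dim {h \<in> S. T h = \<mu> *\<^sub>R h}))"

text \<open>For integral \<open>k\<close> the last term has coefficient \<open>0\<close>; list positions start at \<open>0\<close>.\<close>

definition lowest_eigenvalue_sum :: "real \<Rightarrow> real list \<Rightarrow> real" where
  "lowest_eigenvalue_sum k ls =
     (\<Sum>i<nat \<lfloor>k\<rfloor>. ls ! i) + (k - of_int \<lfloor>k\<rfloor>) * ls ! nat \<lfloor>k\<rfloor>"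

definition second_kind_nonneg ::
  "real \<Rightarrow> ('m, 'n::finite) chart set \<Rightarrow> (('m, 'n) chart \<Rightarrow> 'n metric) \<Rightarrow> bool" where
  "second_kind_nonneg k A g \<longleftrightarrow> (\<forall>c\<in>A. \<forall>x\<in>snd c ` fst c. \<forall>e. orthonormal_frame (g c) x e \<longrightarrow>
     lowest_eigenvalue_sum k (eigenvalue_list tracefree_sym (curv_op_second (g c) x e)) \<ge> 0)"

definition second_kind_nonpos ::
  "real \<Rightarrow> ('m, 'n::finite) chart set \<Rightarrow> (('m, 'n) chart \<Rightarrow> 'n metric) \<Rightarrow> bool" where
  "second_kind_nonpos k A g \<longleftrightarrow> (\<forall>c\<in>A. \<forall>x\<in>snd c ` fst c. \<forall>e. orthonormal_frame (g c) x e \<longrightarrow>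
     lowest_eigenvalue_sum k
       (eigenvalue_list tracefree_sym (\<lambda>h. - curv_op_second (g c) x e h)) \<ge> 0)"

end

theory Submission
  imports Defs
begin

text \<open>Parallel transport along a loop is an isometry that preserves the curvature tensor, because
  \<open>\<nabla>R = 0\<close>; so the eigenspaces of the Ricci tensor are invariant under holonomy, and irreducibility
  makes \<open>M\<close> Einstein. Differentiating \<open>\<nabla>R = 0\<close> once more gives \<open>R(u, v) \<cdot> R = 0\<close>. From here on the
  argument is algebra at a point, in an orthonormal frame, up to replacing \<open>R\<close> by \<open>-R\<close>.

  Let \<open>S\<^sub>i\<close> be an orthonormal eigenbasis of the curvature operator of the second kind with eigenvalues
  \<open>l i\<close>. A parallel tensor that is not invariant under all rotations gives weights \<open>f i \<ge> 0\<close>, the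
  squared norms of the action of \<open>S\<^sub>i\<close> on it, with \<open>f i \<le> a\<close>, \<open>\<Sum> f i = a (n + 2) / 2\<close> and
  \<open>\<Sum> l i f i = - \<rho> a\<close>. After a shift by a constant the weighted sum of the \<open>l i\<close> vanishes, while the
  ratio of the total weight to the largest weight is exactly \<open>3 n (n + 2) / (2 (n + 4))\<close>; this
  contradicts \<open>N\<close>-nonnegativity unless \<open>\<rho> = 0\<close>. Applied to projections, skew endomorphisms and
  4-forms commuting with the curvature, this excludes proper holonomy and two distinct nonzero
  eigenvalues of the ordinary curvature operator. If that operator has a single nonzero eigenvalue,
  the first three power sums of the \<open>l i\<close> provide weights that exclude a nontrivial kernel.\<close>

section \<open>Orthonormal bases and the spectral theorem\<close>

text \<open>For a locally symmetric space the holonomy algebra is the image of the curvature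
  operator on 2-forms. Once that operator is diagonalised by \<open>\<omega>\<close> and
  \<open>c\<close>, a tensor is parallel when every \<open>\<omega> \<gamma>\<close> with
  \<open>c \<gamma> \<noteq> 0\<close> annihilates it, and all exclusions are stated in this form.
  Irreducibility enters through the Einstein condition.

  The eigenvalues of the operator of the second kind stay unknown; averages of them can be computed
  because h \<mapsto> 2 \<Sum> c \<alpha> \<omega> \<alpha> h \<omega> \<alpha> makes sense on all
  matrices. It restricts to that operator on trace-free symmetric matrices and is multiplication by
  - c \<alpha> on \<omega> \<alpha> and by - \<rho> on the identity. Sums over the unknown
  eigenbasis are thus sums over matrix units minus explicit terms.

  The obstacle is a single nonzero c with a kernel: there the 4-form \<Sum> \<omega> \<alpha> \<and>
  \<omega> \<alpha> over the eigenspace is zero by the Bianchi identity, so weights quadratic in the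
  eigenvalues take the place of parallel tensors.\<close>

definition onb :: "'a::euclidean_space set \<Rightarrow> 'i set \<Rightarrow> ('i \<Rightarrow> 'a) \<Rightarrow> bool" where
  "onb V I b \<longleftrightarrow> finite I \<and> b ` I \<subseteq> V \<and> (\<forall>i\<in>I. \<forall>j\<in>I. b i \<bullet> b j = (if i = j then 1 else 0)) \<and>
     (\<forall>x\<in>V. x = (\<Sum>i\<in>I. (x \<bullet> b i) *\<^sub>R b i))"

lemma onb_D:
  assumes "onb V I b"
  shows "finite I" "i \<in> I \<Longrightarrow> b i \<in> V"
    "i \<in> I \<Longrightarrow> j \<in> I \<Longrightarrow> b i \<bullet> b j = (if i = j then 1 else 0)"
    "x \<in> V \<Longrightarrow> (\<Sum>i\<in>I. (x \<bullet> b i) *\<^sub>R b i) = x"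
  using assms unfolding onb_def by (auto simp: image_subset_iff)

lemma onb_reindex:
  assumes "onb V I b" "bij_betw f J I"
  shows "onb V J (b \<circ> f)"
proof -
  have "finite J" using assms bij_betw_finite onb_D(1) by blast
  moreover have "(\<Sum>i\<in>J. (x \<bullet> b (f i)) *\<^sub>R b (f i)) = (\<Sum>i\<in>I. (x \<bullet> b i) *\<^sub>R b i)" for x
    by (rule sum.reindex_bij_betw[OF assms(2)])
  ultimately show ?thesis
    using assms unfolding onb_def bij_betw_def by (auto simp: inj_on_eq_iff)
qed

lemma onb_inner:
  assumes "onb V I b" "x \<in> V"
  shows "x \<bullet> y = (\<Sum>i\<in>I. (x \<bullet> b i) * (y \<bullet> b i))"
proof -
  have "x \<bullet> y = (\<Sum>i\<in>I. (x \<bullet> b i) *\<^sub>R b i) \<bullet> y" using onb_D(4)[OF assms] by simp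
  also have "\<dots> = (\<Sum>i\<in>I. (x \<bullet> b i) * (y \<bullet> b i))"
    unfolding inner_sum_left inner_scaleR_left by (simp add: inner_commute[of y])
  finally show ?thesis .
qed

text \<open>Expanding each \<open>b' j\<close> in \<open>b\<close> produces coefficients whose sum
  over \<open>j\<close> is \<open>b i \<bullet> b k\<close> by Parseval. Values in any real vector
  space are allowed, so matrix-valued sums such as \<Sum> S X S are covered.\<close>

lemma onb_trace:
  fixes \<beta> :: "'a::euclidean_space \<Rightarrow> 'a \<Rightarrow> 'b::real_vector"
  assumes "bilinear \<beta>" "onb UNIV I b" "onb UNIV J b'"
  shows "(\<Sum>i\<in>I. \<beta> (b i) (b i)) = (\<Sum>j\<in>J. \<beta> (b' j) (b' j))"
proof -
  note I = onb_D[OF assms(2)] and J = onb_D[OF assms(3)]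
  have l: "linear (\<lambda>x. \<beta> x y)" "linear (\<beta> x)" for x y using assms(1) by (auto simp: bilinear_def)
  have "(\<Sum>j\<in>J. \<beta> (b' j) (b' j))
      = (\<Sum>j\<in>J. \<Sum>i\<in>I. \<Sum>k\<in>I. ((b i \<bullet> b' j) * (b k \<bullet> b' j)) *\<^sub>R \<beta> (b i) (b k))"
  proof (rule sum.cong[OF refl])
    fix j
    have "\<beta> (b' j) (b' j)
      = \<beta> (\<Sum>i\<in>I. (b' j \<bullet> b i) *\<^sub>R b i) (\<Sum>k\<in>I. (b' j \<bullet> b k) *\<^sub>R b k)"
      using I(4) by simp
    also have "\<dots> = (\<Sum>i\<in>I. (b' j \<bullet> b i) *\<^sub>R (\<Sum>k\<in>I. (b' j \<bullet> b k) *\<^sub>R \<beta> (b i) (b k)))"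
      unfolding linear_sum[OF l(1)] linear_scale[OF l(1)]
      unfolding linear_sum[OF l(2)] linear_scale[OF l(2)] by (rule refl)
    also have "\<dots> = (\<Sum>i\<in>I. \<Sum>k\<in>I. ((b i \<bullet> b' j) * (b k \<bullet> b' j)) *\<^sub>R \<beta> (b i) (b k))"
      by (simp add: scaleR_sum_right inner_commute)
    finally show "\<beta> (b' j) (b' j) = \<dots>" .
  qed
  also have "\<dots> = (\<Sum>i\<in>I. \<Sum>k\<in>I. \<Sum>j\<in>J. ((b i \<bullet> b' j) * (b k \<bullet> b' j)) *\<^sub>R \<beta> (b i) (b k))"
    by (subst sum.swap, rule sum.cong[OF refl], rule sum.swap)
  also have "\<dots> = (\<Sum>i\<in>I. \<Sum>k\<in>I. (b i \<bullet> b k) *\<^sub>R \<beta> (b i) (b k))"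
    by (intro sum.cong refl)
      (simp only: scaleR_sum_left[symmetric] onb_inner[OF assms(3) UNIV_I, symmetric])
  also have "\<dots> = (\<Sum>i\<in>I. \<Sum>k\<in>I. if k = i then \<beta> (b i) (b k) else 0)"
    by (intro sum.cong refl) (auto simp: I(3))
  also have "\<dots> = (\<Sum>i\<in>I. \<beta> (b i) (b i))" using I(1) by simp
  finally show ?thesis by simp
qed

text \<open>The minimum of the Rayleigh quotient on the unit sphere of \<open>V\<close>. The
  minimality is kept in the conclusion because it later sorts the eigenvalues.\<close>

lemma selfadjoint_min_eigenvector:
  fixes T :: "'a::euclidean_space \<Rightarrow> 'a"
  assumes V: "subspace V" and T: "linear T" "\<And>x. x \<in> V \<Longrightarrow> T x \<in> V"
    and sa: "\<And>x y. x \<in> V \<Longrightarrow> y \<in> V \<Longrightarrow> T x \<bullet> y = x \<bullet> T y" and ne: "V \<noteq> {0}"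
  obtains v m where "v \<in> V" "norm v = 1" "T v = m *\<^sub>R v" "\<And>y. y \<in> V \<Longrightarrow> m * (y \<bullet> y) \<le> T y \<bullet> y"
proof -
  let ?K = "V \<inter> sphere 0 1"
  obtain w where w: "w \<in> V" "w \<noteq> 0" using ne subspace_0[OF V] by blast
  have "w /\<^sub>R norm w \<in> ?K" using w V by (simp add: subspace_scale)
  hence nek: "?K \<noteq> {}" by blast
  have ck: "compact ?K" by (simp add: V closed_subspace closed_Int_compact)
  have "continuous_on ?K (\<lambda>x. T x \<bullet> x)"
    by (intro continuous_intros linear_continuous_on) (simp add: T linear_conv_bounded_linear[symmetric])
  from continuous_attains_inf[OF ck nek this] obtain v where
    v: "v \<in> ?K" and vm: "\<And>y. y \<in> ?K \<Longrightarrow> T v \<bullet> v \<le> T y \<bullet> y" by blast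
  define m where "m = T v \<bullet> v"
  have vV: "v \<in> V" and vn: "norm v = 1" and vv: "v \<bullet> v = 1" using v by (auto simp: norm_eq_1)
  have ge: "m * (y \<bullet> y) \<le> T y \<bullet> y" if y: "y \<in> V" for y
  proof (cases "y = 0")
    case True thus ?thesis by (simp add: linear_0[OF T(1)])
  next
    case False
    hence "y /\<^sub>R norm y \<in> ?K" using y V by (simp add: subspace_scale)
    from vm[OF this] have "m \<le> (T y \<bullet> y) / (norm y)\<^sup>2"
      by (simp add: m_def linear_scale[OF T(1)] power2_eq_square divide_simps)
    thus ?thesis using False by (simp add: field_simps power2_norm_eq_inner)
  qed
  \<comment> \<open>\<open>z\<close> is the residual of the eigenvector equation. Moving from
    \<open>v\<close> by \<open>- s *\<^sub>R z\<close> changes the nonnegative form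
    \<open>T y \<bullet> y - m * (y \<bullet> y)\<close> by a quadratic in \<open>s\<close> with
    linear term - 2 s (z \<bullet> z), which must vanish.\<close>
  define z where "z = T v - m *\<^sub>R v"
  have zV: "z \<in> V" unfolding z_def using V T(2) vV by (simp add: subspace_diff subspace_scale)
  define q where "q = T z \<bullet> z - m * (z \<bullet> z)"
  have q0: "0 \<le> q" using ge[OF zV] by (simp add: q_def)
  have key: "0 \<le> - 2 * s * (z \<bullet> z) + s\<^sup>2 * q" for s :: real
  proof -
    have "v - s *\<^sub>R z \<in> V" using V vV zV by (simp add: subspace_diff subspace_scale)
    from ge[OF this] have "0 \<le> T (v - s *\<^sub>R z) \<bullet> (v - s *\<^sub>R z) - m * ((v - s *\<^sub>R z) \<bullet> (v - s *\<^sub>R z))"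
      by simp
    also have "\<dots> = - 2 * s * (T v \<bullet> z - m * (v \<bullet> z)) + s\<^sup>2 * q"
    proof -
      have "T z \<bullet> v = T v \<bullet> z" using sa[OF zV vV] by (simp add: inner_commute)
      moreover have "z \<bullet> v = v \<bullet> z" by (rule inner_commute)
      ultimately show ?thesis unfolding q_def linear_diff[OF T(1)] linear_scale[OF T(1)] inner_diff_left
        inner_diff_right inner_scaleR_left inner_scaleR_right vv m_def[symmetric]
        by (simp add: algebra_simps power2_eq_square)
    qed
    also have "T v \<bullet> z - m * (v \<bullet> z) = z \<bullet> z"
      by (simp add: z_def inner_diff_left)
    finally show ?thesis .
  qed
  have "z \<bullet> z = 0"
  proof (rule ccontr)
    assume "z \<bullet> z \<noteq> 0"
    hence p: "z \<bullet> z > 0" by simp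
    \<comment> \<open>A step small enough for the linear term to win; \<open>q + 1\<close> keeps the
      denominator positive.\<close>
    define k where "k = (z \<bullet> z) / (q + 1)"
    have k: "z \<bullet> z = k * (q + 1)" "k > 0" using p q0 by (auto simp: k_def)
    have "0 \<le> - 2 * k * (k * (q + 1)) + k\<^sup>2 * q" using key[of k] k(1) by simp
    also have "\<dots> = k\<^sup>2 * (- 2 * (q + 1) + q)" by (simp add: power2_eq_square algebra_simps)
    also have "\<dots> < 0" using k q0 by (intro mult_pos_neg) auto
    finally show False by simp
  qed
  hence "T v = m *\<^sub>R v" by (simp add: z_def)
  thus ?thesis using that vV vn ge by blast
qed

text \<open>Split off a minimal eigenvector and recurse on its orthogonal complement in
  \<open>V\<close>. Each minimum bounds the later ones, so the eigenvalues come out in increasing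
  order.\<close>

lemma spectral_theorem:
  fixes T :: "'a::euclidean_space \<Rightarrow> 'a"
  assumes "linear T"
  shows "subspace V \<Longrightarrow> (\<And>x. x \<in> V \<Longrightarrow> T x \<in> V) \<Longrightarrow>
    (\<And>x y. x \<in> V \<Longrightarrow> y \<in> V \<Longrightarrow> T x \<bullet> y = x \<bullet> T y) \<Longrightarrow>
    \<exists>b ev. onb V {..<dim V} b \<and> (\<forall>i<dim V. T (b i) = ev i *\<^sub>R b i) \<and>
      (\<forall>i j. i \<le> j \<longrightarrow> j < dim V \<longrightarrow> ev i \<le> ev j)"
proof (induction "dim V" arbitrary: V)
  case 0
  hence "V = {0}" using subspace_0 by (metis dim_eq_0 subset_singletonD empty_iff)
  thus ?case using 0 by (auto simp: onb_def)
next
  case (Suc n)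
  hence "V \<noteq> {0}" by auto
  from selfadjoint_min_eigenvector[OF Suc(3) assms Suc(4,5) this]
  obtain v m where v: "v \<in> V" "norm v = 1" "T v = m *\<^sub>R v"
    and ge: "\<And>y. y \<in> V \<Longrightarrow> m * (y \<bullet> y) \<le> T y \<bullet> y" by metis
  have vv: "v \<bullet> v = 1" using v(2) by (simp add: norm_eq_1)
  define W where "W = {x \<in> V. v \<bullet> x = 0}"
  have sW: "subspace W" unfolding W_def using Suc(3)
    by (auto simp: subspace_def inner_add_right)
  have WV: "W \<subseteq> V" by (auto simp: W_def)
  have "W = {y \<in> V. \<forall>x\<in>span {v}. orthogonal x y}"
    by (auto simp: W_def span_singleton orthogonal_def)
  hence "dim W + dim (span {v}) = dim V"
    using dim_subspace_orthogonal_to_vectors[of "span {v}" V] Suc(3) v(1)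
    by (simp add: span_minimal)
  moreover have "v \<noteq> 0" using v(2) by auto
  ultimately have dW: "dim W = n" using Suc(2) by (simp add: dim_insert)
  have TW: "T x \<in> W" if "x \<in> W" for x
    using that Suc(4) Suc(5)[of v x] v by (simp add: W_def inner_commute)
  have "\<exists>b ev. onb W {..<dim W} b \<and> (\<forall>i<dim W. T (b i) = ev i *\<^sub>R b i) \<and>
      (\<forall>i j. i \<le> j \<longrightarrow> j < dim W \<longrightarrow> ev i \<le> ev j)"
    using Suc(5) WV by (intro Suc(1) dW[symmetric] sW TW) auto
  then obtain b ev where b: "onb W {..<n} b" and ev: "\<forall>i<n. T (b i) = ev i *\<^sub>R b i"
    and srt: "\<forall>i j. i \<le> j \<longrightarrow> j < n \<longrightarrow> ev i \<le> ev j"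
    unfolding dW by blast
  note bD = onb_D[OF b]
  define b' where "b' = case_nat v b"
  define ev' where "ev' = case_nat m ev"
  have bv: "v \<bullet> b i = 0" "b i \<in> V" "b i \<bullet> v = 0" if "i < n" for i
    using bD(2)[of i] that by (auto simp: W_def inner_commute)
  have onb': "onb V {..<Suc n} b'"
    unfolding onb_def
  proof (intro conjI ballI)
    show "b' ` {..<Suc n} \<subseteq> V" using v bv by (auto simp: b'_def split: nat.split)
    show "b' i \<bullet> b' j = (if i = j then 1 else 0)" if "i \<in> {..<Suc n}" "j \<in> {..<Suc n}" for i j
      using that bD(3) bv vv by (auto simp: b'_def split: nat.split)
    fix x assume x: "x \<in> V"
    have "x - (x \<bullet> v) *\<^sub>R v \<in> W"
      using x v(1) Suc(3) vv by (auto simp: W_def subspace_diff subspace_scale inner_diff_right inner_commute)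
    from bD(4)[OF this] have "(\<Sum>i<n. (x \<bullet> b i) *\<^sub>R b i) = x - (x \<bullet> v) *\<^sub>R v"
      by (simp add: inner_diff_left bv cong: sum.cong_simp)
    thus "x = (\<Sum>i<Suc n. (x \<bullet> b' i) *\<^sub>R b' i)"
      unfolding sum.lessThan_Suc_shift by (simp add: b'_def)
  qed simp
  moreover have "\<forall>i<Suc n. T (b' i) = ev' i *\<^sub>R b' i"
    using ev v by (auto simp: b'_def ev'_def split: nat.split)
  moreover have "m \<le> ev j" if "j < n" for j
    using ge[of "b j"] bv(2)[OF that] bD(3)[of j j] ev that by simp
  hence "\<forall>i j. i \<le> j \<longrightarrow> j < Suc n \<longrightarrow> ev' i \<le> ev' j"
    using srt by (auto simp: ev'_def split: nat.split)
  ultimately show ?case using Suc(2) by metis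
qed

lemma onb_dim:
  assumes "subspace V" "onb V I b"
  shows "dim V = card I"
proof -
  note b = onb_D[OF assms(2)]
  have inj: "inj_on b I"
  proof (rule inj_onI)
    fix i j assume "i \<in> I" "j \<in> I" "b i = b j"
    with b(3)[of i j] b(3)[of i i] show "i = j" by (auto split: if_splits)
  qed
  have "pairwise orthogonal (b ` I)"
    unfolding pairwise_def orthogonal_def using b(3) by auto
  moreover have "0 \<notin> b ` I" using b(3) by fastforce
  ultimately have "independent (b ` I)" by (rule pairwise_orthogonal_independent)
  moreover have "V \<subseteq> span (b ` I)"
  proof
    fix x assume "x \<in> V"
    from b(4)[OF this] have "x = (\<Sum>i\<in>I. (x \<bullet> b i) *\<^sub>R b i)" by simp
    thus "x \<in> span (b ` I)"
      by (metis (no_types, lifting) imageI span_base span_scale span_sum)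
  qed
  moreover have "b ` I \<subseteq> V" using b(2) by auto
  ultimately show ?thesis using basis_card_eq_dim[of "b ` I" V] card_image[OF inj] by simp
qed

text \<open>Identifies the definite description: multiplicities count basis vectors in an
  eigenspace, and a sorted list is determined by its multiset. \<open>T'\<close> is compared with
  the linear \<open>T\<close> on \<open>S\<close> alone, because that is where the projected
  curvature operator is identified.\<close>

lemma eigenvalue_list_eq:
  fixes T :: "'a::euclidean_space \<Rightarrow> 'a"
  assumes S: "subspace S" and T: "linear T" and TT: "\<And>h. h \<in> S \<Longrightarrow> T' h = T h"
    and b: "onb S {..<d} b" and ev: "\<And>i. i < d \<Longrightarrow> T (b i) = ev i *\<^sub>R b i"
    and srt: "\<And>i j. i \<le> j \<Longrightarrow> j < d \<Longrightarrow> ev i \<le> ev j"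
  shows "eigenvalue_list S T' = map ev [0..<d]"
proof -
  note bD = onb_D[OF b]
  let ?l = "map ev [0..<d]"
  have cnt: "count_list ?l \<mu> = dim {h \<in> S. T' h = \<mu> *\<^sub>R h}" for \<mu>
  proof -
    let ?I = "{i. i < d \<and> ev i = \<mu>}" and ?E = "{h \<in> S. T h = \<mu> *\<^sub>R h}"
    have sE: "subspace ?E" using S
      by (auto simp: subspace_def linear_add[OF T] linear_scale[OF T] linear_0[OF T] algebra_simps)
    have "onb ?E ?I b"
      unfolding onb_def
    proof (intro conjI ballI)
      show "b ` ?I \<subseteq> ?E" using bD(2) ev by auto
      show "b i \<bullet> b j = (if i = j then 1 else 0)" if "i \<in> ?I" "j \<in> ?I" for i j
        using that bD(3) by auto
      fix x assume x: "x \<in> ?E"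
      \<comment> \<open>Comparing the eigenvector equation for \<open>x\<close> with the expansion
        of \<open>T x\<close> kills the coordinates belonging to other eigenvalues.\<close>
      have "(x \<bullet> b i) *\<^sub>R b i = 0" if i: "i < d" "ev i \<noteq> \<mu>" for i
      proof -
        have "T x = T (\<Sum>j<d. (x \<bullet> b j) *\<^sub>R b j)" using bD(4) x by simp
        also have "\<dots> = (\<Sum>j<d. ((x \<bullet> b j) * ev j) *\<^sub>R b j)"
          by (simp add: linear_sum[OF T] linear_scale[OF T] ev)
        finally have "T x \<bullet> b i = (\<Sum>j<d. ((x \<bullet> b j) * ev j) * (b j \<bullet> b i))"
          by (simp add: inner_sum_left)
        also have "\<dots> = (\<Sum>j<d. if j = i then (x \<bullet> b j) * ev j else 0)"
          using i by (intro sum.cong refl) (simp add: bD(3))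
        also have "\<dots> = (x \<bullet> b i) * ev i" using i by simp
        finally have "\<mu> * (x \<bullet> b i) = (x \<bullet> b i) * ev i" using x by simp
        thus ?thesis using i by simp
      qed
      hence "(\<Sum>i\<in>?I. (x \<bullet> b i) *\<^sub>R b i) = (\<Sum>i<d. (x \<bullet> b i) *\<^sub>R b i)"
        by (intro sum.mono_neutral_left) auto
      thus "x = (\<Sum>i\<in>?I. (x \<bullet> b i) *\<^sub>R b i)" using bD(4)[of x] x by simp
    qed simp
    from onb_dim[OF sE this] have "dim ?E = card ?I" .
    moreover have "{h \<in> S. T' h = \<mu> *\<^sub>R h} = ?E" using TT by auto
    moreover have "count_list ?l \<mu> = card ?I"
    proof -
      have "count_list (map ev [0..<k]) \<mu> = card {i. i < k \<and> ev i = \<mu>}" for k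
      proof (induction k)
        case (Suc k)
        have "{i. i < Suc k \<and> ev i = \<mu>} = (if ev k = \<mu> then insert k {i. i < k \<and> ev i = \<mu>} else {i. i < k \<and> ev i = \<mu>})"
          by (auto simp: less_Suc_eq)
        thus ?case using Suc by simp
      qed simp
      thus ?thesis .
    qed
    ultimately show ?thesis by simp
  qed
  have sl: "sorted ?l" by (rule sorted_map_mono[rotated]) (auto simp: mono_on_def srt)
  show ?thesis unfolding eigenvalue_list_def
  proof (rule the_equality)
    show "sorted ?l \<and> (\<forall>\<mu>. count_list ?l \<mu> = dim {h \<in> S. T' h = \<mu> *\<^sub>R h})" using cnt sl by simp
    fix ls assume "sorted ls \<and> (\<forall>\<mu>. count_list ls \<mu> = dim {h \<in> S. T' h = \<mu> *\<^sub>R h})"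
    hence ls: "sorted ls" "count_list ls \<mu> = count_list ?l \<mu>" for \<mu>
      using cnt by auto
    have "mset ls = mset ?l"
      by (rule multiset_eqI) (simp only: count_mset ls(2))
    from properties_for_sort[OF this ls(1)] show "ls = ?l"
      using sl by (simp only: sorted_sort_id)
  qed
qed

lemma orth_proj_mem:
  assumes "h \<in> S" "subspace S"
  shows "orth_proj S h = h"
  unfolding orth_proj_def
proof (rule the_equality)
  show "h \<in> S \<and> (\<forall>s\<in>S. orthogonal (h - h) s)" using assms by (simp add: orthogonal_def)
  fix y assume y: "y \<in> S \<and> (\<forall>s\<in>S. orthogonal (h - y) s)"
  hence "orthogonal (h - y) (h - y)" using assms by (blast intro: subspace_diff)
  thus "y = h" by (simp add: orthogonal_def)
qed

section \<open>Matrix algebra\<close>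

lemma bilinear_matrix_mult: "bilinear ((**) :: real^'n^'m \<Rightarrow> real^'p^'n \<Rightarrow> real^'p^'m)"
  unfolding bilinear_def
  by (auto intro!: linearI simp: vec_eq_iff matrix_matrix_mult_def sum.distrib sum_distrib_left algebra_simps)

lemmas matrix_mult_simps =
  bilinear_ladd[OF bilinear_matrix_mult] bilinear_radd[OF bilinear_matrix_mult]
  bilinear_lsub[OF bilinear_matrix_mult] bilinear_rsub[OF bilinear_matrix_mult]
  bilinear_lneg[OF bilinear_matrix_mult] bilinear_rneg[OF bilinear_matrix_mult]
  bilinear_lmul[OF bilinear_matrix_mult] bilinear_rmul[OF bilinear_matrix_mult]
  bilinear_lzero[OF bilinear_matrix_mult] bilinear_rzero[OF bilinear_matrix_mult]

lemma matrix_mult_sum_left: "(\<Sum>i\<in>I. f i) ** (B :: real^'p^'n) = (\<Sum>i\<in>I. f i ** B)"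
  and matrix_mult_sum_right: "(A :: real^'n^'m) ** (\<Sum>i\<in>I. g i) = (\<Sum>i\<in>I. A ** g i)"
proof -
  have l: "linear (\<lambda>A. A ** B)" "linear (\<lambda>X. A ** X)"
    using bilinear_matrix_mult[unfolded bilinear_def] by blast+
  show "(\<Sum>i\<in>I. f i) ** B = (\<Sum>i\<in>I. f i ** B)" by (rule linear_sum[OF l(1)])
  show "A ** (\<Sum>i\<in>I. g i) = (\<Sum>i\<in>I. A ** g i)" by (rule linear_sum[OF l(2)])
qed

lemma linear_transpose: "linear (transpose :: real^'n^'m \<Rightarrow> real^'m^'n)"
  by (auto intro!: linearI simp: transpose_def vec_eq_iff)

lemma linear_trace: "linear (trace :: real^'n^'n \<Rightarrow> real)"
  by (auto intro!: linearI simp: trace_def sum.distrib sum_distrib_left)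

lemmas transpose_simps = linear_add[OF linear_transpose] linear_diff[OF linear_transpose]
  linear_neg[OF linear_transpose] linear_scale[OF linear_transpose] linear_0[OF linear_transpose]
  linear_sum[OF linear_transpose] matrix_transpose_mul
lemmas trace_simps = linear_add[OF linear_trace] linear_diff[OF linear_trace]
  linear_neg[OF linear_trace] linear_scale[OF linear_trace] linear_0[OF linear_trace]
  linear_sum[OF linear_trace]

lemma trace_transpose: "trace (transpose A) = trace (A :: real^'n^'n)"
  by (simp add: trace_def transpose_def)

lemma inner_matrix: "(A :: real^'n^'m) \<bullet> B = (\<Sum>i\<in>UNIV. \<Sum>j\<in>UNIV. A $ i $ j * B $ i $ j)"
  by (simp add: inner_vec_def)

lemma inner_matrix_trace: "(A :: real^'n^'n) \<bullet> B = trace (transpose A ** B)"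
proof -
  have "trace (transpose A ** B) = (\<Sum>j\<in>UNIV. \<Sum>i\<in>UNIV. A $ i $ j * B $ i $ j)"
    by (simp add: trace_def matrix_matrix_mult_def transpose_def)
  also have "\<dots> = (\<Sum>i\<in>UNIV. \<Sum>j\<in>UNIV. A $ i $ j * B $ i $ j)" by (rule sum.swap)
  finally show ?thesis by (simp add: inner_matrix)
qed

lemma inner_mult_left: "((A :: real^'n^'n) ** (B :: real^'n^'n)) \<bullet> C = B \<bullet> (transpose A ** C)"
  by (simp add: inner_matrix_trace matrix_transpose_mul matrix_mul_assoc)

lemma inner_mult_right: "((A :: real^'n^'n) ** (B :: real^'n^'n)) \<bullet> C = A \<bullet> (C ** transpose B)"
  by (simp add: inner_matrix_trace matrix_transpose_mul matrix_mul_assoc)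
     (metis matrix_mul_assoc trace_mul_sym)

lemma inner_transpose: "transpose (A :: real^'n^'n) \<bullet> transpose B = A \<bullet> B"
  by (simp add: inner_matrix_trace) (metis matrix_transpose_mul trace_mul_sym trace_transpose transpose_transpose)

lemma inner_mat1: "(mat 1 :: real^'n^'n) \<bullet> A = trace A" "(A :: real^'n^'n) \<bullet> mat 1 = trace A"
  by (simp_all add: inner_matrix_trace trace_transpose)

definition mat_unit :: "'n \<Rightarrow> 'n \<Rightarrow> real^'n^'n" where
  "mat_unit i j = axis i (axis j 1)"

lemma mat_unit_nth: "(mat_unit i j :: real^'n^'n) $ a $ b = (if a = i \<and> b = j then 1 else 0)"
  by (auto simp: mat_unit_def axis_def)

lemma mat_unit_mult:
  "(mat_unit i j ** (X :: real^'n^'n)) $ a $ b = (if a = i then X $ j $ b else 0)"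
  "((X :: real^'n^'n) ** mat_unit i j) $ a $ b = (if b = j then X $ a $ i else 0)"
proof -
  have "(mat_unit i j ** X) $ a $ b = (\<Sum>k\<in>UNIV. if k = j then (if a = i then X $ k $ b else 0) else 0)"
    unfolding matrix_matrix_mult_def vec_lambda_beta by (intro sum.cong refl) (auto simp: mat_unit_nth)
  thus "(mat_unit i j ** X) $ a $ b = (if a = i then X $ j $ b else 0)" by simp
  have "(X ** mat_unit i j) $ a $ b = (\<Sum>k\<in>UNIV. if k = i then (if b = j then X $ a $ k else 0) else 0)"
    unfolding matrix_matrix_mult_def vec_lambda_beta by (intro sum.cong refl) (auto simp: mat_unit_nth)
  thus "(X ** mat_unit i j) $ a $ b = (if b = j then X $ a $ i else 0)" by simp
qed

lemma transpose_mat_unit: "transpose (mat_unit i j) = (mat_unit j i :: real^'n^'n)"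
  by (auto simp: mat_unit_def transpose_def vec_eq_iff axis_def)

text \<open>Completeness relations of the matrix units. Together with \<open>onb_trace\<close> they
  evaluate \<Sum> B X B and \<Sum> B X B^T over any orthonormal basis of the matrices.\<close>

lemma sum_mat_unit_sandwich:
  "(\<Sum>i\<in>UNIV. \<Sum>j\<in>UNIV. mat_unit i j ** X ** mat_unit i j) = transpose (X :: real^'n^'n)"
  "(\<Sum>i\<in>UNIV. \<Sum>j\<in>UNIV. mat_unit i j ** X ** mat_unit j i) = trace X *\<^sub>R (mat 1 :: real^'n^'n)"
proof -
  show "(\<Sum>i\<in>UNIV. \<Sum>j\<in>UNIV. mat_unit i j ** X ** mat_unit i j) = transpose X"
  proof (unfold vec_eq_iff, intro allI)
    fix a b :: 'n
    have "(\<Sum>i\<in>UNIV. \<Sum>j\<in>UNIV. (mat_unit i j ** X ** mat_unit i j) $ a $ b)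
      = (\<Sum>i\<in>UNIV. \<Sum>j\<in>UNIV. if j = b then (if i = a then X $ j $ i else 0) else 0)"
      by (intro sum.cong refl) (simp add: mat_unit_mult)
    thus "(\<Sum>i\<in>UNIV. \<Sum>j\<in>UNIV. mat_unit i j ** X ** mat_unit i j) $ a $ b = transpose X $ a $ b"
      by (simp add: transpose_def)
  qed
  show "(\<Sum>i\<in>UNIV. \<Sum>j\<in>UNIV. mat_unit i j ** X ** mat_unit j i) = trace X *\<^sub>R (mat 1 :: real^'n^'n)"
  proof (unfold vec_eq_iff, intro allI)
    fix a b :: 'n
    have "(\<Sum>i\<in>UNIV. \<Sum>j\<in>UNIV. (mat_unit i j ** X ** mat_unit j i) $ a $ b)
      = (\<Sum>i\<in>UNIV. if i = a then (if a = b then trace X else 0) else 0)"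
    proof (intro sum.cong refl)
      fix i :: 'n
      show "(\<Sum>j\<in>UNIV. (mat_unit i j ** X ** mat_unit j i) $ a $ b)
        = (if i = a then (if a = b then trace X else 0) else 0)"
        by (cases "a = i"; cases "b = i") (simp_all add: mat_unit_mult trace_def)
    qed
    thus "(\<Sum>i\<in>UNIV. \<Sum>j\<in>UNIV. mat_unit i j ** X ** mat_unit j i) $ a $ b
        = (trace X *\<^sub>R (mat 1 :: real^'n^'n)) $ a $ b"
      by (simp add: mat_def)
  qed
qed

lemma inner_mat_unit: "(A :: real^'n^'n) \<bullet> mat_unit i j = A $ i $ j"
proof -
  have "A \<bullet> mat_unit i j = (\<Sum>a\<in>UNIV. \<Sum>b\<in>UNIV. if b = j then (if a = i then A $ a $ b else 0) else 0)"
    unfolding inner_matrix by (intro sum.cong refl) (auto simp: mat_unit_nth)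
  thus ?thesis by simp
qed

text \<open>The left side is the trace of the linear map X \<mapsto> A X B.\<close>

lemma sum_mat_unit_inner:
  "(\<Sum>i\<in>UNIV. \<Sum>j\<in>UNIV. ((A :: real^'n^'n) ** mat_unit i j ** B) \<bullet> mat_unit i j) = trace A * trace B"
proof -
  have *: "(A ** mat_unit i j ** B) $ i $ j = A $ i $ i * B $ j $ j" for i j
  proof -
    have "(A ** mat_unit i j ** B) $ i $ j = (\<Sum>k\<in>UNIV. if k = j then A $ i $ i * B $ k $ j else 0)"
      unfolding matrix_matrix_mult_def[of "A ** mat_unit i j"] vec_lambda_beta
      by (intro sum.cong refl) (auto simp: mat_unit_mult)
    thus ?thesis by simp
  qed
  show ?thesis
    by (simp add: inner_mat_unit * trace_def sum_product)
qed

lemma onb_mat_unit: "onb UNIV UNIV (\<lambda>p. mat_unit (fst p) (snd p) :: real^'n^'n)"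
  unfolding onb_def
proof (intro conjI ballI)
  show "(mat_unit (fst p) (snd p) :: real^'n^'n) \<bullet> mat_unit (fst q) (snd q) = (if p = q then 1 else 0)" for p q
    by (cases p; cases q) (auto simp: inner_mat_unit mat_unit_nth)
  fix x :: "real^'n^'n"
  have "(\<Sum>p\<in>UNIV. (x \<bullet> mat_unit (fst p) (snd p)) *\<^sub>R mat_unit (fst p) (snd p))
      = (\<Sum>i\<in>UNIV. \<Sum>j\<in>UNIV. (x $ i $ j) *\<^sub>R mat_unit i j)"
    unfolding UNIV_Times_UNIV[symmetric] sum.cartesian_product
    by (simp add: inner_mat_unit case_prod_unfold del: UNIV_Times_UNIV)
  also have "\<dots> = x"
  proof (unfold vec_eq_iff, intro allI)
    fix a b
    have "(\<Sum>i\<in>UNIV. \<Sum>j\<in>UNIV. ((x $ i $ j) *\<^sub>R (mat_unit i j :: real^'n^'n)) $ a $ b)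
      = (\<Sum>i\<in>UNIV. \<Sum>j\<in>UNIV. if j = b then (if i = a then x $ i $ j else 0) else 0)"
      by (intro sum.cong refl) (auto simp: mat_unit_nth)
    thus "(\<Sum>i\<in>UNIV. \<Sum>j\<in>UNIV. (x $ i $ j) *\<^sub>R mat_unit i j) $ a $ b = x $ a $ b" by simp
  qed
  finally show "x = (\<Sum>p\<in>UNIV. (x \<bullet> mat_unit (fst p) (snd p)) *\<^sub>R mat_unit (fst p) (snd p))" ..
qed auto

section \<open>Skew matrices, commutators and the orthogonal splitting of the matrix space\<close>

definition skew :: "(real^'n^'n) set" where
  "skew = {A. transpose A = - A}"

definition commut :: "real^'n^'n \<Rightarrow> real^'n^'n \<Rightarrow> real^'n^'n" where
  "commut A B = A ** B - B ** A"

lemma subspace_skew: "subspace (skew :: (real^'n^'n) set)"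
  by (auto simp: subspace_def skew_def transpose_simps)

lemma subspace_tracefree_sym: "subspace (tracefree_sym :: (real^'n^'n) set)"
  by (auto simp: subspace_def tracefree_sym_def transpose_simps trace_simps)

lemma trace_skew: "A \<in> skew \<Longrightarrow> trace A = 0"
  using trace_transpose[of A] by (simp add: skew_def trace_simps)

lemma skew_sym_orthogonal:
  assumes "A \<in> skew" "transpose B = B"
  shows "A \<bullet> B = 0"
  using inner_transpose[of A B] assms by (simp add: skew_def)

lemma commut_skew: "A \<in> skew \<Longrightarrow> B \<in> skew \<Longrightarrow> commut A B \<in> skew"
  by (simp add: skew_def commut_def transpose_simps matrix_mult_simps)

text \<open>Matrices split orthogonally into trace-free symmetric, scalar and skew ones. A sum over
  an unknown eigenbasis \<open>S\<close> can therefore be exchanged for a sum over matrix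
  units.\<close>

lemma matrix_orthonormal_split:
  fixes \<beta> :: "real^'n^'n \<Rightarrow> real^'n^'n \<Rightarrow> 'b::real_vector"
  assumes "bilinear \<beta>" and w: "onb skew J \<omega>" and S: "onb tracefree_sym I S"
  shows "(\<Sum>i\<in>UNIV. \<Sum>j\<in>UNIV. \<beta> (mat_unit i j) (mat_unit i j)) =
    (\<Sum>a\<in>I. \<beta> (S a) (S a)) + (1 / real CARD('n)) *\<^sub>R \<beta> (mat 1) (mat 1) + (\<Sum>a\<in>J. \<beta> (\<omega> a) (\<omega> a))"
proof -
  let ?n = "real CARD('n)"
  \<comment> \<open>\<open>mat 1\<close> has squared norm n; this normalisation is the source of the
    factor 1/n.\<close>
  define e where "e = (1 / sqrt ?n) *\<^sub>R (mat 1 :: real^'n^'n)"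
  have n: "?n > 0" by simp
  define b where "b = case_sum S (case_sum (\<lambda>u::unit. e) \<omega>)"
  let ?K = "I <+> ({()} <+> J)"
  note Sd = onb_D[OF S] and wd = onb_D[OF w]
  have so: "A \<bullet> B = 0" "B \<bullet> A = 0" if "A \<in> skew" "B \<in> tracefree_sym" for A B :: "real^'n^'n"
    using skew_sym_orthogonal[of A B] that by (auto simp: tracefree_sym_def inner_commute[of B])
  have eo: "A \<bullet> mat 1 = 0" "mat 1 \<bullet> A = 0" if "A \<in> skew \<or> A \<in> tracefree_sym" for A :: "real^'n^'n"
    using that trace_skew by (auto simp: inner_mat1 tracefree_sym_def)
  have eo': "A \<bullet> e = 0" "e \<bullet> A = 0" if "A \<in> skew \<or> A \<in> tracefree_sym" for A
    using eo[OF that] by (auto simp: e_def)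
  have ee: "e \<bullet> e = 1" using n by (simp add: e_def inner_mat1 trace_I trace_simps)
  have fin: "finite ?K" using Sd(1) wd(1) by auto
  have "onb UNIV ?K b"
    unfolding onb_def
  proof (intro conjI ballI)
    show "b k \<bullet> b l = (if k = l then 1 else 0)" if "k \<in> ?K" "l \<in> ?K" for k l
      using that by (auto simp: b_def Sd(3) wd(3) so[OF wd(2) Sd(2)] eo' Sd(2) wd(2) ee split: if_splits)
    fix x :: "real^'n^'n"
    \<comment> \<open>\<open>s\<close> and \<open>t\<close> are the trace-free symmetric and the
      skew part of \<open>x\<close>.\<close>
    define s where "s = (1/2) *\<^sub>R (x + transpose x) - (trace x / ?n) *\<^sub>R mat 1"
    define t where "t = (1/2) *\<^sub>R (x - transpose x)"
    have sS: "s \<in> tracefree_sym" using n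
      by (simp add: s_def tracefree_sym_def transpose_simps trace_simps trace_transpose trace_I add.commute)
    have tT: "t \<in> skew" by (simp add: t_def skew_def transpose_simps algebra_simps)
    have x: "x = s + (trace x / ?n) *\<^sub>R mat 1 + t"
      by (simp add: s_def t_def vec_eq_iff field_simps)
    have 1: "x \<bullet> S a = s \<bullet> S a" if "a \<in> I" for a
      using so[OF tT Sd(2)[OF that]] eo(2)[of "S a"] Sd(2)[OF that]
      by (subst x) (simp add: inner_add_left)
    have 2: "x \<bullet> \<omega> a = t \<bullet> \<omega> a" if "a \<in> J" for a
      using so[OF wd(2)[OF that] sS] eo(2)[of "\<omega> a"] wd(2)[OF that]
      by (subst x) (simp add: inner_add_left)
    have "(\<Sum>k\<in>?K. (x \<bullet> b k) *\<^sub>R b k) = (\<Sum>a\<in>I. (x \<bullet> S a) *\<^sub>R S a) + ((x \<bullet> e) *\<^sub>R e + (\<Sum>a\<in>J. (x \<bullet> \<omega> a) *\<^sub>R \<omega> a))"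
      using Sd(1) wd(1) by (simp add: sum.Plus b_def)
    also have "\<dots> = s + ((trace x / ?n) *\<^sub>R mat 1 + t)"
    proof -
      have "(x \<bullet> e) *\<^sub>R e = (trace x / ?n) *\<^sub>R mat 1" using n by (simp add: e_def inner_mat1)
      thus ?thesis using onb_D(4)[OF S sS] onb_D(4)[OF w tT] by (simp add: 1 2 cong: sum.cong)
    qed
    finally show "x = (\<Sum>k\<in>?K. (x \<bullet> b k) *\<^sub>R b k)" using x by (simp add: add.assoc)
  qed (use fin in auto)
  from onb_trace[OF assms(1) this onb_mat_unit]
  have "(\<Sum>k\<in>?K. \<beta> (b k) (b k)) = (\<Sum>p\<in>UNIV. \<beta> (mat_unit (fst p) (snd p)) (mat_unit (fst p) (snd p)))"
    .
  also have "\<dots> = (\<Sum>i\<in>UNIV. \<Sum>j\<in>UNIV. \<beta> (mat_unit i j) (mat_unit i j))"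
    unfolding UNIV_Times_UNIV[symmetric] sum.cartesian_product
    by (simp add: case_prod_unfold del: UNIV_Times_UNIV)
  also have "(\<Sum>k\<in>?K. \<beta> (b k) (b k)) = (\<Sum>a\<in>I. \<beta> (S a) (S a)) + (\<beta> e e + (\<Sum>a\<in>J. \<beta> (\<omega> a) (\<omega> a)))"
    using Sd(1) wd(1) by (simp add: sum.Plus b_def)
  also have "\<beta> e e = (1 / ?n) *\<^sub>R \<beta> (mat 1) (mat 1)"
    using n by (simp only: e_def bilinear_lmul[OF assms(1)] bilinear_rmul[OF assms(1)] scaleR_scaleR) simp
  finally show ?thesis by (simp add: add.assoc)
qed

section \<open>Spectral data of an Einstein curvature tensor\<close>

lemma linear_commut: "linear (commut A)"
  by (rule linearI) (simp_all add: commut_def matrix_mult_simps algebra_simps)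

lemma commut_inner:
  assumes "A \<in> skew"
  shows "commut A X \<bullet> Y = - (X \<bullet> commut A Y)"
proof -
  have "transpose A = - A" using assms by (simp add: skew_def)
  thus ?thesis
    by (simp add: commut_def inner_diff_left inner_diff_right inner_mult_left[of A X Y]
        inner_mult_right[of X A Y] matrix_mult_simps)
qed

text \<open>A curvature tensor in diagonal form: \<open>\<omega>\<close> is an eigenbasis of the
  curvature operator on 2-forms, and R_ijkl = 2 \<Sum> c \<alpha> \<omega>_ij \<omega>_kl.
  \<open>bianchi\<close> is the first Bianchi identity contracted with \<open>B\<close>,
  \<open>einstein\<close> says Ric = \<rho> g, and \<open>inv\<close> expresses R.R = 0: the adjoint
  action of each \<open>\<omega> \<gamma>\<close> in the image of the operator preserves its
  eigenspaces.\<close>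

locale curv_spectral =
  fixes \<omega> :: "nat \<Rightarrow> real^'n^'n" and c :: "nat \<Rightarrow> real" and D :: nat and \<rho> :: real
  assumes onb_w: "onb skew {..<D} \<omega>"
    and bianchi: "B \<in> skew \<Longrightarrow>
      2 *\<^sub>R (\<Sum>\<alpha><D. c \<alpha> *\<^sub>R (\<omega> \<alpha> ** B ** \<omega> \<alpha>)) = - (\<Sum>\<alpha><D. (c \<alpha> * (\<omega> \<alpha> \<bullet> B)) *\<^sub>R \<omega> \<alpha>)"
    and einstein: "(\<Sum>\<alpha><D. c \<alpha> *\<^sub>R (\<omega> \<alpha> ** \<omega> \<alpha>)) = (- \<rho> / 2) *\<^sub>R mat 1"
    and inv: "\<gamma> < D \<Longrightarrow> \<alpha> < D \<Longrightarrow> \<beta> < D \<Longrightarrow> c \<gamma> \<noteq> 0 \<Longrightarrow> c \<alpha> \<noteq> c \<beta> \<Longrightarrow> commut (\<omega> \<gamma>) (\<omega> \<alpha>) \<bullet> \<omega> \<beta> = 0"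
begin

text \<open>In components this is \<Sum> R_iklj h_kl, the operator R-bar, but on all matrices
  instead of the symmetric ones.\<close>

definition P :: "real^'n^'n \<Rightarrow> real^'n^'n" where
  "P h = 2 *\<^sub>R (\<Sum>\<alpha><D. c \<alpha> *\<^sub>R (\<omega> \<alpha> ** h ** \<omega> \<alpha>))"

lemma w_skew: "\<alpha> < D \<Longrightarrow> \<omega> \<alpha> \<in> skew" "\<alpha> < D \<Longrightarrow> transpose (\<omega> \<alpha>) = - \<omega> \<alpha>"
  using onb_D(2)[OF onb_w] by (auto simp: skew_def)

lemma w_inner: "\<alpha> < D \<Longrightarrow> \<beta> < D \<Longrightarrow> \<omega> \<alpha> \<bullet> \<omega> \<beta> = (if \<alpha> = \<beta> then 1 else 0)"
  using onb_D(3)[OF onb_w] by auto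

lemma w_expand: "B \<in> skew \<Longrightarrow> (\<Sum>\<alpha><D. (B \<bullet> \<omega> \<alpha>) *\<^sub>R \<omega> \<alpha>) = B"
  using onb_D(4)[OF onb_w] by auto

lemma linear_P: "linear P"
  by (rule linearI) (simp_all add: P_def matrix_mult_simps sum.distrib scaleR_sum_right algebra_simps)

lemma P_selfadjoint: "P h \<bullet> k = h \<bullet> P k"
proof -
  have "(\<omega> \<alpha> ** h ** \<omega> \<alpha>) \<bullet> k = h \<bullet> (\<omega> \<alpha> ** k ** \<omega> \<alpha>)" if "\<alpha> < D" for \<alpha>
    by (simp add: inner_mult_right[of "\<omega> \<alpha> ** h"] inner_mult_left[of "\<omega> \<alpha>" h] w_skew(2)[OF that]
        matrix_mult_simps matrix_mul_assoc)
  thus ?thesis by (simp add: P_def inner_sum_left inner_sum_right)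
qed

lemma P_transpose: "transpose (P h) = P (transpose h)"
  by (simp add: P_def transpose_simps w_skew(2) matrix_mult_simps matrix_mul_assoc)

lemma P_mat1: "P (mat 1) = - \<rho> *\<^sub>R mat 1"
  using einstein by (simp add: P_def)

lemma trace_P: "trace (P h) = - \<rho> * trace h"
  using P_selfadjoint[of h "mat 1"] by (simp add: P_mat1 inner_mat1)

lemma P_tracefree_sym: "h \<in> tracefree_sym \<Longrightarrow> P h \<in> tracefree_sym"
  using trace_P[of h] P_transpose[of h] by (simp add: tracefree_sym_def)

lemma P_w:
  assumes "\<beta> < D"
  shows "P (\<omega> \<beta>) = - c \<beta> *\<^sub>R \<omega> \<beta>"
proof -
  have "(\<Sum>\<alpha><D. (c \<alpha> * (\<omega> \<alpha> \<bullet> \<omega> \<beta>)) *\<^sub>R \<omega> \<alpha>) = (\<Sum>\<alpha><D. if \<alpha> = \<beta> then c \<alpha> *\<^sub>R \<omega> \<alpha> else 0)"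
    using assms by (intro sum.cong refl) (simp add: w_inner)
  thus ?thesis using bianchi[OF w_skew(1)[OF assms]] assms by (simp add: P_def)
qed

text \<open>A function of the curvature operator commutes with the adjoint action of the holonomy
  algebra. In coordinates, \<open>F\<close> is antisymmetric and vanishes between different
  eigenspaces, so it remains antisymmetric after multiplication by
  \<open>\<phi> (c \<alpha>)\<close>. The lemma is used for the identity and for the indicator
  function of one eigenvalue.\<close>

lemma invariant_bilinear:
  fixes \<beta> :: "real^'n^'n \<Rightarrow> real^'n^'n \<Rightarrow> 'b::real_vector"
  assumes b: "bilinear \<beta>" and g: "\<gamma> < D" "c \<gamma> \<noteq> 0"
  shows "(\<Sum>\<alpha><D. \<phi> (c \<alpha>) *\<^sub>R (\<beta> (commut (\<omega> \<gamma>) (\<omega> \<alpha>)) (\<omega> \<alpha>) + \<beta> (\<omega> \<alpha>) (commut (\<omega> \<gamma>) (\<omega> \<alpha>)))) = 0"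
proof -
  define F where "F \<alpha> \<delta> = commut (\<omega> \<gamma>) (\<omega> \<alpha>) \<bullet> \<omega> \<delta>" for \<alpha> \<delta>
  have anti: "F \<alpha> \<delta> = - F \<delta> \<alpha>" if "\<alpha> < D" "\<delta> < D" for \<alpha> \<delta>
    unfolding F_def commut_inner[OF w_skew(1)[OF g(1)], of "\<omega> \<alpha>"] by (simp add: inner_commute)
  have ex: "commut (\<omega> \<gamma>) (\<omega> \<alpha>) = (\<Sum>\<delta><D. F \<alpha> \<delta> *\<^sub>R \<omega> \<delta>)" if "\<alpha> < D" for \<alpha>
    unfolding F_def using w_expand[OF commut_skew[OF w_skew(1)[OF g(1)] w_skew(1)[OF that]]] by simp
  have l: "linear (\<lambda>x. \<beta> x y)" "linear (\<beta> x)" for x y using b by (auto simp: bilinear_def)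
  have z: "\<phi> (c \<alpha>) * F \<alpha> \<delta> + \<phi> (c \<delta>) * F \<delta> \<alpha> = 0" if "\<alpha> < D" "\<delta> < D" for \<alpha> \<delta>
  proof (cases "c \<alpha> = c \<delta>")
    case True thus ?thesis using anti[OF that] by simp
  next
    case False thus ?thesis using inv[OF g(1) _ _ g(2)] that by (auto simp: F_def)
  qed
  have "(\<Sum>\<alpha><D. \<phi> (c \<alpha>) *\<^sub>R (\<beta> (commut (\<omega> \<gamma>) (\<omega> \<alpha>)) (\<omega> \<alpha>) + \<beta> (\<omega> \<alpha>) (commut (\<omega> \<gamma>) (\<omega> \<alpha>))))
    = (\<Sum>\<alpha><D. \<Sum>\<delta><D. (\<phi> (c \<alpha>) * F \<alpha> \<delta>) *\<^sub>R \<beta> (\<omega> \<delta>) (\<omega> \<alpha>)) + (\<Sum>\<alpha><D. \<Sum>\<delta><D. (\<phi> (c \<alpha>) * F \<alpha> \<delta>) *\<^sub>R \<beta> (\<omega> \<alpha>) (\<omega> \<delta>))"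
    unfolding sum.distrib[symmetric]
    by (intro sum.cong refl)
       (simp add: ex linear_sum[OF l(1)] linear_sum[OF l(2)] linear_scale[OF l(1)] linear_scale[OF l(2)]
          sum.distrib scaleR_add_right scaleR_sum_right)
  also have "(\<Sum>\<alpha><D. \<Sum>\<delta><D. (\<phi> (c \<alpha>) * F \<alpha> \<delta>) *\<^sub>R \<beta> (\<omega> \<delta>) (\<omega> \<alpha>))
      = (\<Sum>\<alpha><D. \<Sum>\<delta><D. (\<phi> (c \<delta>) * F \<delta> \<alpha>) *\<^sub>R \<beta> (\<omega> \<alpha>) (\<omega> \<delta>))" by (rule sum.swap)
  also have "\<dots> + (\<Sum>\<alpha><D. \<Sum>\<delta><D. (\<phi> (c \<alpha>) * F \<alpha> \<delta>) *\<^sub>R \<beta> (\<omega> \<alpha>) (\<omega> \<delta>))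
      = (\<Sum>\<alpha><D. \<Sum>\<delta><D. (\<phi> (c \<alpha>) * F \<alpha> \<delta> + \<phi> (c \<delta>) * F \<delta> \<alpha>) *\<^sub>R \<beta> (\<omega> \<alpha>) (\<omega> \<delta>))"
    by (simp add: sum.distrib[symmetric] scaleR_add_left add.commute)
  also have "\<dots> = 0" using z by (simp add: sum.neutral)
  finally show ?thesis .
qed

text \<open>The case of \<open>invariant_bilinear\<close> in which \<phi> is the identity and
  \<beta> x y = x h y.\<close>

lemma P_commut:
  assumes g: "\<gamma> < D" "c \<gamma> \<noteq> 0"
  shows "P (commut (\<omega> \<gamma>) h) = commut (\<omega> \<gamma>) (P h)"
proof -
  have "bilinear (\<lambda>x y. x ** h ** y)"
    by (auto simp: bilinear_def intro!: linearI simp: matrix_mult_simps)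
  from invariant_bilinear[OF this g, of "\<lambda>x. x"]
  have "2 *\<^sub>R (\<Sum>\<alpha><D. c \<alpha> *\<^sub>R (commut (\<omega> \<gamma>) (\<omega> \<alpha>) ** h ** \<omega> \<alpha> + \<omega> \<alpha> ** h ** commut (\<omega> \<gamma>) (\<omega> \<alpha>))) = 0"
    by simp
  moreover have "commut (\<omega> \<gamma>) (P h) - P (commut (\<omega> \<gamma>) h)
     = 2 *\<^sub>R (\<Sum>\<alpha><D. c \<alpha> *\<^sub>R (commut (\<omega> \<gamma>) (\<omega> \<alpha>) ** h ** \<omega> \<alpha> + \<omega> \<alpha> ** h ** commut (\<omega> \<gamma>) (\<omega> \<alpha>)))"
    unfolding P_def linear_scale[OF linear_commut] linear_sum[OF linear_commut]
      scaleR_diff_right[symmetric] sum_subtractf[symmetric]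
    by (intro arg_cong[where f = "(*\<^sub>R) 2"] sum.cong refl arg_cong[where f = "(*\<^sub>R) (c _)"])
       (simp add: commut_def matrix_mult_simps matrix_mul_assoc)
  ultimately show ?thesis by simp
qed

text \<open>In the double commutator the two square terms are evaluated by \<open>einstein\<close>,
  each contributing - \<rho> / 2, and the cross terms add up to
  \<open>- P (\<omega> \<beta>)\<close>.\<close>

lemma adjoint_casimir:
  assumes "\<beta> < D"
  shows "(\<Sum>\<alpha><D. c \<alpha> *\<^sub>R commut (\<omega> \<alpha>) (commut (\<omega> \<alpha>) (\<omega> \<beta>))) = (c \<beta> - \<rho>) *\<^sub>R \<omega> \<beta>"
proof -
  have "(\<Sum>\<alpha><D. c \<alpha> *\<^sub>R commut (\<omega> \<alpha>) (commut (\<omega> \<alpha>) (\<omega> \<beta>)))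
     = (\<Sum>\<alpha><D. c \<alpha> *\<^sub>R (\<omega> \<alpha> ** \<omega> \<alpha>)) ** \<omega> \<beta> + \<omega> \<beta> ** (\<Sum>\<alpha><D. c \<alpha> *\<^sub>R (\<omega> \<alpha> ** \<omega> \<alpha>)) - P (\<omega> \<beta>)"
    unfolding P_def commut_def matrix_mult_sum_left matrix_mult_sum_right scaleR_sum_right
      sum.distrib[symmetric] sum_subtractf[symmetric]
    by (intro sum.cong refl)
       (simp add: matrix_mult_simps matrix_mul_assoc, simp add: vec_eq_iff algebra_simps)
  also have "\<dots> = (c \<beta> - \<rho>) *\<^sub>R \<omega> \<beta>"
    by (simp add: einstein P_w[OF assms] matrix_mult_simps) (simp add: vec_eq_iff algebra_simps)
  finally show ?thesis .
qed

lemma sum_c_commut: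
  assumes "\<beta> < D"
  shows "(\<Sum>\<alpha><D. c \<alpha> * (commut (\<omega> \<alpha>) (\<omega> \<beta>) \<bullet> commut (\<omega> \<alpha>) (\<omega> \<beta>))) = \<rho> - c \<beta>"
proof -
  have "(\<Sum>\<alpha><D. c \<alpha> * (commut (\<omega> \<alpha>) (\<omega> \<beta>) \<bullet> commut (\<omega> \<alpha>) (\<omega> \<beta>)))
     = - (\<omega> \<beta> \<bullet> (\<Sum>\<alpha><D. c \<alpha> *\<^sub>R commut (\<omega> \<alpha>) (commut (\<omega> \<alpha>) (\<omega> \<beta>))))"
    by (simp add: inner_sum_right sum_negf[symmetric]) (intro sum.cong refl, simp add: commut_inner w_skew(1))
  thus ?thesis using adjoint_casimir[OF assms] w_inner[OF assms assms] by simp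
qed

end

locale curv_eigenbasis = curv_spectral \<omega> c D \<rho>
  for \<omega> :: "nat \<Rightarrow> real^'n^'n" and c D \<rho> +
  fixes S :: "nat \<Rightarrow> real^'n^'n" and ev :: "nat \<Rightarrow> real" and d :: nat
  assumes onb_S: "onb tracefree_sym {..<d} S"
    and P_S: "a < d \<Longrightarrow> P (S a) = ev a *\<^sub>R S a"
begin

lemma S_sym: "a < d \<Longrightarrow> transpose (S a) = S a" "a < d \<Longrightarrow> trace (S a) = 0"
  using onb_D(2)[OF onb_S] by (auto simp: tracefree_sym_def)

lemma S_inner: "a < d \<Longrightarrow> b < d \<Longrightarrow> S a \<bullet> S b = (if a = b then 1 else 0)"
  using onb_D(3)[OF onb_S] by auto

lemmas split_sum = matrix_orthonormal_split[OF _ onb_w onb_S]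

text \<open>Transposing one factor changes the sign on a skew basis and does nothing on a symmetric
  one. Hence the two completeness relations give the sum and the difference of the two unknown
  sums.\<close>

lemma sum_sandwich:
  "(\<Sum>a<d. S a ** X ** S a) = (1/2) *\<^sub>R (transpose X + trace X *\<^sub>R mat 1) - (1 / real CARD('n)) *\<^sub>R X" (is ?A)
  "(\<Sum>a<D. \<omega> a ** X ** \<omega> a) = (1/2) *\<^sub>R (transpose X - trace X *\<^sub>R mat 1)" (is ?B)
proof -
  let ?s = "\<Sum>a<d. S a ** X ** S a" and ?w = "\<Sum>a<D. \<omega> a ** X ** \<omega> a"
  have "bilinear (\<lambda>A B. A ** X ** B)"
    by (auto simp: bilinear_def intro!: linearI simp: matrix_mult_simps)
  from split_sum[OF this] have 1: "transpose X = ?s + (1 / real CARD('n)) *\<^sub>R X + ?w"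
    by (simp add: sum_mat_unit_sandwich)
  have "bilinear (\<lambda>A B. A ** X ** transpose B)"
    by (auto simp: bilinear_def intro!: linearI simp: matrix_mult_simps transpose_simps)
  from split_sum[OF this] have 2: "trace X *\<^sub>R mat 1 = ?s + (1 / real CARD('n)) *\<^sub>R X - ?w"
    by (simp add: sum_mat_unit_sandwich S_sym w_skew(2) transpose_mat_unit matrix_mult_simps sum_negf)
  show ?A ?B unfolding 1 2 by (simp_all add: vec_eq_iff field_simps)
qed

text \<open>The split is applied to \<open>P A ** X ** transpose B\<close>: in the eigenbases
  \<open>P\<close> acts by scalars, and in matrix units its definition can be summed
  directly.\<close>

lemma sum_ev_sandwich:
  "(\<Sum>a<d. ev a *\<^sub>R (S a ** X ** S a)) = (\<rho> / real CARD('n)) *\<^sub>R X - (\<Sum>\<alpha><D. c \<alpha> *\<^sub>R (\<omega> \<alpha> ** X ** \<omega> \<alpha>))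
     + 2 *\<^sub>R (\<Sum>\<alpha><D. (c \<alpha> * trace (\<omega> \<alpha> ** X)) *\<^sub>R \<omega> \<alpha>)"
proof -
  have "bilinear (\<lambda>A B. P A ** X ** transpose B)"
    by (auto simp: bilinear_def intro!: linearI simp: matrix_mult_simps transpose_simps
        linear_add[OF linear_P] linear_scale[OF linear_P])
  from split_sum[OF this]
  have "(\<Sum>i\<in>UNIV. \<Sum>j\<in>UNIV. P (mat_unit i j) ** X ** mat_unit j i) =
      (\<Sum>a<d. ev a *\<^sub>R (S a ** X ** S a)) + (1 / real CARD('n)) *\<^sub>R (- \<rho> *\<^sub>R X) + (\<Sum>\<alpha><D. c \<alpha> *\<^sub>R (\<omega> \<alpha> ** X ** \<omega> \<alpha>))"
    by (simp add: P_S P_mat1 P_w S_sym w_skew(2) transpose_mat_unit matrix_mult_simps)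
  moreover have "(\<Sum>i\<in>UNIV. \<Sum>j\<in>UNIV. P (mat_unit i j) ** X ** mat_unit j i)
      = 2 *\<^sub>R (\<Sum>\<alpha><D. (c \<alpha> * trace (\<omega> \<alpha> ** X)) *\<^sub>R \<omega> \<alpha>)"
  proof -
    have "(\<Sum>i\<in>UNIV. \<Sum>j\<in>UNIV. P (mat_unit i j) ** X ** mat_unit j i)
      = (\<Sum>i\<in>UNIV. \<Sum>j\<in>UNIV. \<Sum>\<alpha><D. (2 * c \<alpha>) *\<^sub>R (\<omega> \<alpha> ** (mat_unit i j ** (\<omega> \<alpha> ** X) ** mat_unit j i)))"
      by (simp add: P_def matrix_mult_simps matrix_mult_sum_left scaleR_sum_right matrix_mul_assoc)
    also have "\<dots> = (\<Sum>\<alpha><D. \<Sum>i\<in>UNIV. \<Sum>j\<in>UNIV. (2 * c \<alpha>) *\<^sub>R (\<omega> \<alpha> ** (mat_unit i j ** (\<omega> \<alpha> ** X) ** mat_unit j i)))"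
      by (simp only: sum.swap[of _ "{..<D}" UNIV])
    also have "\<dots> = (\<Sum>\<alpha><D. (2 * c \<alpha>) *\<^sub>R (\<omega> \<alpha> ** (trace (\<omega> \<alpha> ** X) *\<^sub>R mat 1)))"
      by (simp only: scaleR_sum_right[symmetric] matrix_mult_sum_right[symmetric] sum_mat_unit_sandwich)
    finally show ?thesis by (simp add: matrix_mult_simps scaleR_sum_right ac_simps)
  qed
  ultimately show ?thesis by (simp add: vec_eq_iff algebra_simps)
qed

lemma trace_w_w: "\<alpha> < D \<Longrightarrow> \<beta> < D \<Longrightarrow> trace (\<omega> \<alpha> ** \<omega> \<beta>) = (if \<alpha> = \<beta> then - 1 else 0)"
  using w_inner[of \<alpha> \<beta>] by (auto simp: inner_matrix_trace w_skew(2) matrix_mult_simps trace_simps)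

text \<open>Both dimensions are traces of \<open>sum_sandwich\<close> at the identity
  matrix.\<close>

lemma card_d: "real d = (real CARD('n) - 1) * (real CARD('n) + 2) / 2" and card_D: "real D = real CARD('n) * (real CARD('n) - 1) / 2"
proof -
  have "real d = trace (\<Sum>a<d. S a ** mat 1 ** S a)"
    using S_inner by (simp add: trace_simps inner_matrix_trace S_sym)
  also have "\<dots> = (real CARD('n) - 1) * (real CARD('n) + 2) / 2"
    unfolding sum_sandwich by (simp add: trace_simps trace_I field_simps)
  finally show "real d = (real CARD('n) - 1) * (real CARD('n) + 2) / 2" .
  have "- real D = trace (\<Sum>a<D. \<omega> a ** mat 1 ** \<omega> a)"
    by (simp add: trace_simps trace_w_w)
  also have "\<dots> = - (real CARD('n) * (real CARD('n) - 1) / 2)"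
    unfolding sum_sandwich by (simp add: trace_simps trace_I field_simps)
  finally show "real D = real CARD('n) * (real CARD('n) - 1) / 2" by simp
qed

lemma sum_c: "(\<Sum>\<alpha><D. c \<alpha>) = real CARD('n) * \<rho> / 2"
  using arg_cong[OF einstein, of trace] by (simp add: trace_simps trace_w_w trace_I sum_negf)

text \<open>The trace of \<open>Q\<close> on all matrices, taken in the eigenbases of
  \<open>P\<close>. For \<open>Q\<close> a power of \<open>P\<close> it converts traces of products
  of the \<open>\<omega> \<alpha>\<close> into power sums of \<open>ev\<close>.\<close>

lemma trace_sum_power:
  assumes "linear Q" and QS: "\<And>a. a < d \<Longrightarrow> Q (S a) = f (ev a) *\<^sub>R S a"
    and "Q (mat 1) = f (- \<rho>) *\<^sub>R mat 1" and "\<And>\<alpha>. \<alpha> < D \<Longrightarrow> Q (\<omega> \<alpha>) = f (- c \<alpha>) *\<^sub>R \<omega> \<alpha>"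
  shows "(\<Sum>i\<in>UNIV. \<Sum>j\<in>UNIV. Q (mat_unit i j) \<bullet> mat_unit i j)
    = (\<Sum>a<d. f (ev a)) + f (- \<rho>) + (\<Sum>\<alpha><D. f (- c \<alpha>))"
proof -
  have "bilinear (\<lambda>A B. Q A \<bullet> B)"
    by (auto simp: bilinear_def intro!: linearI simp: linear_add[OF assms(1)] linear_scale[OF assms(1)]
      inner_add_left inner_add_right)
  from split_sum[OF this] show ?thesis
    by (simp add: assms S_inner w_inner inner_mat1 trace_I trace_simps)
qed

text \<open>\<open>P\<close> has trace zero because each \<open>\<omega> \<alpha>\<close>
  has.\<close>

lemma sum_ev: "(\<Sum>a<d. ev a) = \<rho> * (real CARD('n) + 2) / 2"
proof -
  have "(\<Sum>i\<in>UNIV. \<Sum>j\<in>UNIV. P (mat_unit i j) \<bullet> mat_unit i j)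
      = (\<Sum>i\<in>UNIV. \<Sum>j\<in>UNIV. \<Sum>\<alpha><D. (2 * c \<alpha>) * ((\<omega> \<alpha> ** mat_unit i j ** \<omega> \<alpha>) \<bullet> mat_unit i j))"
    by (simp add: P_def inner_sum_left sum_distrib_left ac_simps)
  also have "\<dots> = (\<Sum>\<alpha><D. (2 * c \<alpha>) * (\<Sum>i\<in>UNIV. \<Sum>j\<in>UNIV. (\<omega> \<alpha> ** mat_unit i j ** \<omega> \<alpha>) \<bullet> mat_unit i j))"
    unfolding sum_distrib_left by (simp only: sum.swap[of _ "{..<D}" UNIV])
  also have "\<dots> = 0" by (simp add: sum_mat_unit_inner trace_skew w_skew)
  finally show ?thesis
    using trace_sum_power[of P "\<lambda>x. x"] linear_P P_S P_mat1 P_w sum_c by (simp add: sum_negf algebra_simps)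
qed

lemma sum_ev_square: "(\<Sum>a<d. (ev a)\<^sup>2) = 3 * (\<Sum>\<alpha><D. (c \<alpha>)\<^sup>2) - \<rho>\<^sup>2"
proof -
  have "P (P X) = (\<Sum>\<alpha><D. \<Sum>\<beta><D. (4 * c \<alpha> * c \<beta>) *\<^sub>R ((\<omega> \<alpha> ** \<omega> \<beta>) ** X ** (\<omega> \<beta> ** \<omega> \<alpha>)))" for X
    by (simp add: P_def matrix_mult_simps matrix_mult_sum_left matrix_mult_sum_right scaleR_sum_right matrix_mul_assoc ac_simps)
  hence "(\<Sum>i\<in>UNIV. \<Sum>j\<in>UNIV. P (P (mat_unit i j)) \<bullet> mat_unit i j)
      = (\<Sum>i\<in>UNIV. \<Sum>j\<in>UNIV. \<Sum>\<alpha><D. \<Sum>\<beta><D. (4 * c \<alpha> * c \<beta>) * (((\<omega> \<alpha> ** \<omega> \<beta>) ** mat_unit i j ** (\<omega> \<beta> ** \<omega> \<alpha>)) \<bullet> mat_unit i j))"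
    by (simp add: inner_sum_left)
  also have "\<dots> = (\<Sum>\<alpha><D. \<Sum>\<beta><D. (4 * c \<alpha> * c \<beta>) * (\<Sum>i\<in>UNIV. \<Sum>j\<in>UNIV. ((\<omega> \<alpha> ** \<omega> \<beta>) ** mat_unit i j ** (\<omega> \<beta> ** \<omega> \<alpha>)) \<bullet> mat_unit i j))"
    unfolding sum_distrib_left
    by (simp only: sum.swap[of _ "{..<D}" UNIV])
  also have "\<dots> = (\<Sum>\<alpha><D. \<Sum>\<beta><D. if \<beta> = \<alpha> then 4 * (c \<alpha>)\<^sup>2 else 0)"
    by (intro sum.cong refl) (simp add: sum_mat_unit_inner trace_w_w power2_eq_square)
  also have "\<dots> = 4 * (\<Sum>\<alpha><D. (c \<alpha>)\<^sup>2)" by (simp add: sum_distrib_left)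
  finally show ?thesis
    using trace_sum_power[of "\<lambda>x. P (P x)" "\<lambda>x. x\<^sup>2"] linear_compose[OF linear_P linear_P]
    by (simp add: o_def P_S P_mat1 P_w linear_scale[OF linear_P] linear_neg[OF linear_P] power2_eq_square)
qed

text \<open>Transposition reverses a product of three skew matrices and changes its sign, so each of
  the two traces is, up to sign, half a structure constant.\<close>

lemma trace_www:
  assumes "\<alpha> < D" "\<beta> < D" "\<gamma> < D"
  shows "trace (\<omega> \<alpha> ** \<omega> \<beta> ** \<omega> \<gamma>) * trace (\<omega> \<gamma> ** \<omega> \<beta> ** \<omega> \<alpha>) = - (1/4) * (commut (\<omega> \<alpha>) (\<omega> \<beta>) \<bullet> \<omega> \<gamma>)\<^sup>2"
proof -
  note w = w_skew(2)[OF assms(1)] w_skew(2)[OF assms(2)] w_skew(2)[OF assms(3)]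
  have 1: "trace (\<omega> \<alpha> ** \<omega> \<beta> ** \<omega> \<gamma>) = (\<omega> \<beta> ** \<omega> \<alpha>) \<bullet> \<omega> \<gamma>"
    by (simp add: inner_matrix_trace transpose_simps w matrix_mult_simps)
  have "trace (\<omega> \<gamma> ** \<omega> \<beta> ** \<omega> \<alpha>) = trace (\<omega> \<beta> ** \<omega> \<alpha> ** \<omega> \<gamma>)"
    using trace_mul_sym[of "\<omega> \<gamma>" "\<omega> \<beta> ** \<omega> \<alpha>"] by (simp add: matrix_mul_assoc)
  also have "\<dots> = (\<omega> \<alpha> ** \<omega> \<beta>) \<bullet> \<omega> \<gamma>"
    by (simp add: inner_matrix_trace transpose_simps w matrix_mult_simps)
  finally have 2: "trace (\<omega> \<gamma> ** \<omega> \<beta> ** \<omega> \<alpha>) = (\<omega> \<alpha> ** \<omega> \<beta>) \<bullet> \<omega> \<gamma>" .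
  have "(\<omega> \<beta> ** \<omega> \<alpha>) \<bullet> \<omega> \<gamma> = - ((\<omega> \<alpha> ** \<omega> \<beta>) \<bullet> \<omega> \<gamma>)"
    using inner_transpose[of "\<omega> \<alpha> ** \<omega> \<beta>" "\<omega> \<gamma>"] by (simp add: transpose_simps w matrix_mult_simps)
  thus ?thesis unfolding 1 2 commut_def by (simp add: inner_diff_left power2_eq_square)
qed

text \<open>The trace of the cube of \<open>P\<close> is a weighted sum of squared structure
  constants. Invariance of the eigenspaces removes \<open>c \<gamma>\<close> from the weight;
  Parseval over \<gamma> and \<open>sum_c_commut\<close> then finish the sum.\<close>

lemma sum_ev_cube: "(\<Sum>a<d. ev a ^ 3) = \<rho> ^ 3 - 2 * \<rho> * (\<Sum>\<alpha><D. (c \<alpha>)\<^sup>2) + 3 * (\<Sum>\<alpha><D. c \<alpha> ^ 3)"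
proof -
  let ?f = "\<lambda>\<alpha> \<beta> \<gamma>. (commut (\<omega> \<alpha>) (\<omega> \<beta>) \<bullet> \<omega> \<gamma>)\<^sup>2"
  have "P (P (P X)) = (\<Sum>\<alpha><D. \<Sum>\<beta><D. \<Sum>\<gamma><D. (8 * c \<alpha> * c \<beta> * c \<gamma>) *\<^sub>R ((\<omega> \<alpha> ** \<omega> \<beta> ** \<omega> \<gamma>) ** X ** (\<omega> \<gamma> ** \<omega> \<beta> ** \<omega> \<alpha>)))" for X
    by (simp add: P_def matrix_mult_simps matrix_mult_sum_left matrix_mult_sum_right scaleR_sum_right matrix_mul_assoc ac_simps)
  hence "(\<Sum>i\<in>UNIV. \<Sum>j\<in>UNIV. P (P (P (mat_unit i j))) \<bullet> mat_unit i j)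
      = (\<Sum>i\<in>UNIV. \<Sum>j\<in>UNIV. \<Sum>\<alpha><D. \<Sum>\<beta><D. \<Sum>\<gamma><D. (8 * c \<alpha> * c \<beta> * c \<gamma>) * (((\<omega> \<alpha> ** \<omega> \<beta> ** \<omega> \<gamma>) ** mat_unit i j ** (\<omega> \<gamma> ** \<omega> \<beta> ** \<omega> \<alpha>)) \<bullet> mat_unit i j))"
    by (simp add: inner_sum_left)
  also have "\<dots> = (\<Sum>\<alpha><D. \<Sum>\<beta><D. \<Sum>\<gamma><D. (8 * c \<alpha> * c \<beta> * c \<gamma>) * (\<Sum>i\<in>UNIV. \<Sum>j\<in>UNIV. ((\<omega> \<alpha> ** \<omega> \<beta> ** \<omega> \<gamma>) ** mat_unit i j ** (\<omega> \<gamma> ** \<omega> \<beta> ** \<omega> \<alpha>)) \<bullet> mat_unit i j))"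
    unfolding sum_distrib_left
    by (simp only: sum.swap[of _ "{..<D}" UNIV])
  also have "\<dots> = (\<Sum>\<alpha><D. \<Sum>\<beta><D. \<Sum>\<gamma><D. (- 2 * (c \<beta>)\<^sup>2 * c \<alpha>) * ?f \<alpha> \<beta> \<gamma>)"
  proof (intro sum.cong refl)
    fix \<alpha> \<beta> \<gamma> assume "\<alpha> \<in> {..<D}" "\<beta> \<in> {..<D}" "\<gamma> \<in> {..<D}"
    hence l: "\<alpha> < D" "\<beta> < D" "\<gamma> < D" by auto
    \<comment> \<open>For \<open>c \<alpha> \<noteq> 0\<close> a nonzero structure constant forces
      \<open>c \<beta> = c \<gamma>\<close>; for \<open>c \<alpha> = 0\<close> both sides
      vanish.\<close>
    have "c \<alpha> * c \<gamma> * ?f \<alpha> \<beta> \<gamma> = c \<alpha> * c \<beta> * ?f \<alpha> \<beta> \<gamma>" by (cases "c \<beta> = c \<gamma>") (use inv[OF l] in auto)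
    hence "c \<beta> * (c \<alpha> * c \<gamma> * ?f \<alpha> \<beta> \<gamma>) = c \<beta> * (c \<alpha> * c \<beta> * ?f \<alpha> \<beta> \<gamma>)" by simp
    thus "8 * c \<alpha> * c \<beta> * c \<gamma> * (\<Sum>i\<in>UNIV. \<Sum>j\<in>UNIV. ((\<omega> \<alpha> ** \<omega> \<beta> ** \<omega> \<gamma>) ** mat_unit i j ** (\<omega> \<gamma> ** \<omega> \<beta> ** \<omega> \<alpha>)) \<bullet> mat_unit i j)
       = (- 2 * (c \<beta>)\<^sup>2 * c \<alpha>) * ?f \<alpha> \<beta> \<gamma>"
      unfolding sum_mat_unit_inner trace_www[OF l] by (simp add: power2_eq_square ac_simps)
  qed
  also have "\<dots> = (\<Sum>\<alpha><D. \<Sum>\<beta><D. (- 2 * (c \<beta>)\<^sup>2) * (c \<alpha> * (commut (\<omega> \<alpha>) (\<omega> \<beta>) \<bullet> commut (\<omega> \<alpha>) (\<omega> \<beta>))))"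
  proof (intro sum.cong refl)
    fix \<alpha> \<beta> assume "\<alpha> \<in> {..<D}" "\<beta> \<in> {..<D}"
    hence "commut (\<omega> \<alpha>) (\<omega> \<beta>) \<in> skew" by (auto intro: commut_skew w_skew)
    from onb_inner[OF onb_w this, of "commut (\<omega> \<alpha>) (\<omega> \<beta>)"]
    show "(\<Sum>\<gamma><D. (- 2 * (c \<beta>)\<^sup>2 * c \<alpha>) * ?f \<alpha> \<beta> \<gamma>) = (- 2 * (c \<beta>)\<^sup>2) * (c \<alpha> * (commut (\<omega> \<alpha>) (\<omega> \<beta>) \<bullet> commut (\<omega> \<alpha>) (\<omega> \<beta>)))"
      by (simp add: sum_distrib_left power2_eq_square ac_simps)
  qed
  also have "\<dots> = (\<Sum>\<beta><D. (- 2 * (c \<beta>)\<^sup>2) * (\<rho> - c \<beta>))"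
    by (subst sum.swap) (simp only: sum_distrib_left[symmetric], intro sum.cong refl, simp add: sum_c_commut)
  also have "\<dots> = 2 * (\<Sum>\<beta><D. c \<beta> ^ 3) - 2 * \<rho> * (\<Sum>\<beta><D. (c \<beta>)\<^sup>2)"
    by (simp add: sum_distrib_left sum_subtractf[symmetric] algebra_simps power2_eq_square power3_eq_cube)
  finally show ?thesis
    using trace_sum_power[of "\<lambda>x. P (P (P x))" "\<lambda>x. x ^ 3"] linear_compose[OF linear_P linear_compose[OF linear_P linear_P]]
    by (simp add: o_def P_S P_mat1 P_w linear_scale[OF linear_P] linear_neg[OF linear_P] power3_eq_cube sum_negf)
qed

end

section \<open>Weighted sums of the eigenvalues\<close>

text \<open>With L = \<open>l k\<close>, subtracting L from all values and using the bound M below L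
  gives \<Sum> l w \<ge> L (\<Sum> w - N M), so L = 0. The bound on the weights is asked for where
  \<open>l i < l k\<close>, because the quadratic weights of \<open>power_sums_contradiction\<close>
  may be large at the upper end.\<close>

lemma weighted_sum_nonpos_imp_zero:
  fixes l w :: "nat \<Rightarrow> real"
  assumes srt: "\<And>i j. i \<le> j \<Longrightarrow> j < d \<Longrightarrow> l i \<le> l j"
    and N: "1 \<le> N" and k: "k = nat \<lfloor>N\<rfloor>" "k < d"
    and low: "0 \<le> (\<Sum>i<k. l i) + (N - of_int \<lfloor>N\<rfloor>) * l k"
    and w: "\<And>i. i < d \<Longrightarrow> 0 < w i" "\<And>i. i < d \<Longrightarrow> l i < l k \<Longrightarrow> w i \<le> M"
    and M: "0 \<le> M" "N * M < (\<Sum>i<d. w i)" and le: "(\<Sum>i<d. l i * w i) \<le> 0"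
  shows "i < d \<Longrightarrow> l i = 0"
proof -
  let ?L = "l k"
  have kN: "real k = of_int \<lfloor>N\<rfloor>" "real k \<le> N" using k N by auto
  have low': "0 \<le> (\<Sum>i<k. l i) + (N - real k) * ?L" using low kN by simp
  have "(\<Sum>i<k. l i) \<le> (\<Sum>i<k. ?L)" using srt k by (intro sum_mono) auto
  hence "0 \<le> N * ?L" using low' by (simp add: algebra_simps)
  hence L0: "0 \<le> ?L" using N by (simp add: zero_le_mult_iff)
  have "(\<Sum>i<k. (l i - ?L) * M) \<le> (\<Sum>i<d. (l i - ?L) * w i)"
  proof -
    have "(\<Sum>i<k. (l i - ?L) * M) \<le> (\<Sum>i<k. (l i - ?L) * w i)"
    proof (rule sum_mono)
      fix i assume "i \<in> {..<k}"
      hence i: "i < d" "l i \<le> ?L" using srt k by auto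
      show "(l i - ?L) * M \<le> (l i - ?L) * w i"
        by (cases "l i = ?L") (use i w(2) in \<open>auto intro!: mult_left_mono_neg\<close>)
    qed
    also have "\<dots> \<le> (\<Sum>i<d. (l i - ?L) * w i)"
    proof (intro sum_mono2)
      fix i assume "i \<in> {..<d} - {..<k}"
      hence "?L \<le> l i" "0 < w i" using srt[of k i] w(1) by auto
      thus "0 \<le> (l i - ?L) * w i" by simp
    qed (use k in auto)
    finally show ?thesis .
  qed
  moreover have "(\<Sum>i<k. (l i - ?L) * M) = ((\<Sum>i<k. l i) - real k * ?L) * M"
    by (simp add: sum_distrib_right[symmetric] sum_subtractf)
  moreover have "- (N * ?L) * M \<le> ((\<Sum>i<k. l i) - real k * ?L) * M"
    using low' M by (intro mult_right_mono) (auto simp: algebra_simps)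
  moreover have "(\<Sum>i<d. (l i - ?L) * w i) = (\<Sum>i<d. l i * w i) - ?L * (\<Sum>i<d. w i)"
    by (simp add: sum_subtractf algebra_simps sum_distrib_left)
  ultimately have "?L * ((\<Sum>i<d. w i) - N * M) \<le> 0" using le by (simp add: algebra_simps)
  hence "?L = 0" using M(2) L0 by (simp add: mult_le_0_iff)
  \<comment> \<open>The \<open>k\<close> lowest values are now nonpositive with nonnegative sum,
    hence zero; after that every value is nonnegative and positive weights finish.\<close>
  hence neg: "l i \<le> 0" if "i < k" for i using srt[of i k] k that by auto
  have "(\<Sum>i<k. - l i) = 0"
    using low' \<open>?L = 0\<close> sum_nonpos[of "{..<k}" l] neg by (simp add: sum_negf)
  hence "\<forall>i\<in>{..<k}. - l i = 0" using neg by (subst (asm) sum_nonneg_eq_0_iff) auto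
  hence nn: "0 \<le> l i" if "i < d" for i
    using srt[of k i] that \<open>?L = 0\<close> by (cases "i < k") auto
  have "(\<Sum>i<d. l i * w i) = 0"
  proof (intro antisym sum_nonneg)
    fix i assume "i \<in> {..<d}"
    thus "0 \<le> l i * w i" using nn[of i] w(1)[of i] by simp
  qed (rule le)
  hence "\<forall>i\<in>{..<d}. l i * w i = 0"
  proof (subst (asm) sum_nonneg_eq_0_iff)
    fix i assume "i \<in> {..<d}"
    thus "0 \<le> l i * w i" using nn[of i] w(1)[of i] by simp
  qed auto
  thus "i < d \<Longrightarrow> l i = 0" using w(1)[of i] by auto
qed

text \<open>The weights are \<open>(\<mu> - v)\<^sup>2 + v (t - 1 + v)\<close> with \<open>\<mu> = l - 1\<close>; the first three power sums
  of \<open>\<mu>\<close> are \<open>0\<close>, \<open>d v\<close> and \<open>- t d v\<close>, which makes the weighted sum of the \<open>l i\<close> vanish. The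
  multiplicity three of the smallest value enters through \<open>u\<^sup>2 \<le> v (d - 3) / 3\<close>.\<close>

lemma power_sums_contradiction:
  fixes l :: "nat \<Rightarrow> real" and n N x :: real
  assumes n: "4 \<le> n" and d: "real d = (n - 1) * (n + 2) / 2" and x: "1 < x"
    and srt: "\<And>i j. i \<le> j \<Longrightarrow> j < d \<Longrightarrow> l i \<le> l j"
    and N: "1 \<le> N" "N < 3 * n / 2 * ((n + 2) / (n + 4))" and k: "k = nat \<lfloor>N\<rfloor>"
    and low: "0 \<le> (\<Sum>i<k. l i) + (N - of_int \<lfloor>N\<rfloor>) * l k"
    and s1: "(\<Sum>i<d. l i) = d"
    and s2: "(\<Sum>i<d. (l i)\<^sup>2) = 3 * (n * (n - 1) / 2) * x - (n - 1)\<^sup>2"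
    and s3: "(\<Sum>i<d. l i ^ 3) = (n - 1) ^ 3 - 2 * (n - 1) * (n * (n - 1) / 2) * x + 3 * (n * (n - 1) / 2) * x\<^sup>2"
    and m3: "l 1 = l 0" "l 2 = l 0"
  shows False
proof -
  define \<mu> where "\<mu> i = l i - 1" for i
  define v where "v = 3 * n * (x - 1) / (n + 2)"
  define t where "t = 2 * (n + 2) / 3 - x"
  \<comment> \<open>The smallest value lies \<open>u\<close> below the mean 1 of the
    \<open>l i\<close>.\<close>
  define u where "u = - \<mu> 0"
  have v0: "v > 0" using n x by (simp add: v_def)
  have "(n + 2) * v = 3 * n * (x - 1)" using n by (simp add: v_def)
  hence xv: "x = 1 + (n + 2) * v / (3 * n)" using n by simp
  have d9: "9 \<le> real d"
  proof -
    have "3 * 6 \<le> (n - 1) * (n + 2)" using n by (intro mult_mono) auto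
    thus ?thesis using d by simp
  qed
  have m1: "(\<Sum>i<d. \<mu> i) = 0" using s1 by (simp add: \<mu>_def sum_subtractf)
  have m2: "(\<Sum>i<d. (\<mu> i)\<^sup>2) = d * v"
  proof -
    have "(\<Sum>i<d. (\<mu> i)\<^sup>2) = (\<Sum>i<d. (l i)\<^sup>2) - 2 * (\<Sum>i<d. l i) + d"
      by (simp add: \<mu>_def power2_diff sum.distrib sum_subtractf sum_distrib_left)
    also have "\<dots> = d * v" using n unfolding s1 s2 d v_def by (simp add: field_simps power2_eq_square)
    finally show ?thesis .
  qed
  have m3': "(\<Sum>i<d. \<mu> i ^ 3) = - t * (d * v)"
  proof -
    have "(\<Sum>i<d. \<mu> i ^ 3) = (\<Sum>i<d. l i ^ 3) - 3 * (\<Sum>i<d. (l i)\<^sup>2) + 3 * (\<Sum>i<d. l i) - d"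
      unfolding sum_distrib_left sum_subtractf[symmetric] sum.distrib[symmetric]
      by (simp add: \<mu>_def power3_eq_cube power2_eq_square algebra_simps sum.distrib sum_subtractf sum_distrib_left)
    also have "\<dots> = - t * (d * v)" using n unfolding s1 s2 s3 d v_def t_def
      by (simp add: field_simps power2_eq_square power3_eq_cube)
    finally show ?thesis .
  qed
  have tv: "t - 1 + v > 0"
  proof -
    have "t - 1 + v = (2 * n - 2) / 3 + v * ((2 * n - 2) / (3 * n))"
      using n by (simp add: t_def xv field_simps)
    thus ?thesis using n v0 by (simp add: add_pos_pos)
  qed
  have msrt: "\<mu> i \<le> \<mu> j" if "i \<le> j" "j < d" for i j using srt[OF that] by (simp add: \<mu>_def)
  have u_le: "- u \<le> \<mu> i" if "i < d" for i using msrt[of 0 i] that by (simp add: u_def)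
  have "(\<Sum>i<d. - u) \<le> (\<Sum>i<d. \<mu> i)" using u_le by (intro sum_mono) auto
  hence u0: "0 \<le> u" using m1 d9 by (simp add: zero_le_mult_iff)
  have split: "(\<Sum>i<d. f i) = f 0 + f 1 + f 2 + (\<Sum>i\<in>{3..<d}. f i)" for f :: "nat \<Rightarrow> real"
  proof -
    have "{..<d} = {0, 1, 2} \<union> {3..<d}" using d9 by auto
    thus ?thesis by (simp add: sum.union_disjoint)
  qed
  have \<mu>3: "\<mu> 0 = - u" "\<mu> 1 = - u" "\<mu> 2 = - u" using m3 by (auto simp: u_def \<mu>_def)
  \<comment> \<open>Cauchy--Schwarz for the other \<open>d - 3\<close> values of \<mu>, which add up
    to \<open>3 * u\<close>.\<close>
  have u2: "u\<^sup>2 \<le> v * (real d - 3) / 3"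
  proof -
    have "(\<Sum>i\<in>{3..<d}. \<mu> i)\<^sup>2 \<le> (\<Sum>i\<in>{3..<d}. (\<mu> i)\<^sup>2) * (\<Sum>i\<in>{3..<d}. 1\<^sup>2)"
      using Cauchy_Schwarz_ineq_sum[of \<mu> "\<lambda>i. 1" "{3..<d}"] by simp
    moreover have "(\<Sum>i\<in>{3..<d}. \<mu> i) = 3 * u" using m1 split[of \<mu>] \<mu>3 by simp
    moreover have "(\<Sum>i\<in>{3..<d}. (\<mu> i)\<^sup>2) = d * v - 3 * u\<^sup>2" using m2 split[of "\<lambda>i. (\<mu> i)\<^sup>2"] \<mu>3 by simp
    ultimately have "(3 * u)\<^sup>2 \<le> (d * v - 3 * u\<^sup>2) * (real d - 3)" using d9 by (simp add: of_nat_diff)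
    hence "d * (3 * u\<^sup>2) \<le> d * (v * (real d - 3))" by (simp add: algebra_simps power2_eq_square)
    hence "3 * u\<^sup>2 \<le> v * (real d - 3)" using d9 by (subst (asm) mult_le_cancel_left_pos) auto
    thus ?thesis by simp
  qed
  have n4: "4 * n \<le> n * n" using n by (intro mult_right_mono) auto
  \<comment> \<open>At most half of the eigenvalues are summed; this is what bounds
    \<open>\<mu> k\<close> by \<open>u\<close>.\<close>
  have Nd: "2 * N \<le> d"
  proof -
    have "(n - 1) * (n + 4) = n * n + 3 * n - 4" by (simp add: algebra_simps)
    hence "6 * n \<le> (n - 1) * (n + 4)" using n4 n by linarith
    hence "6 * n * (n + 2) \<le> (n - 1) * (n + 4) * (n + 2)" using n by (intro mult_right_mono) auto
    hence "3 * n / 2 * ((n + 2) / (n + 4)) \<le> d / 2" using n unfolding d by (simp add: field_simps)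
    thus ?thesis using N by simp
  qed
  have kN: "real k \<le> N" "k < d"
  proof -
    show "real k \<le> N" using k N by simp
    hence "2 * real k \<le> real d" using Nd by simp
    thus "k < d" using d9 by linarith
  qed
  \<comment> \<open>The \<open>k\<close> lowest values are at least \<open>- u\<close>, the others
    at least \<open>\<mu> k\<close>, and the total is 0. So \<mu> stays between \<open>- u\<close>
    and \<open>u\<close> wherever \<open>l i < l k\<close>.\<close>
  have mk: "\<mu> k \<le> u"
  proof -
    have "(\<Sum>i<k. - u) \<le> (\<Sum>i<k. \<mu> i)" using u_le kN by (intro sum_mono) auto
    moreover have "(\<Sum>i\<in>{k..<d}. \<mu> k) \<le> (\<Sum>i\<in>{k..<d}. \<mu> i)" using msrt by (intro sum_mono) auto
    moreover have "(\<Sum>i<d. \<mu> i) = (\<Sum>i<k. \<mu> i) + (\<Sum>i\<in>{k..<d}. \<mu> i)"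
      using sum.atLeastLessThan_concat[of 0 k d \<mu>] kN by (simp add: lessThan_atLeast0)
    ultimately have "(real d - real k) * \<mu> k \<le> real k * u" using m1 kN by (simp add: of_nat_diff algebra_simps)
    also have "\<dots> \<le> (real d - real k) * u" using u0 kN Nd by (intro mult_right_mono) auto
    finally show ?thesis using kN by simp
  qed
  define w where "w i = (\<mu> i - v)\<^sup>2 + v * (t - 1 + v)" for i
  \<comment> \<open>The weight at the value \<open>- u\<close>, which is the largest one between
    \<open>- u\<close> and \<open>u\<close> because \<open>v > 0\<close>.\<close>
  define M where "M = (u + v)\<^sup>2 + v * (t - 1 + v)"
  have M0: "M > 0" using v0 tv by (simp add: M_def add_nonneg_pos)
  have sw: "(\<Sum>i<d. w i) = d * v * (t + 2 * v)"
  proof -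
    have "(\<Sum>i<d. w i) = (\<Sum>i<d. (\<mu> i)\<^sup>2) - 2 * v * (\<Sum>i<d. \<mu> i) + d * (v\<^sup>2 + v * (t - 1 + v))"
      by (simp add: w_def power2_diff sum.distrib sum_subtractf sum_distrib_left algebra_simps)
    thus ?thesis unfolding m1 m2 by (simp add: algebra_simps power2_eq_square)
  qed
  have slw: "(\<Sum>i<d. l i * w i) = 0"
  proof -
    have "l i * w i = \<mu> i ^ 3 + (1 - 2 * v) * (\<mu> i)\<^sup>2 + (v\<^sup>2 + v * (t - 1 + v) - 2 * v) * \<mu> i + (v\<^sup>2 + v * (t - 1 + v))" for i
      by (simp add: w_def \<mu>_def power2_eq_square power3_eq_cube algebra_simps)
    hence "(\<Sum>i<d. l i * w i) = (\<Sum>i<d. \<mu> i ^ 3) + (1 - 2 * v) * (\<Sum>i<d. (\<mu> i)\<^sup>2)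
       + (v\<^sup>2 + v * (t - 1 + v) - 2 * v) * (\<Sum>i<d. \<mu> i) + d * (v\<^sup>2 + v * (t - 1 + v))"
      by (simp add: sum.distrib sum_distrib_left)
    thus ?thesis unfolding m1 m2 m3' by (simp add: algebra_simps power2_eq_square)
  qed
  \<comment> \<open>The threshold for \<open>N\<close> divided by \<open>d\<close>; the required
    bound on \<open>N * M\<close> reduces to \<open>key\<close>.\<close>
  define r where "r = 3 * n / ((n - 1) * (n + 4))"
  have r: "0 < r" "3 * n / 2 * ((n + 2) / (n + 4)) = r * d" "(1 - r) * (3 * n) = r * (n\<^sup>2 - 4)"
  proof -
    define q where "q = (n - 1) * (n + 4)"
    have q: "q > 0" "n - 1 > 0" "n + 4 > 0" using n by (auto simp: q_def)
    show "0 < r" using q n by (simp add: r_def q_def[symmetric])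
    show "3 * n / 2 * ((n + 2) / (n + 4)) = r * d" using q(2,3) unfolding r_def d by (simp add: ac_simps)
    have "q - 3 * n = n\<^sup>2 - 4" by (simp add: q_def power2_eq_square algebra_simps)
    hence "1 - r = (n\<^sup>2 - 4) / q" using q(1) by (simp add: r_def q_def[symmetric] diff_divide_eq_iff)
    thus "(1 - r) * (3 * n) = r * (n\<^sup>2 - 4)" by (simp add: r_def q_def[symmetric])
  qed
  have key: "r * M \<le> v * (t + 2 * v)"
  proof -
    let ?e = "(n\<^sup>2 + n - 8) / 6"
    have e: "(real d - 3) / 3 = ?e" unfolding d by (simp add: field_simps power2_eq_square)
    have "8 \<le> n * n" using n4 n by linarith
    hence e0: "0 \<le> ?e" using n by (simp add: power2_eq_square)
    have u2': "u\<^sup>2 \<le> v * ?e" using u2 unfolding e[symmetric] by simp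
    \<comment> \<open>Completing a square bounds \<open>2 * u\<close> linearly in
      \<open>u\<^sup>2\<close>, hence in \<open>v\<close>. The centre 2 n / 5 is a choice for which
      both the coefficient of \<open>v\<close> (in \<open>q1\<close>) and the constant term (in
      \<open>q2\<close>) are dominated.\<close>
    have "0 \<le> (5 / (2 * n)) * (u - 2 * n / 5)\<^sup>2" using n by simp
    also have "\<dots> = (5 / (2 * n)) * u\<^sup>2 - 2 * u + 2 * n / 5" using n by (simp add: field_simps power2_eq_square)
    finally have "2 * u \<le> (5 / (2 * n)) * u\<^sup>2 + 2 * n / 5" by simp
    also have "\<dots> \<le> (5 / (2 * n)) * (v * ?e) + 2 * n / 5"
      using u2' n by (intro add_right_mono mult_left_mono) auto
    finally have u1: "2 * u \<le> (5 / (2 * n)) * (v * ?e) + 2 * n / 5" .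
    have q1: "(5 / (2 * n)) * ?e \<le> (n\<^sup>2 - 4) / (3 * n) * ((5 * n - 2) / (3 * n))"
    proof -
      have "0 \<le> (5 * n\<^sup>2 - 23 * n + 40)"
      proof -
        have "5 * n\<^sup>2 - 23 * n + 40 = 5 * (n - 23/10)\<^sup>2 + 271/20" by (simp add: power2_eq_square algebra_simps)
        thus ?thesis by simp
      qed
      hence "0 \<le> n * (5 * n\<^sup>2 - 23 * n + 40) + 32" using n by simp
      hence "15 * n * (n\<^sup>2 + n - 8) \<le> 4 * (n\<^sup>2 - 4) * (5 * n - 2)" by (simp add: algebra_simps power2_eq_square)
      thus ?thesis using n by (simp add: divide_simps) (simp add: algebra_simps)
    qed
    have q2: "?e - 1 + 2 * n / 5 \<le> (n\<^sup>2 - 4) / (3 * n) * ((2 * n + 1) / 3)"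
    proof -
      have "5 * n\<^sup>2 - 41 * n + 130 = 5 * (n - 41/10)\<^sup>2 + 919/20" by (simp add: power2_eq_square algebra_simps)
      hence "10 \<le> 5 * n\<^sup>2 - 41 * n + 130" using zero_le_power2[of "n - 41/10"] by linarith
      hence "4 * 10 \<le> n * (5 * n\<^sup>2 - 41 * n + 130)" using n by (intro mult_mono) auto
      hence "15 * n * (n\<^sup>2 + n - 14) + 36 * n\<^sup>2 \<le> 10 * (n\<^sup>2 - 4) * (2 * n + 1)" by (simp add: algebra_simps power2_eq_square)
      thus ?thesis using n by (simp add: divide_simps) (simp add: algebra_simps power2_eq_square)
    qed
    have "?e - 1 + 2 * u \<le> (n\<^sup>2 - 4) / (3 * n) * ((2 * n + 1) / 3) + v * ((n\<^sup>2 - 4) / (3 * n) * ((5 * n - 2) / (3 * n)))"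
    proof -
      have gen: "A - 1 + y \<le> p + v * q" if "y \<le> b * (v * A) + h" "b * A \<le> q" "A - 1 + h \<le> p" for A y p q b h
        using mult_left_mono[OF that(2), of v] v0 that(1)[unfolded mult.left_commute[of b v]] that(3) by linarith
      show ?thesis by (rule gen[OF u1 q1 q2])
    qed
    also have "\<dots> = (n\<^sup>2 - 4) / (3 * n) * (t + 2 * v)"
    proof -
      have "t + 2 * v = (2 * n + 1) / 3 + v * ((5 * n - 2) / (3 * n))" using n by (simp add: t_def xv field_simps)
      thus ?thesis by (simp add: algebra_simps)
    qed
    finally have "r * (?e - 1 + 2 * u) \<le> r * ((n\<^sup>2 - 4) / (3 * n) * (t + 2 * v))" using r(1) by (intro mult_left_mono) auto
    also have "\<dots> = (1 - r) * (t + 2 * v)"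
    proof -
      have "r * ((n\<^sup>2 - 4) / (3 * n)) = 1 - r" using r(3) n by (simp add: field_simps)
      thus ?thesis by (simp only: mult.assoc[symmetric])
    qed
    finally have "v * (r * (?e - 1 + 2 * u)) \<le> v * ((1 - r) * (t + 2 * v))" using v0 by (intro mult_left_mono) auto
    moreover have "r * u\<^sup>2 \<le> r * (v * ?e)" using u2' r(1) by (intro mult_left_mono) auto
    moreover have "r * M \<le> v * (t + 2 * v)"
      if "v * (r * (E - 1 + 2 * u)) \<le> v * ((1 - r) * (t + 2 * v))" "r * u\<^sup>2 \<le> r * (v * E)" for E
      using that by (simp add: M_def algebra_simps power2_eq_square)
    ultimately show ?thesis by blast
  qed
  have "N * M < r * d * M" using N r M0 by simp
  also have "\<dots> \<le> d * (v * (t + 2 * v))" using mult_left_mono[OF key, of "real d"] by (simp add: ac_simps)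
  finally have NM: "N * M < (\<Sum>i<d. w i)" unfolding sw by (simp add: ac_simps)
  have wM: "w i \<le> M" if "i < d" "l i < l k" for i
  proof -
    have "\<bar>\<mu> i - v\<bar> \<le> \<bar>u + v\<bar>" using u_le[OF that(1)] that(2) mk v0 u0 by (auto simp: \<mu>_def)
    thus ?thesis by (simp add: w_def M_def abs_le_square_iff)
  qed
  have w0: "w i > 0" for i using v0 tv by (simp add: w_def add_nonneg_pos)
  have "l i = 0" if "i < d" for i
    by (rule weighted_sum_nonpos_imp_zero[where l = l and w = w and M = M, OF srt N(1) k kN(2) low w0 wM less_imp_le[OF M0] NM])
      (use slw that in auto)
  hence "(\<Sum>i<d. l i) = 0" by simp
  thus False using s1 d9 by simp
qed

section \<open>Bochner formulas\<close>

lemma onb_axis: "onb UNIV UNIV (\<lambda>i. axis i 1 :: real^'n)"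
  unfolding onb_def
proof (intro conjI ballI)
  show "(axis i 1 :: real^'n) \<bullet> axis j 1 = (if i = j then 1 else 0)" for i j
    by (simp add: inner_axis_axis)
  show "x = (\<Sum>i\<in>UNIV. (x \<bullet> axis i 1) *\<^sub>R axis i 1)" for x :: "real^'n"
    using basis_expansion[of x] by (simp add: inner_axis scalar_mult_eq_scaleR)
qed auto

lemma inner_matrix_vector:
  fixes A :: "real^'n^'n"
  shows "x \<bullet> (A *v y) = (transpose A *v x) \<bullet> y"
  by (metis dot_lmul_matrix vector_transpose_matrix transpose_transpose)

lemma onb_inner_matrix:
  fixes o' :: "'i \<Rightarrow> real^'n"
  assumes "onb UNIV I o'"
  shows "(A :: real^'n^'n) \<bullet> B = (\<Sum>i\<in>I. \<Sum>j\<in>I. (o' j \<bullet> (A *v o' i)) * (o' j \<bullet> (B *v o' i)))"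
    and "trace A = (\<Sum>i\<in>I. o' i \<bullet> (A *v o' i))"
proof -
  have tr: "trace A = (\<Sum>i\<in>I. o' i \<bullet> (A *v o' i))" for A :: "real^'n^'n"
  proof -
    have "bilinear (\<lambda>x y. x \<bullet> (A *v y))"
      by (auto simp: bilinear_def intro!: linearI simp: inner_add_left inner_add_right
        matrix_vector_right_distrib matrix_vector_mult_scaleR)
    from onb_trace[OF this assms onb_axis]
    have "(\<Sum>i\<in>I. o' i \<bullet> (A *v o' i)) = (\<Sum>i\<in>UNIV. axis i 1 \<bullet> (A *v axis i 1))" .
    also have "\<dots> = trace A" by (simp add: trace_def inner_axis' matrix_vector_mul_component matrix_vector_mult_basis column_def)
    finally show ?thesis by simp
  qed
  show "trace A = (\<Sum>i\<in>I. o' i \<bullet> (A *v o' i))" by (rule tr)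
  have "A \<bullet> B = (\<Sum>i\<in>I. (A *v o' i) \<bullet> (B *v o' i))"
  proof -
    have "x \<bullet> ((transpose A ** B) *v x) = (A *v x) \<bullet> (B *v x)" for x
      using inner_matrix_vector[of x "transpose A" "B *v x"]
      by (simp only: matrix_vector_mul_assoc transpose_transpose)
    thus ?thesis unfolding inner_matrix_trace tr by simp
  qed
  thus "A \<bullet> B = (\<Sum>i\<in>I. \<Sum>j\<in>I. (o' j \<bullet> (A *v o' i)) * (o' j \<bullet> (B *v o' i)))"
    by (simp only: onb_inner[OF assms UNIV_I, of "A *v _" "B *v _"] inner_commute[of "o' _"])
qed

lemma skew_inner_vector:
  assumes "A \<in> skew"
  shows "x \<bullet> (A *v y) = - ((A *v x) \<bullet> y)"
proof -
  have "(- A) *v x = - (A *v x)" by (simp add: vec_eq_iff matrix_vector_mult_def sum_negf)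
  thus ?thesis using assms by (simp add: inner_matrix_vector[of x] skew_def)
qed

lemma symmetric_eigenbasis:
  fixes S :: "real^'n^'n"
  assumes "transpose S = S"
  obtains e :: "'n \<Rightarrow> real^'n" and s where "onb UNIV UNIV e" "\<And>i. S *v e i = s i *\<^sub>R e i"
proof -
  have "\<exists>b ev. onb UNIV {..<dim (UNIV :: (real^'n) set)} b \<and>
      (\<forall>i<dim (UNIV :: (real^'n) set). S *v b i = ev i *\<^sub>R b i) \<and>
      (\<forall>i j. i \<le> j \<longrightarrow> j < dim (UNIV :: (real^'n) set) \<longrightarrow> ev i \<le> ev j)"
    using inner_matrix_vector[of _ S] assms
    by (intro spectral_theorem) (auto simp: inner_commute)
  then obtain b ev where b: "onb UNIV {..<CARD('n)} b" and ev: "\<And>i. i < CARD('n) \<Longrightarrow> S *v b i = ev i *\<^sub>R b i"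
    by auto
  have "card (UNIV :: 'n set) = card {..<CARD('n)}" by simp
  then obtain f where f: "bij_betw f (UNIV :: 'n set) {..<CARD('n)}"
    using finite_same_card_bij[of "UNIV :: 'n set" "{..<CARD('n)}"] by auto
  hence "f i < CARD('n)" for i by (auto simp: bij_betw_def)
  thus ?thesis using that[OF onb_reindex[OF b f], of "ev \<circ> f"] ev by simp
qed

text \<open>Cauchy--Schwarz on the two blocks \<open>T\<close> and \<open>- T\<close>.\<close>

lemma tracefree_partial_sum_bound:
  fixes s :: "'n::finite \<Rightarrow> real"
  assumes "(\<Sum>i\<in>UNIV. s i) = 0"
  shows "(\<Sum>i\<in>T. s i)\<^sup>2 \<le> real (card T) * (real CARD('n) - card T) / real CARD('n) * (\<Sum>i\<in>UNIV. (s i)\<^sup>2)"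
proof -
  let ?n = "real CARD('n)" and ?p = "real (card T)" and ?q = "(\<Sum>i\<in>T. s i)"
  have cs: "(\<Sum>i\<in>U. s i)\<^sup>2 \<le> real (card U) * (\<Sum>i\<in>U. (s i)\<^sup>2)" for U
    using Cauchy_Schwarz_ineq_sum[of s "\<lambda>i. 1" U] by (simp add: mult.commute)
  have c: "real (card (- T)) = ?n - ?p"
    using card_Un_disjoint[of T "- T"] by simp
  have sp: "sum f UNIV = sum f T + sum f (- T)" for f :: "'n \<Rightarrow> real"
    using sum.union_disjoint[of T "- T" f] by simp
  have "?q\<^sup>2 * (?n - ?p) \<le> ?p * (\<Sum>i\<in>T. (s i)\<^sup>2) * (?n - ?p)"
    using cs[of T] c by (intro mult_right_mono) auto
  moreover have "?q\<^sup>2 * ?p \<le> (?n - ?p) * (\<Sum>i\<in>-T. (s i)\<^sup>2) * ?p"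
    using cs[of "- T"] c assms sp[of s] by (intro mult_right_mono) (auto simp: eq_neg_iff_add_eq_0[symmetric])
  ultimately have "?q\<^sup>2 * ?n \<le> ?p * (?n - ?p) * (\<Sum>i\<in>UNIV. (s i)\<^sup>2)"
    unfolding sp[of "\<lambda>i. (s i)\<^sup>2"] by (simp add: algebra_simps)
  thus ?thesis by (simp add: field_simps)
qed

lemma symmetric_unit_eigenbasis:
  fixes S :: "real^'n^'n"
  assumes "S \<in> tracefree_sym" "S \<bullet> S = 1"
  obtains e :: "'n \<Rightarrow> real^'n" and s where "onb UNIV UNIV e" "\<And>i. S *v e i = s i *\<^sub>R e i"
    "(\<Sum>i\<in>UNIV. s i) = 0" "(\<Sum>i\<in>UNIV. (s i)\<^sup>2) = 1"
proof -
  obtain e :: "'n \<Rightarrow> real^'n" and s where e: "onb UNIV UNIV e" "\<And>i. S *v e i = s i *\<^sub>R e i"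
    using assms(1) symmetric_eigenbasis[of S] by (auto simp: tracefree_sym_def)
  have ee: "e i \<bullet> e j = (if i = j then 1 else 0)" for i j using onb_D(3)[OF e(1)] by simp
  have "(\<Sum>i\<in>UNIV. s i) = 0"
    using onb_inner_matrix(2)[OF e(1), of S] assms(1) by (simp add: e(2) ee tracefree_sym_def)
  moreover have "(\<Sum>i\<in>UNIV. (s i)\<^sup>2) = 1"
    using onb_inner_matrix(1)[OF e(1), of S S] assms(2)
    by (simp add: e(2) ee power2_eq_square if_distrib[where f = "\<lambda>x. _ * x"] cong: if_cong)
  ultimately show ?thesis using that e by blast
qed

text \<open>Keeps the position given by the floor of N inside the eigenvalue list. That the
  threshold is at most d amounts to n^2 \<ge> 4.\<close>

lemma (in curv_eigenbasis) floor_less_d: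
  assumes dim3: "3 \<le> CARD('n)" and N: "1 \<le> N" "N < 3 * real CARD('n) / 2 * ((real CARD('n) + 2) / (real CARD('n) + 4))"
  shows "N < real d" "nat \<lfloor>N\<rfloor> < d"
proof -
  let ?n = "real CARD('n)"
  have n: "?n \<ge> 3" using dim3 by simp
  hence "3 * 3 \<le> ?n * ?n" by (intro mult_mono) auto
  moreover have "(?n - 1) * (?n + 4) = ?n * ?n + 3 * ?n - 4" by (simp add: algebra_simps)
  ultimately have "3 * ?n \<le> (?n - 1) * (?n + 4)" by linarith
  hence "3 * ?n * (?n + 2) \<le> (?n - 1) * (?n + 4) * (?n + 2)" using n by (intro mult_right_mono) auto
  hence "3 * ?n / 2 * ((?n + 2) / (?n + 4)) \<le> d" using n unfolding card_d by (simp add: field_simps)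
  thus "N < real d" using N by simp
  thus "nat \<lfloor>N\<rfloor> < d" using N by linarith
qed

locale curv_N_nonneg = curv_eigenbasis \<omega> c D \<rho> S ev d
  for \<omega> :: "nat \<Rightarrow> real^'n^'n" and c D \<rho> S ev d +
  fixes N :: real
  assumes ev_sorted: "\<And>i j. i \<le> j \<Longrightarrow> j < d \<Longrightarrow> ev i \<le> ev j"
    and dim3: "3 \<le> CARD('n)" and N: "1 \<le> N" "N < 3 * real CARD('n) / 2 * ((real CARD('n) + 2) / (real CARD('n) + 4))"
    and low: "0 \<le> (\<Sum>i<nat \<lfloor>N\<rfloor>. ev i) + (N - of_int \<lfloor>N\<rfloor>) * ev (nat \<lfloor>N\<rfloor>)"
begin

lemmas N_less_d = floor_less_d[OF dim3 N]

lemma weights_contradiction: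
  assumes "\<And>a. a < d \<Longrightarrow> 0 < w a" "\<And>a. a < d \<Longrightarrow> w a \<le> M" "0 \<le> M" "N * M < (\<Sum>a<d. w a)" "(\<Sum>a<d. ev a * w a) \<le> 0"
  shows "a < d \<Longrightarrow> ev a = 0"
  by (rule weighted_sum_nonpos_imp_zero[where l = ev and w = w and M = M, OF ev_sorted N(1) refl N_less_d(2) low])
    (use assms in auto)

text \<open>Origin of the threshold. Adding the constant 2 \<alpha> / (n + 2) to \<open>f\<close>
  cancels - \<rho> \<alpha>, because the \<open>ev a\<close> add up to \<rho> (n + 2) / 2. The total
  weight becomes \<alpha> (n + 2) / 2 + \<alpha> (n - 1) = 3 n \<alpha> / 2, and each weight is at
  most \<alpha> (n + 4) / (n + 2).\<close>

lemma bochner_contradiction: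
  assumes "0 < \<rho>" "0 < \<alpha>" and f: "\<And>a. a < d \<Longrightarrow> 0 \<le> f a" "\<And>a. a < d \<Longrightarrow> f a \<le> \<alpha>"
    and sf: "(\<Sum>a<d. f a) = \<alpha> * (real CARD('n) + 2) / 2" "(\<Sum>a<d. ev a * f a) = - \<rho> * \<alpha>"
  shows False
proof -
  let ?n = "real CARD('n)"
  define w where "w a = f a + 2 * \<alpha> / (?n + 2)" for a
  define M where "M = \<alpha> * ((?n + 4) / (?n + 2))"
  have n: "?n \<ge> 3" using dim3 by simp
  have M0: "M > 0" using assms(2) n by (simp add: M_def)
  have sw: "(\<Sum>a<d. w a) = 3 * ?n / 2 * \<alpha>"
    using n by (simp add: w_def sum.distrib sf card_d) (simp add: field_simps)
  have "(\<Sum>a<d. ev a * w a) = 0"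
  proof -
    have "(\<Sum>a<d. ev a * w a) = (\<Sum>a<d. ev a * f a) + (\<Sum>a<d. ev a) * (2 * \<alpha> / (?n + 2))"
      unfolding w_def distrib_left sum.distrib by (simp only: sum_distrib_right)
    thus ?thesis using n by (simp add: sf sum_ev)
  qed
  moreover have "N * M < (\<Sum>a<d. w a)"
  proof -
    have "N * M < 3 * ?n / 2 * ((?n + 2) / (?n + 4)) * M" using N(2) M0 by (rule mult_strict_right_mono)
    also have "\<dots> = 3 * ?n / 2 * \<alpha> * (((?n + 2) / (?n + 4)) * ((?n + 4) / (?n + 2)))"
      by (simp only: M_def ac_simps)
    also have "((?n + 2) / (?n + 4)) * ((?n + 4) / (?n + 2)) = 1" using n by simp
    finally show ?thesis using sw by simp
  qed
  moreover have "w a \<le> M" "0 < w a" if "a < d" for a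
  proof -
    have "M = \<alpha> + 2 * \<alpha> / (?n + 2)" using n by (simp add: M_def field_simps)
    thus "w a \<le> M" using f(2)[OF that] by (simp add: w_def)
    show "0 < w a" using f(1)[OF that] assms(2) n by (simp add: w_def add_nonneg_pos)
  qed
  ultimately have "ev a = 0" if "a < d" for a using weights_contradiction[of w M] M0 that by auto
  hence "\<rho> * (?n + 2) / 2 = 0" using sum_ev by simp
  thus False using assms(1) n by simp
qed

lemma sum_S_square: "(\<Sum>a<d. S a ** S a) = ((real CARD('n) + 1) / 2 - 1 / real CARD('n)) *\<^sub>R mat 1"
proof -
  have "(\<Sum>a<d. S a ** S a) = (\<Sum>a<d. S a ** mat 1 ** S a)" by simp
  also have "\<dots> = ((real CARD('n) + 1) / 2 - 1 / real CARD('n)) *\<^sub>R mat 1"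
    unfolding sum_sandwich
    by (simp add: trace_I scaleR_add_right scaleR_diff_left add_divide_distrib scaleR_add_left)
  finally show ?thesis .
qed

lemma sum_ev_S_square: "(\<Sum>a<d. ev a *\<^sub>R (S a ** S a)) = (\<rho> / real CARD('n) + \<rho> / 2) *\<^sub>R mat 1"
  using sum_ev_sandwich[of "mat 1"] by (simp add: einstein trace_skew w_skew scaleR_add_left)

text \<open>\<open>f a\<close> is the squared norm of the derivation action of \<open>S a\<close> on
  the 2-form \<open>J\<close>. In an eigenframe of \<open>S a\<close> the entries of
  \<open>J\<close> are multiplied by s i + s j, whose square is at most 2 (n - 2) / n; the sums over
  \<open>a\<close> come from the sandwich formulas.\<close>

lemma no_parallel_2form:
  assumes "0 < \<rho>" and J: "J \<in> skew" "J \<noteq> 0" and comm: "\<And>\<gamma>. \<gamma> < D \<Longrightarrow> c \<gamma> \<noteq> 0 \<Longrightarrow> commut (\<omega> \<gamma>) J = 0"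
  shows False
proof -
  let ?n = "real CARD('n)"
  define f where "f a = (S a ** J + J ** S a) \<bullet> (S a ** J + J ** S a)" for a
  define \<alpha> where "\<alpha> = 2 * (?n - 2) / ?n * (J \<bullet> J)"
  have n: "?n \<ge> 3" using dim3 by simp
  have JJ: "J \<bullet> J > 0" using J by simp
  have Jt: "transpose J = - J" using J by (simp add: skew_def)
  have fe: "f a = 2 * (J \<bullet> (S a ** S a ** J)) + 2 * (J \<bullet> (S a ** J ** S a))" if "a < d" for a
  proof -
    have 1: "(S a ** J) \<bullet> (S a ** J) = J \<bullet> (S a ** S a ** J)"
      by (simp add: inner_mult_left[of "S a" J] S_sym[OF that] matrix_mul_assoc)
    have 2: "(S a ** J) \<bullet> (J ** S a) = J \<bullet> (S a ** J ** S a)"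
      by (simp add: inner_mult_left[of "S a" J] S_sym[OF that] matrix_mul_assoc)
    have "(J ** S a) \<bullet> (J ** S a) = transpose (J ** S a) \<bullet> transpose (J ** S a)" by (simp add: inner_transpose)
    also have "\<dots> = (S a ** J) \<bullet> (S a ** J)" by (simp add: transpose_simps Jt S_sym[OF that] matrix_mult_simps)
    finally have 3: "(J ** S a) \<bullet> (J ** S a) = J \<bullet> (S a ** S a ** J)" using 1 by simp
    show ?thesis unfolding f_def inner_add_left inner_add_right
      using 1 2 3 by (simp add: inner_commute[of "J ** S a" "S a ** J"])
  qed
  \<comment> \<open>\<open>J\<close> commutes with each \<open>\<omega> \<alpha>\<close> that has a
    nonzero coefficient, so it can be pulled out of the sum.\<close>
  have cJ: "(\<Sum>\<alpha><D. c \<alpha> *\<^sub>R (\<omega> \<alpha> ** J ** \<omega> \<alpha>)) = - (\<rho> / 2) *\<^sub>R J"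
  proof -
    have "c \<alpha> *\<^sub>R (\<omega> \<alpha> ** J ** \<omega> \<alpha>) = J ** (c \<alpha> *\<^sub>R (\<omega> \<alpha> ** \<omega> \<alpha>))" if "\<alpha> < D" for \<alpha>
      using comm[OF that] by (cases "c \<alpha> = 0") (auto simp: commut_def matrix_mult_simps matrix_mul_assoc)
    hence "(\<Sum>\<alpha><D. c \<alpha> *\<^sub>R (\<omega> \<alpha> ** J ** \<omega> \<alpha>)) = J ** (\<Sum>\<alpha><D. c \<alpha> *\<^sub>R (\<omega> \<alpha> ** \<omega> \<alpha>))"
      by (simp add: matrix_mult_sum_right)
    thus ?thesis by (simp add: einstein matrix_mult_simps)
  qed
  have tJ: "(\<Sum>\<alpha><D. (c \<alpha> * trace (\<omega> \<alpha> ** J)) *\<^sub>R \<omega> \<alpha>) = - \<rho> *\<^sub>R J"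
  proof -
    have "trace (\<omega> \<alpha> ** J) = - (\<omega> \<alpha> \<bullet> J)" if "\<alpha> < D" for \<alpha>
      by (simp add: inner_matrix_trace w_skew(2)[OF that] matrix_mult_simps trace_simps)
    hence "(\<Sum>\<alpha><D. (c \<alpha> * trace (\<omega> \<alpha> ** J)) *\<^sub>R \<omega> \<alpha>) = - (\<Sum>\<alpha><D. (c \<alpha> * (\<omega> \<alpha> \<bullet> J)) *\<^sub>R \<omega> \<alpha>)"
      by (simp add: sum_negf)
    also have "\<dots> = - \<rho> *\<^sub>R J" using bianchi[OF J(1)] by (simp add: cJ)
    finally show ?thesis .
  qed
  show False
  proof (rule bochner_contradiction[OF assms(1)])
    show "0 < \<alpha>" using JJ n by (simp add: \<alpha>_def)
    show "0 \<le> f a" for a by (simp add: f_def)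
    show "f a \<le> \<alpha>" if "a < d" for a
    proof -
      have "S a \<in> tracefree_sym" "S a \<bullet> S a = 1" using that S_inner onb_D(2)[OF onb_S] by auto
      from symmetric_unit_eigenbasis[OF this]
      obtain e :: "'n \<Rightarrow> real^'n" and s where e: "onb UNIV UNIV e" "\<And>i. S a *v e i = s i *\<^sub>R e i"
        and s: "(\<Sum>i\<in>UNIV. s i) = 0" "(\<Sum>i\<in>UNIV. (s i)\<^sup>2) = 1" by metis
      have ent: "e j \<bullet> ((S a ** J + J ** S a) *v e i) = (s i + s j) * (e j \<bullet> (J *v e i))" for i j
      proof -
        have "e j \<bullet> ((S a ** J) *v e i) = s j * (e j \<bullet> (J *v e i))"
          by (simp add: matrix_vector_mul_assoc[symmetric] inner_matrix_vector[of _ "S a"] S_sym[OF that] e(2))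
        moreover have "e j \<bullet> ((J ** S a) *v e i) = s i * (e j \<bullet> (J *v e i))"
          by (simp add: matrix_vector_mul_assoc[symmetric] e(2) matrix_vector_mult_scaleR)
        ultimately show ?thesis by (simp add: matrix_vector_mult_add_rdistrib inner_add_right algebra_simps)
      qed
      have J0: "e i \<bullet> (J *v e i) = 0" for i
        using skew_inner_vector[OF J(1), of "e i" "e i"] by (simp add: inner_commute)
      have b: "(s i + s j)\<^sup>2 * (e j \<bullet> (J *v e i))\<^sup>2 \<le> 2 * (?n - 2) / ?n * (e j \<bullet> (J *v e i))\<^sup>2" for i j
      proof (cases "i = j")
        case False
        hence "(s i + s j)\<^sup>2 \<le> 2 * (?n - 2) / ?n" using tracefree_partial_sum_bound[OF s(1), of "{i, j}"] s(2) by simp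
        thus ?thesis by (rule mult_right_mono) simp
      qed (simp add: J0)
      have "f a = (\<Sum>i\<in>UNIV. \<Sum>j\<in>UNIV. (s i + s j)\<^sup>2 * (e j \<bullet> (J *v e i))\<^sup>2)"
        unfolding f_def onb_inner_matrix(1)[OF e(1)] ent by (simp add: power2_eq_square ac_simps)
      also have "\<dots> \<le> (\<Sum>i\<in>UNIV. \<Sum>j\<in>UNIV. 2 * (?n - 2) / ?n * (e j \<bullet> (J *v e i))\<^sup>2)"
        by (intro sum_mono b)
      also have "\<dots> = \<alpha>" unfolding \<alpha>_def onb_inner_matrix(1)[OF e(1)] sum_distrib_left by (simp add: power2_eq_square)
      finally show ?thesis .
    qed
    have "(\<Sum>a<d. f a) = 2 * (J \<bullet> ((\<Sum>a<d. S a ** S a) ** J)) + 2 * (J \<bullet> (\<Sum>a<d. S a ** J ** S a))"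
      by (simp add: fe sum.distrib sum_distrib_left inner_sum_right matrix_mult_sum_left)
    also have "\<dots> = \<alpha> * (?n + 2) / 2"
      using n unfolding sum_S_square sum_sandwich(1) \<alpha>_def trace_skew[OF J(1)] Jt
      by (simp add: matrix_mult_simps inner_diff_right) (simp add: field_simps)
    finally show "(\<Sum>a<d. f a) = \<alpha> * (?n + 2) / 2" .
    have "(\<Sum>a<d. ev a * f a) = 2 * (J \<bullet> ((\<Sum>a<d. ev a *\<^sub>R (S a ** S a)) ** J)) + 2 * (J \<bullet> (\<Sum>a<d. ev a *\<^sub>R (S a ** J ** S a)))"
      by (simp add: fe sum.distrib sum_distrib_left inner_sum_right matrix_mult_sum_left matrix_mult_simps algebra_simps)
    also have "\<dots> = - \<rho> * \<alpha>"
      using n unfolding sum_ev_S_square sum_ev_sandwich cJ tJ \<alpha>_def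
      by (simp add: matrix_mult_simps inner_diff_right inner_add_right) (simp add: field_simps)
    finally show "(\<Sum>a<d. ev a * f a) = - \<rho> * \<alpha>" .
  qed
qed

end

section \<open>Alternating 4-forms and the norm of their derivation action\<close>

lemma sum_swap4:
  "(\<Sum>i\<in>A. \<Sum>j\<in>B. \<Sum>k\<in>C. \<Sum>l\<in>E. f i j k l) = (\<Sum>k\<in>C. \<Sum>l\<in>E. \<Sum>i\<in>A. \<Sum>j\<in>B. f i j k l)"
proof -
  have "(\<Sum>i\<in>A. \<Sum>j\<in>B. \<Sum>k\<in>C. \<Sum>l\<in>E. f i j k l) = (\<Sum>i\<in>A. \<Sum>k\<in>C. \<Sum>j\<in>B. \<Sum>l\<in>E. f i j k l)"
    by (rule sum.cong[OF refl], rule sum.swap)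
  also have "\<dots> = (\<Sum>k\<in>C. \<Sum>i\<in>A. \<Sum>j\<in>B. \<Sum>l\<in>E. f i j k l)" by (rule sum.swap)
  also have "\<dots> = (\<Sum>k\<in>C. \<Sum>i\<in>A. \<Sum>l\<in>E. \<Sum>j\<in>B. f i j k l)"
    by (rule sum.cong[OF refl], rule sum.cong[OF refl], rule sum.swap)
  also have "\<dots> = (\<Sum>k\<in>C. \<Sum>l\<in>E. \<Sum>i\<in>A. \<Sum>j\<in>B. f i j k l)"
    by (rule sum.cong[OF refl], rule sum.swap)
  finally show ?thesis .
qed

lemma onb_sum_square_bilinear:
  fixes G :: "'a::euclidean_space \<Rightarrow> 'a \<Rightarrow> real"
  assumes G: "bilinear G" and e: "onb UNIV I e" "onb UNIV J e'"
  shows "(\<Sum>i\<in>I. \<Sum>j\<in>I. (G (e i) (e j))\<^sup>2) = (\<Sum>i\<in>J. \<Sum>j\<in>J. (G (e' i) (e' j))\<^sup>2)"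
proof -
  have lin: "(\<Sum>i\<in>I. (g (e i))\<^sup>2) = (\<Sum>i\<in>J. (g (e' i))\<^sup>2)" if "linear g" for g :: "'a \<Rightarrow> real"
  proof -
    have "bilinear (\<lambda>x y. g x * g y)"
      by (auto simp: bilinear_def intro!: linearI simp: linear_add[OF that] linear_scale[OF that] algebra_simps)
    from onb_trace[OF this e] show ?thesis by (simp add: power2_eq_square)
  qed
  have l: "linear (\<lambda>x. G x y)" "linear (G x)" for x y using G by (auto simp: bilinear_def)
  have "(\<Sum>i\<in>I. \<Sum>j\<in>I. (G (e i) (e j))\<^sup>2) = (\<Sum>i\<in>I. \<Sum>j\<in>J. (G (e i) (e' j))\<^sup>2)" by (simp only: lin[OF l(2)])
  also have "\<dots> = (\<Sum>j\<in>J. \<Sum>i\<in>I. (G (e i) (e' j))\<^sup>2)" by (rule sum.swap)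
  also have "\<dots> = (\<Sum>j\<in>J. \<Sum>i\<in>J. (G (e' i) (e' j))\<^sup>2)" by (simp only: lin[OF l(1)])
  also have "\<dots> = (\<Sum>i\<in>J. \<Sum>j\<in>J. (G (e' i) (e' j))\<^sup>2)" by (rule sum.swap)
  finally show ?thesis .
qed

text \<open>The adjacent transpositions generate all permutations, and their signs carry linearity
  from the first slot to the others.\<close>

locale four_form =
  fixes \<Psi> :: "real^'n \<Rightarrow> real^'n \<Rightarrow> real^'n \<Rightarrow> real^'n \<Rightarrow> real"
  assumes lin: "linear (\<lambda>u. \<Psi> u v w z)"
    and a12: "\<Psi> u v w z = - \<Psi> v u w z" and a23: "\<Psi> u v w z = - \<Psi> u w v z" and a34: "\<Psi> u v w z = - \<Psi> u v z w"
begin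

definition deriv_action :: "real^'n^'n \<Rightarrow> real^'n \<Rightarrow> real^'n \<Rightarrow> real^'n \<Rightarrow> real^'n \<Rightarrow> real" where
  "deriv_action A u v w z = \<Psi> (A *v u) v w z + \<Psi> u (A *v v) w z + \<Psi> u v (A *v w) z + \<Psi> u v w (A *v z)"

text \<open>Freezing two arguments gives a skew matrix, so that a derivation in the other two slots
  becomes matrix multiplication.\<close>

definition slice :: "'n \<Rightarrow> 'n \<Rightarrow> real^'n^'n" where
  "slice k l = (\<chi> i j. \<Psi> (axis i 1) (axis j 1) (axis k 1) (axis l 1))"

lemma lin2: "linear (\<lambda>v. \<Psi> u v w z)"
  using linear_compose_neg[OF lin[of u w z]] by (subst a12)

lemma lin3: "linear (\<lambda>w. \<Psi> u v w z)"
  using linear_compose_neg[OF lin2[of u v z]] by (subst a23)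

lemma lin4: "linear (\<lambda>z. \<Psi> u v w z)"
  using linear_compose_neg[OF lin3[of u v w]] by (subst a34)

lemma linear_deriv_action:
  "linear (\<lambda>u. deriv_action A u v w z)" "linear (\<lambda>v. deriv_action A u v w z)"
  "linear (\<lambda>w. deriv_action A u v w z)" "linear (\<lambda>z. deriv_action A u v w z)"
  by (auto intro!: linearI simp: deriv_action_def matrix_vector_right_distrib matrix_vector_mult_scaleR
      linear_add[OF lin] linear_add[OF lin2] linear_add[OF lin3] linear_add[OF lin4]
      linear_scale[OF lin] linear_scale[OF lin2] linear_scale[OF lin3] linear_scale[OF lin4] algebra_simps)

lemma vanish: "\<Psi> u u w z = 0" "\<Psi> u v v z = 0" "\<Psi> u v w w = 0" "\<Psi> u v u z = 0" "\<Psi> u v w v = 0" "\<Psi> u v w u = 0"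
proof -
  show 1: "\<Psi> u u w z = 0" for u w z using a12[of u u w z] by simp
  show 2: "\<Psi> u v v z = 0" for u v z using a23[of u v v z] by simp
  show "\<Psi> u v w w = 0" using a34[of u v w w] by simp
  show 3: "\<Psi> u v u z = 0" for u v z using a23[of u v u z] 1 by simp
  show "\<Psi> u v w v = 0" using a34[of u v w v] 2 by simp
  show "\<Psi> u v w u = 0" using a34[of u v w u] 3 by simp
qed

lemma slice_skew: "slice k l \<in> skew"
  by (simp add: skew_def slice_def transpose_def vec_eq_iff, intro allI, rule a12)

lemma matrix_axis: "(A :: real^'n^'n) *v axis i 1 = (\<Sum>m\<in>UNIV. A $ m $ i *\<^sub>R axis m 1)"
  using basis_expansion[of "A *v axis i 1"]
  by (simp add: matrix_vector_mult_basis column_def scalar_mult_eq_scaleR)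

lemma slice_mult:
  "\<Psi> (A *v axis i 1) (axis j 1) (axis k 1) (axis l 1) = (transpose A ** slice k l) $ i $ j"
  "\<Psi> (axis i 1) (A *v axis j 1) (axis k 1) (axis l 1) = (slice k l ** A) $ i $ j"
  unfolding matrix_axis linear_sum[OF lin] linear_sum[OF lin2] linear_scale[OF lin] linear_scale[OF lin2]
  by (simp_all add: matrix_matrix_mult_def transpose_def slice_def mult.commute)

text \<open>Expanding the square gives four squares and twelve ordered mixed products. Renaming
  summation indices and alternation make all squares equal and all mixed products equal, since signs
  occur in pairs.\<close>

lemma sum_deriv_action:
  "(\<Sum>i\<in>UNIV. \<Sum>j\<in>UNIV. \<Sum>k\<in>UNIV. \<Sum>l\<in>UNIV. (deriv_action A (axis i 1) (axis j 1) (axis k 1) (axis l 1))\<^sup>2)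
   = (\<Sum>k\<in>UNIV. \<Sum>l\<in>UNIV. 4 * ((transpose A ** slice k l) \<bullet> (transpose A ** slice k l))
        + 12 * ((transpose A ** slice k l) \<bullet> (slice k l ** A)))"
proof -
  define X1 where "X1 i j k l = \<Psi> (A *v axis i 1) (axis j 1) (axis k 1) (axis l 1)" for i j k l :: 'n
  define X2 where "X2 i j k l = \<Psi> (axis i 1) (A *v axis j 1) (axis k 1) (axis l 1)" for i j k l :: 'n
  define X3 where "X3 i j k l = \<Psi> (axis i 1) (axis j 1) (A *v axis k 1) (axis l 1)" for i j k l :: 'n
  define X4 where "X4 i j k l = \<Psi> (axis i 1) (axis j 1) (axis k 1) (A *v axis l 1)" for i j k l :: 'n
  note X = X1_def X2_def X3_def X4_def
  define S4 where "S4 F = (\<Sum>i\<in>UNIV. \<Sum>j\<in>UNIV. \<Sum>k\<in>UNIV. \<Sum>l\<in>UNIV. F i j k l)" for F :: "'n \<Rightarrow> 'n \<Rightarrow> 'n \<Rightarrow> 'n \<Rightarrow> real"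
  have p12: "S4 F = S4 (\<lambda>i j k l. F j i k l)" for F unfolding S4_def by (rule sum.swap)
  have p23: "S4 F = S4 (\<lambda>i j k l. F i k j l)" for F unfolding S4_def by (rule sum.cong[OF refl], rule sum.swap)
  have p34: "S4 F = S4 (\<lambda>i j k l. F i j l k)" for F unfolding S4_def
    by (rule sum.cong[OF refl], rule sum.cong[OF refl], rule sum.swap)
  have r21: "X2 i j k l = - X1 j i k l" and r33: "X3 i j k l = - X3 j i k l" for i j k l
    unfolding X by (rule a12)+
  have r32: "X3 i j k l = - X2 i k j l" and r11: "X1 i j k l = - X1 i k j l" and r44: "X4 i j k l = - X4 i k j l" for i j k l
    unfolding X by (rule a23)+
  have r43: "X4 i j k l = - X3 i j l k" and r11': "X1 i j k l = - X1 i j l k" and r22: "X2 i j k l = - X2 i j l k" for i j k l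
    unfolding X by (rule a34)+
  let ?S = "\<lambda>F G. S4 (\<lambda>i j k l. F i j k l * G i j k l)"
  have e22: "?S X2 X2 = ?S X1 X1" by (subst p12) (simp add: r21)
  have e33: "?S X3 X3 = ?S X1 X1" unfolding e22[symmetric] by (subst p23) (simp add: r32)
  have e44: "?S X4 X4 = ?S X1 X1" unfolding e33[symmetric] by (subst p34) (simp add: r43)
  have e13: "?S X1 X3 = ?S X1 X2" 
  proof -
    have "?S X1 X2 = S4 (\<lambda>i j k l. X1 i k j l * X2 i k j l)" by (rule p23)
    also have "\<dots> = ?S X1 X3"
    proof -
      have "X1 i k j l * X2 i k j l = X1 i j k l * X3 i j k l" for i j k l using r11[of i j k l] r32[of i j k l] by simp
      thus ?thesis by (simp only:)
    qed
    finally show ?thesis by simp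
  qed
  have e14: "?S X1 X4 = ?S X1 X2"
  proof -
    have "?S X1 X3 = S4 (\<lambda>i j k l. X1 i j l k * X3 i j l k)" by (rule p34)
    also have "\<dots> = ?S X1 X4"
    proof -
      have "X1 i j l k * X3 i j l k = X1 i j k l * X4 i j k l" for i j k l using r11'[of i j k l] r43[of i j k l] by simp
      thus ?thesis by (simp only:)
    qed
    finally show ?thesis using e13 by simp
  qed
  have e23: "?S X2 X3 = ?S X1 X2"
  proof -
    have "?S X1 X3 = S4 (\<lambda>i j k l. X1 j i k l * X3 j i k l)" by (rule p12)
    also have "\<dots> = ?S X2 X3"
    proof -
      have "X1 j i k l * X3 j i k l = X2 i j k l * X3 i j k l" for i j k l using r33[of i j k l] r21[of i j k l] by simp
      thus ?thesis by (simp only:)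
    qed
    finally show ?thesis using e13 by simp
  qed
  have e24: "?S X2 X4 = ?S X1 X2"
  proof -
    have "?S X2 X3 = S4 (\<lambda>i j k l. X2 i j l k * X3 i j l k)" by (rule p34)
    also have "\<dots> = ?S X2 X4"
    proof -
      have "X2 i j l k * X3 i j l k = X2 i j k l * X4 i j k l" for i j k l using r22[of i j k l] r43[of i j k l] by simp
      thus ?thesis by (simp only:)
    qed
    finally show ?thesis using e23 by simp
  qed
  have e34: "?S X3 X4 = ?S X1 X2"
  proof -
    have "?S X2 X4 = S4 (\<lambda>i j k l. X2 i k j l * X4 i k j l)" by (rule p23)
    also have "\<dots> = ?S X3 X4"
    proof -
      have "X2 i k j l * X4 i k j l = X3 i j k l * X4 i j k l" for i j k l using r44[of i j k l] r32[of i j k l] by simp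
      thus ?thesis by (simp only:)
    qed
    finally show ?thesis using e24 by simp
  qed
  have "(\<Sum>i\<in>UNIV. \<Sum>j\<in>UNIV. \<Sum>k\<in>UNIV. \<Sum>l\<in>UNIV. (deriv_action A (axis i 1) (axis j 1) (axis k 1) (axis l 1))\<^sup>2)
    = S4 (\<lambda>i j k l. (X1 i j k l + X2 i j k l + X3 i j k l + X4 i j k l)\<^sup>2)"
    unfolding S4_def deriv_action_def X ..
  also have "\<dots> = ?S X1 X1 + ?S X2 X2 + ?S X3 X3 + ?S X4 X4 + 2 * (?S X1 X2 + ?S X1 X3 + ?S X1 X4 + ?S X2 X3 + ?S X2 X4 + ?S X3 X4)"
    by (simp add: S4_def power2_eq_square algebra_simps sum.distrib sum_distrib_left)
  also have "\<dots> = 4 * ?S X1 X1 + 12 * ?S X1 X2"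
    unfolding e22 e33 e44 e13 e14 e23 e24 e34 by simp
  also have "\<dots> = (\<Sum>k\<in>UNIV. \<Sum>l\<in>UNIV. 4 * ((transpose A ** slice k l) \<bullet> (transpose A ** slice k l))
        + 12 * ((transpose A ** slice k l) \<bullet> (slice k l ** A)))"
    unfolding S4_def X slice_mult inner_matrix
    by (subst (1 2) sum_swap4) (simp add: sum.distrib sum_distrib_left)
  finally show ?thesis .
qed

text \<open>The frame is changed in two slots at a time, by
  \<open>onb_sum_square_bilinear\<close>.\<close>

lemma sum_deriv_action_onb:
  assumes "onb UNIV UNIV (e :: 'n \<Rightarrow> real^'n)"
    and F: "\<And>v w z. linear (\<lambda>u. F u v w z)" "\<And>u w z. linear (\<lambda>v. F u v w z)"
      "\<And>u v z. linear (\<lambda>w. F u v w z)" "\<And>u v w. linear (\<lambda>z. F u v w z)"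
  shows "(\<Sum>i\<in>UNIV. \<Sum>j\<in>UNIV. \<Sum>k\<in>UNIV. \<Sum>l\<in>UNIV. (F (axis i 1) (axis j 1) (axis k 1) (axis l 1))\<^sup>2)
    = (\<Sum>i\<in>UNIV. \<Sum>j\<in>UNIV. \<Sum>k\<in>UNIV. \<Sum>l\<in>UNIV. (F (e i) (e j) (e k) (e l) :: real)\<^sup>2)"
proof -
  have b1: "bilinear (\<lambda>w z. F u v w z)" and b2: "bilinear (\<lambda>u v. F u v w z)" for u v w z
    using F by (auto simp: bilinear_def)
  have "(\<Sum>i\<in>UNIV. \<Sum>j\<in>UNIV. \<Sum>k\<in>UNIV. \<Sum>l\<in>UNIV. (F (e i) (e j) (e k) (e l))\<^sup>2)
    = (\<Sum>i\<in>UNIV. \<Sum>j\<in>UNIV. \<Sum>k\<in>UNIV. \<Sum>l\<in>UNIV. (F (e i) (e j) (axis k 1) (axis l 1))\<^sup>2)"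
    by (intro sum.cong refl onb_sum_square_bilinear[OF b1 assms(1) onb_axis])
  also have "\<dots> = (\<Sum>k\<in>UNIV. \<Sum>l\<in>UNIV. \<Sum>i\<in>UNIV. \<Sum>j\<in>UNIV. (F (e i) (e j) (axis k 1) (axis l 1))\<^sup>2)"
    by (rule sum_swap4)
  also have "\<dots> = (\<Sum>k\<in>UNIV. \<Sum>l\<in>UNIV. \<Sum>i\<in>UNIV. \<Sum>j\<in>UNIV. (F (axis i 1) (axis j 1) (axis k 1) (axis l 1))\<^sup>2)"
    by (intro sum.cong refl onb_sum_square_bilinear[OF b2 assms(1) onb_axis])
  also have "\<dots> = (\<Sum>i\<in>UNIV. \<Sum>j\<in>UNIV. \<Sum>k\<in>UNIV. \<Sum>l\<in>UNIV. (F (axis i 1) (axis j 1) (axis k 1) (axis l 1))\<^sup>2)"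
    by (rule sum_swap4)
  finally show ?thesis by simp
qed

lemma nonzero_slice:
  assumes "\<Psi> u v w z \<noteq> 0"
  shows "0 < (\<Sum>k\<in>UNIV. \<Sum>l\<in>UNIV. slice k l \<bullet> slice k l)"
proof (rule ccontr)
  assume "\<not> ?thesis"
  hence "(\<Sum>k\<in>UNIV. \<Sum>l\<in>UNIV. slice k l \<bullet> slice k l) = 0"
    by (intro antisym sum_nonneg) auto
  hence "slice k l = 0" for k l
    by (simp add: sum_nonneg_eq_0_iff sum_nonneg)
  hence z: "\<Psi> (axis i 1) (axis j 1) (axis k 1) (axis l 1) = 0" for i j k l
    by (simp add: slice_def vec_eq_iff)
  have ex: "x = (\<Sum>m\<in>UNIV. x $ m *\<^sub>R axis m 1)" for x :: "real^'n"
    using basis_expansion[of x] by (simp add: scalar_mult_eq_scaleR)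
  have "\<Psi> u v w z = 0"
    by (subst ex[of u], subst ex[of v], subst ex[of w], subst ex[of z])
      (simp add: linear_sum[OF lin] linear_sum[OF lin2] linear_sum[OF lin3] linear_sum[OF lin4]
        linear_scale[OF lin] linear_scale[OF lin2] linear_scale[OF lin3] linear_scale[OF lin4] z)
  with assms show False by simp
qed

end

lemma matrix_eqI_onb:
  fixes A B :: "real^'n^'n"
  assumes "onb UNIV I e" "\<And>i j. i \<in> I \<Longrightarrow> j \<in> I \<Longrightarrow> e j \<bullet> (A *v e i) = e j \<bullet> (B *v e i)"
  shows "A = B"
proof -
  have "(A - B) \<bullet> (A - B) = 0"
    unfolding onb_inner_matrix(1)[OF assms(1)]
    by (intro sum.neutral ballI) (simp add: assms(2) matrix_vector_mult_diff_rdistrib inner_diff_right)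
  thus ?thesis by simp
qed

section \<open>Parallel 4-forms, distributions and symmetric endomorphisms\<close>

context curv_N_nonneg
begin

text \<open>The scheme used for 2-forms, now with entries multiplied by s i + s j + s k + s l and
  the bound 4 (n - 4) / n, which is positive from n = 5 on.\<close>

lemma no_parallel_4form:
  assumes "0 < \<rho>" and n5: "5 \<le> CARD('n)" and \<Psi>: "four_form \<Psi>" "\<Psi> x1 x2 x3 x4 \<noteq> 0"
    and comm: "\<And>\<gamma> u v w z. \<gamma> < D \<Longrightarrow> c \<gamma> \<noteq> 0 \<Longrightarrow> four_form.deriv_action \<Psi> (\<omega> \<gamma>) u v w z = 0"
  shows False
proof -
  interpret four_form \<Psi> by fact
  let ?n = "real CARD('n)"
  have n: "?n \<ge> 5" using n5 by simp
  define Q where "Q = (\<Sum>k\<in>UNIV. \<Sum>l\<in>UNIV. slice k l \<bullet> slice k l)"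
  define B where "B = (\<Sum>k\<in>UNIV. \<Sum>l\<in>UNIV. slice k l \<bullet> (\<Sum>\<alpha><D. c \<alpha> *\<^sub>R (\<omega> \<alpha> ** slice k l ** \<omega> \<alpha>)))"
  have Q0: "Q > 0" unfolding Q_def by (rule nonzero_slice[OF \<Psi>(2)])
  define norm4 where "norm4 A = (\<Sum>i\<in>UNIV. \<Sum>j\<in>UNIV. \<Sum>k\<in>UNIV. \<Sum>l\<in>UNIV. (deriv_action A (axis i 1) (axis j 1) (axis k 1) (axis l 1))\<^sup>2)" for A
  have nS: "norm4 (S a) = (\<Sum>k\<in>UNIV. \<Sum>l\<in>UNIV. 4 * (slice k l \<bullet> ((S a ** S a) ** slice k l)) + 12 * (slice k l \<bullet> (S a ** slice k l ** S a)))"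
    if "a < d" for a
    unfolding norm4_def sum_deriv_action
    by (simp add: S_sym[OF that] inner_mult_left[of "S a"] matrix_mul_assoc)
  have nw: "norm4 (\<omega> \<alpha>) = (\<Sum>k\<in>UNIV. \<Sum>l\<in>UNIV. - 4 * (slice k l \<bullet> ((\<omega> \<alpha> ** \<omega> \<alpha>) ** slice k l)) + 12 * (slice k l \<bullet> (\<omega> \<alpha> ** slice k l ** \<omega> \<alpha>)))"
    if "\<alpha> < D" for \<alpha>
    unfolding norm4_def sum_deriv_action
    by (simp add: w_skew(2)[OF that] inner_mult_left[of "\<omega> \<alpha>"] matrix_mult_simps matrix_mul_assoc)
  \<comment> \<open>The norm formula is applied to the \<open>\<omega> \<alpha>\<close> themselves:
    those with nonzero coefficient annihilate \<Psi>, and expanding the vanishing weighted sum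
    determines \<open>B\<close>.\<close>
  have BQ: "12 * B = - 2 * \<rho> * Q"
  proof -
    have "c \<alpha> * norm4 (\<omega> \<alpha>) = 0" if "\<alpha> < D" for \<alpha>
      by (cases "c \<alpha> = 0") (simp_all add: norm4_def comm that)
    hence "0 = (\<Sum>\<alpha><D. c \<alpha> * norm4 (\<omega> \<alpha>))" by (simp add: sum.neutral del: mult_eq_0_iff)
    also have "\<dots> = (\<Sum>\<alpha><D. \<Sum>k\<in>UNIV. \<Sum>l\<in>UNIV. - 4 * (slice k l \<bullet> ((c \<alpha> *\<^sub>R (\<omega> \<alpha> ** \<omega> \<alpha>)) ** slice k l)) + 12 * (slice k l \<bullet> (c \<alpha> *\<^sub>R (\<omega> \<alpha> ** slice k l ** \<omega> \<alpha>))))"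
      by (intro sum.cong refl) (simp add: nw sum_distrib_left matrix_mult_simps algebra_simps)
    also have "\<dots> = (\<Sum>k\<in>UNIV. \<Sum>l\<in>UNIV. \<Sum>\<alpha><D. - 4 * (slice k l \<bullet> ((c \<alpha> *\<^sub>R (\<omega> \<alpha> ** \<omega> \<alpha>)) ** slice k l)) + 12 * (slice k l \<bullet> (c \<alpha> *\<^sub>R (\<omega> \<alpha> ** slice k l ** \<omega> \<alpha>))))"
      by (subst sum.swap, rule sum.cong[OF refl], rule sum.swap)
    also have "\<dots> = (\<Sum>k\<in>UNIV. \<Sum>l\<in>UNIV. - 4 * (slice k l \<bullet> ((\<Sum>\<alpha><D. c \<alpha> *\<^sub>R (\<omega> \<alpha> ** \<omega> \<alpha>)) ** slice k l)) + 12 * (slice k l \<bullet> (\<Sum>\<alpha><D. c \<alpha> *\<^sub>R (\<omega> \<alpha> ** slice k l ** \<omega> \<alpha>))))"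
      unfolding sum.distrib sum_distrib_left[symmetric] inner_sum_right[symmetric] matrix_mult_sum_left[symmetric] ..
    also have "\<dots> = 2 * \<rho> * Q + 12 * B"
      unfolding einstein by (simp add: Q_def B_def matrix_mult_simps sum.distrib sum_distrib_left mult.assoc)
    finally have "0 = 2 * \<rho> * Q + 12 * B" .
    thus ?thesis by linarith
  qed
  \<comment> \<open>The Bianchi identity turns the trace term of \<open>sum_ev_sandwich\<close> into
    another sandwich sum.\<close>
  have tr: "(\<Sum>\<alpha><D. (c \<alpha> * trace (\<omega> \<alpha> ** J)) *\<^sub>R \<omega> \<alpha>) = 2 *\<^sub>R (\<Sum>\<alpha><D. c \<alpha> *\<^sub>R (\<omega> \<alpha> ** J ** \<omega> \<alpha>))" if "J \<in> skew" for J
  proof -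
    have "trace (\<omega> \<alpha> ** J) = - (\<omega> \<alpha> \<bullet> J)" if "\<alpha> < D" for \<alpha>
      by (simp add: inner_matrix_trace w_skew(2)[OF that] matrix_mult_simps trace_simps)
    hence "(\<Sum>\<alpha><D. (c \<alpha> * trace (\<omega> \<alpha> ** J)) *\<^sub>R \<omega> \<alpha>) = - (\<Sum>\<alpha><D. (c \<alpha> * (\<omega> \<alpha> \<bullet> J)) *\<^sub>R \<omega> \<alpha>)"
      by (simp add: sum_negf)
    thus ?thesis using bianchi[OF that] by simp
  qed
  define al where "al = 4 * (?n - 4) / ?n * Q"
  show False
  proof (rule bochner_contradiction[OF assms(1), of al "\<lambda>a. norm4 (S a)"])
    show "0 < al" using Q0 n by (simp add: al_def)
    show "0 \<le> norm4 (S a)" for a by (simp add: norm4_def sum_nonneg)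
    have "(\<Sum>a<d. norm4 (S a)) = (\<Sum>a<d. \<Sum>k\<in>UNIV. \<Sum>l\<in>UNIV. 4 * (slice k l \<bullet> ((S a ** S a) ** slice k l)) + 12 * (slice k l \<bullet> (S a ** slice k l ** S a)))"
      by (intro sum.cong refl nS) simp
    also have "\<dots> = (\<Sum>k\<in>UNIV. \<Sum>l\<in>UNIV. \<Sum>a<d. 4 * (slice k l \<bullet> ((S a ** S a) ** slice k l)) + 12 * (slice k l \<bullet> (S a ** slice k l ** S a)))"
      by (subst sum.swap, rule sum.cong[OF refl], rule sum.swap)
    also have "\<dots> = (\<Sum>k\<in>UNIV. \<Sum>l\<in>UNIV. 4 * (slice k l \<bullet> ((\<Sum>a<d. S a ** S a) ** slice k l)) + 12 * (slice k l \<bullet> (\<Sum>a<d. S a ** slice k l ** S a)))"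
      unfolding sum.distrib sum_distrib_left[symmetric] inner_sum_right[symmetric] matrix_mult_sum_left[symmetric] ..
    also have "\<dots> = (\<Sum>k\<in>UNIV. \<Sum>l\<in>UNIV. (4 * ((?n + 1) / 2 - 1 / ?n) + 12 * (- 1 / 2 - 1 / ?n)) * (slice k l \<bullet> slice k l))"
    proof (intro sum.cong refl)
      fix k l
      have "transpose (slice k l) = - slice k l" using slice_skew by (simp add: skew_def)
      thus "4 * (slice k l \<bullet> ((\<Sum>a<d. S a ** S a) ** slice k l)) + 12 * (slice k l \<bullet> (\<Sum>a<d. S a ** slice k l ** S a))
        = (4 * ((?n + 1) / 2 - 1 / ?n) + 12 * (- 1 / 2 - 1 / ?n)) * (slice k l \<bullet> slice k l)"
        unfolding sum_S_square sum_sandwich(1) trace_skew[OF slice_skew]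
        by (simp add: matrix_mult_simps inner_diff_right algebra_simps)
    qed
    also have "\<dots> = al * (?n + 2) / 2"
      unfolding sum_distrib_left[symmetric] Q_def[symmetric] al_def using n by (simp add: field_simps)
    finally show "(\<Sum>a<d. norm4 (S a)) = al * (?n + 2) / 2" .
    have "(\<Sum>a<d. ev a * norm4 (S a)) = (\<Sum>a<d. \<Sum>k\<in>UNIV. \<Sum>l\<in>UNIV. 4 * (slice k l \<bullet> ((ev a *\<^sub>R (S a ** S a)) ** slice k l)) + 12 * (slice k l \<bullet> (ev a *\<^sub>R (S a ** slice k l ** S a))))"
      by (intro sum.cong refl) (simp add: nS sum_distrib_left matrix_mult_simps algebra_simps)
    also have "\<dots> = (\<Sum>k\<in>UNIV. \<Sum>l\<in>UNIV. \<Sum>a<d. 4 * (slice k l \<bullet> ((ev a *\<^sub>R (S a ** S a)) ** slice k l)) + 12 * (slice k l \<bullet> (ev a *\<^sub>R (S a ** slice k l ** S a))))"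
      by (subst sum.swap, rule sum.cong[OF refl], rule sum.swap)
    also have "\<dots> = (\<Sum>k\<in>UNIV. \<Sum>l\<in>UNIV. 4 * (slice k l \<bullet> ((\<Sum>a<d. ev a *\<^sub>R (S a ** S a)) ** slice k l)) + 12 * (slice k l \<bullet> (\<Sum>a<d. ev a *\<^sub>R (S a ** slice k l ** S a))))"
      unfolding sum.distrib sum_distrib_left[symmetric] inner_sum_right[symmetric] matrix_mult_sum_left[symmetric] ..
    \<comment> \<open>In \<open>sum_ev_sandwich\<close> the sandwich occurs with - 1 directly and
      with 2 * 2 through \<open>tr\<close>; the factor 12 makes this 36.\<close>
    also have "\<dots> = (\<Sum>k\<in>UNIV. \<Sum>l\<in>UNIV. (16 * \<rho> / ?n + 2 * \<rho>) * (slice k l \<bullet> slice k l)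
        + 36 * (slice k l \<bullet> (\<Sum>\<alpha><D. c \<alpha> *\<^sub>R (\<omega> \<alpha> ** slice k l ** \<omega> \<alpha>))))"
      unfolding sum_ev_S_square sum_ev_sandwich tr[OF slice_skew]
      by (intro sum.cong refl) (simp add: matrix_mult_simps inner_diff_right inner_add_right algebra_simps)
    also have "\<dots> = (16 * \<rho> / ?n + 2 * \<rho>) * Q + 36 * B"
      by (simp add: sum.distrib sum_distrib_left Q_def B_def)
    also have "\<dots> = (16 * \<rho> / ?n - 4 * \<rho>) * Q" using BQ by (simp add: algebra_simps)
    also have "\<dots> = - \<rho> * al" unfolding al_def using n by (simp add: field_simps)
    finally show "(\<Sum>a<d. ev a * norm4 (S a)) = - \<rho> * al" .
    show "norm4 (S a) \<le> al" if "a < d" for a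
    proof -
      have "S a \<in> tracefree_sym" "S a \<bullet> S a = 1" using that S_inner onb_D(2)[OF onb_S] by auto
      from symmetric_unit_eigenbasis[OF this]
      obtain e :: "'n \<Rightarrow> real^'n" and s where e: "onb UNIV UNIV e" "\<And>i. S a *v e i = s i *\<^sub>R e i"
        and s: "(\<Sum>i\<in>UNIV. s i) = 0" "(\<Sum>i\<in>UNIV. (s i)\<^sup>2) = 1" by metis
      have ent: "deriv_action (S a) (e i) (e j) (e k) (e l) = (s i + s j + s k + s l) * \<Psi> (e i) (e j) (e k) (e l)" for i j k l
        by (simp add: deriv_action_def e(2) linear_scale[OF lin] linear_scale[OF lin2] linear_scale[OF lin3]
            linear_scale[OF lin4] algebra_simps)
      have b: "(deriv_action (S a) (e i) (e j) (e k) (e l))\<^sup>2 \<le> 4 * (?n - 4) / ?n * (\<Psi> (e i) (e j) (e k) (e l))\<^sup>2" for i j k l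
      proof (cases "i = j \<or> i = k \<or> i = l \<or> j = k \<or> j = l \<or> k = l")
        case True
        hence "\<Psi> (e i) (e j) (e k) (e l) = 0" using vanish by auto
        thus ?thesis by (simp add: ent)
      next
        case False
        hence "(s i + s j + s k + s l)\<^sup>2 \<le> 4 * (?n - 4) / ?n"
          using tracefree_partial_sum_bound[OF s(1), of "{i, j, k, l}"] s(2) by (simp add: add.assoc)
        hence "(s i + s j + s k + s l)\<^sup>2 * (\<Psi> (e i) (e j) (e k) (e l))\<^sup>2 \<le> 4 * (?n - 4) / ?n * (\<Psi> (e i) (e j) (e k) (e l))\<^sup>2"
          by (rule mult_right_mono) simp
        thus ?thesis by (simp only: ent power_mult_distrib)
      qed
      have "norm4 (S a) = (\<Sum>i\<in>UNIV. \<Sum>j\<in>UNIV. \<Sum>k\<in>UNIV. \<Sum>l\<in>UNIV. (deriv_action (S a) (e i) (e j) (e k) (e l))\<^sup>2)"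
        unfolding norm4_def by (rule sum_deriv_action_onb[OF e(1) linear_deriv_action])
      also have "\<dots> \<le> (\<Sum>i\<in>UNIV. \<Sum>j\<in>UNIV. \<Sum>k\<in>UNIV. \<Sum>l\<in>UNIV. 4 * (?n - 4) / ?n * (\<Psi> (e i) (e j) (e k) (e l))\<^sup>2)"
        by (intro sum_mono b)
      also have "\<dots> = 4 * (?n - 4) / ?n * (\<Sum>i\<in>UNIV. \<Sum>j\<in>UNIV. \<Sum>k\<in>UNIV. \<Sum>l\<in>UNIV. (\<Psi> (axis i 1) (axis j 1) (axis k 1) (axis l 1))\<^sup>2)"
        unfolding sum_deriv_action_onb[OF e(1) lin lin2 lin3 lin4] sum_distrib_left ..
      also have "(\<Sum>i\<in>UNIV. \<Sum>j\<in>UNIV. \<Sum>k\<in>UNIV. \<Sum>l\<in>UNIV. (\<Psi> (axis i 1) (axis j 1) (axis k 1) (axis l 1))\<^sup>2) = Q"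
        unfolding Q_def inner_matrix slice_def by (subst sum_swap4) (simp add: power2_eq_square)
      finally show ?thesis by (simp add: al_def)
    qed
  qed
qed

text \<open>The span of the \<open>e i\<close> with \<open>i \<in> T\<close> is a parallel
  distribution. \<open>f a\<close> is the squared norm of the action of \<open>S a\<close> on its
  unit volume form: \<open>S a \<bullet> Q\<close> is the component along the form itself, and
  \<open>Q ** S a ** K\<close> collects the terms with one factor turned out of the
  distribution.\<close>

lemma no_parallel_projection:
  fixes e :: "'n \<Rightarrow> real^'n"
  assumes "0 < \<rho>" and e: "onb UNIV UNIV e" and T: "T \<noteq> {}" "T \<noteq> UNIV"
    and comm: "\<And>\<gamma> i j. \<gamma> < D \<Longrightarrow> c \<gamma> \<noteq> 0 \<Longrightarrow> i \<in> T \<Longrightarrow> j \<notin> T \<Longrightarrow> e j \<bullet> (\<omega> \<gamma> *v e i) = 0"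
  shows False
proof -
  let ?n = "real CARD('n)" and ?p = "real (card T)"
  have ee: "e i \<bullet> e j = (if i = j then 1 else 0)" for i j using onb_D(3)[OF e] by simp
  define Q :: "real^'n^'n" where "Q = (\<chi> a b. \<Sum>i\<in>T. e i $ a * e i $ b)"
  have Qv: "Q *v x = (\<Sum>i\<in>T. (x \<bullet> e i) *\<^sub>R e i)" for x
  proof (unfold vec_eq_iff, intro allI)
    fix a
    have "(Q *v x) $ a = (\<Sum>b\<in>UNIV. \<Sum>i\<in>T. e i $ a * e i $ b * x $ b)"
      by (simp add: matrix_vector_mult_def Q_def sum_distrib_right)
    also have "\<dots> = (\<Sum>i\<in>T. \<Sum>b\<in>UNIV. e i $ a * e i $ b * x $ b)" by (rule sum.swap)
    finally show "(Q *v x) $ a = (\<Sum>i\<in>T. (x \<bullet> e i) *\<^sub>R e i) $ a"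
      by (simp add: inner_vec_def sum_distrib_left sum_distrib_right ac_simps)
  qed
  have Qe: "Q *v e i = (if i \<in> T then e i else 0)" for i
  proof -
    have "Q *v e i = (\<Sum>j\<in>T. if j = i then e j else 0)" unfolding Qv by (intro sum.cong refl) (simp add: ee)
    thus ?thesis by simp
  qed
  define K where "K = mat 1 - Q"
  have Ke: "K *v e i = (if i \<in> T then 0 else e i)" for i
    by (simp add: K_def matrix_vector_mult_diff_rdistrib Qe)
  have Qt: "transpose Q = Q"
    by (rule matrix_eqI_onb[OF e]) (simp add: inner_matrix_vector[of _ "transpose Q"] Qe ee del: transpose_matrix_vector)
  have Kt: "transpose K = K" by (simp add: K_def transpose_simps Qt)
  have QQ: "Q ** Q = Q"
    by (rule matrix_eqI_onb[OF e]) (simp add: matrix_vector_mul_assoc[symmetric] Qe)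
  have trQ: "trace Q = ?p"
  proof -
    have "trace Q = (\<Sum>i\<in>UNIV. if i \<in> T then 1 else 0)"
      unfolding onb_inner_matrix(2)[OF e] by (intro sum.cong refl) (simp add: Qe ee)
    thus ?thesis by (simp add: sum.If_cases)
  qed
  have QK: "Q \<bullet> K = 0" "mat 1 \<bullet> K = ?n - ?p"
    by (simp_all add: K_def inner_diff_right inner_mat1 trQ inner_matrix_trace Qt QQ trace_I trace_simps matrix_mult_simps)
  have cQ: "\<omega> \<gamma> ** Q = Q ** \<omega> \<gamma>" if "\<gamma> < D" "c \<gamma> \<noteq> 0" for \<gamma>
  proof (rule matrix_eqI_onb[OF e])
    fix i j
    have 1: "e j \<bullet> ((\<omega> \<gamma> ** Q) *v e i) = (if i \<in> T then e j \<bullet> (\<omega> \<gamma> *v e i) else 0)"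
      by (simp add: matrix_vector_mul_assoc[symmetric] Qe)
    have 2: "e j \<bullet> ((Q ** \<omega> \<gamma>) *v e i) = (if j \<in> T then e j \<bullet> (\<omega> \<gamma> *v e i) else 0)"
      using inner_matrix_vector[of "e j" Q "\<omega> \<gamma> *v e i"] by (simp only: matrix_vector_mul_assoc Qt Qe) simp
    have "e j \<bullet> (\<omega> \<gamma> *v e i) = 0" if "j \<in> T" "i \<notin> T"
      using skew_inner_vector[OF w_skew(1), of \<gamma> "e j" "e i"] comm[of \<gamma> j i] that \<open>\<gamma> < D\<close> \<open>c \<gamma> \<noteq> 0\<close>
      by (simp add: inner_commute)
    thus "e j \<bullet> ((\<omega> \<gamma> ** Q) *v e i) = e j \<bullet> ((Q ** \<omega> \<gamma>) *v e i)"
      unfolding 1 2 using comm that by auto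
  qed
  have p: "1 \<le> ?p" "?p \<le> ?n - 1"
  proof -
    have "card T > 0" using T(1) finite[of T] by (simp add: card_gt_0_iff)
    moreover have "card T < CARD('n)" using T(2) by (intro psubset_card_mono) auto
    ultimately show "1 \<le> ?p" "?p \<le> ?n - 1" by linarith+
  qed
  define al where "al = ?p * (?n - ?p) / ?n"
  define f where "f a = (S a \<bullet> Q)\<^sup>2 + (Q ** S a ** K) \<bullet> (Q ** S a ** K)" for a
  have KK: "K ** K = K" by (simp add: K_def matrix_mult_simps QQ)
  have QSK: "(Q ** S a ** K) \<bullet> (Q ** S a ** K) = (S a ** Q ** S a) \<bullet> K" if "a < d" for a
  proof -
    have "(Q ** S a ** K) \<bullet> (Q ** S a ** K) = (S a ** K) \<bullet> (Q ** S a ** K)"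
      by (simp only: matrix_mul_assoc[symmetric] inner_mult_left[of Q] Qt)
         (simp only: matrix_mul_assoc QQ)
    also have "\<dots> = K \<bullet> (S a ** Q ** S a ** K)"
      by (simp only: inner_mult_left[of "S a"] S_sym[OF that] matrix_mul_assoc)
    also have "\<dots> = (S a ** Q ** S a ** K) \<bullet> K" by (rule inner_commute)
    also have "\<dots> = (S a ** Q ** S a) \<bullet> K"
      by (simp only: inner_mult_right[of "S a ** Q ** S a"] Kt KK)
    finally show ?thesis .
  qed
  \<comment> \<open>The trace-free part of the projection. Since \<open>Q\<close> is parallel, it is
    an eigenvector of \<open>P\<close> for - \<rho>, which handles the first summand of
    \<open>f\<close>.\<close>
  define Q0 where "Q0 = Q - (?p / ?n) *\<^sub>R mat 1"
  have Q0: "Q0 \<in> tracefree_sym"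
    by (simp add: Q0_def tracefree_sym_def transpose_simps trace_simps Qt trQ trace_I)
  have SQ: "S a \<bullet> Q = Q0 \<bullet> S a" if "a < d" for a
    by (simp add: Q0_def inner_diff_left inner_mat1 S_sym[OF that] inner_commute[of "S a"])
  have Q0Q0: "Q0 \<bullet> Q0 = al"
    by (simp add: Q0_def inner_diff_left inner_diff_right inner_mat1 trQ trace_I inner_matrix_trace[of Q Q] Qt QQ al_def trace_simps)
      (simp add: field_simps)
  have wQ: "c \<alpha> *\<^sub>R (\<omega> \<alpha> ** Q ** \<omega> \<alpha>) = Q ** (c \<alpha> *\<^sub>R (\<omega> \<alpha> ** \<omega> \<alpha>))" if "\<alpha> < D" for \<alpha>
    using cQ[OF that] by (cases "c \<alpha> = 0") (auto simp: matrix_mult_simps matrix_mul_assoc)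
  have sQ: "(\<Sum>\<alpha><D. c \<alpha> *\<^sub>R (\<omega> \<alpha> ** Q ** \<omega> \<alpha>)) = - (\<rho> / 2) *\<^sub>R Q"
  proof -
    have "(\<Sum>\<alpha><D. c \<alpha> *\<^sub>R (\<omega> \<alpha> ** Q ** \<omega> \<alpha>)) = (\<Sum>\<alpha><D. Q ** (c \<alpha> *\<^sub>R (\<omega> \<alpha> ** \<omega> \<alpha>)))"
      by (intro sum.cong refl) (simp add: wQ)
    thus ?thesis unfolding matrix_mult_sum_right[symmetric] einstein by (simp add: matrix_mult_simps)
  qed
  have PQ0: "P Q0 = - \<rho> *\<^sub>R Q0"
    unfolding Q0_def linear_diff[OF linear_P] linear_scale[OF linear_P] P_mat1
    by (simp add: P_def sQ algebra_simps)
  show False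
  proof (rule bochner_contradiction[OF assms(1), of al f])
    show "0 < al" using p by (simp add: al_def)
    show "0 \<le> f a" for a by (simp add: f_def)
    have "(\<Sum>a<d. f a) = (\<Sum>a<d. (Q0 \<bullet> S a) * (Q0 \<bullet> S a)) + (\<Sum>a<d. S a ** Q ** S a) \<bullet> K"
      by (simp add: f_def QSK SQ sum.distrib inner_sum_left power2_eq_square)
    also have "\<dots> = al + ?p * (?n - ?p) / 2"
      unfolding onb_inner[OF onb_S Q0, symmetric] Q0Q0 sum_sandwich Qt trQ
      by (simp add: inner_diff_left inner_add_left QK)
    also have "\<dots> = al * (?n + 2) / 2" by (simp add: al_def field_simps)
    finally show "(\<Sum>a<d. f a) = al * (?n + 2) / 2" .
    have "(\<Sum>a<d. ev a * f a) = (\<Sum>a<d. (Q0 \<bullet> S a) * (P Q0 \<bullet> S a)) + (\<Sum>a<d. ev a *\<^sub>R (S a ** Q ** S a)) \<bullet> K"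
      by (simp add: f_def QSK SQ sum.distrib inner_sum_left power2_eq_square P_selfadjoint P_S algebra_simps cong: sum.cong_simp)
    also have "(\<Sum>a<d. (Q0 \<bullet> S a) * (P Q0 \<bullet> S a)) = Q0 \<bullet> P Q0" by (rule onb_inner[OF onb_S Q0, symmetric])
    also have "\<dots> = - \<rho> * al" by (simp add: PQ0 Q0Q0)
    also have "(\<Sum>a<d. ev a *\<^sub>R (S a ** Q ** S a)) \<bullet> K = 0"
    proof -
      have "trace (\<omega> \<alpha> ** Q) = 0" if "\<alpha> < D" for \<alpha>
        using skew_sym_orthogonal[OF w_skew(1)[OF that] Qt]
        by (simp add: inner_matrix_trace w_skew(2)[OF that] matrix_mult_simps trace_simps)
      thus ?thesis unfolding sum_ev_sandwich sQ by (simp add: inner_diff_left inner_add_left QK)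
    qed
    finally show "(\<Sum>a<d. ev a * f a) = - \<rho> * al" by simp
    show "f a \<le> al" if "a < d" for a
    proof -
      define g where "g i j = e j \<bullet> (S a *v e i)" for i j
      have gs: "g i j = g j i" for i j
        using inner_matrix_vector[of "e j" "S a" "e i"] S_sym[OF that] by (simp add: g_def inner_commute)
      define di where "di = (\<Sum>i\<in>UNIV. (g i i)\<^sup>2)"
      define off where "off = (\<Sum>i\<in>- T. \<Sum>j\<in>T. (g i j)\<^sup>2)"
      have 1: "S a \<bullet> Q = (\<Sum>i\<in>T. g i i)"
      proof -
        have "S a \<bullet> Q = (\<Sum>i\<in>UNIV. \<Sum>j\<in>UNIV. g i j * (e j \<bullet> (Q *v e i)))"
          unfolding onb_inner_matrix(1)[OF e] g_def ..
        also have "\<dots> = (\<Sum>i\<in>UNIV. \<Sum>j\<in>UNIV. if j = i then (if i \<in> T then g i i else 0) else 0)"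
          by (intro sum.cong refl) (auto simp: Qe ee)
        finally show ?thesis by (simp add: sum.If_cases)
      qed
      have 2: "(Q ** S a ** K) \<bullet> (Q ** S a ** K) = off"
      proof -
        have en: "e j \<bullet> ((Q ** S a ** K) *v e i) = (if i \<in> - T \<and> j \<in> T then g i j else 0)" for i j
        proof -
          have "e j \<bullet> ((Q ** S a ** K) *v e i) = (Q *v e j) \<bullet> ((S a ** K) *v e i)"
            using inner_matrix_vector[of "e j" Q "S a *v (K *v e i)"] by (simp only: matrix_vector_mul_assoc matrix_mul_assoc Qt)
          thus ?thesis by (simp add: Qe Ke g_def matrix_vector_mul_assoc[symmetric])
        qed
        have "(Q ** S a ** K) \<bullet> (Q ** S a ** K) = (\<Sum>i\<in>UNIV. if i \<in> - T then (\<Sum>j\<in>T. (g i j)\<^sup>2) else 0)"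
          unfolding onb_inner_matrix(1)[OF e] en
        proof (rule sum.cong[OF refl])
          fix i
          have "(\<Sum>j\<in>UNIV. (if i \<in> - T \<and> j \<in> T then g i j else 0) * (if i \<in> - T \<and> j \<in> T then g i j else 0))
            = (\<Sum>j\<in>UNIV. if j \<in> T then (if i \<in> - T then (g i j)\<^sup>2 else 0) else 0)"
            by (intro sum.cong refl) (auto simp: power2_eq_square)
          thus "(\<Sum>j\<in>UNIV. (if i \<in> - T \<and> j \<in> T then g i j else 0) * (if i \<in> - T \<and> j \<in> T then g i j else 0))
            = (if i \<in> - T then (\<Sum>j\<in>T. (g i j)\<^sup>2) else 0)" by (simp add: sum.If_cases)
        qed
        thus ?thesis by (simp add: sum.If_cases off_def Compl_eq)
      qed
      have 3: "di + 2 * off \<le> 1"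
      proof -
        have off': "off = (\<Sum>i\<in>T. \<Sum>j\<in>- T. (g i j)\<^sup>2)"
          unfolding off_def by (subst sum.swap) (simp add: gs[symmetric])
        have "di + 2 * off = (\<Sum>i\<in>UNIV. (g i i)\<^sup>2) + (\<Sum>i\<in>T. \<Sum>j\<in>- T. (g i j)\<^sup>2) + (\<Sum>i\<in>-T. \<Sum>j\<in>T. (g i j)\<^sup>2)"
          using off' unfolding di_def off_def by simp
        also have "\<dots> = (\<Sum>i\<in>T. (g i i)\<^sup>2 + (\<Sum>j\<in>- T. (g i j)\<^sup>2)) + (\<Sum>i\<in>-T. (g i i)\<^sup>2 + (\<Sum>j\<in>T. (g i j)\<^sup>2))"
          using sum.union_disjoint[of T "- T" "\<lambda>i. (g i i)\<^sup>2"] by (simp add: sum.distrib)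
        also have "\<dots> \<le> (\<Sum>i\<in>T. \<Sum>j\<in>UNIV. (g i j)\<^sup>2) + (\<Sum>i\<in>-T. \<Sum>j\<in>UNIV. (g i j)\<^sup>2)"
        proof (intro add_mono sum_mono)
          fix i assume "i \<in> T"
          hence "(\<Sum>j\<in>insert i (- T). (g i j)\<^sup>2) = (g i i)\<^sup>2 + (\<Sum>j\<in>- T. (g i j)\<^sup>2)" by simp
          thus "(g i i)\<^sup>2 + (\<Sum>j\<in>- T. (g i j)\<^sup>2) \<le> (\<Sum>j\<in>UNIV. (g i j)\<^sup>2)"
            by (metis (no_types, lifting) finite subset_UNIV sum_mono2 zero_le_power2)
        next
          fix i assume "i \<in> - T"
          hence "(\<Sum>j\<in>insert i T. (g i j)\<^sup>2) = (g i i)\<^sup>2 + (\<Sum>j\<in>T. (g i j)\<^sup>2)" by simp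
          thus "(g i i)\<^sup>2 + (\<Sum>j\<in>T. (g i j)\<^sup>2) \<le> (\<Sum>j\<in>UNIV. (g i j)\<^sup>2)"
            by (metis (no_types, lifting) finite subset_UNIV sum_mono2 zero_le_power2)
        qed
        also have "\<dots> = (\<Sum>i\<in>UNIV. \<Sum>j\<in>UNIV. (g i j)\<^sup>2)"
          using sum.union_disjoint[of T "- T" "\<lambda>i. \<Sum>j\<in>UNIV. (g i j)\<^sup>2"] by simp
        also have "\<dots> = S a \<bullet> S a" unfolding onb_inner_matrix(1)[OF e] g_def by (simp add: power2_eq_square)
        also have "\<dots> = 1" using S_inner that by simp
        finally show ?thesis .
      qed
      have "(\<Sum>i\<in>UNIV. g i i) = 0"
        using onb_inner_matrix(2)[OF e, of "S a"] S_sym[OF that] by (simp add: g_def)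
      from tracefree_partial_sum_bound[OF this, of T]
      have "f a \<le> al * di + off" unfolding f_def 1 2 al_def di_def by simp
      also have "\<dots> \<le> al * (1 - 2 * off) + off"
        using 3 p by (intro add_right_mono mult_left_mono) (auto simp: al_def)
      \<comment> \<open>Off-diagonal entries count twice in the norm of \<open>S a\<close>, so
        trading them for diagonal ones does not lower the bound once \<open>1 \<le> 2 * al\<close>;
        this follows from p (n - p) \<ge> n - 1.\<close>
      also have "\<dots> \<le> al"
      proof -
        have "0 \<le> (?p - 1) * (?n - 1 - ?p)" using p by (intro mult_nonneg_nonneg) auto
        hence "?n - 1 \<le> ?p * (?n - ?p)" by (simp add: algebra_simps)
        moreover have "?n \<ge> 3" using dim3 by simp
        ultimately have "?n \<le> 2 * (?p * (?n - ?p))" by linarith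
        hence "1 \<le> 2 * al" unfolding al_def by (simp add: field_simps)
        moreover have "0 \<le> off" unfolding off_def by (intro sum_nonneg) auto
        ultimately have "off * 1 \<le> off * (2 * al)" by (intro mult_left_mono) auto
        thus ?thesis by (simp add: algebra_simps)
      qed
      finally show ?thesis .
    qed
  qed
qed

text \<open>An eigenspace of \<open>h\<close> is invariant under all matrices commuting with
  \<open>h\<close>, and it is proper because \<open>h\<close> is trace-free and nonzero.\<close>

lemma no_parallel_sym:
  assumes "0 < \<rho>" "h \<in> tracefree_sym" "h \<noteq> 0"
    and comm: "\<And>\<gamma>. \<gamma> < D \<Longrightarrow> c \<gamma> \<noteq> 0 \<Longrightarrow> commut (\<omega> \<gamma>) h = 0"
  shows False
proof -
  have ht: "transpose h = h" "trace h = 0" using assms(2) by (auto simp: tracefree_sym_def)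
  obtain e :: "'n \<Rightarrow> real^'n" and s where e: "onb UNIV UNIV e" "\<And>i. h *v e i = s i *\<^sub>R e i"
    using symmetric_eigenbasis[OF ht(1)] by metis
  have ee: "e i \<bullet> e j = (if i = j then 1 else 0)" for i j using onb_D(3)[OF e(1)] by simp
  fix i0 :: 'n
  have ne: "{i. s i = s i0} \<noteq> UNIV"
  proof
    assume "{i. s i = s i0} = UNIV"
    then obtain m where all: "\<And>i. s i = m" by blast
    have "trace h = (\<Sum>i\<in>(UNIV :: 'n set). m)"
      unfolding onb_inner_matrix(2)[OF e(1)] by (intro sum.cong refl) (simp add: e(2) ee all)
    hence "m = 0" using ht(2) by simp
    hence "h = 0" by (intro matrix_eqI_onb[OF e(1)]) (simp add: e(2) all)
    thus False using assms(3) by simp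
  qed
  have "e j \<bullet> (\<omega> \<gamma> *v e i) = 0" if "\<gamma> < D" "c \<gamma> \<noteq> 0" "i \<in> {i. s i = s i0}" "j \<notin> {i. s i = s i0}" for \<gamma> i j
  proof -
    have "(\<omega> \<gamma> ** h) = h ** \<omega> \<gamma>" using comm[OF that(1,2)] by (simp add: commut_def)
    hence "\<omega> \<gamma> *v (h *v e i) = h *v (\<omega> \<gamma> *v e i)" by (simp add: matrix_vector_mul_assoc)
    hence "e j \<bullet> (\<omega> \<gamma> *v (h *v e i)) = e j \<bullet> (h *v (\<omega> \<gamma> *v e i))" by simp
    also have "\<dots> = (h *v e j) \<bullet> (\<omega> \<gamma> *v e i)" using inner_matrix_vector[of "e j" h] ht(1) by simp
    finally have "(s i - s j) * (e j \<bullet> (\<omega> \<gamma> *v e i)) = 0"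
      by (simp add: e(2) matrix_vector_mult_scaleR algebra_simps)
    thus ?thesis using that(3,4) by auto
  qed
  thus False by (rule no_parallel_projection[OF assms(1) e(1) _ ne, rotated]) auto
qed

end

section \<open>Rigidity at a point\<close>

context curv_N_nonneg
begin

lemma sum_S_expand_zero:
  assumes "x \<in> tracefree_sym" "\<And>b. b < d \<Longrightarrow> x \<bullet> S b = 0"
  shows "x = 0"
  using onb_inner[OF onb_S assms(1), of x] assms(2) by simp

lemma sum_w_expand_zero:
  assumes "x \<in> skew" "\<And>b. b < D \<Longrightarrow> x \<bullet> \<omega> b = 0"
  shows "x = 0"
  using onb_inner[OF onb_w assms(1), of x] assms(2) by simp

text \<open>\<open>P\<close> commutes with the adjoint action, so the commutator stays in the
  eigenspace of \<open>S a\<close>; skewness makes it orthogonal to \<open>S a\<close>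
  itself.\<close>

lemma commut_S:
  assumes "\<gamma> < D" "c \<gamma> \<noteq> 0" "a < d"
  shows "commut (\<omega> \<gamma>) (S a) \<in> tracefree_sym"
    and "b < d \<Longrightarrow> ev a \<noteq> ev b \<or> a = b \<Longrightarrow> commut (\<omega> \<gamma>) (S a) \<bullet> S b = 0"
proof -
  show "commut (\<omega> \<gamma>) (S a) \<in> tracefree_sym"
    by (simp add: tracefree_sym_def commut_def transpose_simps S_sym[OF assms(3)] w_skew(2)[OF assms(1)]
        matrix_mult_simps trace_simps trace_mul_sym[of "S a"])
  show "commut (\<omega> \<gamma>) (S a) \<bullet> S b = 0" if "b < d" "ev a \<noteq> ev b \<or> a = b"
  proof (cases "a = b")
    case True
    thus ?thesis using commut_inner[OF w_skew(1)[OF assms(1)], of "S a" "S a"] by (simp add: inner_commute)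
  next
    case False
    have "P (commut (\<omega> \<gamma>) (S a)) = ev a *\<^sub>R commut (\<omega> \<gamma>) (S a)"
      by (simp only: P_commut[OF assms(1,2)] P_S[OF assms(3)] linear_scale[OF linear_commut])
    hence "ev a * (commut (\<omega> \<gamma>) (S a) \<bullet> S b) = P (commut (\<omega> \<gamma>) (S a)) \<bullet> S b" by simp
    also have "\<dots> = ev b * (commut (\<omega> \<gamma>) (S a) \<bullet> S b)" by (simp add: P_selfadjoint P_S[OF that(1)])
    finally show ?thesis using False that by simp
  qed
qed

text \<open>If the lowest eigenspace had dimension at most two, the commutator of two of its basis
  elements would be a parallel 2-form, hence zero, which in turn makes the elements parallel.\<close>

lemma lowest_multiplicity:
  assumes "0 < \<rho>"
  shows "ev 1 = ev 0" "ev 2 = ev 0"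
proof -
  have "2 * 5 \<le> (real CARD('n) - 1) * (real CARD('n) + 2)" using dim3 by (intro mult_mono) auto
  hence d5: "5 \<le> d" using card_d by simp
  have "ev 2 = ev 0"
  proof (rule ccontr)
    assume ne: "ev 2 \<noteq> ev 0"
    have gt: "ev 0 < ev b" if "2 \<le> b" "b < d" for b
      using ev_sorted[of 0 2] ev_sorted[of 2 b] ne that d5 by simp
    \<comment> \<open>The rate at which \<open>\<omega> \<gamma>\<close> rotates \<open>S 0\<close>
      towards \<open>S 1\<close>.\<close>
    let ?\<theta> = "\<lambda>\<gamma>. commut (\<omega> \<gamma>) (S 0) \<bullet> S 1"
    have S0: "commut (\<omega> \<gamma>) (S 0) = ?\<theta> \<gamma> *\<^sub>R S 1" if g: "\<gamma> < D" "c \<gamma> \<noteq> 0" for \<gamma>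
    proof -
      have "commut (\<omega> \<gamma>) (S 0) - ?\<theta> \<gamma> *\<^sub>R S 1 = 0"
      proof (rule sum_S_expand_zero)
        show "commut (\<omega> \<gamma>) (S 0) - ?\<theta> \<gamma> *\<^sub>R S 1 \<in> tracefree_sym"
          by (intro subspace_diff[OF subspace_tracefree_sym] subspace_scale[OF subspace_tracefree_sym]
              commut_S(1)[OF g] onb_D(2)[OF onb_S]) (use d5 in auto)
        fix b assume b: "b < d"
        consider "b = 0" | "b = 1" | "2 \<le> b" by linarith
        thus "(commut (\<omega> \<gamma>) (S 0) - ?\<theta> \<gamma> *\<^sub>R S 1) \<bullet> S b = 0"
        proof cases
          case 1 thus ?thesis using commut_S(2)[OF g, of 0 0] S_inner[of 1 0] d5 by (simp add: inner_diff_left)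
        next
          case 2 thus ?thesis using S_inner[of 1 1] d5 by (simp add: inner_diff_left)
        next
          case 3
          hence "commut (\<omega> \<gamma>) (S 0) \<bullet> S b = 0" using gt[OF 3 b] b d5 by (intro commut_S(2)[OF g]) auto
          thus ?thesis using S_inner[of 1 b] 3 b by (simp add: inner_diff_left)
        qed
      qed
      thus ?thesis by simp
    qed
    have "S 0 \<in> tracefree_sym" "S 0 \<noteq> 0"
      using onb_D(2)[OF onb_S, of 0] S_inner[of 0 0] d5 by auto
    have \<theta>0: "?\<theta> \<gamma> = 0" if g: "\<gamma> < D" "c \<gamma> \<noteq> 0" for \<gamma>
    proof (cases "ev 1 = ev 0")
      case False
      thus ?thesis using commut_S(2)[OF g, of 0 1] d5 by auto
    next
      case True
      have S1: "commut (\<omega> \<gamma>) (S 1) = - ?\<theta> \<gamma> *\<^sub>R S 0" if g: "\<gamma> < D" "c \<gamma> \<noteq> 0" for \<gamma>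
      proof -
        have "commut (\<omega> \<gamma>) (S 1) + ?\<theta> \<gamma> *\<^sub>R S 0 = 0"
        proof (rule sum_S_expand_zero)
          show "commut (\<omega> \<gamma>) (S 1) + ?\<theta> \<gamma> *\<^sub>R S 0 \<in> tracefree_sym"
            by (intro subspace_add[OF subspace_tracefree_sym] subspace_scale[OF subspace_tracefree_sym]
                commut_S(1)[OF g] onb_D(2)[OF onb_S]) (use d5 in auto)
          fix b assume b: "b < d"
          have 0: "commut (\<omega> \<gamma>) (S 1) \<bullet> S 0 = - ?\<theta> \<gamma>"
            using commut_inner[OF w_skew(1)[OF g(1)], of "S 1" "S 0"] by (simp add: inner_commute)
          consider "b = 0" | "b = 1" | "2 \<le> b" by linarith
          thus "(commut (\<omega> \<gamma>) (S 1) + ?\<theta> \<gamma> *\<^sub>R S 0) \<bullet> S b = 0"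
          proof cases
            case 1 thus ?thesis using 0 S_inner[of 0 0] d5 by (simp add: inner_add_left)
          next
            case 2 thus ?thesis using commut_S(2)[OF g, of 1 1] S_inner[of 0 1] d5 by (simp add: inner_add_left)
          next
            case 3
            hence "commut (\<omega> \<gamma>) (S 1) \<bullet> S b = 0" using gt[OF 3 b] b d5 True by (intro commut_S(2)[OF g]) auto
            thus ?thesis using S_inner[of 0 b] 3 b by (simp add: inner_add_left)
          qed
        qed
        thus ?thesis by (simp add: eq_neg_iff_add_eq_0)
      qed
      \<comment> \<open>The action on the plane of \<open>S 0\<close> and \<open>S 1\<close> is by
        rotations, and these fix any antisymmetric product of the two matrices.\<close>
      define J where "J = commut (S 0) (S 1)"
      have Jsk: "J \<in> skew" using d5 by (simp add: J_def skew_def commut_def transpose_simps S_sym)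
      have "commut (\<omega> \<delta>) J = 0" if d: "\<delta> < D" "c \<delta> \<noteq> 0" for \<delta>
      proof -
        have "commut (\<omega> \<delta>) J = commut (commut (\<omega> \<delta>) (S 0)) (S 1) + commut (S 0) (commut (\<omega> \<delta>) (S 1))"
          by (simp add: J_def commut_def matrix_mult_simps matrix_mul_assoc)
        moreover obtain t where t: "commut (\<omega> \<delta>) (S 0) = t *\<^sub>R S 1" "commut (\<omega> \<delta>) (S 1) = - t *\<^sub>R S 0"
          using S0[OF d] S1[OF d] by blast
        have "commut (commut (\<omega> \<delta>) (S 0)) (S 1) + commut (S 0) (commut (\<omega> \<delta>) (S 1)) = 0"
          unfolding t by (simp add: commut_def matrix_mult_simps)
        ultimately show ?thesis by (simp only:)
      qed
      hence "J = 0" using no_parallel_2form[OF assms Jsk] by blast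
      hence e: "S 0 ** S 1 = S 1 ** S 0" by (simp add: J_def commut_def)
      \<comment> \<open>The rate is the pairing of \<open>\<omega> \<gamma>\<close> with the
        commutator of \<open>S 1\<close> and \<open>S 0\<close>, which vanishes together with
        \<open>J\<close>.\<close>
      have "?\<theta> \<gamma> = \<omega> \<gamma> \<bullet> (S 1 ** S 0) - \<omega> \<gamma> \<bullet> (S 0 ** S 1)"
        using d5 by (simp add: commut_def inner_diff_left inner_mult_right[of "\<omega> \<gamma>"] inner_mult_left[of "S 0"] S_sym)
      also have "\<dots> = 0" by (simp only: e diff_self)
      finally show ?thesis .
    qed
    have "commut (\<omega> \<gamma>) (S 0) = 0" if g: "\<gamma> < D" "c \<gamma> \<noteq> 0" for \<gamma>
      using S0[OF g] unfolding \<theta>0[OF g] by simp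
    with \<open>S 0 \<in> tracefree_sym\<close> \<open>S 0 \<noteq> 0\<close> show False by (rule no_parallel_sym[OF assms])
  qed
  thus "ev 2 = ev 0" .
  thus "ev 1 = ev 0" using ev_sorted[of 0 1] ev_sorted[of 1 2] d5 by simp
qed

text \<open>The eigenspace is an ideal of the holonomy algebra. In dimension at most two it is
  abelian, and invariance of the inner product then makes \<open>\<omega> \<alpha>\<close> central,
  that is, a nonzero parallel 2-form.\<close>

lemma c_multiplicity:
  assumes "0 < \<rho>" "\<alpha> < D" "c \<alpha> \<noteq> 0"
  shows "3 \<le> card {\<beta>. \<beta> < D \<and> c \<beta> = c \<alpha>}"
proof (rule ccontr)
  let ?A = "{\<beta>. \<beta> < D \<and> c \<beta> = c \<alpha>}"
  assume "\<not> 3 \<le> card ?A"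
  moreover have "finite ?A" "\<alpha> \<in> ?A" using assms by auto
  ultimately have "card (?A - {\<alpha>}) \<le> 1" by simp
  hence "\<forall>x\<in>?A - {\<alpha>}. \<forall>y\<in>?A - {\<alpha>}. x = y" using card_le_Suc0_iff_eq[of "?A - {\<alpha>}"] by simp
  \<comment> \<open>If \<alpha> is the only index of its class, any \<beta> serves.\<close>
  hence "\<exists>\<beta>. ?A - {\<alpha>} \<subseteq> {\<beta>}" by (cases "?A - {\<alpha>} = {}") blast+
  then obtain \<beta> where \<beta>: "\<And>\<delta>. \<delta> < D \<Longrightarrow> c \<delta> = c \<alpha> \<Longrightarrow> \<delta> = \<alpha> \<or> \<delta> = \<beta>" by blast
  note wa = w_skew(1)[OF assms(2)]
  have self: "commut X X = 0" for X :: "real^'n^'n" by (simp add: commut_def)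
  have aa: "commut (\<omega> \<gamma>) (\<omega> \<alpha>) \<bullet> \<omega> \<alpha> = 0" if "\<gamma> < D" for \<gamma>
    using commut_inner[OF w_skew(1)[OF that], of "\<omega> \<alpha>" "\<omega> \<alpha>"] by (simp add: inner_commute)
  have ab: "commut (\<omega> \<alpha>) (\<omega> \<beta>) = 0" if b: "\<beta> < D" "c \<beta> = c \<alpha>"
  proof (rule sum_w_expand_zero[OF commut_skew[OF wa w_skew(1)[OF b(1)]]])
    fix \<delta> assume d: "\<delta> < D"
    have "commut (\<omega> \<alpha>) (\<omega> \<beta>) \<bullet> \<omega> \<alpha> = 0" using commut_inner[OF wa, of "\<omega> \<beta>" "\<omega> \<alpha>"] by (simp add: self)
    moreover have "commut (\<omega> \<alpha>) (\<omega> \<beta>) \<bullet> \<omega> \<beta> = 0"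
      using commut_inner[OF wa, of "\<omega> \<beta>" "\<omega> \<beta>"] by (simp add: inner_commute)
    ultimately show "commut (\<omega> \<alpha>) (\<omega> \<beta>) \<bullet> \<omega> \<delta> = 0"
      using inv[OF assms(2) b(1) d assms(3)] \<beta>[OF d] b(2) by (cases "c \<delta> = c \<alpha>") auto
  qed
  have "commut (\<omega> \<gamma>) (\<omega> \<alpha>) = 0" if g: "\<gamma> < D" "c \<gamma> \<noteq> 0" for \<gamma>
  proof (rule sum_w_expand_zero[OF commut_skew[OF w_skew(1)[OF g(1)] wa]])
    fix \<delta> assume d: "\<delta> < D"
    have "commut (\<omega> \<gamma>) (\<omega> \<alpha>) = - commut (\<omega> \<alpha>) (\<omega> \<gamma>)" by (simp add: commut_def)
    hence "commut (\<omega> \<gamma>) (\<omega> \<alpha>) \<bullet> \<omega> \<beta> = 0" if "\<beta> < D" "c \<beta> = c \<alpha>"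
      using commut_inner[OF wa, of "\<omega> \<gamma>" "\<omega> \<beta>"] ab[OF that] by simp
    thus "commut (\<omega> \<gamma>) (\<omega> \<alpha>) \<bullet> \<omega> \<delta> = 0"
      using inv[OF g(1) assms(2) d g(2)] \<beta>[OF d] aa[OF g(1)] d by (cases "c \<delta> = c \<alpha>") auto
  qed
  moreover have "\<omega> \<alpha> \<noteq> 0" using w_inner[OF assms(2) assms(2)] by auto
  ultimately show False using no_parallel_2form[OF assms(1) wa] by blast
qed

text \<open>When all of \<open>so(n)\<close> acts, compare the Casimir weighted by \<open>c\<close> with the unweighted one.\<close>

lemma full_holonomy:
  assumes nz: "\<And>\<alpha>. \<alpha> < D \<Longrightarrow> c \<alpha> \<noteq> 0" and b: "\<beta> < D"
  shows "c \<beta> = \<rho> / (real CARD('n) - 1)"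
proof -
  let ?n = "real CARD('n)"
  \<comment> \<open>Brackets between different eigenspaces vanish, because they would lie in both;
    hence \<open>c \<alpha>\<close> may be replaced by \<open>c \<beta>\<close> throughout the
    Casimir sum.\<close>
  have eq: "c \<alpha> *\<^sub>R commut (\<omega> \<alpha>) (commut (\<omega> \<alpha>) (\<omega> \<beta>)) = c \<beta> *\<^sub>R commut (\<omega> \<alpha>) (commut (\<omega> \<alpha>) (\<omega> \<beta>))" if a: "\<alpha> < D" for \<alpha>
  proof (cases "c \<alpha> = c \<beta>")
    case False
    have "commut (\<omega> \<alpha>) (\<omega> \<beta>) = 0"
    proof (rule sum_w_expand_zero[OF commut_skew[OF w_skew(1)[OF a] w_skew(1)[OF b]]])
      fix \<delta> assume d: "\<delta> < D"
      have "commut (\<omega> \<alpha>) (\<omega> \<beta>) = - commut (\<omega> \<beta>) (\<omega> \<alpha>)" by (simp add: commut_def)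
      thus "commut (\<omega> \<alpha>) (\<omega> \<beta>) \<bullet> \<omega> \<delta> = 0"
        using inv[OF a b d nz[OF a]] inv[OF b a d nz[OF b]] False by (cases "c \<beta> = c \<delta>") auto
    qed
    thus ?thesis by (simp add: linear_0[OF linear_commut])
  qed simp
  have "(\<Sum>\<alpha><D. commut (\<omega> \<alpha>) (commut (\<omega> \<alpha>) (\<omega> \<beta>)))
     = (\<Sum>\<alpha><D. \<omega> \<alpha> ** mat 1 ** \<omega> \<alpha>) ** \<omega> \<beta> + \<omega> \<beta> ** (\<Sum>\<alpha><D. \<omega> \<alpha> ** mat 1 ** \<omega> \<alpha>) - 2 *\<^sub>R (\<Sum>\<alpha><D. \<omega> \<alpha> ** \<omega> \<beta> ** \<omega> \<alpha>)"
    unfolding commut_def matrix_mult_sum_left matrix_mult_sum_right scaleR_sum_right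
      sum.distrib[symmetric] sum_subtractf[symmetric]
    by (intro sum.cong refl) (simp add: matrix_mult_simps matrix_mul_assoc scaleR_2)
  also have "\<dots> = - (?n - 2) *\<^sub>R \<omega> \<beta>"
    unfolding sum_sandwich by (simp add: matrix_mult_simps w_skew(2)[OF b] trace_skew[OF w_skew(1)[OF b]] trace_I)
      (simp add: vec_eq_iff field_simps)
  finally have sum: "(\<Sum>\<alpha><D. commut (\<omega> \<alpha>) (commut (\<omega> \<alpha>) (\<omega> \<beta>))) = - (?n - 2) *\<^sub>R \<omega> \<beta>" .
  have "c \<beta> *\<^sub>R (- (?n - 2) *\<^sub>R \<omega> \<beta>) = (\<Sum>\<alpha><D. c \<beta> *\<^sub>R commut (\<omega> \<alpha>) (commut (\<omega> \<alpha>) (\<omega> \<beta>)))"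
    by (simp only: scaleR_sum_right[symmetric] sum)
  also have "\<dots> = (c \<beta> - \<rho>) *\<^sub>R \<omega> \<beta>" using adjoint_casimir[OF b] eq by simp
  finally have "(c \<beta> * (- (?n - 2))) *\<^sub>R \<omega> \<beta> = (c \<beta> - \<rho>) *\<^sub>R \<omega> \<beta>" by (simp only: scaleR_scaleR)
  moreover have "\<omega> \<beta> \<noteq> 0" using w_inner[OF b b] by auto
  ultimately have "c \<beta> * (- (?n - 2)) = c \<beta> - \<rho>" by (metis scaleR_cancel_right)
  hence "c \<beta> * (?n - 1) = \<rho>" by (simp add: algebra_simps)
  thus ?thesis using dim3 by (simp add: field_simps)
qed

text \<open>For an eigenvalue \<open>c\<^sub>0 \<noteq> 0\<close> of the curvature operator with eigenspace spanned by certain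
  \<open>\<omega> \<alpha>\<close>, the 4-form \<open>\<Sum>\<alpha>. \<omega> \<alpha> \<and> \<omega> \<alpha>\<close> is parallel.\<close>

lemma two_nonzero_c_contradiction:
  assumes "0 < \<rho>" "5 \<le> CARD('n)" and a0: "\<alpha>0 < D" "c \<alpha>0 \<noteq> 0" and a1: "\<alpha>1 < D" "c \<alpha>1 \<noteq> 0" and ne: "c \<alpha>0 \<noteq> c \<alpha>1"
  shows False
proof -
  \<comment> \<open>The indicator function of the eigenvalue \<open>c \<alpha>0\<close>.\<close>
  define \<phi> where "\<phi> x = (if x = c \<alpha>0 then 1 else 0 :: real)" for x
  \<comment> \<open>For A = B skew the cyclic sum is A \<and> A up to a factor; it is polarised in A
    and B so that \<open>invariant_bilinear\<close> applies.\<close>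
  define \<beta> where "\<beta> u v w z A B = (u \<bullet> (A *v v)) * (w \<bullet> (B *v z)) + (v \<bullet> (A *v w)) * (u \<bullet> (B *v z))
      + (w \<bullet> (A *v u)) * (v \<bullet> (B *v z))" for u v w z :: "real^'n" and A B :: "real^'n^'n"
  define \<Psi> where "\<Psi> u v w z = (\<Sum>\<alpha><D. \<phi> (c \<alpha>) * \<beta> u v w z (\<omega> \<alpha>) (\<omega> \<alpha>))" for u v w z
  have sk: "x \<bullet> (\<omega> \<alpha> *v y) = - (y \<bullet> (\<omega> \<alpha> *v x))" if "\<alpha> < D" for \<alpha> x y
    using skew_inner_vector[OF w_skew(1)[OF that], of x y] by (simp add: inner_commute)
  have bil: "bilinear (\<beta> u v w z)" for u v w z
    by (auto simp: bilinear_def \<beta>_def intro!: linearI simp: matrix_vector_mult_add_rdistrib inner_add_right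
        scaleR_matrix_vector_assoc[symmetric] algebra_simps)
  interpret \<Psi>: four_form \<Psi>
  proof (rule four_form.intro)
    show "linear (\<lambda>u. \<Psi> u v w z)" for v w z
      by (rule linearI) (simp_all add: \<Psi>_def \<beta>_def inner_add_left matrix_vector_right_distrib inner_add_right
          matrix_vector_mult_scaleR algebra_simps sum.distrib sum_distrib_left)
    have t: "\<beta> u v w z (\<omega> \<alpha>) (\<omega> \<alpha>) = - \<beta> v u w z (\<omega> \<alpha>) (\<omega> \<alpha>)"
      "\<beta> u v w z (\<omega> \<alpha>) (\<omega> \<alpha>) = - \<beta> u w v z (\<omega> \<alpha>) (\<omega> \<alpha>)"
      "\<beta> u v w z (\<omega> \<alpha>) (\<omega> \<alpha>) = - \<beta> u v z w (\<omega> \<alpha>) (\<omega> \<alpha>)" if "\<alpha> < D" for u v w z \<alpha>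
      using sk[OF that, of u v] sk[OF that, of u w] sk[OF that, of v w] sk[OF that, of w z] sk[OF that, of u z] sk[OF that, of v z]
      unfolding \<beta>_def by algebra+
    show "\<Psi> u v w z = - \<Psi> v u w z" "\<Psi> u v w z = - \<Psi> u w v z" "\<Psi> u v w z = - \<Psi> u v z w" for u v w z
      unfolding \<Psi>_def sum_negf[symmetric] mult_minus_right[symmetric]
      by (intro sum.cong refl arg_cong[where f = "(*) _"]; use t in blast)+
  qed
  have par: "\<Psi>.deriv_action (\<omega> \<gamma>) u v w z = 0" if g: "\<gamma> < D" "c \<gamma> \<noteq> 0" for \<gamma> u v w z
  proof -
    have m: "(\<omega> \<gamma> *v x) \<bullet> (A *v y) + x \<bullet> (A *v (\<omega> \<gamma> *v y)) = - (x \<bullet> (commut (\<omega> \<gamma>) A *v y))" for x y A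
    proof -
      have "(\<omega> \<gamma> *v x) \<bullet> (A *v y) = - (x \<bullet> (\<omega> \<gamma> *v (A *v y)))"
        using skew_inner_vector[OF w_skew(1)[OF g(1)], of x "A *v y"] by simp
      thus ?thesis by (simp add: commut_def matrix_vector_mult_diff_rdistrib inner_diff_right matrix_vector_mul_assoc)
    qed
    have "\<beta> (\<omega> \<gamma> *v u) v w z A B + \<beta> u (\<omega> \<gamma> *v v) w z A B + \<beta> u v (\<omega> \<gamma> *v w) z A B + \<beta> u v w (\<omega> \<gamma> *v z) A B
      = - (\<beta> u v w z (commut (\<omega> \<gamma>) A) B + \<beta> u v w z A (commut (\<omega> \<gamma>) B))" for A B
      using m[of u A v] m[of v A w] m[of w A u] m[of w B z] m[of u B z] m[of v B z]
      unfolding \<beta>_def by algebra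
    hence "\<Psi>.deriv_action (\<omega> \<gamma>) u v w z = - (\<Sum>\<alpha><D. \<phi> (c \<alpha>) *\<^sub>R (\<beta> u v w z (commut (\<omega> \<gamma>) (\<omega> \<alpha>)) (\<omega> \<alpha>) + \<beta> u v w z (\<omega> \<alpha>) (commut (\<omega> \<gamma>) (\<omega> \<alpha>))))"
      unfolding \<Psi>.deriv_action_def \<Psi>_def sum.distrib[symmetric] distrib_left[symmetric] sum_negf[symmetric]
      by (intro sum.cong refl) (simp add: right_diff_distrib distrib_left)
    thus ?thesis using invariant_bilinear[OF bil g, of \<phi>] by simp
  qed
  have "\<Psi> u v w z = 0" for u v w z
    using no_parallel_4form[OF assms(1,2) \<Psi>.four_form_axioms _ par] by blast
  note zero = this
  \<comment> \<open>The vanishing form is contracted with an element of the other nonzero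
    eigenspace, which is orthogonal to the chosen eigenspace and commutes with it.\<close>
  let ?B = "\<omega> \<alpha>1"
  have comm: "\<omega> \<alpha> ** ?B = ?B ** \<omega> \<alpha>" if a: "\<alpha> < D" "c \<alpha> = c \<alpha>0" for \<alpha>
  proof -
    have "commut (\<omega> \<alpha>) ?B = 0"
    proof (rule sum_w_expand_zero[OF commut_skew[OF w_skew(1)[OF a(1)] w_skew(1)[OF a1(1)]]])
      fix \<delta> assume d: "\<delta> < D"
      have "commut (\<omega> \<alpha>) ?B = - commut ?B (\<omega> \<alpha>)" by (simp add: commut_def)
      thus "commut (\<omega> \<alpha>) ?B \<bullet> \<omega> \<delta> = 0"
        using inv[OF a(1) a1(1) d] inv[OF a1(1) a(1) d a1(2)] ne a(2) a0(2) by (cases "c \<alpha>1 = c \<delta>") auto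
    qed
    thus ?thesis by (simp add: commut_def)
  qed
  define Z where "Z = (\<Sum>\<alpha><D. \<phi> (c \<alpha>) *\<^sub>R (\<omega> \<alpha> ** \<omega> \<alpha>))"
  have ZB: "Z ** ?B = 0"
  proof -
    have con: "(\<Sum>k\<in>UNIV. \<Sum>l\<in>UNIV. \<beta> u v (axis k 1) (axis l 1) A A * ?B $ k $ l)
       = (u \<bullet> (A *v v)) * (A \<bullet> ?B) + 2 * (u \<bullet> ((A ** ?B ** A) *v v))" if A: "A \<in> skew" for u v and A :: "real^'n^'n"
    proof -
      have s1: "axis k 1 \<bullet> (A *v axis l 1) = A $ k $ l" for k l
        by (simp add: inner_axis' matrix_vector_mult_basis column_def)
      have s2: "x \<bullet> (A *v axis l 1) = - (A *v x) $ l" for x l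
        using skew_inner_vector[OF A, of x "axis l 1"] by (simp add: inner_axis)
      have s3: "axis k 1 \<bullet> (A *v x) = (A *v x) $ k" for x k by (simp add: inner_axis')
      have dbl: "(\<Sum>k\<in>UNIV. \<Sum>l\<in>UNIV. x $ k * y $ l * ?B $ k $ l) = x \<bullet> (?B *v y)" for x y
        by (simp add: inner_vec_def matrix_vector_mult_def sum_distrib_left ac_simps)
      have ABA: "(A *v x) \<bullet> (?B *v (A *v y)) = - (x \<bullet> ((A ** ?B ** A) *v y))" for x y
        using skew_inner_vector[OF A, of x "?B *v (A *v y)"] by (simp add: matrix_vector_mul_assoc matrix_mul_assoc)
      have sym: "v \<bullet> ((A ** ?B ** A) *v u) = - (u \<bullet> ((A ** ?B ** A) *v v))"
      proof -
        have "A ** ?B ** A \<in> skew"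
          using A w_skew(1)[OF a1(1)] by (simp add: skew_def transpose_simps matrix_mult_simps matrix_mul_assoc)
        from skew_inner_vector[OF this, of v u] show ?thesis by (simp add: inner_commute)
      qed
      have "(\<Sum>k\<in>UNIV. \<Sum>l\<in>UNIV. \<beta> u v (axis k 1) (axis l 1) A A * ?B $ k $ l)
        = (\<Sum>k\<in>UNIV. \<Sum>l\<in>UNIV. (u \<bullet> (A *v v)) * (A $ k $ l * ?B $ k $ l)
            + (A *v v) $ k * (A *v u) $ l * ?B $ k $ l - (A *v u) $ k * (A *v v) $ l * ?B $ k $ l)"
        unfolding \<beta>_def s1 unfolding s2 s3 by (intro sum.cong refl) (simp add: algebra_simps)
      also have "\<dots> = (u \<bullet> (A *v v)) * (A \<bullet> ?B) + (A *v v) \<bullet> (?B *v (A *v u)) - (A *v u) \<bullet> (?B *v (A *v v))"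
        unfolding sum.distrib sum_subtractf dbl inner_matrix sum_distrib_left ..
      also have "\<dots> = (u \<bullet> (A *v v)) * (A \<bullet> ?B) + 2 * (u \<bullet> ((A ** ?B ** A) *v v))"
        unfolding ABA sym by simp
      finally show ?thesis .
    qed
    have t: "\<phi> (c \<alpha>) * (\<Sum>k\<in>UNIV. \<Sum>l\<in>UNIV. \<beta> u v (axis k 1) (axis l 1) (\<omega> \<alpha>) (\<omega> \<alpha>) * ?B $ k $ l)
        = 2 * (u \<bullet> ((\<phi> (c \<alpha>) *\<^sub>R (\<omega> \<alpha> ** \<omega> \<alpha>) ** ?B) *v v))" if "\<alpha> < D" for \<alpha> u v
    proof (cases "c \<alpha> = c \<alpha>0")
      case True
      hence "\<omega> \<alpha> \<bullet> ?B = 0" using w_inner[OF that a1(1)] ne by auto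
      moreover have "\<omega> \<alpha> ** ?B ** \<omega> \<alpha> = \<omega> \<alpha> ** \<omega> \<alpha> ** ?B" using comm[OF that True] by (metis matrix_mul_assoc)
      ultimately show ?thesis using con[OF w_skew(1)[OF that]] True by (simp add: \<phi>_def)
    next
      case False
      thus ?thesis by (simp add: \<phi>_def matrix_mult_simps)
    qed
    have "u \<bullet> ((Z ** ?B) *v v) = 0" for u v
    proof -
      have "0 = (\<Sum>k\<in>UNIV. \<Sum>l\<in>UNIV. \<Psi> u v (axis k 1) (axis l 1) * ?B $ k $ l)" by (simp add: zero)
      also have "\<dots> = (\<Sum>k\<in>UNIV. \<Sum>l\<in>UNIV. \<Sum>\<alpha><D. \<phi> (c \<alpha>) * (\<beta> u v (axis k 1) (axis l 1) (\<omega> \<alpha>) (\<omega> \<alpha>) * ?B $ k $ l))"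
        by (simp add: \<Psi>_def sum_distrib_right mult.assoc)
      also have "\<dots> = (\<Sum>\<alpha><D. \<phi> (c \<alpha>) * (\<Sum>k\<in>UNIV. \<Sum>l\<in>UNIV. \<beta> u v (axis k 1) (axis l 1) (\<omega> \<alpha>) (\<omega> \<alpha>) * ?B $ k $ l))"
        unfolding sum_distrib_left by (simp only: sum.swap[of _ "{..<D}" UNIV])
      also have "\<dots> = (\<Sum>\<alpha><D. 2 * (u \<bullet> ((\<phi> (c \<alpha>) *\<^sub>R (\<omega> \<alpha> ** \<omega> \<alpha>) ** ?B) *v v)))"
        by (intro sum.cong refl) (simp add: t)
      also have "\<dots> = 2 * (u \<bullet> ((Z ** ?B) *v v))"
      proof -
        have "linear (\<lambda>A. u \<bullet> (A *v v))"
          by (rule linearI) (simp_all add: matrix_vector_mult_add_rdistrib inner_add_right scaleR_matrix_vector_assoc[symmetric])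
        note linear_sum[OF this, of "\<lambda>\<alpha>. \<phi> (c \<alpha>) *\<^sub>R (\<omega> \<alpha> ** \<omega> \<alpha>) ** ?B" "{..<D}"]
        thus ?thesis unfolding Z_def matrix_mult_sum_left sum_distrib_left[symmetric] by simp
      qed
      finally show ?thesis by simp
    qed
    thus ?thesis by (intro matrix_eqI_onb[OF onb_axis]) simp
  qed
  have Zt: "transpose Z = Z" by (simp add: Z_def transpose_simps w_skew(2) matrix_mult_simps)
  have Zc: "commut (\<omega> \<gamma>) Z = 0" if g: "\<gamma> < D" "c \<gamma> \<noteq> 0" for \<gamma>
  proof -
    have "commut (\<omega> \<gamma>) (\<omega> \<alpha> ** \<omega> \<alpha>) = commut (\<omega> \<gamma>) (\<omega> \<alpha>) ** \<omega> \<alpha> + \<omega> \<alpha> ** commut (\<omega> \<gamma>) (\<omega> \<alpha>)" for \<alpha>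
      by (simp add: commut_def matrix_mult_simps matrix_mul_assoc)
    thus ?thesis using invariant_bilinear[OF bilinear_matrix_mult g, of \<phi>]
      by (simp add: Z_def linear_sum[OF linear_commut] linear_scale[OF linear_commut])
  qed
  \<comment> \<open>\<open>Z\<close> is parallel and symmetric, hence scalar.
    \<open>Z ** ?B = 0\<close> makes that scalar 0, whereas the trace of \<open>Z\<close> is minus
    the dimension of the eigenspace.\<close>
  define Z0 where "Z0 = Z - (trace Z / real CARD('n)) *\<^sub>R mat 1"
  have "Z0 = 0"
  proof (rule ccontr)
    assume "Z0 \<noteq> 0"
    moreover have "Z0 \<in> tracefree_sym"
      by (simp add: Z0_def tracefree_sym_def transpose_simps trace_simps Zt trace_I)
    moreover have "commut (\<omega> \<gamma>) Z0 = 0" if "\<gamma> < D" "c \<gamma> \<noteq> 0" for \<gamma>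
      using Zc[OF that] by (simp add: Z0_def commut_def matrix_mult_simps)
    ultimately show False using no_parallel_sym[OF assms(1)] by blast
  qed
  hence "Z = (trace Z / real CARD('n)) *\<^sub>R mat 1" by (simp add: Z0_def)
  hence "(trace Z / real CARD('n)) *\<^sub>R ?B = 0" using ZB by (metis bilinear_lmul[OF bilinear_matrix_mult] matrix_mul_lid)
  moreover have "?B \<noteq> 0" using w_inner[OF a1(1) a1(1)] by auto
  ultimately have "trace Z = 0" by simp
  moreover have "trace Z = - (\<Sum>\<alpha><D. \<phi> (c \<alpha>))" by (simp add: Z_def trace_simps trace_w_w sum_negf)
  moreover have "(\<Sum>\<alpha><D. \<phi> (c \<alpha>)) \<ge> \<phi> (c \<alpha>0)" using a0(1) by (intro member_le_sum) (auto simp: \<phi>_def)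
  ultimately show False by (simp add: \<phi>_def)
qed

text \<open>When c takes the values 0 and \<open>c0\<close>, all power sums of c reduce to \<Sum> c
  = n \<rho> / 2. After division by \<kappa> = \<rho> / (n - 1) the first three moments of
  \<open>ev\<close> depend on n and x = c0 / \<kappa> alone; a kernel is what makes x > 1.\<close>

lemma single_c_contradiction:
  assumes "0 < \<rho>" "4 \<le> CARD('n)" and c0: "0 < c0" "\<And>\<alpha>. \<alpha> < D \<Longrightarrow> c \<alpha> = c0 \<or> c \<alpha> = 0"
    and gt: "\<rho> / (real CARD('n) - 1) < c0"
  shows False
proof -
  let ?n = "real CARD('n)"
  define \<kappa> where "\<kappa> = \<rho> / (?n - 1)"
  have n: "?n \<ge> 4" using assms(2) by simp
  have k: "\<kappa> > 0" "\<rho> = (?n - 1) * \<kappa>" using n assms(1) by (auto simp: \<kappa>_def)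
  define x where "x = c0 / \<kappa>"
  have "\<kappa> < c0" using gt by (simp only: \<kappa>_def)
  hence x: "1 < x" "c0 = x * \<kappa>" using k by (auto simp: x_def)
  have "(\<Sum>\<alpha><D. (c \<alpha>)\<^sup>2) = (\<Sum>\<alpha><D. c0 * c \<alpha>)" "(\<Sum>\<alpha><D. c \<alpha> ^ 3) = (\<Sum>\<alpha><D. c0\<^sup>2 * c \<alpha>)"
    using c0(2) by (intro sum.cong refl; force simp: power2_eq_square power3_eq_cube)+
  hence c2: "(\<Sum>\<alpha><D. (c \<alpha>)\<^sup>2) = c0 * (?n * \<rho> / 2)" and c3: "(\<Sum>\<alpha><D. c \<alpha> ^ 3) = c0\<^sup>2 * (?n * \<rho> / 2)"
    by (simp_all only: sum_distrib_left[symmetric] sum_c)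
  show False
  proof (rule power_sums_contradiction[of ?n d x "\<lambda>a. ev a / \<kappa>" N])
    show "4 \<le> ?n" "real d = (?n - 1) * (?n + 2) / 2" "1 < x" "1 \<le> N" "N < 3 * ?n / 2 * ((?n + 2) / (?n + 4))"
      using n card_d x N by auto
    show "ev i / \<kappa> \<le> ev j / \<kappa>" if "i \<le> j" "j < d" for i j
      using ev_sorted[OF that] k by (simp add: divide_right_mono)
    show "nat \<lfloor>N\<rfloor> = nat \<lfloor>N\<rfloor>" ..
    have "0 \<le> ((\<Sum>i<nat \<lfloor>N\<rfloor>. ev i) + (N - of_int \<lfloor>N\<rfloor>) * ev (nat \<lfloor>N\<rfloor>)) / \<kappa>" using low k by simp
    thus "0 \<le> (\<Sum>i<nat \<lfloor>N\<rfloor>. ev i / \<kappa>) + (N - of_int \<lfloor>N\<rfloor>) * (ev (nat \<lfloor>N\<rfloor>) / \<kappa>)"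
      by (simp add: add_divide_distrib sum_divide_distrib)
    have "(\<Sum>i<d. ev i / \<kappa>) = (\<Sum>i<d. ev i) / \<kappa>" by (simp add: sum_divide_distrib)
    also have "\<dots> = real d" unfolding sum_ev card_d k(2) using k(1) by simp
    finally show "(\<Sum>i<d. ev i / \<kappa>) = real d" .
    have "(\<Sum>i<d. (ev i / \<kappa>)\<^sup>2) = (\<Sum>i<d. (ev i)\<^sup>2) / \<kappa>\<^sup>2" by (simp add: sum_divide_distrib power_divide)
    also have "\<dots> = 3 * (?n * (?n - 1) / 2) * x - (?n - 1)\<^sup>2"
      unfolding sum_ev_square c2 k(2) x(2) using k(1) by (simp add: field_simps power2_eq_square)
    finally show "(\<Sum>i<d. (ev i / \<kappa>)\<^sup>2) = 3 * (?n * (?n - 1) / 2) * x - (?n - 1)\<^sup>2" .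
    have "(\<Sum>i<d. (ev i / \<kappa>) ^ 3) = (\<Sum>i<d. ev i ^ 3) / \<kappa> ^ 3" by (simp add: sum_divide_distrib power_divide)
    also have "\<dots> = (?n - 1) ^ 3 - 2 * (?n - 1) * (?n * (?n - 1) / 2) * x + 3 * (?n * (?n - 1) / 2) * x\<^sup>2"
      unfolding sum_ev_cube c2 c3 k(2) x(2) using k(1) by (simp add: field_simps power2_eq_square power3_eq_cube)
    finally show "(\<Sum>i<d. (ev i / \<kappa>) ^ 3) = (?n - 1) ^ 3 - 2 * (?n - 1) * (?n * (?n - 1) / 2) * x + 3 * (?n * (?n - 1) / 2) * x\<^sup>2" .
    show "ev 1 / \<kappa> = ev 0 / \<kappa>" "ev 2 / \<kappa> = ev 0 / \<kappa>" using lowest_multiplicity[OF assms(1)] by auto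
  qed
qed

text \<open>A second nonzero eigenvalue is excluded by 4-forms for n \<ge> 5; for n \<le> 4 two
  multiplicities of at least three already fill so(n), so there is no kernel. With one nonzero
  eigenvalue a kernel forces n \<ge> 4, because multiplicity three exhausts so(3).\<close>

lemma all_c_equal_pos:
  assumes "0 < \<rho>" "\<beta> < D"
  shows "c \<beta> = \<rho> / (real CARD('n) - 1)"
proof -
  let ?n = "real CARD('n)"
  have n: "?n \<ge> 3" using dim3 by simp
  have pos: "(\<Sum>\<alpha><D. c \<alpha>) > 0" unfolding sum_c using assms(1) n by simp
  have nonpos: "(\<Sum>\<alpha><D. c \<alpha>) \<le> 0" if "\<not> (\<exists>\<alpha><D. c \<alpha> > 0)"
    using that by (intro sum_nonpos) (metis lessThan_iff not_less)
  have "\<exists>\<alpha><D. c \<alpha> > 0"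
  proof (rule ccontr)
    assume "\<not> ?thesis"
    from nonpos[OF this] pos show False by simp
  qed
  then obtain \<alpha> where a: "\<alpha> < D" "c \<alpha> > 0" by blast
  let ?A = "\<lambda>\<alpha>. {\<beta>. \<beta> < D \<and> c \<beta> = c \<alpha>}"
  have sub: "?A x \<subseteq> {..<D}" and fA: "finite (?A x)" for x by auto
  show ?thesis
  proof (cases "\<exists>\<gamma><D. c \<gamma> \<noteq> 0 \<and> c \<gamma> \<noteq> c \<alpha>")
    case True
    then obtain \<gamma> where g: "\<gamma> < D" "c \<gamma> \<noteq> 0" "c \<gamma> \<noteq> c \<alpha>" by blast
    have c4: "CARD('n) \<le> 4"
    proof (rule ccontr)
      assume "\<not> ?thesis"
      thus False by (intro two_nonzero_c_contradiction[OF assms(1) _ g(1,2) a(1) _ g(3)]) (use a in auto)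
    qed
    have "?A \<alpha> \<inter> ?A \<gamma> = {}" using g by auto
    hence "card (?A \<alpha> \<union> ?A \<gamma>) = card (?A \<alpha>) + card (?A \<gamma>)" by (intro card_Un_disjoint) auto
    hence 6: "6 \<le> card (?A \<alpha> \<union> ?A \<gamma>)"
      using c_multiplicity[OF assms(1) a(1)] c_multiplicity[OF assms(1) g(1,2)] a(2) by simp
    have "?n * (?n - 1) \<le> 4 * 3" using c4 n by (intro mult_mono) auto
    hence "D \<le> 6" using card_D by simp
    moreover have "card (?A \<alpha> \<union> ?A \<gamma>) \<le> card {..<D}" by (intro card_mono) auto
    ultimately have "?A \<alpha> \<union> ?A \<gamma> = {..<D}" using 6 by (intro card_subset_eq) auto
    hence "c \<delta> \<noteq> 0" if "\<delta> < D" for \<delta>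
    proof -
      have "\<delta> \<in> ?A \<alpha> \<union> ?A \<gamma>" using that \<open>?A \<alpha> \<union> ?A \<gamma> = {..<D}\<close> by blast
      thus ?thesis using g(2) a(2) by auto
    qed
    thus ?thesis by (rule full_holonomy) (use assms(2) in auto)
  next
    case False
    hence two: "c \<delta> = c \<alpha> \<or> c \<delta> = 0" if "\<delta> < D" for \<delta> using that by blast
    have "(\<Sum>\<delta><D. c \<delta>) = (\<Sum>\<delta>\<in>?A \<alpha>. c \<delta>)"
      using two sub by (intro sum.mono_neutral_right) auto
    hence m: "real (card (?A \<alpha>)) * c \<alpha> = ?n * \<rho> / 2" unfolding sum_c by simp
    show ?thesis
    proof (cases "card (?A \<alpha>) = D")
      case True
      hence "?A \<alpha> = {..<D}" by (intro card_subset_eq) auto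
      hence "c \<beta> = c \<alpha>" using assms(2) by auto
      moreover have "c \<alpha> = \<rho> / (?n - 1)"
      proof -
        have "?n * ((?n - 1) * c \<alpha>) = ?n * \<rho>" using m unfolding True card_D by simp
        hence "(?n - 1) * c \<alpha> = \<rho>" using n by simp
        thus ?thesis using n by (simp add: field_simps)
      qed
      ultimately show ?thesis by simp
    next
      case False
      hence lt: "card (?A \<alpha>) < D" using card_mono[OF finite_lessThan sub[of \<alpha>]] by simp
      have "4 \<le> CARD('n)"
      proof (rule ccontr)
        assume "\<not> 4 \<le> CARD('n)"
        hence "?n = 3" using dim3 by simp
        hence "D = 3" using card_D by simp
        thus False using lt c_multiplicity[OF assms(1) a(1)] a(2) by simp
      qed
      moreover have "\<rho> / (?n - 1) < c \<alpha>"
      proof -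
        have "real (card (?A \<alpha>)) * c \<alpha> < real D * c \<alpha>" using lt a(2) by simp
        hence "?n * \<rho> < ?n * ((?n - 1) * c \<alpha>)" using m unfolding card_D by simp
        hence "\<rho> < (?n - 1) * c \<alpha>" using n by (subst (asm) mult_less_cancel_left_pos) auto
        thus ?thesis using n by (simp add: field_simps)
      qed
      ultimately show ?thesis using single_c_contradiction[OF assms(1) _ a(2) two] by blast
    qed
  qed
qed

text \<open>For \<rho> \<le> 0 the constant weight 1 works because N < d: all \<open>ev a\<close>
  vanish, and the first two power sums give \<rho> = 0 and then c = 0.\<close>

lemma all_c_equal:
  assumes "\<beta> < D"
  shows "c \<beta> = \<rho> / (real CARD('n) - 1)"
proof (cases "0 < \<rho>")
  case False
  have "\<rho> * (real CARD('n) + 2) \<le> 0" using False by (intro mult_nonpos_nonneg) auto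
  hence "(\<Sum>a<d. ev a) \<le> 0" using sum_ev by simp
  hence "ev a = 0" if "a < d" for a
    by (intro weights_contradiction[of "\<lambda>_. 1" 1]) (use that N_less_d in auto)
  hence "\<rho> * (real CARD('n) + 2) / 2 = 0" "3 * (\<Sum>\<alpha><D. (c \<alpha>)\<^sup>2) - \<rho>\<^sup>2 = 0"
    using sum_ev sum_ev_square by auto
  moreover have "real CARD('n) + 2 \<noteq> 0" by (simp add: add_nonneg_pos)
  ultimately have r: "\<rho> = 0" and "(\<Sum>\<alpha><D. (c \<alpha>)\<^sup>2) = 0" by auto
  thus ?thesis using assms by (simp add: sum_nonneg_eq_0_iff)
qed (use all_c_equal_pos assms in auto)

end

section \<open>From an algebraic curvature tensor to its spectral data\<close>

lemma skew_nth:
  assumes "A \<in> skew"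
  shows "A $ i $ j = - A $ j $ i"
proof -
  have "transpose A $ j $ i = (- A) $ j $ i" using assms by (simp add: skew_def)
  thus ?thesis by (simp add: transpose_def)
qed

lemma skewI:
  assumes "\<And>i j. A $ i $ j = - A $ j $ i"
  shows "A \<in> skew"
  by (simp add: skew_def vec_eq_iff transpose_def) (intro allI assms)

definition second_kind_op :: "('n::finite \<Rightarrow> 'n \<Rightarrow> 'n \<Rightarrow> 'n \<Rightarrow> real) \<Rightarrow> real^'n^'n \<Rightarrow> real^'n^'n" where
  "second_kind_op R h = (\<chi> i j. \<Sum>k\<in>UNIV. \<Sum>l\<in>UNIV. R i k l j * h $ k $ l)"

text \<open>The factor 1/2 counts each coordinate plane once, so that constant curvature \<kappa>
  gives the eigenvalue \<kappa> on skew matrices.\<close>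

definition first_kind_op :: "('n::finite \<Rightarrow> 'n \<Rightarrow> 'n \<Rightarrow> 'n \<Rightarrow> real) \<Rightarrow> real^'n^'n \<Rightarrow> real^'n^'n" where
  "first_kind_op R B = (\<chi> i j. (1/2) * (\<Sum>k\<in>UNIV. \<Sum>l\<in>UNIV. R i j k l * B $ k $ l))"

text \<open>\<open>parallel_R\<close> is R(a,b).R = 0, the algebraic residue at a point of \<nabla>R
  = 0.\<close>

locale einstein_curv =
  fixes R :: "'n::finite \<Rightarrow> 'n \<Rightarrow> 'n \<Rightarrow> 'n \<Rightarrow> real" and \<rho> :: real
  assumes a12: "R i j k l = - R j i k l" and a34: "R i j k l = - R i j l k" and pair: "R i j k l = R k l i j"
    and bianchi_R: "R i j k l + R j k i l + R k i j l = 0"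
    and einstein_R: "(\<Sum>k\<in>UNIV. R i k j k) = (if i = j then \<rho> else 0)"
    and parallel_R: "(\<Sum>p\<in>UNIV. R a b i p * R p j k l + R a b j p * R i p k l + R a b k p * R i j p l + R a b l p * R i j k p) = 0"
begin

lemma linear_first_kind: "linear (first_kind_op R)"
  by (rule linearI) (simp_all add: first_kind_op_def vec_eq_iff sum.distrib sum_distrib_left algebra_simps)

lemma first_kind_skew: "first_kind_op R B \<in> skew"
proof -
  have "(\<Sum>k\<in>UNIV. \<Sum>l\<in>UNIV. R j i k l * B $ k $ l) = - (\<Sum>k\<in>UNIV. \<Sum>l\<in>UNIV. R i j k l * B $ k $ l)" for i j
    unfolding sum_negf[symmetric] by (intro sum.cong refl) (subst a12, simp)
  note neg = this
  show ?thesis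
    by (rule skewI) (unfold first_kind_op_def vec_lambda_beta, subst neg, rule mult_minus_right)
qed

lemma first_kind_inner: "first_kind_op R A \<bullet> B = A \<bullet> first_kind_op R B"
proof -
  have "2 * (first_kind_op R A \<bullet> B) = (\<Sum>i\<in>UNIV. \<Sum>j\<in>UNIV. \<Sum>k\<in>UNIV. \<Sum>l\<in>UNIV. R i j k l * A $ k $ l * B $ i $ j)"
    by (simp add: inner_matrix first_kind_op_def sum_distrib_left sum_distrib_right)
  also have "\<dots> = (\<Sum>k\<in>UNIV. \<Sum>l\<in>UNIV. \<Sum>i\<in>UNIV. \<Sum>j\<in>UNIV. R i j k l * A $ k $ l * B $ i $ j)" by (rule sum_swap4)
  also have "\<dots> = (\<Sum>k\<in>UNIV. \<Sum>l\<in>UNIV. \<Sum>i\<in>UNIV. \<Sum>j\<in>UNIV. R k l i j * A $ k $ l * B $ i $ j)"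
    by (intro sum.cong refl) (subst pair, rule refl)
  also have "\<dots> = 2 * (A \<bullet> first_kind_op R B)"
    by (simp add: inner_matrix first_kind_op_def sum_distrib_left sum_distrib_right ac_simps)
  finally show ?thesis by simp
qed

text \<open>The curvature operator is diagonalised on skew matrices; the further assumptions of
  \<open>curv_spectral\<close> are then contractions of the tensor identities of the locale.\<close>

lemma spectral_data:
  "\<exists>\<omega> c D. curv_spectral \<omega> c D \<rho> \<and>
    (\<forall>i j k l. R i j k l = 2 * (\<Sum>\<alpha><D. c \<alpha> * (\<omega> \<alpha> $ i $ j) * (\<omega> \<alpha> $ k $ l))) \<and>
    (\<forall>h. curv_spectral.P \<omega> c D h = second_kind_op R h)"
proof -
  have "\<exists>b ev. onb skew {..<dim (skew :: (real^'n^'n) set)} b \<and>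
      (\<forall>i<dim (skew :: (real^'n^'n) set). first_kind_op R (b i) = ev i *\<^sub>R b i) \<and>
      (\<forall>i j. i \<le> j \<longrightarrow> j < dim (skew :: (real^'n^'n) set) \<longrightarrow> ev i \<le> ev j)"
    by (intro spectral_theorem linear_first_kind subspace_skew first_kind_skew first_kind_inner)
  then obtain D and \<omega> :: "nat \<Rightarrow> real^'n^'n" and c where w: "onb skew {..<D} \<omega>"
    and ev: "\<And>\<alpha>. \<alpha> < D \<Longrightarrow> first_kind_op R (\<omega> \<alpha>) = c \<alpha> *\<^sub>R \<omega> \<alpha>" by blast
  note wd = onb_D[OF w]
  have wt: "transpose (\<omega> \<alpha>) = - \<omega> \<alpha>" if "\<alpha> < D" for \<alpha> using wd(2)[of \<alpha>] that by (simp add: skew_def)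
  have Req: "R i j k l = 2 * (\<Sum>\<alpha><D. c \<alpha> * (\<omega> \<alpha> $ i $ j) * (\<omega> \<alpha> $ k $ l))" for i j k l
  proof -
    define A :: "real^'n^'n" where "A = (\<chi> k l. R i j k l)"
    have "A \<in> skew" unfolding skew_def A_def transpose_def vec_eq_iff by (simp, intro allI, rule a34)
    from wd(4)[OF this] have "A $ k $ l = (\<Sum>\<alpha><D. (A \<bullet> \<omega> \<alpha>) *\<^sub>R \<omega> \<alpha>) $ k $ l" by simp
    moreover have "A \<bullet> \<omega> \<alpha> = 2 * c \<alpha> * \<omega> \<alpha> $ i $ j" if "\<alpha> < D" for \<alpha>
    proof -
      have "A \<bullet> \<omega> \<alpha> = 2 * first_kind_op R (\<omega> \<alpha>) $ i $ j" by (simp add: A_def inner_matrix first_kind_op_def)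
      thus ?thesis by (simp add: ev[OF that])
    qed
    ultimately show ?thesis by (simp add: A_def sum_distrib_left ac_simps)
  qed
  have Pop: "2 *\<^sub>R (\<Sum>\<alpha><D. c \<alpha> *\<^sub>R (\<omega> \<alpha> ** h ** \<omega> \<alpha>)) = second_kind_op R h" for h
  proof (unfold vec_eq_iff, intro allI)
    fix i j
    have "(\<omega> \<alpha> ** h ** \<omega> \<alpha>) $ i $ j = (\<Sum>k\<in>UNIV. \<Sum>l\<in>UNIV. \<omega> \<alpha> $ i $ k * h $ k $ l * \<omega> \<alpha> $ l $ j)" for \<alpha>
      unfolding matrix_matrix_mult_def by (simp add: sum_distrib_right) (rule sum.swap)
    hence "(2 *\<^sub>R (\<Sum>\<alpha><D. c \<alpha> *\<^sub>R (\<omega> \<alpha> ** h ** \<omega> \<alpha>))) $ i $ j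
      = (\<Sum>\<alpha><D. \<Sum>k\<in>UNIV. \<Sum>l\<in>UNIV. 2 * (c \<alpha> * (\<omega> \<alpha> $ i $ k) * (\<omega> \<alpha> $ l $ j)) * h $ k $ l)"
      by (simp add: sum_distrib_left ac_simps)
    also have "\<dots> = (\<Sum>k\<in>UNIV. \<Sum>l\<in>UNIV. \<Sum>\<alpha><D. 2 * (c \<alpha> * (\<omega> \<alpha> $ i $ k) * (\<omega> \<alpha> $ l $ j)) * h $ k $ l)"
      by (simp only: sum.swap[of _ "{..<D}" UNIV])
    also have "\<dots> = second_kind_op R h $ i $ j"
      by (simp add: second_kind_op_def Req sum_distrib_right sum_distrib_left)
    finally show "(2 *\<^sub>R (\<Sum>\<alpha><D. c \<alpha> *\<^sub>R (\<omega> \<alpha> ** h ** \<omega> \<alpha>))) $ i $ j = second_kind_op R h $ i $ j" .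
  qed
  have cs: "curv_spectral \<omega> c D \<rho>"
  proof
    show "onb skew {..<D} \<omega>" by (rule w)
    show "2 *\<^sub>R (\<Sum>\<alpha><D. c \<alpha> *\<^sub>R (\<omega> \<alpha> ** B ** \<omega> \<alpha>)) = - (\<Sum>\<alpha><D. (c \<alpha> * (\<omega> \<alpha> \<bullet> B)) *\<^sub>R \<omega> \<alpha>)" if B: "B \<in> skew" for B
    proof -
      have Bs: "B $ l $ k = - B $ k $ l" for k l by (rule skew_nth[OF B])
      have "second_kind_op R B = - first_kind_op R B"
      proof (unfold vec_eq_iff, intro allI)
        fix i j
        have "second_kind_op R B $ i $ j = (\<Sum>k\<in>UNIV. \<Sum>l\<in>UNIV. R i k l j * B $ k $ l)" by (simp add: second_kind_op_def)
        moreover have "second_kind_op R B $ i $ j = (\<Sum>k\<in>UNIV. \<Sum>l\<in>UNIV. - R i l k j * B $ k $ l)"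
        proof -
          have "R i l k j * B $ l $ k = - R i l k j * B $ k $ l" for k l by (subst Bs) simp
          thus ?thesis unfolding second_kind_op_def vec_lambda_beta by (subst sum.swap) (simp only:)
        qed
        \<comment> \<open>Adding the copy with \<open>k\<close> and \<open>l\<close> exchanged
          brings out the combination to which the Bianchi identity applies.\<close>
        ultimately have "2 * second_kind_op R B $ i $ j = (\<Sum>k\<in>UNIV. \<Sum>l\<in>UNIV. R i k l j * B $ k $ l)
            + (\<Sum>k\<in>UNIV. \<Sum>l\<in>UNIV. - R i l k j * B $ k $ l)" by linarith
        also have "\<dots> = (\<Sum>k\<in>UNIV. \<Sum>l\<in>UNIV. (R i k l j - R i l k j) * B $ k $ l)"
          unfolding sum.distrib[symmetric] by (intro sum.cong refl) (simp add: algebra_simps)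
        also have "\<dots> = (\<Sum>k\<in>UNIV. \<Sum>l\<in>UNIV. - (R i j k l * B $ k $ l))"
        proof (intro sum.cong refl)
          fix k l
          have "R i k l j - R i l k j = - R i j k l"
            using bianchi_R[of i k l j] a12[of i l k j] pair[of i j k l] by simp
          thus "(R i k l j - R i l k j) * B $ k $ l = - (R i j k l * B $ k $ l)" by simp
        qed
        finally show "second_kind_op R B $ i $ j = (- first_kind_op R B) $ i $ j"
          by (simp add: first_kind_op_def sum_negf)
      qed
      moreover have "first_kind_op R B = (\<Sum>\<alpha><D. (c \<alpha> * (\<omega> \<alpha> \<bullet> B)) *\<^sub>R \<omega> \<alpha>)"
      proof -
        have "first_kind_op R B = first_kind_op R (\<Sum>\<alpha><D. (B \<bullet> \<omega> \<alpha>) *\<^sub>R \<omega> \<alpha>)" using wd(4)[OF B] by simp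
        also have "\<dots> = (\<Sum>\<alpha><D. (B \<bullet> \<omega> \<alpha>) *\<^sub>R first_kind_op R (\<omega> \<alpha>))"
          by (simp only: linear_sum[OF linear_first_kind] linear_scale[OF linear_first_kind])
        also have "\<dots> = (\<Sum>\<alpha><D. (c \<alpha> * (\<omega> \<alpha> \<bullet> B)) *\<^sub>R \<omega> \<alpha>)"
          by (intro sum.cong refl) (simp add: ev inner_commute mult.commute)
        finally show ?thesis .
      qed
      ultimately show ?thesis by (simp add: Pop)
    qed
    show "(\<Sum>\<alpha><D. c \<alpha> *\<^sub>R (\<omega> \<alpha> ** \<omega> \<alpha>)) = (- \<rho> / 2) *\<^sub>R mat 1"
    proof -
      have "second_kind_op R (mat 1) = - \<rho> *\<^sub>R mat 1"
      proof (unfold vec_eq_iff, intro allI)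
        fix i j
        have "second_kind_op R (mat 1) $ i $ j = (\<Sum>k\<in>UNIV. \<Sum>l\<in>UNIV. if l = k then R i k l j else 0)"
          unfolding second_kind_op_def vec_lambda_beta by (intro sum.cong refl) (auto simp: mat_def)
        also have "\<dots> = - (\<Sum>k\<in>UNIV. R i k j k)"
          by (simp add: sum_negf[symmetric]) (intro sum.cong refl, rule a34)
        finally show "second_kind_op R (mat 1) $ i $ j = (- \<rho> *\<^sub>R mat 1) $ i $ j"
          by (simp add: einstein_R mat_def)
      qed
      with Pop[of "mat 1"] have "2 *\<^sub>R (\<Sum>\<alpha><D. c \<alpha> *\<^sub>R (\<omega> \<alpha> ** \<omega> \<alpha>)) = - \<rho> *\<^sub>R mat 1" by simp
      hence "(1/2) *\<^sub>R (2 *\<^sub>R (\<Sum>\<alpha><D. c \<alpha> *\<^sub>R (\<omega> \<alpha> ** \<omega> \<alpha>))) = (1/2) *\<^sub>R (- \<rho> *\<^sub>R mat 1)" by (rule arg_cong)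
      thus ?thesis by simp
    qed
    show "commut (\<omega> \<gamma>) (\<omega> \<alpha>) \<bullet> \<omega> \<beta> = 0"
      if l: "\<gamma> < D" "\<alpha> < D" "\<beta> < D" and "c \<gamma> \<noteq> 0" "c \<alpha> \<noteq> c \<beta>" for \<gamma> \<alpha> \<beta>
    proof -
      let ?w = "\<lambda>i p. \<omega> \<gamma> $ i $ p"
      \<comment> \<open>Contracting \<open>parallel_R\<close> with \<open>\<omega> \<gamma>\<close>
        in its first two indices gives \<open>2 * c \<gamma>\<close> times the derivation action of
        \<open>\<omega> \<gamma>\<close> on R; the factor is nonzero and cancels.\<close>
      have act: "(\<Sum>p\<in>UNIV. ?w i p * R p j k l + ?w j p * R i p k l + ?w k p * R i j p l + ?w l p * R i j k p) = 0" for i j k l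
      proof -
        have wR: "2 * c \<gamma> * ?w i p = (\<Sum>a\<in>UNIV. \<Sum>b\<in>UNIV. ?w a b * R a b i p)" for i p
        proof -
          have "2 * c \<gamma> * ?w i p = 2 * first_kind_op R (\<omega> \<gamma>) $ i $ p" by (simp add: ev[OF l(1)])
          also have "\<dots> = (\<Sum>a\<in>UNIV. \<Sum>b\<in>UNIV. R i p a b * ?w a b)" by (simp add: first_kind_op_def)
          also have "\<dots> = (\<Sum>a\<in>UNIV. \<Sum>b\<in>UNIV. ?w a b * R a b i p)"
            by (intro sum.cong refl) (subst pair, rule mult.commute)
          finally show ?thesis .
        qed
        have "0 = (\<Sum>a\<in>UNIV. \<Sum>b\<in>UNIV. ?w a b * (\<Sum>p\<in>UNIV. R a b i p * R p j k l + R a b j p * R i p k l + R a b k p * R i j p l + R a b l p * R i j k p))"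
          by (simp add: parallel_R)
        also have "\<dots> = (\<Sum>p\<in>UNIV. \<Sum>a\<in>UNIV. \<Sum>b\<in>UNIV. ?w a b * (R a b i p * R p j k l + R a b j p * R i p k l + R a b k p * R i j p l + R a b l p * R i j k p))"
          unfolding sum_distrib_left
          by (rule trans[OF sum.cong[OF refl sum.swap] sum.swap])
        also have "\<dots> = (\<Sum>p\<in>UNIV. (2 * c \<gamma> * ?w i p) * R p j k l + (2 * c \<gamma> * ?w j p) * R i p k l + (2 * c \<gamma> * ?w k p) * R i j p l + (2 * c \<gamma> * ?w l p) * R i j k p)"
          unfolding wR sum_distrib_right sum.distrib[symmetric]
          by (intro sum.cong refl) (simp add: algebra_simps)
        also have "\<dots> = (2 * c \<gamma>) * (\<Sum>p\<in>UNIV. ?w i p * R p j k l + ?w j p * R i p k l + ?w k p * R i j p l + ?w l p * R i j k p)"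
          unfolding sum_distrib_left by (intro sum.cong refl) (simp add: algebra_simps)
        finally show ?thesis using \<open>c \<gamma> \<noteq> 0\<close> by simp
      qed
      have cm: "commut (\<omega> \<gamma>) X $ i $ j = (\<Sum>p\<in>UNIV. ?w i p * X $ p $ j + ?w j p * X $ i $ p)" for X i j
      proof -
        have "\<omega> \<gamma> \<in> skew" using wd(2)[of \<gamma>] l(1) by simp
        hence "?w p j = - ?w j p" for p by (rule skew_nth)
        thus ?thesis by (simp add: commut_def matrix_matrix_mult_def sum.distrib sum_negf mult.commute)
      qed
      have act2: "(\<Sum>\<delta><D. c \<delta> * (commut (\<omega> \<gamma>) (\<omega> \<delta>) $ i $ j * \<omega> \<delta> $ k $ l + \<omega> \<delta> $ i $ j * commut (\<omega> \<gamma>) (\<omega> \<delta>) $ k $ l)) = 0" for i j k l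
      proof -
        have "0 = (\<Sum>p\<in>UNIV. ?w i p * R p j k l + ?w j p * R i p k l + ?w k p * R i j p l + ?w l p * R i j k p)"
          using act[of i j k l] by (rule sym)
        also have "\<dots> = (\<Sum>p\<in>UNIV. \<Sum>\<delta><D. 2 * c \<delta> * ((?w i p * \<omega> \<delta> $ p $ j + ?w j p * \<omega> \<delta> $ i $ p) * \<omega> \<delta> $ k $ l
              + \<omega> \<delta> $ i $ j * (?w k p * \<omega> \<delta> $ p $ l + ?w l p * \<omega> \<delta> $ k $ p)))"
          unfolding Req sum_distrib_left sum.distrib[symmetric]
          by (intro sum.cong refl) (simp add: algebra_simps)
        also have "\<dots> = (\<Sum>\<delta><D. \<Sum>p\<in>UNIV. 2 * c \<delta> * ((?w i p * \<omega> \<delta> $ p $ j + ?w j p * \<omega> \<delta> $ i $ p) * \<omega> \<delta> $ k $ l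
              + \<omega> \<delta> $ i $ j * (?w k p * \<omega> \<delta> $ p $ l + ?w l p * \<omega> \<delta> $ k $ p)))" by (rule sum.swap)
        also have "\<dots> = 2 * (\<Sum>\<delta><D. c \<delta> * (commut (\<omega> \<gamma>) (\<omega> \<delta>) $ i $ j * \<omega> \<delta> $ k $ l + \<omega> \<delta> $ i $ j * commut (\<omega> \<gamma>) (\<omega> \<delta>) $ k $ l))"
          unfolding cm sum_distrib_left sum_distrib_right sum.distrib[symmetric]
          by (intro sum.cong refl) (simp add: algebra_simps)
        finally show ?thesis by simp
      qed
      \<comment> \<open>Contraction with \<open>\<omega> \<beta>\<close> and
        \<open>\<omega> \<alpha>\<close> isolates one structure constant, multiplied by c \<alpha> -
        c \<beta>.\<close>
      have con: "(\<Sum>i\<in>UNIV. \<Sum>j\<in>UNIV. \<Sum>k\<in>UNIV. \<Sum>l\<in>UNIV. (X $ i $ j * Y $ k $ l) * (\<omega> \<beta> $ i $ j * \<omega> \<alpha> $ k $ l)) = (X \<bullet> \<omega> \<beta>) * (Y \<bullet> \<omega> \<alpha>)" for X Y :: "real^'n^'n"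
      proof -
        have "(\<Sum>k\<in>UNIV. \<Sum>l\<in>UNIV. (X $ i $ j * Y $ k $ l) * (\<omega> \<beta> $ i $ j * \<omega> \<alpha> $ k $ l))
            = (X $ i $ j * \<omega> \<beta> $ i $ j) * (Y \<bullet> \<omega> \<alpha>)" for i j
          by (simp add: inner_matrix sum_distrib_left ac_simps)
        thus ?thesis by (simp only: sum_distrib_right[symmetric] inner_matrix[of X])
      qed
      have "0 = (\<Sum>i\<in>UNIV. \<Sum>j\<in>UNIV. \<Sum>k\<in>UNIV. \<Sum>l\<in>UNIV. (\<Sum>\<delta><D. c \<delta> * (commut (\<omega> \<gamma>) (\<omega> \<delta>) $ i $ j * \<omega> \<delta> $ k $ l + \<omega> \<delta> $ i $ j * commut (\<omega> \<gamma>) (\<omega> \<delta>) $ k $ l)) * (\<omega> \<beta> $ i $ j * \<omega> \<alpha> $ k $ l))"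
        by (simp add: act2)
      also have "\<dots> = (\<Sum>i\<in>UNIV. \<Sum>j\<in>UNIV. \<Sum>k\<in>UNIV. \<Sum>l\<in>UNIV. \<Sum>\<delta><D. c \<delta> * ((commut (\<omega> \<gamma>) (\<omega> \<delta>) $ i $ j * \<omega> \<delta> $ k $ l) * (\<omega> \<beta> $ i $ j * \<omega> \<alpha> $ k $ l)) + c \<delta> * ((\<omega> \<delta> $ i $ j * commut (\<omega> \<gamma>) (\<omega> \<delta>) $ k $ l) * (\<omega> \<beta> $ i $ j * \<omega> \<alpha> $ k $ l)))"
        unfolding sum_distrib_right by (intro sum.cong refl) (simp add: algebra_simps)
      also have "\<dots> = (\<Sum>\<delta><D. \<Sum>i\<in>UNIV. \<Sum>j\<in>UNIV. \<Sum>k\<in>UNIV. \<Sum>l\<in>UNIV. c \<delta> * ((commut (\<omega> \<gamma>) (\<omega> \<delta>) $ i $ j * \<omega> \<delta> $ k $ l) * (\<omega> \<beta> $ i $ j * \<omega> \<alpha> $ k $ l)) + c \<delta> * ((\<omega> \<delta> $ i $ j * commut (\<omega> \<gamma>) (\<omega> \<delta>) $ k $ l) * (\<omega> \<beta> $ i $ j * \<omega> \<alpha> $ k $ l)))"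
        by (simp only: sum.swap[of _ "{..<D}" UNIV])
      also have "\<dots> = (\<Sum>\<delta><D. c \<delta> * ((commut (\<omega> \<gamma>) (\<omega> \<delta>) \<bullet> \<omega> \<beta>) * (\<omega> \<delta> \<bullet> \<omega> \<alpha>)) + c \<delta> * ((\<omega> \<delta> \<bullet> \<omega> \<beta>) * (commut (\<omega> \<gamma>) (\<omega> \<delta>) \<bullet> \<omega> \<alpha>)))"
        unfolding sum.distrib sum_distrib_left[symmetric] con ..
      also have "\<dots> = (\<Sum>\<delta><D. if \<delta> = \<alpha> then c \<delta> * (commut (\<omega> \<gamma>) (\<omega> \<delta>) \<bullet> \<omega> \<beta>) else 0)
          + (\<Sum>\<delta><D. if \<delta> = \<beta> then c \<delta> * (commut (\<omega> \<gamma>) (\<omega> \<delta>) \<bullet> \<omega> \<alpha>) else 0)"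
        unfolding sum.distrib using l by (intro arg_cong2[where f = "(+)"] sum.cong refl) (simp_all add: wd(3))
      also have "\<dots> = c \<alpha> * (commut (\<omega> \<gamma>) (\<omega> \<alpha>) \<bullet> \<omega> \<beta>) + c \<beta> * (commut (\<omega> \<gamma>) (\<omega> \<beta>) \<bullet> \<omega> \<alpha>)"
        using l by simp
      also have "commut (\<omega> \<gamma>) (\<omega> \<beta>) \<bullet> \<omega> \<alpha> = - (commut (\<omega> \<gamma>) (\<omega> \<alpha>) \<bullet> \<omega> \<beta>)"
        using commut_inner[OF wd(2)[of \<gamma>], of "\<omega> \<beta>" "\<omega> \<alpha>"] l by (simp add: inner_commute)
      finally have "c \<alpha> * (commut (\<omega> \<gamma>) (\<omega> \<alpha>) \<bullet> \<omega> \<beta>) = c \<beta> * (commut (\<omega> \<gamma>) (\<omega> \<alpha>) \<bullet> \<omega> \<beta>)" by linarith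
      thus ?thesis using \<open>c \<alpha> \<noteq> c \<beta>\<close> by simp
    qed
  qed
  show ?thesis
    by (intro exI conjI allI, rule cs, rule Req) (simp add: curv_spectral.P_def[OF cs] Pop)
qed

text \<open>\<open>T\<close> stands for the projected operator, which agrees with
  \<open>second_kind_op R\<close> wherever the latter has a trace-free symmetric value; by the
  Einstein condition that is on all of \<open>tracefree_sym\<close>.\<close>

lemma pointwise_rigidity:
  assumes dim3: "3 \<le> CARD('n)" and N: "1 \<le> N" "N < 3 * real CARD('n) / 2 * ((real CARD('n) + 2) / (real CARD('n) + 4))"
    and T: "\<And>h. h \<in> tracefree_sym \<Longrightarrow> second_kind_op R h \<in> tracefree_sym \<Longrightarrow> T h = second_kind_op R h"
    and low: "0 \<le> lowest_eigenvalue_sum N (eigenvalue_list tracefree_sym T)"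
  shows "R i j k l = \<rho> / (real CARD('n) - 1) * ((if i = k \<and> j = l then 1 else 0) - (if i = l \<and> j = k then 1 else 0))"
proof -
  from spectral_data obtain \<omega> c D where cs: "curv_spectral \<omega> c D \<rho>"
    and Req: "\<forall>i j k l. R i j k l = 2 * (\<Sum>\<alpha><D. c \<alpha> * (\<omega> \<alpha> $ i $ j) * (\<omega> \<alpha> $ k $ l))"
    and Pop: "\<forall>h. curv_spectral.P \<omega> c D h = second_kind_op R h" by (elim exE conjE)
  interpret A: curv_spectral \<omega> c D \<rho> by (rule cs)
  let ?d = "dim (tracefree_sym :: (real^'n^'n) set)"
  have "\<exists>b ev. onb tracefree_sym {..<?d} b \<and> (\<forall>i<?d. A.P (b i) = ev i *\<^sub>R b i) \<and>
      (\<forall>i j. i \<le> j \<longrightarrow> j < ?d \<longrightarrow> ev i \<le> ev j)"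
    by (intro spectral_theorem A.linear_P subspace_tracefree_sym A.P_tracefree_sym A.P_selfadjoint)
  then obtain S ev where Sev: "onb tracefree_sym {..<?d} S" "\<forall>i<?d. A.P (S i) = ev i *\<^sub>R S i"
      "\<forall>i j. i \<le> j \<longrightarrow> j < ?d \<longrightarrow> ev i \<le> ev j" by (elim exE conjE)
  define d where "d = ?d"
  have S: "onb tracefree_sym {..<d} S" "\<And>a. a < d \<Longrightarrow> A.P (S a) = ev a *\<^sub>R S a"
    and srt: "\<And>i j. i \<le> j \<Longrightarrow> j < d \<Longrightarrow> ev i \<le> ev j"
    unfolding d_def using Sev by blast+
  interpret B: curv_eigenbasis \<omega> c D \<rho> S ev d 
    by (intro curv_eigenbasis.intro curv_eigenbasis_axioms.intro cs S)
  have "eigenvalue_list tracefree_sym T = map ev [0..<d]"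
  proof (rule eigenvalue_list_eq[OF subspace_tracefree_sym A.linear_P _ S(1)])
    fix h :: "real^'n^'n" assume h: "h \<in> tracefree_sym"
    have "second_kind_op R h \<in> tracefree_sym" using A.P_tracefree_sym[OF h] Pop by simp
    thus "T h = A.P h" using T[OF h] Pop by simp
  qed (use S(2) srt in auto)
  hence "0 \<le> (\<Sum>i<nat \<lfloor>N\<rfloor>. ev i) + (N - of_int \<lfloor>N\<rfloor>) * ev (nat \<lfloor>N\<rfloor>)"
    using low B.floor_less_d(2)[OF dim3 N] by (simp add: lowest_eigenvalue_sum_def)
  then interpret C: curv_N_nonneg \<omega> c D \<rho> S ev d N
    by (intro curv_N_nonneg.intro curv_N_nonneg_axioms.intro B.curv_eigenbasis_axioms srt dim3 N)
  \<comment> \<open>Expanding this elementary skew matrix in \<omega> is the completeness relation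
    of the basis; with all \<open>c \<alpha>\<close> equal it becomes the tensor of constant
    curvature.\<close>
  define A :: "real^'n^'n" where "A = (1/2) *\<^sub>R (mat_unit i j - mat_unit j i)"
  have Ask: "A \<in> skew"
    by (simp add: A_def skew_def transpose_simps transpose_mat_unit scaleR_diff_right)
  have "A \<bullet> \<omega> \<alpha> = \<omega> \<alpha> $ i $ j" if "\<alpha> < D" for \<alpha>
  proof -
    have e: "\<omega> \<alpha> $ j $ i = - \<omega> \<alpha> $ i $ j" by (rule skew_nth[OF A.w_skew(1)[OF that]])
    have u: "mat_unit a b \<bullet> \<omega> \<alpha> = \<omega> \<alpha> $ a $ b" for a b
      by (subst inner_commute) (rule inner_mat_unit)
    have "A \<bullet> \<omega> \<alpha> = (1/2) * (\<omega> \<alpha> $ i $ j - \<omega> \<alpha> $ j $ i)"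
      unfolding A_def by (simp add: inner_diff_left u)
    thus ?thesis unfolding e by simp
  qed
  hence "A = (\<Sum>\<alpha><D. (\<omega> \<alpha> $ i $ j) *\<^sub>R \<omega> \<alpha>)" using A.w_expand[OF Ask] by simp
  hence "(\<Sum>\<alpha><D. (\<omega> \<alpha> $ i $ j) * (\<omega> \<alpha> $ k $ l)) = A $ k $ l" by simp
  moreover have "R i j k l = 2 * (\<rho> / (real CARD('n) - 1)) * (\<Sum>\<alpha><D. (\<omega> \<alpha> $ i $ j) * (\<omega> \<alpha> $ k $ l))"
    by (subst Req[rule_format]) (simp add: sum_distrib_left C.all_c_equal ac_simps cong: sum.cong_simp)
  moreover have "A $ k $ l = 1/2 * ((if i = k \<and> j = l then 1 else 0) - (if i = l \<and> j = k then 1 else 0))"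
  proof -
    have "(k = i \<and> l = j) = (i = k \<and> j = l)" "(k = j \<and> l = i) = (i = l \<and> j = k)" by auto
    thus ?thesis unfolding A_def by (simp only: vector_scaleR_component vector_minus_component mat_unit_nth real_scaleR_def)
  qed
  ultimately show ?thesis by simp
qed

end

section \<open>Smooth functions\<close>

lemma partial_deriv_eqI:
  assumes "(f has_derivative D) (at x)"
  shows "partial_deriv i f x = D (axis i 1)"
  unfolding partial_deriv_def frechet_derivative_at[OF assms, symmetric] ..

text \<open>Openness of \<open>S\<close> lets derivatives that are taken in the full space depend on
  the values on \<open>S\<close> alone.\<close>

lemma Ck_on_cong:
  assumes "open S"
  shows "(\<And>x. x \<in> S \<Longrightarrow> f x = g x) \<Longrightarrow> Ck_on k S f \<longleftrightarrow> Ck_on k S g"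
proof (induction k arbitrary: f g)
  case 0
  thus ?case by (simp cong: continuous_on_cong)
next
  case (Suc k)
  have d: "f differentiable (at x) \<longleftrightarrow> g differentiable (at x)" "partial_deriv i f x = partial_deriv i g x" if x: "x \<in> S" for x i
  proof -
    have *: "(f has_derivative D) (at x) \<longleftrightarrow> (g has_derivative D) (at x)" for D
    proof
      assume "(f has_derivative D) (at x)"
      thus "(g has_derivative D) (at x)"
        by (rule has_derivative_transform_within_open[OF _ assms x]) (rule Suc.prems)
    next
      assume "(g has_derivative D) (at x)"
      thus "(f has_derivative D) (at x)"
        by (rule has_derivative_transform_within_open[OF _ assms x]) (rule Suc.prems[symmetric])
    qed
    show "f differentiable (at x) \<longleftrightarrow> g differentiable (at x)" unfolding differentiable_def by (simp only: *)
    show "partial_deriv i f x = partial_deriv i g x" 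
      unfolding partial_deriv_def frechet_derivative_def by (simp only: *)
  qed
  have "Ck_on k S (partial_deriv i f) \<longleftrightarrow> Ck_on k S (partial_deriv i g)" for i
    by (rule Suc.IH) (rule d(2))
  moreover have "(\<forall>x\<in>S. f differentiable (at x)) \<longleftrightarrow> (\<forall>x\<in>S. g differentiable (at x))"
    by (rule ball_cong[OF refl d(1)])
  ultimately show ?case unfolding Ck_on.simps by (simp only:)
qed

lemma smooth_on_cong:
  assumes "open S" "\<And>x. x \<in> S \<Longrightarrow> f x = g x"
  shows "smooth_on S f \<longleftrightarrow> smooth_on S g"
proof -
  have "Ck_on k S f \<longleftrightarrow> Ck_on k S g" for k by (rule Ck_on_cong[OF assms])
  thus ?thesis unfolding smooth_on_def by (simp only:)
qed

lemma Ck_on_Suc_imp: "Ck_on (Suc k) S f \<Longrightarrow> Ck_on k S f"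
proof (induction k arbitrary: f)
  case 0
  thus ?case by (auto intro!: continuous_at_imp_continuous_on differentiable_imp_continuous_within)
next
  case (Suc k)
  thus ?case by (metis Ck_on.simps(2))
qed

lemma smooth_on_differentiable: "smooth_on S f \<Longrightarrow> x \<in> S \<Longrightarrow> f differentiable (at x)"
  unfolding smooth_on_def by (metis Ck_on.simps(2))

lemma smooth_on_partial_deriv: "smooth_on S f \<Longrightarrow> smooth_on S (partial_deriv i f)"
  unfolding smooth_on_def by (metis Ck_on.simps(2))

lemma smooth_on_continuous: "smooth_on S f \<Longrightarrow> continuous_on S f"
  unfolding smooth_on_def by (metis Ck_on.simps(1))

lemma Ck_on_bounded_linear:
  assumes "open S" "bounded_linear L"
  shows "Ck_on k S f \<Longrightarrow> Ck_on k S (\<lambda>x. L (f x))"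
proof (induction k arbitrary: f)
  case 0
  thus ?case using assms(2) by (auto intro: bounded_linear.continuous_on)
next
  case (Suc k)
  have hd: "((\<lambda>x. L (f x)) has_derivative (\<lambda>u. L (frechet_derivative f (at x) u))) (at x)" if "x \<in> S" for x
    using Suc.prems that by (auto intro!: bounded_linear.has_derivative[OF assms(2)] simp: frechet_derivative_works[symmetric])
  have "partial_deriv i (\<lambda>x. L (f x)) x = L (partial_deriv i f x)" if "x \<in> S" for x i
    unfolding partial_deriv_eqI[OF hd[OF that]] by (simp only: partial_deriv_def)
  hence "Ck_on k S (partial_deriv i (\<lambda>x. L (f x))) \<longleftrightarrow> Ck_on k S (\<lambda>x. L (partial_deriv i f x))" for i
    by (intro Ck_on_cong assms(1))
  thus ?case using hd Suc by (auto simp: differentiable_def)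
qed

lemma smooth_on_bounded_linear:
  "open S \<Longrightarrow> bounded_linear L \<Longrightarrow> smooth_on S f \<Longrightarrow> smooth_on S (\<lambda>x. L (f x))"
  by (auto simp: smooth_on_def Ck_on_bounded_linear)

lemma smooth_on_nth: "open S \<Longrightarrow> smooth_on S f \<Longrightarrow> smooth_on S (\<lambda>x. f x $ i)"
  by (rule smooth_on_bounded_linear[OF _ bounded_linear_vec_nth])

lemma Ck_on_const: "Ck_on k (S :: (real^'n) set) (\<lambda>x. c)"
proof (induction k arbitrary: c)
  case (Suc k)
  have "partial_deriv i (\<lambda>x :: real^'n. c) = (\<lambda>x. 0)" for i
    by (rule ext) (simp add: partial_deriv_def frechet_derivative_const)
  thus ?case using Suc by simp
qed simp

lemma smooth_on_const: "smooth_on S (\<lambda>x. c)"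
  by (simp add: smooth_on_def Ck_on_const)

lemma Ck_on_add:
  assumes "open S"
  shows "Ck_on k S f \<Longrightarrow> Ck_on k S g \<Longrightarrow> Ck_on k S (\<lambda>x. f x + g x)"
proof (induction k arbitrary: f g)
  case 0
  thus ?case by (auto intro: continuous_on_add)
next
  case (Suc k)
  have hd: "((\<lambda>x. f x + g x) has_derivative (\<lambda>u. frechet_derivative f (at x) u + frechet_derivative g (at x) u)) (at x)" if "x \<in> S" for x
    using Suc.prems that by (auto intro!: has_derivative_add simp: frechet_derivative_works[symmetric])
  have "partial_deriv i (\<lambda>x. f x + g x) x = partial_deriv i f x + partial_deriv i g x" if "x \<in> S" for x i
    unfolding partial_deriv_eqI[OF hd[OF that]] by (simp only: partial_deriv_def)
  hence "Ck_on k S (partial_deriv i (\<lambda>x. f x + g x)) \<longleftrightarrow> Ck_on k S (\<lambda>x. partial_deriv i f x + partial_deriv i g x)" for i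
    by (intro Ck_on_cong assms(1))
  thus ?case using hd Suc by (auto simp: differentiable_def)
qed

lemma Ck_on_mult:
  fixes f g :: "real^'n \<Rightarrow> real"
  assumes "open S"
  shows "Ck_on k S f \<Longrightarrow> Ck_on k S g \<Longrightarrow> Ck_on k S (\<lambda>x. f x * g x)"
proof (induction k arbitrary: f g)
  case 0
  thus ?case by (auto intro: continuous_on_mult)
next
  case (Suc k)
  have hd: "((\<lambda>x. f x * g x) has_derivative (\<lambda>u. f x * frechet_derivative g (at x) u + frechet_derivative f (at x) u * g x)) (at x)" if "x \<in> S" for x
    using Suc.prems that by (auto intro!: has_derivative_mult simp: frechet_derivative_works[symmetric])
  have "partial_deriv i (\<lambda>x. f x * g x) x = f x * partial_deriv i g x + partial_deriv i f x * g x" if "x \<in> S" for x i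
    unfolding partial_deriv_eqI[OF hd[OF that]] by (simp only: partial_deriv_def)
  hence "Ck_on k S (partial_deriv i (\<lambda>x. f x * g x)) \<longleftrightarrow> Ck_on k S (\<lambda>x. f x * partial_deriv i g x + partial_deriv i f x * g x)" for i
    by (intro Ck_on_cong assms(1))
  moreover have "Ck_on k S (\<lambda>x. f x * partial_deriv i g x + partial_deriv i f x * g x)" for i
    using Suc.prems Ck_on_Suc_imp[OF Suc.prems(1)] Ck_on_Suc_imp[OF Suc.prems(2)]
    by (intro Ck_on_add[OF assms(1)] Suc.IH) auto
  ultimately show ?case using hd by (auto simp: differentiable_def)
qed

lemma Ck_on_inverse:
  fixes f :: "real^'n \<Rightarrow> real"
  assumes "open S" "\<And>x. x \<in> S \<Longrightarrow> f x \<noteq> 0"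
  shows "Ck_on k S f \<Longrightarrow> Ck_on k S (\<lambda>x. inverse (f x))"
proof (induction k)
  case 0
  thus ?case using assms(2) by (auto intro: continuous_on_inverse)
next
  case (Suc k)
  have hd: "((\<lambda>x. inverse (f x)) has_derivative (\<lambda>u. - (inverse (f x) * frechet_derivative f (at x) u * inverse (f x)))) (at x)" if "x \<in> S" for x
    using Suc.prems that assms(2) by (auto intro!: has_derivative_inverse simp: frechet_derivative_works[symmetric])
  have "partial_deriv i (\<lambda>x. inverse (f x)) x = - 1 * (inverse (f x) * partial_deriv i f x * inverse (f x))" if "x \<in> S" for x i
    unfolding partial_deriv_eqI[OF hd[OF that]] by (simp only: partial_deriv_def mult_minus1)
  hence "Ck_on k S (partial_deriv i (\<lambda>x. inverse (f x))) \<longleftrightarrow> Ck_on k S (\<lambda>x. - 1 * (inverse (f x) * partial_deriv i f x * inverse (f x)))" for i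
    by (intro Ck_on_cong assms(1))
  moreover have "Ck_on k S (\<lambda>x. - 1 * (inverse (f x) * partial_deriv i f x * inverse (f x)))" for i
    using Suc.prems Suc.IH[OF Ck_on_Suc_imp[OF Suc.prems]]
    by (intro Ck_on_mult[OF assms(1)] Ck_on_const) auto
  ultimately show ?case using hd by (auto simp: differentiable_def)
qed

lemma smooth_on_add: "open S \<Longrightarrow> smooth_on S f \<Longrightarrow> smooth_on S g \<Longrightarrow> smooth_on S (\<lambda>x. f x + g x)"
  by (auto simp: smooth_on_def Ck_on_add)

lemma smooth_on_mult:
  fixes f g :: "real^'n \<Rightarrow> real"
  shows "open S \<Longrightarrow> smooth_on S f \<Longrightarrow> smooth_on S g \<Longrightarrow> smooth_on S (\<lambda>x. f x * g x)"
  by (auto simp: smooth_on_def Ck_on_mult)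

lemma smooth_on_divide:
  fixes f g :: "real^'n \<Rightarrow> real"
  shows "open S \<Longrightarrow> smooth_on S f \<Longrightarrow> smooth_on S g \<Longrightarrow> (\<And>x. x \<in> S \<Longrightarrow> g x \<noteq> 0) \<Longrightarrow> smooth_on S (\<lambda>x. f x / g x)"
  by (auto simp: smooth_on_def divide_inverse intro!: Ck_on_mult Ck_on_inverse)

lemma smooth_on_diff:
  fixes f g :: "real^'n \<Rightarrow> real"
  shows "open S \<Longrightarrow> smooth_on S f \<Longrightarrow> smooth_on S g \<Longrightarrow> smooth_on S (\<lambda>x. f x - g x)"
  using smooth_on_add[of S f "\<lambda>x. - 1 * g x"] smooth_on_mult[OF _ smooth_on_const, of S g "- 1"] by simp

lemma smooth_on_sum:
  "open S \<Longrightarrow> (\<And>i. i \<in> I \<Longrightarrow> smooth_on S (f i)) \<Longrightarrow> smooth_on S (\<lambda>x. \<Sum>i\<in>I. f i x)"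
  by (induction I rule: infinite_finite_induct) (auto intro: smooth_on_add smooth_on_const)

lemma smooth_on_prod:
  fixes f :: "'i \<Rightarrow> real^'n \<Rightarrow> real"
  shows "open S \<Longrightarrow> (\<And>i. i \<in> I \<Longrightarrow> smooth_on S (f i)) \<Longrightarrow> smooth_on S (\<lambda>x. \<Prod>i\<in>I. f i x)"
  by (induction I rule: infinite_finite_induct) (auto intro: smooth_on_mult smooth_on_const)

lemma smooth_on_det:
  fixes A :: "real^'m \<Rightarrow> real^'n^'n"
  assumes "open S" "\<And>i j. smooth_on S (\<lambda>x. A x $ i $ j)"
  shows "smooth_on S (\<lambda>x. det (A x))"
  unfolding det_def by (intro smooth_on_sum smooth_on_mult smooth_on_prod smooth_on_const assms)

lemma matrix_mul_inv_right:
  fixes A :: "real^'n^'n"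
  assumes "invertible A"
  shows "A ** matrix_inv A = mat 1"
  using assms unfolding invertible_def matrix_inv_def by (rule someI2_ex) (rule conjunct1)

text \<open>Cramer's rule: entries of the inverse are quotients of determinants, hence
  smooth.\<close>

lemma matrix_inv_nth:
  fixes A :: "real^'n^'n"
  assumes "invertible A"
  shows "matrix_inv A $ k $ l = det (\<chi> i j. if j = k then axis l 1 $ i else A $ i $ j) / det A"
proof -
  have d: "det A \<noteq> 0" using assms by (simp add: invertible_det_nz)
  have "A *v (matrix_inv A *v axis l 1) = axis l 1"
    using assms by (simp add: matrix_vector_mul_assoc matrix_mul_inv_right)
  hence "matrix_inv A *v axis l 1 = (\<chi> k. det (\<chi> i j. if j = k then axis l 1 $ i else A $ i $ j) / det A)"
    using cramer[OF d] by blast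
  moreover have "(matrix_inv A *v axis l 1) $ k = matrix_inv A $ k $ l"
    by (simp add: matrix_vector_mult_basis column_def)
  ultimately show ?thesis by simp
qed

lemma smooth_on_matrix_inv:
  fixes A :: "real^'m \<Rightarrow> real^'n^'n"
  assumes S: "open S" "\<And>i j. smooth_on S (\<lambda>x. A x $ i $ j)" and inv: "\<And>x. x \<in> S \<Longrightarrow> invertible (A x)"
  shows "smooth_on S (\<lambda>x. matrix_inv (A x) $ k $ l)"
proof -
  have "smooth_on S (\<lambda>x. det (\<chi> i j. if j = k then axis l 1 $ i else A x $ i $ j))"
  proof (rule smooth_on_det[OF S(1)])
    fix i j
    show "smooth_on S (\<lambda>x. (\<chi> i j. if j = k then axis l 1 $ i else A x $ i $ j) $ i $ j)"
      by (cases "j = k") (simp_all add: smooth_on_const S(2))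
  qed
  hence "smooth_on S (\<lambda>x. det (\<chi> i j. if j = k then axis l 1 $ i else A x $ i $ j) / det (A x))"
    by (rule smooth_on_divide[OF S(1) _ smooth_on_det[OF S]]) (use inv in \<open>auto simp: invertible_det_nz\<close>)
  moreover have "smooth_on S (\<lambda>x. matrix_inv (A x) $ k $ l) \<longleftrightarrow>
      smooth_on S (\<lambda>x. det (\<chi> i j. if j = k then axis l 1 $ i else A x $ i $ j) / det (A x))"
    by (rule smooth_on_cong[OF S(1)]) (rule matrix_inv_nth[OF inv])
  ultimately show ?thesis by (simp only:)
qed

section \<open>Symmetry of second derivatives\<close>

lemma frechet_derivative_partial:
  assumes "f differentiable (at x)"
  shows "frechet_derivative f (at x) u = (\<Sum>i\<in>UNIV. u $ i *\<^sub>R partial_deriv i f x)"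
proof -
  have l: "linear (frechet_derivative f (at x))" using assms by (rule linear_frechet_derivative)
  have "u = (\<Sum>i\<in>UNIV. u $ i *\<^sub>R axis i 1)" using basis_expansion[of u] by (simp add: scalar_mult_eq_scaleR)
  hence "frechet_derivative f (at x) u = frechet_derivative f (at x) (\<Sum>i\<in>UNIV. u $ i *\<^sub>R axis i 1)" by simp
  thus ?thesis by (simp add: linear_sum[OF l] linear_scale[OF l] partial_deriv_def)
qed

text \<open>The mean value theorem in direction \<open>i\<close>, then in direction
  \<open>j\<close>.\<close>

lemma second_difference:
  fixes f :: "real^'n \<Rightarrow> real"
  assumes d1: "\<And>y. y \<in> S \<Longrightarrow> f differentiable (at y)" and d2: "\<And>y. y \<in> S \<Longrightarrow> partial_deriv i f differentiable (at y)"
    and box: "\<And>s t. 0 \<le> s \<Longrightarrow> s \<le> h \<Longrightarrow> 0 \<le> t \<Longrightarrow> t \<le> h \<Longrightarrow> x + s *\<^sub>R axis i 1 + t *\<^sub>R axis j 1 \<in> S" and h: "0 < h"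
  obtains s t where "0 \<le> s" "s \<le> h" "0 \<le> t" "t \<le> h"
    "f (x + h *\<^sub>R axis i 1 + h *\<^sub>R axis j 1) - f (x + h *\<^sub>R axis i 1) - f (x + h *\<^sub>R axis j 1) + f x
      = h\<^sup>2 * partial_deriv j (partial_deriv i f) (x + s *\<^sub>R axis i 1 + t *\<^sub>R axis j 1)"
proof -
  let ?p = "\<lambda>s t. x + s *\<^sub>R axis i 1 + t *\<^sub>R axis j 1 :: real^'n"
  have di: "((\<lambda>s. f (?p s t)) has_real_derivative partial_deriv i f (?p s t)) (at s)" if "?p s t \<in> S" for s t
  proof -
    have "((\<lambda>s. ?p s t) has_derivative (\<lambda>r. r *\<^sub>R axis i 1)) (at s)" by (auto intro!: derivative_eq_intros)
    from diff_chain_at[OF this d1[OF that, unfolded frechet_derivative_works]]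
    show ?thesis using linear_scale[OF linear_frechet_derivative[OF d1[OF that]]]
      by (simp add: has_field_derivative_def o_def partial_deriv_def mult_commute_abs)
  qed
  have dj: "((\<lambda>t. partial_deriv i f (?p s t)) has_real_derivative partial_deriv j (partial_deriv i f) (?p s t)) (at t)" if "?p s t \<in> S" for s t
  proof -
    have "((\<lambda>t. ?p s t) has_derivative (\<lambda>r. r *\<^sub>R axis j 1)) (at t)" by (auto intro!: derivative_eq_intros)
    from diff_chain_at[OF this d2[OF that, unfolded frechet_derivative_works]]
    show ?thesis using linear_scale[OF linear_frechet_derivative[OF d2[OF that]]]
      by (simp add: has_field_derivative_def o_def partial_deriv_def[of j] mult_commute_abs)
  qed
  have "\<exists>s. 0 < s \<and> s < h \<and> (f (?p h h) - f (?p h 0)) - (f (?p 0 h) - f (?p 0 0)) = (h - 0) * (partial_deriv i f (?p s h) - partial_deriv i f (?p s 0))"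
    using h by (intro MVT2 DERIV_diff di box) auto
  then obtain s where s: "0 < s" "s < h"
    "(f (?p h h) - f (?p h 0)) - (f (?p 0 h) - f (?p 0 0)) = h * (partial_deriv i f (?p s h) - partial_deriv i f (?p s 0))" by auto
  have "\<exists>t. 0 < t \<and> t < h \<and> partial_deriv i f (?p s h) - partial_deriv i f (?p s 0) = (h - 0) * partial_deriv j (partial_deriv i f) (?p s t)"
    using h s by (intro MVT2 dj box) auto
  then obtain t where t: "0 < t" "t < h" "partial_deriv i f (?p s h) - partial_deriv i f (?p s 0) = h * partial_deriv j (partial_deriv i f) (?p s t)" by auto
  show ?thesis using that[of s t] s t by (simp add: power2_eq_square algebra_simps)
qed

text \<open>The second difference over a small square is symmetric in \<open>i\<close> and
  \<open>j\<close>. So the two mixed derivatives share a value, each at some point near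
  \<open>x\<close>, and continuity moves it to \<open>x\<close>.\<close>

lemma partial_deriv_commute:
  fixes f :: "real^'n \<Rightarrow> real"
  assumes S: "open S" "x \<in> S" and f: "smooth_on S f"
  shows "partial_deriv j (partial_deriv i f) x = partial_deriv i (partial_deriv j f) x"
proof -
  define A where "A = partial_deriv j (partial_deriv i f)"
  define B where "B = partial_deriv i (partial_deriv j f)"
  have "\<bar>A x - B x\<bar> \<le> e" if e: "e > 0" for e
  proof -
    have c: "continuous_on S A" "continuous_on S B"
      unfolding A_def B_def by (intro smooth_on_continuous smooth_on_partial_deriv f)+
    obtain d1 where d1: "d1 > 0" "ball x d1 \<subseteq> S" using S open_contains_ball by blast
    obtain d2 where d2: "d2 > 0" "\<And>y. y \<in> S \<Longrightarrow> dist y x < d2 \<Longrightarrow> dist (A y) (A x) < e / 2"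
      using c(1) S(2) e unfolding continuous_on_iff by (meson half_gt_zero)
    obtain d3 where d3: "d3 > 0" "\<And>y. y \<in> S \<Longrightarrow> dist y x < d3 \<Longrightarrow> dist (B y) (B x) < e / 2"
      using c(2) S(2) e unfolding continuous_on_iff by (meson half_gt_zero)
    \<comment> \<open>Displacements have norm at most s + t \<le> 2 h, which stays below all three
      radii.\<close>
    define h where "h = min d1 (min d2 d3) / 3"
    have h: "h > 0" using d1 d2 d3 by (simp add: h_def)
    have near: "dist (x + s *\<^sub>R axis i 1 + t *\<^sub>R axis k 1) x < min d1 (min d2 d3)"
      if "0 \<le> s" "s \<le> h" "0 \<le> t" "t \<le> h" for s t and i k :: 'n
    proof -
      have "norm (s *\<^sub>R axis i 1 + t *\<^sub>R axis k 1 :: real^'n) \<le> s + t"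
        using that by (intro order_trans[OF norm_triangle_ineq]) simp
      also have "\<dots> < 3 * h" using that h by simp
      also have "\<dots> = min d1 (min d2 d3)" by (simp add: h_def)
      finally show ?thesis by (simp add: dist_norm add.assoc)
    qed
    have inS: "x + s *\<^sub>R axis i 1 + t *\<^sub>R axis k 1 \<in> S"
      if "0 \<le> s" "s \<le> h" "0 \<le> t" "t \<le> h" for s t and i k :: 'n
      using near[OF that, of i k] d1(2) by (auto simp: dist_commute)
    have df: "f differentiable (at y)" "partial_deriv k f differentiable (at y)" if "y \<in> S" for y k
      using smooth_on_differentiable[OF f that] smooth_on_differentiable[OF smooth_on_partial_deriv[OF f] that] by auto
    obtain s t where st: "0 \<le> s" "s \<le> h" "0 \<le> t" "t \<le> h"
      "f (x + h *\<^sub>R axis i 1 + h *\<^sub>R axis j 1) - f (x + h *\<^sub>R axis i 1) - f (x + h *\<^sub>R axis j 1) + f x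
        = h\<^sup>2 * A (x + s *\<^sub>R axis i 1 + t *\<^sub>R axis j 1)"
      unfolding A_def by (rule second_difference[of S f i h x j]) (assumption | rule df inS h that)+
    obtain s' t' where st': "0 \<le> s'" "s' \<le> h" "0 \<le> t'" "t' \<le> h"
      "f (x + h *\<^sub>R axis j 1 + h *\<^sub>R axis i 1) - f (x + h *\<^sub>R axis j 1) - f (x + h *\<^sub>R axis i 1) + f x
        = h\<^sup>2 * B (x + s' *\<^sub>R axis j 1 + t' *\<^sub>R axis i 1)"
      unfolding B_def by (rule second_difference[of S f j h x i]) (assumption | rule df inS h that)+
    have "h\<^sup>2 * A (x + s *\<^sub>R axis i 1 + t *\<^sub>R axis j 1) = h\<^sup>2 * B (x + s' *\<^sub>R axis j 1 + t' *\<^sub>R axis i 1)"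
      unfolding st(5)[symmetric] st'(5)[symmetric] by (simp add: add.assoc add.commute[of "h *\<^sub>R axis j 1"])
    hence "A (x + s *\<^sub>R axis i 1 + t *\<^sub>R axis j 1) = B (x + s' *\<^sub>R axis j 1 + t' *\<^sub>R axis i 1)" using h by simp
    moreover have "dist (A (x + s *\<^sub>R axis i 1 + t *\<^sub>R axis j 1)) (A x) < e / 2"
      using near[OF st(1-4), of i j] by (intro d2(2) inS st) simp
    moreover have "dist (B (x + s' *\<^sub>R axis j 1 + t' *\<^sub>R axis i 1)) (B x) < e / 2"
      using near[OF st'(1-4), of j i] by (intro d3(2) inS st') simp
    ultimately show ?thesis unfolding dist_real_def by linarith
  qed
  hence "\<bar>A x - B x\<bar> \<le> 0" by (metis field_le_epsilon add_0)
  thus ?thesis by (simp add: A_def B_def)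
qed

text \<open>Stated for arbitrary expressions of the derivatives, so that a function differentiated
  through the connection yields curvature identities.\<close>

lemma second_derivative_symmetric_real:
  fixes f :: "real^'n \<Rightarrow> real"
  assumes S: "open S" "x \<in> S" and f: "smooth_on S f"
    and f': "\<And>y. y \<in> S \<Longrightarrow> (f has_derivative f' y) (at y)"
    and f'': "\<And>m. ((\<lambda>y. f' y m) has_derivative f'' m) (at x)"
  shows "f'' m p = f'' p m"
proof -
  have a: "f' y m = (\<Sum>i\<in>UNIV. m $ i *\<^sub>R partial_deriv i f y)" if "y \<in> S" for y m
    using frechet_derivative_partial[of f y m] f'[OF that] frechet_derivative_at[OF f'[OF that]]
    by (simp add: differentiable_def) blast
  have s: "partial_deriv i f differentiable (at x)" for i
    using smooth_on_differentiable[OF smooth_on_partial_deriv[OF f] S(2)] .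
  have b: "f'' m p = (\<Sum>i\<in>UNIV. \<Sum>j\<in>UNIV. m $ i * p $ j * partial_deriv j (partial_deriv i f) x)" for m p
  proof -
    have "((\<lambda>y. \<Sum>i\<in>UNIV. m $ i *\<^sub>R partial_deriv i f y) has_derivative
        (\<lambda>p. \<Sum>i\<in>UNIV. m $ i *\<^sub>R frechet_derivative (partial_deriv i f) (at x) p)) (at x)"
      using s by (intro has_derivative_sum has_derivative_scaleR_right) (simp add: frechet_derivative_works[symmetric])
    hence "((\<lambda>y. f' y m) has_derivative
        (\<lambda>p. \<Sum>i\<in>UNIV. m $ i *\<^sub>R frechet_derivative (partial_deriv i f) (at x) p)) (at x)"
      by (rule has_derivative_transform_within_open[OF _ S]) (rule a[symmetric])
    from has_derivative_unique[OF f'' this]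
    have "f'' m p = (\<Sum>i\<in>UNIV. m $ i *\<^sub>R frechet_derivative (partial_deriv i f) (at x) p)" by (rule fun_cong)
    thus ?thesis by (simp add: frechet_derivative_partial[OF s] sum_distrib_left mult.assoc)
  qed
  have "f'' m p = (\<Sum>j\<in>UNIV. \<Sum>i\<in>UNIV. m $ i * p $ j * partial_deriv j (partial_deriv i f) x)"
    unfolding b by (rule sum.swap)
  also have "\<dots> = f'' p m" unfolding b
    by (intro sum.cong refl) (simp only: partial_deriv_commute[OF S f] mult.commute)
  finally show ?thesis .
qed

lemma second_derivative_symmetric:
  fixes f :: "real^'n \<Rightarrow> real^'k"
  assumes S: "open S" "x \<in> S" and f: "smooth_on S f"
    and f': "\<And>y. y \<in> S \<Longrightarrow> (f has_derivative f' y) (at y)"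
    and f'': "\<And>m. ((\<lambda>y. f' y m) has_derivative f'' m) (at x)"
  shows "f'' m p = f'' p m"
proof -
  have "f'' m p $ k = f'' p m $ k" for k
    by (rule second_derivative_symmetric_real[OF S smooth_on_nth[OF S(1) f, of k], where f' = "\<lambda>y m. f' y m $ k" and f'' = "\<lambda>m p. f'' m p $ k"])
      (rule bounded_linear.has_derivative[OF bounded_linear_vec_nth] f' f'' | assumption)+
  thus ?thesis by (simp add: vec_eq_iff)
qed

lemma has_derivative_vecI:
  fixes f :: "'a::real_normed_vector \<Rightarrow> real^'k"
  assumes "\<And>k. ((\<lambda>x. f x $ k) has_derivative (\<lambda>m. f' m $ k)) (at a within S)"
  shows "(f has_derivative f') (at a within S)"
  unfolding has_derivative_componentwise_within[of f] using assms by (auto simp: Basis_vec_def inner_axis)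

section \<open>Multilinear maps\<close>

lemma linear_expansion:
  fixes L :: "real^'n \<Rightarrow> 'b::real_vector"
  assumes "linear L"
  shows "L v = (\<Sum>i\<in>UNIV. v $ i *\<^sub>R L (axis i 1))"
proof -
  have "v = (\<Sum>i\<in>UNIV. v $ i *\<^sub>R axis i 1)" using basis_expansion[of v] by (simp add: scalar_mult_eq_scaleR)
  hence "L v = L (\<Sum>i\<in>UNIV. v $ i *\<^sub>R axis i 1)" by simp
  thus ?thesis by (simp add: linear_sum[OF assms] linear_scale[OF assms])
qed

lemma linear_compose_fun: "linear h \<Longrightarrow> linear f \<Longrightarrow> linear (\<lambda>u. h (f u))"
  using linear_compose[of f h] by (simp add: o_def)

lemma span_axes: "span (range (\<lambda>i. axis i 1 :: real^'n)) = UNIV"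
proof -
  have "range (\<lambda>i. axis i 1 :: real^'n) = Basis" by (auto simp: Basis_vec_def)
  thus ?thesis by simp
qed

lemma linear_eq_spanning:
  "linear f \<Longrightarrow> linear g \<Longrightarrow> span B = UNIV \<Longrightarrow> (\<And>b. b \<in> B \<Longrightarrow> f b = g b) \<Longrightarrow> f u = g u"
  by (rule linear_eq_on[of f g u B]) simp_all

text \<open>This family of lemmas is used with the coordinate axes to compare component formulas and
  with an orthonormal frame to compare tensors at a point.\<close>

lemma multilinear2_eqI:
  assumes B: "span B = UNIV"
    and f: "\<And>v. linear (\<lambda>u. f u v)" "\<And>u. linear (f u)"
    and g: "\<And>v. linear (\<lambda>u. g u v)" "\<And>u. linear (g u)"
    and eq: "\<And>a b. a \<in> B \<Longrightarrow> b \<in> B \<Longrightarrow> f a b = g a b"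
  shows "f u v = g u v"
proof -
  have "f a v = g a v" if "a \<in> B" for a
    by (rule linear_eq_spanning[OF f(2) g(2) B]) (rule eq[OF that])
  thus ?thesis by (rule linear_eq_spanning[OF f(1) g(1) B])
qed

lemma multilinear3_eqI:
  assumes B: "span B = UNIV"
    and f: "\<And>v w. linear (\<lambda>u. f u v w)" "\<And>u w. linear (\<lambda>v. f u v w)" "\<And>u v. linear (f u v)"
    and g: "\<And>v w. linear (\<lambda>u. g u v w)" "\<And>u w. linear (\<lambda>v. g u v w)" "\<And>u v. linear (g u v)"
    and eq: "\<And>a b c. a \<in> B \<Longrightarrow> b \<in> B \<Longrightarrow> c \<in> B \<Longrightarrow> f a b c = g a b c"
  shows "f u v w = g u v w"
proof -
  have "f a v w = g a v w" if "a \<in> B" for a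
    by (rule multilinear2_eqI[OF B f(2,3) g(2,3)]) (rule eq[OF that])
  thus ?thesis by (rule linear_eq_spanning[OF f(1) g(1) B])
qed

lemma multilinear4_eqI:
  assumes B: "span B = UNIV"
    and f: "\<And>v w z. linear (\<lambda>u. f u v w z)" "\<And>u w z. linear (\<lambda>v. f u v w z)" "\<And>u v z. linear (\<lambda>w. f u v w z)" "\<And>u v w. linear (f u v w)"
    and g: "\<And>v w z. linear (\<lambda>u. g u v w z)" "\<And>u w z. linear (\<lambda>v. g u v w z)" "\<And>u v z. linear (\<lambda>w. g u v w z)" "\<And>u v w. linear (g u v w)"
    and eq: "\<And>a b c d. a \<in> B \<Longrightarrow> b \<in> B \<Longrightarrow> c \<in> B \<Longrightarrow> d \<in> B \<Longrightarrow> f a b c d = g a b c d"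
  shows "f u v w z = g u v w z"
proof -
  have "f a v w z = g a v w z" if "a \<in> B" for a
    by (rule multilinear3_eqI[OF B f(2,3,4) g(2,3,4)]) (rule eq[OF that])
  thus ?thesis by (rule linear_eq_spanning[OF f(1) g(1) B])
qed

text \<open>Leibniz rule for an argument that moves with the base point. Derivatives of
  \<open>F\<close> at fixed arguments suffice because \<open>F y (a y)\<close> is a finite sum over
  the coordinates of \<open>a y\<close>.\<close>

lemma has_derivative_slot:
  fixes F :: "'a::real_normed_vector \<Rightarrow> real^'n \<Rightarrow> 'b::real_normed_vector"
  assumes lin: "\<And>y. linear (F y)" and lin': "\<And>m. linear (\<lambda>v. F' v m)"
    and F: "\<And>v. ((\<lambda>y. F y v) has_derivative F' v) (at x within T)"
    and a: "(a has_derivative a') (at x within T)"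
  shows "((\<lambda>y. F y (a y)) has_derivative (\<lambda>m. F' (a x) m + F x (a' m))) (at x within T)"
proof -
  have "((\<lambda>y. \<Sum>i\<in>UNIV. a y $ i *\<^sub>R F y (axis i 1)) has_derivative
      (\<lambda>m. \<Sum>i\<in>UNIV. a x $ i *\<^sub>R F' (axis i 1) m + a' m $ i *\<^sub>R F x (axis i 1))) (at x within T)"
    by (intro has_derivative_sum has_derivative_scaleR F bounded_linear.has_derivative[OF bounded_linear_vec_nth] a)
  moreover have "F y (a y) = (\<Sum>i\<in>UNIV. a y $ i *\<^sub>R F y (axis i 1))" for y by (rule linear_expansion[OF lin])
  moreover have "F' (a x) m + F x (a' m) = (\<Sum>i\<in>UNIV. a x $ i *\<^sub>R F' (axis i 1) m + a' m $ i *\<^sub>R F x (axis i 1))" for m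
    unfolding sum.distrib using linear_expansion[OF lin', of "a x" m] linear_expansion[OF lin, of x "a' m"] by (simp only:)
  ultimately show ?thesis by (simp only:)
qed

lemma has_derivative_slots2:
  fixes F :: "'a::real_normed_vector \<Rightarrow> real^'n \<Rightarrow> real^'k \<Rightarrow> 'b::real_normed_vector"
  assumes lin: "\<And>y v. linear (\<lambda>u. F y u v)" "\<And>y u. linear (F y u)"
    and lin': "\<And>m v. linear (\<lambda>u. F' u v m)" "\<And>m u. linear (\<lambda>v. F' u v m)"
    and F: "\<And>u v. ((\<lambda>y. F y u v) has_derivative F' u v) (at x within T)"
    and a: "(a has_derivative a') (at x within T)" and b: "(b has_derivative b') (at x within T)"
  shows "((\<lambda>y. F y (a y) (b y)) has_derivative (\<lambda>m. F' (a x) (b x) m + F x (a' m) (b x) + F x (a x) (b' m))) (at x within T)"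
proof (rule has_derivative_slot[where F = "\<lambda>y. F y (a y)" and F' = "\<lambda>v m. F' (a x) v m + F x (a' m) v", OF lin(2) _ _ b])
  show "linear (\<lambda>v. F' (a x) v m + F x (a' m) v)" for m by (intro linear_compose_add lin lin')
  show "((\<lambda>y. F y (a y) v) has_derivative (\<lambda>m. F' (a x) v m + F x (a' m) v)) (at x within T)" for v
    by (rule has_derivative_slot[where F = "\<lambda>y u. F y u v" and F' = "\<lambda>u. F' u v", OF lin(1) lin'(1) F a])
qed

lemma has_derivative_slots4:
  fixes F :: "'a::real_normed_vector \<Rightarrow> real^'n \<Rightarrow> real^'n \<Rightarrow> real^'n \<Rightarrow> real^'n \<Rightarrow> 'b::real_normed_vector"
  assumes lin: "\<And>y v w z. linear (\<lambda>u. F y u v w z)" "\<And>y u w z. linear (\<lambda>v. F y u v w z)"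
      "\<And>y u v z. linear (\<lambda>w. F y u v w z)" "\<And>y u v w. linear (F y u v w)"
    and lin': "\<And>m v w z. linear (\<lambda>u. F' u v w z m)" "\<And>m u w z. linear (\<lambda>v. F' u v w z m)"
      "\<And>m u v z. linear (\<lambda>w. F' u v w z m)" "\<And>m u v w. linear (\<lambda>z. F' u v w z m)"
    and F: "\<And>u v w z. ((\<lambda>y. F y u v w z) has_derivative F' u v w z) (at x within T)"
    and a: "(a has_derivative a') (at x within T)" and b: "(b has_derivative b') (at x within T)"
    and c: "(c has_derivative c') (at x within T)" and d: "(d has_derivative d') (at x within T)"
  shows "((\<lambda>y. F y (a y) (b y) (c y) (d y)) has_derivative
    (\<lambda>m. F' (a x) (b x) (c x) (d x) m + F x (a' m) (b x) (c x) (d x) + F x (a x) (b' m) (c x) (d x)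
       + F x (a x) (b x) (c' m) (d x) + F x (a x) (b x) (c x) (d' m))) (at x within T)"
proof (rule has_derivative_slots2[where F = "\<lambda>y. F y (a y) (b y)"
      and F' = "\<lambda>w z m. F' (a x) (b x) w z m + F x (a' m) (b x) w z + F x (a x) (b' m) w z", OF lin(3,4) _ _ _ c d])
  show "linear (\<lambda>w. F' (a x) (b x) w z m + F x (a' m) (b x) w z + F x (a x) (b' m) w z)" for m z
    by (intro linear_compose_add lin lin')
  show "linear (\<lambda>z. F' (a x) (b x) w z m + F x (a' m) (b x) w z + F x (a x) (b' m) w z)" for m w
    by (intro linear_compose_add lin lin')
  show "((\<lambda>y. F y (a y) (b y) w z) has_derivative
      (\<lambda>m. F' (a x) (b x) w z m + F x (a' m) (b x) w z + F x (a x) (b' m) w z)) (at x within T)" for w z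
    by (rule has_derivative_slots2[where F = "\<lambda>y u v. F y u v w z" and F' = "\<lambda>u v. F' u v w z", OF lin(1,2) lin'(1,2) F a b])
qed

section \<open>The Levi-Civita connection of a metric in a chart\<close>

text \<open>The covariant derivative along \<open>u\<close> of the vector field with constant
  coordinates \<open>v\<close>.\<close>

definition conn :: "'n::finite metric \<Rightarrow> real^'n \<Rightarrow> real^'n \<Rightarrow> real^'n \<Rightarrow> real^'n" where
  "conn G x u v = (\<chi> k. \<Sum>i\<in>UNIV. \<Sum>j\<in>UNIV. christoffel G x k i j * u $ i * v $ j)"

definition dconn :: "'n::finite metric \<Rightarrow> real^'n \<Rightarrow> real^'n \<Rightarrow> real^'n \<Rightarrow> real^'n \<Rightarrow> real^'n" where
  "dconn G x m u v = frechet_derivative (\<lambda>y. conn G y u v) (at x) m"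

text \<open>The commutator of covariant derivatives on fields with constant coordinates, whose Lie
  bracket vanishes.\<close>

definition riem :: "'n::finite metric \<Rightarrow> real^'n \<Rightarrow> real^'n \<Rightarrow> real^'n \<Rightarrow> real^'n \<Rightarrow> real^'n" where
  "riem G x u v z = dconn G x u v z - dconn G x v u z + conn G x u (conn G x v z) - conn G x v (conn G x u z)"

definition dmet :: "'n::finite metric \<Rightarrow> real^'n \<Rightarrow> real^'n \<Rightarrow> real^'n \<Rightarrow> real^'n \<Rightarrow> real" where
  "dmet G x m v w = v \<bullet> (frechet_derivative G (at x) m *v w)"

lemma linear_inner_at: "linear (\<lambda>u. inner_at G x u v)" "linear (inner_at G x u)"
  by (auto intro!: linearI simp: inner_at_def inner_add_left inner_add_right matrix_vector_right_distrib matrix_vector_mult_scaleR)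

lemma linear_conn: "linear (\<lambda>u. conn G x u v)" "linear (conn G x u)"
  by (auto intro!: linearI simp: conn_def vec_eq_iff ring_distribs sum.distrib sum_distrib_left mult_ac)

lemma linear_curv_form:
  "linear (\<lambda>u. curv_form G x u v w z)" "linear (\<lambda>v. curv_form G x u v w z)"
  "linear (\<lambda>w. curv_form G x u v w z)" "linear (curv_form G x u v w)"
  by (auto intro!: linearI simp: curv_form_def ring_distribs sum.distrib sum_distrib_left mult_ac)

lemmas multilinear_intros = linear_compose_add linear_compose_sub linear_compose_neg
  linear_inner_at linear_inner_at[THEN linear_compose_fun]
  linear_conn linear_conn[THEN linear_compose_fun]
  linear_curv_form linear_curv_form[THEN linear_compose_fun]

lemma conn_axis: "conn G x (axis i 1) (axis j 1) $ k = christoffel G x k i j"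
  by (simp add: conn_def axis_def if_distrib[of "\<lambda>r. _ * r"] cong: if_cong)

lemma curv_form_axis: "curv_form G x (axis i 1) (axis j 1) (axis k 1) (axis l 1) = curv G x i j k l"
  by (simp add: curv_form_def axis_def if_distrib[of "\<lambda>r. _ * r"] cong: if_cong)

locale chart_metric =
  fixes G :: "'n::finite metric" and U :: "(real^'n) set"
  assumes open_U: "open U" and smooth_G: "smooth_on U G"
    and sym_G: "x \<in> U \<Longrightarrow> transpose (G x) = G x"
    and pos_G: "x \<in> U \<Longrightarrow> v \<noteq> 0 \<Longrightarrow> inner_at G x v v > 0"
begin

lemma inner_at_commute: "x \<in> U \<Longrightarrow> inner_at G x u v = inner_at G x v u"
  using sym_G[of x] unfolding inner_at_def
  by (metis dot_lmul_matrix inner_commute transpose_matrix_vector)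

lemma inner_at_nondegenerate:
  assumes x: "x \<in> U" and eq: "\<And>w. inner_at G x w u = inner_at G x w v"
  shows "u = v"
proof (rule ccontr)
  assume "u \<noteq> v"
  hence "inner_at G x (u - v) (u - v) > 0" by (intro pos_G x) simp
  thus False using eq[of "u - v"] by (simp add: linear_diff[OF linear_inner_at(2)])
qed

lemma invertible_G: "x \<in> U \<Longrightarrow> invertible (G x)"
proof -
  assume x: "x \<in> U"
  have "v = 0" if "G x *v v = 0" for v
    using pos_G[OF x, of v] that by (auto simp: inner_at_def)
  thus ?thesis unfolding invertible_left_inverse matrix_left_invertible_ker by blast
qed

lemma smooth_G_nth: "smooth_on U (\<lambda>x. G x $ i $ j)"
  by (intro smooth_on_nth open_U smooth_G)

lemma smooth_christoffel: "smooth_on U (\<lambda>x. christoffel G x k i j)"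
  unfolding christoffel_def
  by (intro smooth_on_mult smooth_on_const smooth_on_sum smooth_on_add smooth_on_diff open_U
      smooth_on_partial_deriv smooth_G_nth smooth_on_matrix_inv invertible_G)

lemma smooth_curv: "smooth_on U (\<lambda>x. curv G x i j k l)"
  unfolding curv_def curv_vec_def
  by (intro smooth_on_mult smooth_on_sum smooth_on_add smooth_on_diff open_U
      smooth_on_partial_deriv smooth_G_nth smooth_christoffel)

lemma has_derivative_G: "x \<in> U \<Longrightarrow> (G has_derivative frechet_derivative G (at x)) (at x)"
  using smooth_on_differentiable[OF smooth_G] frechet_derivative_works by blast

lemma has_derivative_inner_at_dmet:
  assumes "x \<in> U"
  shows "((\<lambda>y. inner_at G y v w) has_derivative (\<lambda>m. dmet G x m v w)) (at x)"
proof -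
  have "linear (\<lambda>M :: real^'n^'n. v \<bullet> (M *v w))"
    by (auto intro!: linearI simp: matrix_vector_mult_add_rdistrib inner_add_right scaleR_matrix_vector_assoc[symmetric])
  hence "bounded_linear (\<lambda>M :: real^'n^'n. v \<bullet> (M *v w))" by (simp add: linear_conv_bounded_linear)
  from bounded_linear.has_derivative[OF this has_derivative_G[OF assms]]
  show ?thesis by (simp add: inner_at_def dmet_def)
qed

lemma linear_dmet:
  assumes "x \<in> U"
  shows "linear (\<lambda>m. dmet G x m v w)" "linear (\<lambda>v. dmet G x m v w)" "linear (dmet G x m v)"
  using has_derivative_linear[OF has_derivative_inner_at_dmet[OF assms]]
  by (auto intro!: linearI simp: dmet_def inner_add_left inner_add_right matrix_vector_right_distrib matrix_vector_mult_scaleR)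

lemma dmet_commute:
  assumes x: "x \<in> U"
  shows "dmet G x m v w = dmet G x m w v"
proof -
  have "((\<lambda>y. inner_at G y w v) has_derivative (\<lambda>m. dmet G x m v w)) (at x)"
    by (rule has_derivative_transform_within_open[OF has_derivative_inner_at_dmet[OF x] open_U x])
      (rule inner_at_commute)
  from has_derivative_unique[OF this has_derivative_inner_at_dmet[OF x]] show ?thesis by (rule fun_cong)
qed

lemma partial_deriv_G:
  assumes "x \<in> U"
  shows "partial_deriv i (\<lambda>y. G y $ j $ l) x = dmet G x (axis i 1) (axis j 1) (axis l 1)"
proof -
  have "((\<lambda>y. G y $ j $ l) has_derivative (\<lambda>m. frechet_derivative G (at x) m $ j $ l)) (at x)"
    by (intro bounded_linear.has_derivative[OF bounded_linear_vec_nth] has_derivative_G assms)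
  from partial_deriv_eqI[OF this] show ?thesis
    by (simp add: dmet_def matrix_vector_mult_basis column_def inner_axis')
qed

text \<open>Torsion-freeness, metric compatibility and the behaviour under change of chart are
  derived from this formula, in which the inverse metric no longer appears.\<close>

lemma koszul:
  assumes x: "x \<in> U"
  shows "2 * inner_at G x w (conn G x u v) = dmet G x u v w + dmet G x v u w - dmet G x w u v"
proof -
  note dl = linear_dmet[OF x]
  have "inner_at G x w (conn G x u v) = (1/2) *\<^sub>R (dmet G x u v w + dmet G x v u w - dmet G x w u v)"
  proof (rule multilinear3_eqI[OF span_axes, where f = "\<lambda>w u v. inner_at G x w (conn G x u v)"
        and g = "\<lambda>w u v. (1/2) *\<^sub>R (dmet G x u v w + dmet G x v u w - dmet G x w u v)"])
    fix a b c :: "real^'n"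
    assume "a \<in> range (\<lambda>i. axis i 1)" "b \<in> range (\<lambda>i. axis i 1)" "c \<in> range (\<lambda>i. axis i 1)"
    then obtain l i j where abc: "a = axis l 1" "b = axis i 1" "c = axis j 1" by blast
    \<comment> \<open>The covector on the right of the Koszul formula; raising its index is the
      definition of the Christoffel symbols.\<close>
    let ?q = "\<chi> l. (1/2) * (dmet G x b c (axis l 1) + dmet G x c b (axis l 1) - dmet G x (axis l 1) b c)"
    have "conn G x b c = matrix_inv (G x) *v ?q"
      unfolding vec_eq_iff abc conn_axis christoffel_def partial_deriv_G[OF x]
      by (simp add: matrix_vector_mult_def sum_distrib_left mult_ac)
    hence "G x *v conn G x b c = ?q"
      by (simp add: matrix_vector_mul_assoc matrix_mul_inv_right[OF invertible_G[OF x]])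
    thus "inner_at G x a (conn G x b c) = (1/2) *\<^sub>R (dmet G x b c a + dmet G x c b a - dmet G x a b c)"
      by (simp add: inner_at_def abc inner_axis')
  qed (intro linear_compose_scale_right multilinear_intros dl)+
  thus ?thesis by simp
qed

lemma conn_commute: "x \<in> U \<Longrightarrow> conn G x u v = conn G x v u"
proof (rule inner_at_nondegenerate)
  fix w assume x: "x \<in> U"
  show "inner_at G x w (conn G x u v) = inner_at G x w (conn G x v u)"
    using koszul[OF x, of w u v] koszul[OF x, of w v u] dmet_commute[OF x, of w u v] by linarith
qed

lemma dmet_compatible:
  assumes x: "x \<in> U"
  shows "dmet G x m v w = inner_at G x (conn G x m v) w + inner_at G x v (conn G x m w)"
  using koszul[OF x, of w m v] koszul[OF x, of v m w] dmet_commute[OF x, of m v w] dmet_commute[OF x, of w m v] dmet_commute[OF x, of v m w]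
    inner_at_commute[OF x, of "conn G x m v" w] by linarith

lemma has_derivative_inner_at:
  assumes x: "x \<in> U"
  shows "((\<lambda>y. inner_at G y v w) has_derivative
    (\<lambda>m. inner_at G x (conn G x m v) w + inner_at G x v (conn G x m w))) (at x)"
  using has_derivative_inner_at_dmet[OF x, of v w] unfolding dmet_compatible[OF x] .

lemma has_derivative_christoffel:
  "x \<in> U \<Longrightarrow> ((\<lambda>y. christoffel G y k i j) has_derivative frechet_derivative (\<lambda>y. christoffel G y k i j) (at x)) (at x)"
  using smooth_on_differentiable[OF smooth_christoffel] frechet_derivative_works by blast

lemma has_derivative_conn_components:
  assumes x: "x \<in> U"
  shows "((\<lambda>y. conn G y u v) has_derivative
    (\<lambda>m. \<chi> k. \<Sum>i\<in>UNIV. \<Sum>j\<in>UNIV. frechet_derivative (\<lambda>y. christoffel G y k i j) (at x) m * u $ i * v $ j)) (at x)"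
  unfolding conn_def
  by (rule has_derivative_vecI)
    (simp only: vec_lambda_beta, intro has_derivative_sum has_derivative_mult_left has_derivative_christoffel x)

lemma dconn_components:
  assumes x: "x \<in> U"
  shows "dconn G x m u v = (\<chi> k. \<Sum>i\<in>UNIV. \<Sum>j\<in>UNIV. frechet_derivative (\<lambda>y. christoffel G y k i j) (at x) m * u $ i * v $ j)"
  unfolding dconn_def frechet_derivative_at[OF has_derivative_conn_components[OF x], symmetric] ..

lemma has_derivative_conn:
  assumes x: "x \<in> U"
  shows "((\<lambda>y. conn G y u v) has_derivative (\<lambda>m. dconn G x m u v)) (at x)"
  unfolding dconn_components[OF x] by (rule has_derivative_conn_components[OF x])

lemma linear_dconn:
  assumes x: "x \<in> U"
  shows "linear (\<lambda>m. dconn G x m u v)" "linear (\<lambda>u. dconn G x m u v)" "linear (dconn G x m u)"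
  subgoal by (rule has_derivative_linear[OF has_derivative_conn[OF x]])
  by (auto intro!: linearI simp: dconn_components[OF x] vec_eq_iff ring_distribs sum.distrib sum_distrib_left mult_ac)

lemma dconn_commute:
  assumes x: "x \<in> U"
  shows "dconn G x m u v = dconn G x m v u"
proof -
  have "((\<lambda>y. conn G y v u) has_derivative (\<lambda>m. dconn G x m u v)) (at x)"
    by (rule has_derivative_transform_within_open[OF has_derivative_conn[OF x] open_U x])
      (rule conn_commute)
  from has_derivative_unique[OF this has_derivative_conn[OF x]] show ?thesis by (rule fun_cong)
qed

lemma linear_riem:
  assumes x: "x \<in> U"
  shows "linear (\<lambda>u. riem G x u v z)" "linear (\<lambda>v. riem G x u v z)" "linear (riem G x u v)"
  unfolding riem_def by (intro multilinear_intros linear_dconn[OF x])+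

text \<open>The passage from the index definition to the operator form, in which the symmetries are
  proved.\<close>

lemma curv_form_riem:
  assumes x: "x \<in> U"
  shows "curv_form G x u v w z = inner_at G x w (riem G x u v z)"
proof (rule multilinear4_eqI[OF span_axes, where f = "curv_form G x" and g = "\<lambda>u v w z. inner_at G x w (riem G x u v z)"])
  fix a b c d :: "real^'n"
  assume "a \<in> range (\<lambda>i. axis i 1)" "b \<in> range (\<lambda>i. axis i 1)" "c \<in> range (\<lambda>i. axis i 1)" "d \<in> range (\<lambda>i. axis i 1)"
  then obtain i j k l where abcd: "a = axis i 1" "b = axis j 1" "c = axis k 1" "d = axis l 1" by blast
  have dc: "dconn G x (axis i 1) (axis j 1) (axis l 1) $ m = partial_deriv i (\<lambda>y. christoffel G y m j l) x" for i j l m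
    using partial_deriv_eqI[OF bounded_linear.has_derivative[OF bounded_linear_vec_nth[of m] has_derivative_conn[OF x, of "axis j 1" "axis l 1"]], of i]
    by (simp add: conn_axis)
  have cc: "conn G x (axis i 1) (conn G x (axis j 1) (axis l 1)) $ m = (\<Sum>p\<in>UNIV. christoffel G x m i p * christoffel G x p j l)" for i j l m
    unfolding linear_expansion[OF linear_conn(2), of G x "axis i 1" "conn G x (axis j 1) (axis l 1)"]
    by (simp add: conn_axis mult.commute)
  have "riem G x a b d $ m = curv_vec G x i j l m" for m
    unfolding riem_def curv_vec_def abcd by (simp add: dc cc sum_subtractf)
  thus "curv_form G x a b c d = inner_at G x c (riem G x a b d)"
    unfolding abcd curv_form_axis by (simp add: inner_at_def inner_axis' matrix_vector_mult_def curv_def)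
qed (intro multilinear_intros linear_riem[OF x] linear_riem[OF x, THEN linear_compose_fun[OF linear_inner_at(2)]])+

lemma curv_form_antisym12: "x \<in> U \<Longrightarrow> curv_form G x u v w z = - curv_form G x v u w z"
  by (simp add: curv_form_riem riem_def inner_at_def matrix_vector_right_distrib matrix_vector_mult_diff_distrib inner_diff_right inner_add_right)

lemma riem_bianchi: "x \<in> U \<Longrightarrow> riem G x u v z + riem G x v z u + riem G x z u v = 0"
  unfolding riem_def
  using dconn_commute[of x u v z] dconn_commute[of x v z u] dconn_commute[of x z u v]
    conn_commute[of x v z] conn_commute[of x z u] conn_commute[of x u v] by simp

text \<open>For \<open>z\<close> with constant coordinates, exchanging the two directions in the
  second derivative of g(z, z) changes it by 2 g(z, R(u,v) z), while second derivatives are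
  symmetric.\<close>

lemma curv_form_diagonal:
  assumes x: "x \<in> U"
  shows "curv_form G x u v z z = 0"
proof -
  let ?f'' = "\<lambda>m p. 2 * (inner_at G x (conn G x p z) (conn G x m z) + inner_at G x z (conn G x p (conn G x m z))
    + inner_at G x z (dconn G x p m z))"
  have d: "((\<lambda>y. 2 * inner_at G y z (conn G y m z)) has_derivative ?f'' m) (at x)" for m
    by (intro has_derivative_mult_right
      has_derivative_slot[where F = "\<lambda>y. inner_at G y z" and F' = "\<lambda>v m. inner_at G x (conn G x m z) v + inner_at G x z (conn G x m v)"]
      linear_inner_at multilinear_intros has_derivative_inner_at[OF x] has_derivative_conn[OF x])
  have f': "((\<lambda>y. inner_at G y z z) has_derivative (\<lambda>m. 2 * inner_at G y z (conn G y m z))) (at y)" if y: "y \<in> U" for y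
    using has_derivative_inner_at[OF y, of z z] inner_at_commute[OF y, of _ z] by simp
  have "smooth_on U (\<lambda>y. \<Sum>i\<in>UNIV. \<Sum>j\<in>UNIV. z $ i * (G y $ i $ j * z $ j))"
    by (intro smooth_on_sum smooth_on_mult smooth_on_const smooth_G_nth open_U)
  hence s: "smooth_on U (\<lambda>y. inner_at G y z z)"
    by (simp add: inner_at_def inner_vec_def matrix_vector_mult_def sum_distrib_left)
  have "?f'' v u = ?f'' u v" by (rule second_derivative_symmetric_real[OF open_U x s f' d])
  thus ?thesis using inner_at_commute[OF x, of "conn G x v z" "conn G x u z"]
    by (simp add: curv_form_riem[OF x] riem_def inner_at_def matrix_vector_right_distrib matrix_vector_mult_diff_distrib inner_diff_right inner_add_right)
qed

lemma curv_form_antisym34: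
  assumes x: "x \<in> U"
  shows "curv_form G x u v w z = - curv_form G x u v z w"
  using curv_form_diagonal[OF x, of u v "w + z"] curv_form_diagonal[OF x, of u v w] curv_form_diagonal[OF x, of u v z]
  by (simp add: linear_add[OF linear_curv_form(3)] linear_add[OF linear_curv_form(4)])

lemma curv_form_bianchi:
  assumes x: "x \<in> U"
  shows "curv_form G x u v z w + curv_form G x v z u w + curv_form G x z u v w = 0"
proof -
  have "inner_at G x w (riem G x u v z + riem G x v z u + riem G x z u v) = 0"
    by (simp add: riem_bianchi[OF x] inner_at_def)
  hence "curv_form G x u v w z + curv_form G x v z w u + curv_form G x z u w v = 0"
    by (simp add: curv_form_riem[OF x] linear_add[OF linear_inner_at(2)])
  thus ?thesis
    using curv_form_antisym34[OF x, of u v z w] curv_form_antisym34[OF x, of v z u w] curv_form_antisym34[OF x, of z u v w] by linarith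
qed

text \<open>The Bianchi identity for the four cyclic rotations of the arguments, combined with both
  antisymmetries.\<close>

lemma curv_form_pair:
  assumes x: "x \<in> U"
  shows "curv_form G x u v w z = curv_form G x w z u v"
  using curv_form_bianchi[OF x, of u v w z] curv_form_bianchi[OF x, of v w z u] curv_form_bianchi[OF x, of w z u v] curv_form_bianchi[OF x, of z u v w]
    curv_form_antisym12[OF x, of u v w z] curv_form_antisym12[OF x, of v w u z] curv_form_antisym12[OF x, of w u v z]
    curv_form_antisym12[OF x, of v w z u] curv_form_antisym12[OF x, of w z v u] curv_form_antisym12[OF x, of z v w u]
    curv_form_antisym12[OF x, of w z u v] curv_form_antisym12[OF x, of z u w v] curv_form_antisym12[OF x, of u w z v]
    curv_form_antisym12[OF x, of z u v w] curv_form_antisym12[OF x, of u v z w] curv_form_antisym12[OF x, of v z u w]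
    curv_form_antisym34[OF x, of u v w z] curv_form_antisym34[OF x, of v w u z] curv_form_antisym34[OF x, of w u v z]
    curv_form_antisym34[OF x, of v w z u] curv_form_antisym34[OF x, of w z v u] curv_form_antisym34[OF x, of z v w u]
    curv_form_antisym34[OF x, of w z u v] curv_form_antisym34[OF x, of z u w v] curv_form_antisym34[OF x, of u w z v]
    curv_form_antisym34[OF x, of z u v w] curv_form_antisym34[OF x, of u v z w] curv_form_antisym34[OF x, of v z u w]
  by linarith

end

lemma linear_scaled_axis_sum: "linear (\<lambda>v :: real^'n. \<Sum>i\<in>UNIV. v $ i *\<^sub>R c i)"
  by (auto intro!: linearI simp: scaleR_left_distrib sum.distrib scaleR_sum_right)

lemma smooth_on_scaled_partials:
  assumes "open S" "smooth_on S f"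
  shows "smooth_on S (\<lambda>y. \<Sum>i\<in>UNIV. v $ i *\<^sub>R partial_deriv i f y)"
  by (intro smooth_on_sum smooth_on_bounded_linear[OF _ bounded_linear_scaleR_right] smooth_on_partial_deriv assms)

lemma smooth_on_frechet_derivative:
  assumes S: "open S" and f: "smooth_on S f"
  shows "smooth_on S (\<lambda>y. frechet_derivative f (at y) v)"
proof -
  have "smooth_on S (\<lambda>y. frechet_derivative f (at y) v) \<longleftrightarrow> smooth_on S (\<lambda>y. \<Sum>i\<in>UNIV. v $ i *\<^sub>R partial_deriv i f y)"
    by (rule smooth_on_cong[OF S]) (rule frechet_derivative_partial[OF smooth_on_differentiable[OF f]])
  thus ?thesis using smooth_on_scaled_partials[OF S f] by (simp only:)
qed

lemma smooth_on_has_derivative: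
  "smooth_on S f \<Longrightarrow> x \<in> S \<Longrightarrow> (f has_derivative frechet_derivative f (at x)) (at x)"
  using smooth_on_differentiable frechet_derivative_works by blast

context chart_metric
begin

lemma inner_at_parallel:
  assumes x: "s t \<in> U" and s: "(s has_vector_derivative s') (at t within T)"
    and V: "(V has_vector_derivative - conn G (s t) s' (V t)) (at t within T)"
    and W: "(W has_vector_derivative - conn G (s t) s' (W t)) (at t within T)"
  shows "((\<lambda>r. inner_at G (s r) (V r) (W r)) has_vector_derivative 0) (at t within T)"
proof -
  let ?D = "\<lambda>u v r. inner_at G (s t) (conn G (s t) (r *\<^sub>R s') u) v + inner_at G (s t) u (conn G (s t) (r *\<^sub>R s') v)"
  have F: "((\<lambda>r. inner_at G (s r) u v) has_derivative ?D u v) (at t within T)" for u v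
    by (rule has_derivative_compose[OF s[unfolded has_vector_derivative_def] has_derivative_inner_at[OF x]])
  have "((\<lambda>r. inner_at G (s r) (V r) (W r)) has_derivative (\<lambda>r. ?D (V t) (W t) r
      + inner_at G (s t) (r *\<^sub>R (- conn G (s t) s' (V t))) (W t) + inner_at G (s t) (V t) (r *\<^sub>R (- conn G (s t) s' (W t))))) (at t within T)"
    by (rule has_derivative_slots2[where F = "\<lambda>r. inner_at G (s r)" and F' = ?D,
          OF _ _ _ _ F V[unfolded has_vector_derivative_def] W[unfolded has_vector_derivative_def]])
      (intro multilinear_intros)+
  thus ?thesis
    by (simp add: has_vector_derivative_def linear_scale[OF linear_conn(1)] linear_scale[OF linear_inner_at(1)] linear_scale[OF linear_inner_at(2)]
        linear_neg[OF linear_inner_at(1)] linear_neg[OF linear_inner_at(2)])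
qed

end

section \<open>Consequences of \<nabla>R = 0 in a chart\<close>

locale symmetric_chart = chart_metric +
  assumes nabla_zero: "x \<in> U \<Longrightarrow> nabla_curv G x m i j k l = 0"
begin

text \<open>By \<nabla>R = 0 this is the derivative in direction \<open>m\<close> of R on fields
  with constant coordinates; see \<open>has_derivative_curv_form\<close>.\<close>

definition cov :: "real^'a \<Rightarrow> real^'a \<Rightarrow> real^'a \<Rightarrow> real^'a \<Rightarrow> real^'a \<Rightarrow> real^'a \<Rightarrow> real" where
  "cov x u v w z m = curv_form G x (conn G x m u) v w z + curv_form G x u (conn G x m v) w z
     + curv_form G x u v (conn G x m w) z + curv_form G x u v w (conn G x m z)"

lemma linear_cov:
  "linear (\<lambda>u. cov x u v w z m)" "linear (\<lambda>v. cov x u v w z m)" "linear (\<lambda>w. cov x u v w z m)"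
  "linear (\<lambda>z. cov x u v w z m)" "linear (cov x u v w z)"
  unfolding cov_def by (intro multilinear_intros)+

lemma has_derivative_curv_form:
  assumes x: "x \<in> U"
  shows "((\<lambda>y. curv_form G y u v w z) has_derivative cov x u v w z) (at x)"
proof -
  define D where "D i j k l = frechet_derivative (\<lambda>y. curv G y i j k l) (at x)" for i j k l
  define E where "E u v w z m = (\<Sum>i\<in>UNIV. \<Sum>j\<in>UNIV. \<Sum>k\<in>UNIV. \<Sum>l\<in>UNIV. D i j k l m * (u $ i) * (v $ j) * (w $ k) * (z $ l))"
    for u v w z :: "real^'a" and m
  have D: "((\<lambda>y. curv G y i j k l) has_derivative D i j k l) (at x)" for i j k l
    unfolding D_def by (rule smooth_on_has_derivative[OF smooth_curv x])
  have E: "((\<lambda>y. curv_form G y u v w z) has_derivative E u v w z) (at x)" for u v w z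
    unfolding curv_form_def E_def by (intro has_derivative_sum has_derivative_mult_left D)
  have lE: "linear (\<lambda>u. E u v w z m)" "linear (\<lambda>v. E u v w z m)" "linear (\<lambda>w. E u v w z m)" "linear (\<lambda>z. E u v w z m)" for u v w z m
    by (auto intro!: linearI simp: E_def ring_distribs sum.distrib sum_distrib_left mult_ac)
  have e: "curv_form G x (conn G x m u) v w z = (\<Sum>q\<in>UNIV. conn G x m u $ q *\<^sub>R curv_form G x (axis q 1) v w z)"
    "curv_form G x u (conn G x m v) w z = (\<Sum>q\<in>UNIV. conn G x m v $ q *\<^sub>R curv_form G x u (axis q 1) w z)"
    "curv_form G x u v (conn G x m w) z = (\<Sum>q\<in>UNIV. conn G x m w $ q *\<^sub>R curv_form G x u v (axis q 1) z)"
    "curv_form G x u v w (conn G x m z) = (\<Sum>q\<in>UNIV. conn G x m z $ q *\<^sub>R curv_form G x u v w (axis q 1))" for m u v w z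
    by (rule linear_expansion[OF linear_curv_form(1)] linear_expansion[OF linear_curv_form(2)]
        linear_expansion[OF linear_curv_form(3)] linear_expansion[OF linear_curv_form(4)])+
  \<comment> \<open>\<open>nabla_zero\<close> speaks of components, so the comparison is made on
    coordinate axes and extended by multilinearity.\<close>
  have ax: "E a b c d m = cov x a b c d m"
    if "a \<in> range (\<lambda>i. axis i 1)" "b \<in> range (\<lambda>i. axis i 1)" "c \<in> range (\<lambda>i. axis i 1)" "d \<in> range (\<lambda>i. axis i 1)" for a b c d m
  proof (rule linear_eq_spanning[OF has_derivative_linear[OF E] linear_cov(5) span_axes])
    obtain i j k l where abcd: "a = axis i 1" "b = axis j 1" "c = axis k 1" "d = axis l 1" using \<open>a \<in> _\<close> \<open>b \<in> _\<close> \<open>c \<in> _\<close> \<open>d \<in> _\<close> by blast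
    fix m' :: "real^'a" assume "m' \<in> range (\<lambda>i. axis i 1)"
    then obtain p where p: "m' = axis p 1" by blast
    have "E a b c d m' = D i j k l m'"
      by (simp add: E_def abcd axis_def if_distrib[of "\<lambda>r. _ * r"] cong: if_cong)
    also have "\<dots> = partial_deriv p (\<lambda>y. curv G y i j k l) x" by (simp add: p D_def partial_deriv_def)
    also have "\<dots> = (\<Sum>q\<in>UNIV. christoffel G x q p i * curv G x q j k l + christoffel G x q p j * curv G x i q k l
        + christoffel G x q p k * curv G x i j q l + christoffel G x q p l * curv G x i j k q)"
      using nabla_zero[OF x, of p i j k l] by (simp add: nabla_curv_def)
    also have "\<dots> = cov x a b c d m'"
      unfolding cov_def abcd p e
      by (simp add: conn_axis curv_form_axis sum.distrib)
    finally show "E a b c d m' = cov x a b c d m'" .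
  qed
  have "E u v w z m = cov x u v w z m" for m
    by (rule multilinear4_eqI[OF span_axes lE linear_cov(1-4) ax])
  hence "E u v w z = cov x u v w z" by (rule ext)
  thus ?thesis using E[of u v w z] by (simp only:)
qed

lemma curv_form_parallel:
  assumes x: "s t \<in> U" and s: "(s has_vector_derivative s') (at t within T)"
    and V: "\<And>i. (V i has_vector_derivative - conn G (s t) s' (V i t)) (at t within T)"
  shows "((\<lambda>r. curv_form G (s r) (V i r) (V j r) (V k r) (V l r)) has_vector_derivative 0) (at t within T)"
proof -
  let ?D = "\<lambda>u v w z r. cov (s t) u v w z (r *\<^sub>R s')" and ?V = "\<lambda>i r. r *\<^sub>R (- conn G (s t) s' (V i t))"
  have F: "((\<lambda>r. curv_form G (s r) u v w z) has_derivative ?D u v w z) (at t within T)" for u v w z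
    by (rule has_derivative_compose[OF s[unfolded has_vector_derivative_def] has_derivative_curv_form[OF x]])
  have V': "(V i has_derivative ?V i) (at t within T)" for i using V[unfolded has_vector_derivative_def] .
  have "((\<lambda>r. curv_form G (s r) (V i r) (V j r) (V k r) (V l r)) has_derivative (\<lambda>r. ?D (V i t) (V j t) (V k t) (V l t) r
      + curv_form G (s t) (?V i r) (V j t) (V k t) (V l t) + curv_form G (s t) (V i t) (?V j r) (V k t) (V l t)
      + curv_form G (s t) (V i t) (V j t) (?V k r) (V l t) + curv_form G (s t) (V i t) (V j t) (V k t) (?V l r))) (at t within T)"
    by (rule has_derivative_slots4[where F = "\<lambda>r. curv_form G (s r)" and F' = ?D, OF _ _ _ _ _ _ _ _ F V' V' V' V'])
      (intro multilinear_intros linear_cov)+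
  moreover have "?D (V i t) (V j t) (V k t) (V l t) r
      + curv_form G (s t) (?V i r) (V j t) (V k t) (V l t) + curv_form G (s t) (V i t) (?V j r) (V k t) (V l t)
      + curv_form G (s t) (V i t) (V j t) (?V k r) (V l t) + curv_form G (s t) (V i t) (V j t) (V k t) (?V l r) = 0" for r
    unfolding cov_def linear_scale[OF linear_conn(1)]
      linear_scale[OF linear_curv_form(1)] linear_scale[OF linear_curv_form(2)] linear_scale[OF linear_curv_form(3)] linear_scale[OF linear_curv_form(4)]
      linear_neg[OF linear_curv_form(1)] linear_neg[OF linear_curv_form(2)] linear_neg[OF linear_curv_form(3)] linear_neg[OF linear_curv_form(4)]
    by simp
  ultimately show ?thesis by (simp add: has_vector_derivative_def)
qed

text \<open>The second derivative of R on constant fields, obtained by differentiating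
  \<open>cov\<close> once more, is symmetric. All terms cancel in this symmetry except the curvature
  acting on the four slots, which is R(p,m).R = 0.\<close>

lemma ricci_identity:
  assumes x: "x \<in> U"
  shows "curv_form G x (riem G x p m u) v w z + curv_form G x u (riem G x p m v) w z
    + curv_form G x u v (riem G x p m w) z + curv_form G x u v w (riem G x p m z) = 0"
proof -
  let ?d = "\<lambda>a a' b b' c c' d d' p. cov x a b c d p + curv_form G x a' b c d + curv_form G x a b' c d + curv_form G x a b c' d + curv_form G x a b c d'"
  let ?C = "conn G x" and ?DC = "dconn G x"
  \<comment> \<open>Each summand of \<open>cov\<close> has one slot that varies with the point; the
    zeros are the derivatives of the constant slots.\<close>
  let ?f'' = "\<lambda>m p. ?d (?C m u) (?DC p m u) v 0 w 0 z 0 p + ?d u 0 (?C m v) (?DC p m v) w 0 z 0 p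
    + ?d u 0 v 0 (?C m w) (?DC p m w) z 0 p + ?d u 0 v 0 w 0 (?C m z) (?DC p m z) p"
  have slots: "((\<lambda>y. curv_form G y (a y) (b y) (c y) (d y)) has_derivative (\<lambda>p. ?d (a x) (a' p) (b x) (b' p) (c x) (c' p) (d x) (d' p) p)) (at x)"
    if "(a has_derivative a') (at x)" "(b has_derivative b') (at x)" "(c has_derivative c') (at x)" "(d has_derivative d') (at x)" for a a' b b' c c' d d'
    by (rule has_derivative_slots4[where F = "curv_form G" and F' = "\<lambda>u v w z. cov x u v w z", OF _ _ _ _ _ _ _ _ has_derivative_curv_form[OF x] that])
      (intro multilinear_intros linear_cov)+
  have d: "((\<lambda>y. cov y u v w z m) has_derivative ?f'' m) (at x)" for m
    unfolding cov_def[of _ u v w z m] by (intro has_derivative_add slots has_derivative_const has_derivative_conn[OF x])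
  have "smooth_on U (\<lambda>y. curv_form G y u v w z)"
    unfolding curv_form_def by (intro smooth_on_sum smooth_on_mult smooth_on_const smooth_curv open_U)
  from second_derivative_symmetric_real[OF open_U x this has_derivative_curv_form d]
  have "?f'' m p = ?f'' p m" .
  thus ?thesis
    unfolding cov_def riem_def
      linear_0[OF linear_curv_form(1)] linear_0[OF linear_curv_form(2)] linear_0[OF linear_curv_form(3)] linear_0[OF linear_curv_form(4)]
      linear_add[OF linear_curv_form(1)] linear_add[OF linear_curv_form(2)] linear_add[OF linear_curv_form(3)] linear_add[OF linear_curv_form(4)]
      linear_diff[OF linear_curv_form(1)] linear_diff[OF linear_curv_form(2)] linear_diff[OF linear_curv_form(3)] linear_diff[OF linear_curv_form(4)]
    by linarith
qed

end

section \<open>Connection and curvature under a change of chart\<close>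

locale chart_change = A: chart_metric G U + B: chart_metric G' U'
  for G :: "'n::finite metric" and U and G' :: "'n metric" and U' +
  fixes \<phi> :: "real^'n \<Rightarrow> real^'n" and W
  assumes open_W: "open W" and WU: "W \<subseteq> U" and \<phi>W: "\<phi> ` W \<subseteq> U'" and smooth_\<phi>: "smooth_on W \<phi>"
    and isometry: "x \<in> W \<Longrightarrow> inner_at G x u v = inner_at G' (\<phi> x) (frechet_derivative \<phi> (at x) u) (frechet_derivative \<phi> (at x) v)"
begin

text \<open>Unlike the Frechet derivative, this expression is linear in \<open>v\<close> also outside \<open>W\<close>.\<close>

definition J :: "real^'n \<Rightarrow> real^'n \<Rightarrow> real^'n" where
  "J x v = (\<Sum>i\<in>UNIV. v $ i *\<^sub>R partial_deriv i \<phi> x)"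

definition H :: "real^'n \<Rightarrow> real^'n \<Rightarrow> real^'n \<Rightarrow> real^'n" where
  "H x u v = frechet_derivative (\<lambda>y. J y v) (at x) u"

lemma J_eq: "x \<in> W \<Longrightarrow> frechet_derivative \<phi> (at x) = J x"
  unfolding J_def by (rule ext) (rule frechet_derivative_partial[OF smooth_on_differentiable[OF smooth_\<phi>]])

lemma isometry_J: "x \<in> W \<Longrightarrow> inner_at G x u v = inner_at G' (\<phi> x) (J x u) (J x v)"
  using isometry[of x u v] J_eq by simp

lemma in_U: "x \<in> W \<Longrightarrow> x \<in> U" and in_U': "x \<in> W \<Longrightarrow> \<phi> x \<in> U'"
  using WU \<phi>W by auto

lemma linear_J: "linear (J x)"
  unfolding J_def by (rule linear_scaled_axis_sum)

lemma has_derivative_\<phi>: "x \<in> W \<Longrightarrow> (\<phi> has_derivative J x) (at x)"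
  using smooth_on_has_derivative[OF smooth_\<phi>, of x] J_eq by simp

lemma smooth_J: "smooth_on W (\<lambda>y. J y v)"
  unfolding J_def by (rule smooth_on_scaled_partials[OF open_W smooth_\<phi>])

lemma has_derivative_J: "x \<in> W \<Longrightarrow> ((\<lambda>y. J y v) has_derivative (\<lambda>u. H x u v)) (at x)"
  using smooth_on_has_derivative[OF smooth_J] by (simp add: H_def)

lemma H_commute: "x \<in> W \<Longrightarrow> H x u v = H x v u"
  by (rule second_derivative_symmetric[OF open_W _ smooth_\<phi> has_derivative_\<phi>, where f'' = "\<lambda>m p. H x p m" and x = x])
    (assumption | rule has_derivative_J)+

lemma linear_H:
  assumes "x \<in> W"
  shows "linear (H x u)"
proof -
  have "(\<lambda>v. H x v u) = H x u" by (rule ext) (rule H_commute[OF assms])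
  thus ?thesis using has_derivative_linear[OF has_derivative_J[OF assms, of u]] by (simp only:)
qed

text \<open>The derivative of the isometry relation, with \<open>H\<close> the second derivative of
  the transition map.\<close>

lemma dmet_transform:
  assumes x: "x \<in> W"
  shows "dmet G x m v w = inner_at G' (\<phi> x) (conn G' (\<phi> x) (J x m) (J x v) + H x m v) (J x w)
    + inner_at G' (\<phi> x) (conn G' (\<phi> x) (J x m) (J x w) + H x m w) (J x v)"
proof -
  let ?g = "inner_at G' (\<phi> x)" and ?D = "\<lambda>v w m. inner_at G' (\<phi> x) (conn G' (\<phi> x) (J x m) v) w + inner_at G' (\<phi> x) v (conn G' (\<phi> x) (J x m) w)"
  have F: "((\<lambda>y. inner_at G' (\<phi> y) v w) has_derivative ?D v w) (at x)" for v w
    by (rule has_derivative_compose[OF has_derivative_\<phi>[OF x] B.has_derivative_inner_at[OF in_U'[OF x]]])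
  have "((\<lambda>y. inner_at G' (\<phi> y) (J y v) (J y w)) has_derivative (\<lambda>m. ?D (J x v) (J x w) m + ?g (H x m v) (J x w) + ?g (J x v) (H x m w))) (at x)"
    by (rule has_derivative_slots2[where F = "\<lambda>y. inner_at G' (\<phi> y)" and F' = ?D, OF _ _ _ _ F has_derivative_J[OF x] has_derivative_J[OF x]])
      (intro multilinear_intros)+
  hence "((\<lambda>y. inner_at G y v w) has_derivative (\<lambda>m. ?D (J x v) (J x w) m + ?g (H x m v) (J x w) + ?g (J x v) (H x m w))) (at x)"
    by (rule has_derivative_transform_within_open[OF _ open_W x]) (rule isometry_J[symmetric])
  from has_derivative_unique[OF A.has_derivative_inner_at_dmet[OF in_U[OF x]] this]
  have "dmet G x m v w = ?D (J x v) (J x w) m + ?g (H x m v) (J x w) + ?g (J x v) (H x m w)" by (rule fun_cong)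
  thus ?thesis
    unfolding linear_add[OF linear_inner_at(1)]
    using B.inner_at_commute[OF in_U'[OF x], of "J x v" "conn G' (\<phi> x) (J x m) (J x w)"] B.inner_at_commute[OF in_U'[OF x], of "J x v" "H x m w"]
    by linarith
qed

lemma surj_J:
  assumes x: "x \<in> W"
  shows "surj (J x)"
proof -
  have "u = 0" if "J x u = 0" for u
  proof (rule ccontr)
    assume "u \<noteq> 0"
    hence "inner_at G x u u > 0" by (rule A.pos_G[OF in_U[OF x]])
    thus False unfolding isometry_J[OF x] that by (simp add: inner_at_def)
  qed
  hence "inj (J x)" using linear_injective_0[OF linear_J] by blast
  thus ?thesis by (rule linear_inj_imp_surj[OF linear_J])
qed

text \<open>Uniqueness of the Levi-Civita connection: the right side, lowered by the metric as
  \<open>a\<close>, is symmetric in its first two arguments and splits the derivative of the metric,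
  and the Koszul formula solves for such an \<open>a\<close>.\<close>

lemma conn_transform:
  assumes x: "x \<in> W"
  shows "J x (conn G x u v) = conn G' (\<phi> x) (J x u) (J x v) + H x u v"
proof (rule B.inner_at_nondegenerate[OF in_U'[OF x]])
  fix w'
  obtain w where w: "w' = J x w" using surj_J[OF x] by (rule surjE)
  define a where "a u v w = inner_at G' (\<phi> x) (conn G' (\<phi> x) (J x u) (J x v) + H x u v) (J x w)" for u v w
  have a: "a u v w = a v u w" for u v w
    by (simp only: a_def B.conn_commute[OF in_U'[OF x], of "J x u" "J x v"] H_commute[OF x, of u v])
  have d: "dmet G x m v w = a m v w + a m w v" for m v w
    unfolding a_def by (rule dmet_transform[OF x])
  have "2 * inner_at G x w (conn G x u v) = 2 * a u v w"
    using A.koszul[OF in_U[OF x], of w u v] d[of u v w] d[of v u w] d[of w u v] a[of v u w] a[of w u v] a[of w v u] by linarith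
  hence "inner_at G' (\<phi> x) w' (J x (conn G x u v)) = a u v w" unfolding w by (simp add: isometry_J[OF x])
  thus "inner_at G' (\<phi> x) w' (J x (conn G x u v)) = inner_at G' (\<phi> x) w' (conn G' (\<phi> x) (J x u) (J x v) + H x u v)"
    unfolding a_def w using B.inner_at_commute[OF in_U'[OF x]] by metis
qed

text \<open>The law for the connection is differentiated once. Antisymmetrising in \<open>u\<close>
  and \<open>v\<close> removes the third derivative \<open>K\<close> and the terms containing
  \<open>H\<close>.\<close>

lemma riem_transform:
  assumes x: "x \<in> W"
  shows "J x (riem G x u v z) = riem G' (\<phi> x) (J x u) (J x v) (J x z)"
proof -
  let ?C = "conn G x" and ?C' = "conn G' (\<phi> x)" and ?J = "J x" and ?H = "H x" and ?D' = "dconn G' (\<phi> x)"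
  define K where "K p m = frechet_derivative (\<lambda>y. H y m z) (at x) p" for p m
  have smH: "smooth_on W (\<lambda>y. H y m z)" for m
    unfolding H_def by (rule smooth_on_frechet_derivative[OF open_W smooth_J])
  have K: "((\<lambda>y. H y m z) has_derivative (\<lambda>p. K p m)) (at x)" for m
    using smooth_on_has_derivative[OF smH x] by (simp add: K_def)
  have K_commute: "K u v = K v u"
    by (rule second_derivative_symmetric[OF open_W x smooth_J has_derivative_J[of _ z], where f'' = "\<lambda>m p. K p m"])
      (assumption | rule K)+
  have d: "?H u (?C v z) + ?J (dconn G x u v z) = ?D' (?J u) (?J v) (?J z) + ?C' (?H u v) (?J z) + ?C' (?J v) (?H u z) + K u v" for u v
  proof -
    have l: "((\<lambda>y. J y (conn G y v z)) has_derivative (\<lambda>u. ?H u (?C v z) + ?J (dconn G x u v z))) (at x)"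
      by (rule has_derivative_slot[where F = J and F' = "\<lambda>v u. ?H u v"])
        (rule linear_J linear_H x has_derivative_J A.has_derivative_conn in_U)+
    have F: "((\<lambda>y. conn G' (\<phi> y) a b) has_derivative (\<lambda>m. ?D' (?J m) a b)) (at x)" for a b
      by (rule has_derivative_compose[OF has_derivative_\<phi>[OF x] B.has_derivative_conn[OF in_U'[OF x]]])
    have "((\<lambda>y. conn G' (\<phi> y) (J y v) (J y z) + H y v z) has_derivative
        (\<lambda>u. (?D' (?J u) (?J v) (?J z) + ?C' (?H u v) (?J z) + ?C' (?J v) (?H u z)) + K u v)) (at x)"
      by (intro has_derivative_add K has_derivative_slots2[where F = "\<lambda>y. conn G' (\<phi> y)" and F' = "\<lambda>a b m. ?D' (?J m) a b"]
        linear_conn F has_derivative_J x B.linear_dconn in_U')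
    hence "((\<lambda>y. J y (conn G y v z)) has_derivative
        (\<lambda>u. (?D' (?J u) (?J v) (?J z) + ?C' (?H u v) (?J z) + ?C' (?J v) (?H u z)) + K u v)) (at x)"
      by (rule has_derivative_transform_within_open[OF _ open_W x]) (rule conn_transform[symmetric])
    from has_derivative_unique[OF l this] show ?thesis by (rule fun_cong)
  qed
  have e: "?J (?C u (?C v z)) = ?C' (?J u) (?C' (?J v) (?J z)) + ?C' (?J u) (?H v z) + ?H u (?C v z)" for u v
    unfolding conn_transform[OF x] linear_add[OF linear_conn(2)] by (rule refl)
  have d': "?J (dconn G x u v z) = ?D' (?J u) (?J v) (?J z) + ?C' (?H u v) (?J z) + ?C' (?J v) (?H u z) + K u v - ?H u (?C v z)" for u v
    using d[of u v] by (simp add: eq_diff_eq add.commute)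
  show ?thesis
    unfolding riem_def linear_add[OF linear_J] linear_diff[OF linear_J] d' e H_commute[OF x, of v u] K_commute by simp
qed

lemma curv_form_transform:
  assumes x: "x \<in> W"
  shows "curv_form G x u v w z = curv_form G' (\<phi> x) (J x u) (J x v) (J x w) (J x z)"
  unfolding A.curv_form_riem[OF in_U[OF x]] B.curv_form_riem[OF in_U'[OF x]] isometry_J[OF x] riem_transform[OF x] ..

end

section \<open>Orthonormal frames\<close>

text \<open>Orthonormality reads E^T G E = 1 for the matrix E of the frame; a one-sided inverse of a
  square matrix is two-sided, so E E^T G = 1.\<close>

lemma frame_expansion:
  fixes e :: "'n::finite \<Rightarrow> real^'n"
  assumes e: "orthonormal_frame G x e"
  shows "v = (\<Sum>k\<in>UNIV. inner_at G x (e k) v *\<^sub>R e k)"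
proof -
  define E :: "real^'n^'n" where "E = (\<chi> a k. e k $ a)"
  have "(transpose E ** (G x ** E)) $ i $ j = inner_at G x (e i) (e j)" for i j
    by (simp add: E_def inner_at_def matrix_matrix_mult_def inner_vec_def matrix_vector_mult_def transpose_def)
  hence "transpose E ** (G x ** E) = mat 1"
    using e by (simp add: vec_eq_iff mat_def orthonormal_frame_def)
  hence "(transpose E ** G x) ** E = mat 1" by (simp add: matrix_mul_assoc)
  hence "E ** (transpose E ** G x) = mat 1" using matrix_left_right_inverse by blast
  hence "v = E *v (transpose E *v (G x *v v))" by (simp add: matrix_vector_mul_assoc matrix_mul_assoc)
  moreover have "(E *v (transpose E *v (G x *v v))) $ a = (\<Sum>k\<in>UNIV. inner_at G x (e k) v *\<^sub>R e k) $ a" for a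
    unfolding matrix_vector_mult_def[of E] matrix_vector_mult_def[of "transpose E"]
    by (simp add: E_def transpose_def inner_at_def inner_vec_def mult.commute)
  ultimately show ?thesis unfolding vec_eq_iff by (metis (no_types))
qed

lemma frame_spanning:
  assumes "orthonormal_frame G x e"
  shows "span (range e) = UNIV"
proof -
  have "v \<in> span (range e)" for v
    by (subst frame_expansion[OF assms, of v]) (intro span_sum span_scale span_base rangeI)
  thus ?thesis by blast
qed

lemma linear_frame_expansion:
  assumes "orthonormal_frame G x e" "linear L"
  shows "L v = (\<Sum>k\<in>UNIV. inner_at G x (e k) v *\<^sub>R L (e k))"
proof -
  have "L v = L (\<Sum>k\<in>UNIV. inner_at G x (e k) v *\<^sub>R e k)"
    by (rule arg_cong[where f = L]) (rule frame_expansion[OF assms(1)])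
  thus ?thesis by (simp add: linear_sum[OF assms(2)] linear_scale[OF assms(2)])
qed

text \<open>The projection fixes tensors that are already trace-free symmetric; for an Einstein
  curvature tensor all values on \<open>tracefree_sym\<close> are.\<close>

lemma curv_op_second_eq:
  assumes "second_kind_op (\<lambda>i j k l. curv_form G x (e i) (e j) (e k) (e l)) h \<in> tracefree_sym"
  shows "curv_op_second G x e h = second_kind_op (\<lambda>i j k l. curv_form G x (e i) (e j) (e k) (e l)) h"
proof -
  have "R_bar G x e h = second_kind_op (\<lambda>i j k l. curv_form G x (e i) (e j) (e k) (e l)) h"
    by (simp add: R_bar_def second_kind_op_def)
  thus ?thesis using orth_proj_mem[OF assms subspace_tracefree_sym] by (simp add: curv_op_second_def)
qed

context chart_metric
begin

lemma orthonormal_frame_exists: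
  assumes x: "x \<in> U"
  shows "\<exists>e. orthonormal_frame G x e"
proof -
  obtain b :: "'n \<Rightarrow> real^'n" and s where b: "onb UNIV UNIV b" and s: "\<And>i. G x *v b i = s i *\<^sub>R b i"
    by (rule symmetric_eigenbasis[OF sym_G[OF x]]) (rule that)
  have bb: "b i \<bullet> b j = (if i = j then 1 else 0)" for i j using onb_D(3)[OF b] by simp
  have "b i \<noteq> 0" for i using bb[of i i] by auto
  hence sp: "s i > 0" for i using pos_G[OF x, of "b i"] bb[of i i] by (simp add: inner_at_def s)
  have "inner_at G x ((1 / sqrt (s i)) *\<^sub>R b i) ((1 / sqrt (s j)) *\<^sub>R b j) = (if i = j then 1 else 0)" for i j
    using sp[of i] by (cases "i = j") (simp_all add: inner_at_def matrix_vector_mult_scaleR s bb)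
  thus ?thesis unfolding orthonormal_frame_def by (intro exI[of _ "\<lambda>i. (1 / sqrt (s i)) *\<^sub>R b i"]) simp
qed

lemma frame_trace:
  fixes B :: "real^'n \<Rightarrow> real^'n \<Rightarrow> real"
  assumes x: "x \<in> U" and e: "orthonormal_frame G x e" and f: "orthonormal_frame G x f"
    and B: "\<And>v. linear (\<lambda>u. B u v)" "\<And>u. linear (B u)"
  shows "(\<Sum>k\<in>UNIV. B (e k) (e k)) = (\<Sum>k\<in>UNIV. B (f k) (f k))"
proof -
  have "(\<Sum>k\<in>UNIV. B (e k) (e k)) = (\<Sum>k\<in>UNIV. \<Sum>i\<in>UNIV. inner_at G x (f i) (e k) *\<^sub>R B (f i) (e k))"
    by (intro sum.cong refl linear_frame_expansion[OF f B(1)])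
  also have "\<dots> = (\<Sum>i\<in>UNIV. \<Sum>k\<in>UNIV. inner_at G x (e k) (f i) *\<^sub>R B (f i) (e k))"
    unfolding inner_at_commute[OF x, of "e _" "f _"] by (rule sum.swap)
  also have "\<dots> = (\<Sum>i\<in>UNIV. B (f i) (f i))"
    by (intro sum.cong refl linear_frame_expansion[OF e B(2), symmetric])
  finally show ?thesis .
qed

text \<open>In dimension two the antisymmetries leave a single component.\<close>

lemma curv_form_two_dim:
  fixes e :: "'n \<Rightarrow> real^'n"
  assumes x: "x \<in> U" and two: "CARD('n) = 2" 
  shows "\<exists>\<kappa>. \<forall>i j k l. curv_form G x (e i) (e j) (e k) (e l) = \<kappa> * ((if i = k \<and> j = l then 1 else 0) - (if i = l \<and> j = k then 1 else 0))"
proof -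
  obtain a b :: 'n where ab: "UNIV = {a, b}" "a \<noteq> b" using two by (metis card_2_iff)
  let ?R = "\<lambda>i j k l. curv_form G x (e i) (e j) (e k) (e l)"
  have z: "?R i i k l = 0" "?R i j k k = 0" for i j k l
    using curv_form_antisym12[OF x, of "e i" "e i" "e k" "e l"] curv_form_diagonal[OF x] by simp_all
  have s: "?R b a a b = - ?R a b a b" "?R a b b a = - ?R a b a b" "?R b a b a = ?R a b a b"
    using curv_form_antisym12[OF x, of "e b" "e a" "e a" "e b"] curv_form_antisym34[OF x, of "e a" "e b" "e b" "e a"]
      curv_form_antisym12[OF x, of "e b" "e a" "e b" "e a"] by simp_all
  have ab': "i = a \<or> i = b" for i using ab(1) by blast
  have "?R i j k l = ?R a b a b * ((if i = k \<and> j = l then 1 else 0) - (if i = l \<and> j = k then 1 else 0))" for i j k l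
    using ab'[of i] ab'[of j] ab'[of k] ab'[of l]
    by (elim disjE; simp add: z s ab(2) ab(2)[symmetric])
  thus ?thesis by blast
qed

lemma curv_form_from_frame:
  assumes x: "x \<in> U" and e: "orthonormal_frame G x e"
    and R: "\<And>i j k l. curv_form G x (e i) (e j) (e k) (e l) = \<kappa> * ((if i = k \<and> j = l then 1 else 0) - (if i = l \<and> j = k then 1 else 0))"
  shows "curv_form G x u v w z = \<kappa> * (inner_at G x u w * inner_at G x v z - inner_at G x u z * inner_at G x v w)"
proof (rule multilinear4_eqI[OF frame_spanning[OF e], where f = "curv_form G x"
      and g = "\<lambda>u v w z. \<kappa> * (inner_at G x u w * inner_at G x v z - inner_at G x u z * inner_at G x v w)"])
  fix a b c d assume "a \<in> range e" "b \<in> range e" "c \<in> range e" "d \<in> range e"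
  then obtain i j k l where abcd: "a = e i" "b = e j" "c = e k" "d = e l" by blast
  have conj: "(if P \<and> Q then 1 else 0) = (if P then 1 else 0) * (if Q then 1 else (0::real))" for P Q by simp
  have io: "inner_at G x (e i) (e j) = (if i = j then 1 else 0)" for i j
    using e unfolding orthonormal_frame_def by blast
  show "curv_form G x a b c d = \<kappa> * (inner_at G x a c * inner_at G x b d - inner_at G x a d * inner_at G x b c)"
    by (simp only: abcd R io conj)
qed (rule linear_curv_form | rule linearI | simp add: linear_add[OF linear_inner_at(1)] linear_add[OF linear_inner_at(2)]
    linear_scale[OF linear_inner_at(1)] linear_scale[OF linear_inner_at(2)] algebra_simps)+

end

context symmetric_chart
begin

lemma einstein_curv_frame:
  assumes x: "x \<in> U" and e: "orthonormal_frame G x e"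
    and ein: "\<And>i j. (\<Sum>k\<in>UNIV. curv_form G x (e i) (e k) (e j) (e k)) = (if i = j then \<rho> else 0)"
  shows "einstein_curv (\<lambda>i j k l. curv_form G x (e i) (e j) (e k) (e l)) \<rho>"
proof (rule einstein_curv.intro)
  let ?R = "\<lambda>i j k l. curv_form G x (e i) (e j) (e k) (e l)"
  show "?R i j k l = - ?R j i k l" for i j k l by (rule curv_form_antisym12[OF x])
  show "?R i j k l = - ?R i j l k" for i j k l by (rule curv_form_antisym34[OF x])
  show "?R i j k l = ?R k l i j" for i j k l by (rule curv_form_pair[OF x])
  show "?R i j k l + ?R j k i l + ?R k i j l = 0" for i j k l by (rule curv_form_bianchi[OF x])
  show "(\<Sum>k\<in>UNIV. ?R i k j k) = (if i = j then \<rho> else 0)" for i j by (rule ein)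
  fix a b i j k l
  \<comment> \<open>The component of R(e a, e b) e i along \<open>e p\<close>; the sign stems from
    the order of the last two arguments of \<open>curv_form\<close>.\<close>
  have r: "inner_at G x (e p) (riem G x (e a) (e b) (e i)) = - ?R a b i p" for p i
    using curv_form_antisym34[OF x, of "e a" "e b" "e i" "e p"] by (simp add: curv_form_riem[OF x, of _ _ "e p"])
  have ex: "L (riem G x (e a) (e b) (e i)) = - (\<Sum>p\<in>UNIV. ?R a b i p * L (e p))" if "linear L" for L :: "real^'a \<Rightarrow> real" and i
    unfolding linear_frame_expansion[OF e that, of "riem G x (e a) (e b) (e i)"] r by (simp add: sum_negf)
  show "(\<Sum>p\<in>UNIV. ?R a b i p * ?R p j k l + ?R a b j p * ?R i p k l + ?R a b k p * ?R i j p l + ?R a b l p * ?R i j k p) = 0"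
    using ricci_identity[OF x, of "e a" "e b" "e i" "e j" "e k" "e l"]
    unfolding ex[OF linear_curv_form(1), where i = i] ex[OF linear_curv_form(2), where i = j] ex[OF linear_curv_form(3), where i = k] ex[OF linear_curv_form(4), where i = l]
    by (simp add: sum.distrib)
qed

text \<open>Dimension two is treated apart because \<open>pointwise_rigidity\<close> starts at
  three. Nonpositivity is reduced to nonnegativity by passing to - R.\<close>

lemma pointwise_constant_curvature:
  assumes dim: "CARD('a) \<ge> 2" and x: "x \<in> U" and e: "orthonormal_frame G x e"
    and ein: "\<And>i j. (\<Sum>k\<in>UNIV. curv_form G x (e i) (e k) (e j) (e k)) = (if i = j then \<rho> else 0)"
    and N: "1 \<le> N" "N < 3 * real CARD('a) / 2 * ((real CARD('a) + 2) / (real CARD('a) + 4))"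
    and low: "lowest_eigenvalue_sum N (eigenvalue_list tracefree_sym (curv_op_second G x e)) \<ge> 0 \<or>
      lowest_eigenvalue_sum N (eigenvalue_list tracefree_sym (\<lambda>h. - curv_op_second G x e h)) \<ge> 0"
  shows "\<exists>\<kappa>. \<forall>u v w z. curv_form G x u v w z = \<kappa> * (inner_at G x u w * inner_at G x v z - inner_at G x u z * inner_at G x v w)"
proof -
  let ?R = "\<lambda>i j k l. curv_form G x (e i) (e j) (e k) (e l)"
  have "\<exists>\<kappa>. \<forall>i j k l. ?R i j k l = \<kappa> * ((if i = k \<and> j = l then 1 else 0) - (if i = l \<and> j = k then 1 else 0))"
  proof (cases "CARD('a) = 2")
    case True
    show ?thesis by (rule curv_form_two_dim[OF x True])
  next
    case False
    hence dim3: "3 \<le> CARD('a)" using dim by simp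
    interpret E: einstein_curv ?R \<rho> by (rule einstein_curv_frame[OF x e ein])
    from low show ?thesis
    proof
      assume "lowest_eigenvalue_sum N (eigenvalue_list tracefree_sym (curv_op_second G x e)) \<ge> 0"
      from E.pointwise_rigidity[OF dim3 N curv_op_second_eq this] show ?thesis by blast
    next
      assume l: "lowest_eigenvalue_sum N (eigenvalue_list tracefree_sym (\<lambda>h. - curv_op_second G x e h)) \<ge> 0"
      \<comment> \<open>The conditions are linear in R and \<rho>, except that
        \<open>parallel_R\<close> is quadratic in R and so unaffected by the sign.\<close>
      have neg: "einstein_curv (\<lambda>i j k l. - ?R i j k l) (- \<rho>)"
      proof (rule einstein_curv.intro)
        show "- ?R i j k l = - (- ?R j i k l)" for i j k l using E.a12[of i j k l] by linarith
        show "- ?R i j k l = - (- ?R i j l k)" for i j k l using E.a34[of i j k l] by linarith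
        show "- ?R i j k l = - ?R k l i j" for i j k l using E.pair[of i j k l] by linarith
        show "- ?R i j k l + - ?R j k i l + - ?R k i j l = 0" for i j k l using E.bianchi_R[of i j k l] by linarith
        show "(\<Sum>k\<in>UNIV. - ?R i k j k) = (if i = j then - \<rho> else 0)" for i j using E.einstein_R[of i j] by (simp add: sum_negf)
        show "(\<Sum>p\<in>UNIV. - ?R a b i p * - ?R p j k l + - ?R a b j p * - ?R i p k l + - ?R a b k p * - ?R i j p l + - ?R a b l p * - ?R i j k p) = 0" for a b i j k l
          using E.parallel_R[of a b i j k l] by simp
      qed
      have op: "second_kind_op (\<lambda>i j k l. - ?R i j k l) h = - second_kind_op ?R h" for h
        by (simp add: second_kind_op_def vec_eq_iff sum_negf)
      have T: "- curv_op_second G x e h = second_kind_op (\<lambda>i j k l. - ?R i j k l) h"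
        if "second_kind_op (\<lambda>i j k l. - ?R i j k l) h \<in> tracefree_sym" for h
      proof -
        have "- second_kind_op (\<lambda>i j k l. - ?R i j k l) h \<in> tracefree_sym" by (rule subspace_neg[OF subspace_tracefree_sym that])
        hence "second_kind_op ?R h \<in> tracefree_sym" unfolding op by (simp only: minus_minus)
        thus ?thesis unfolding op by (simp only: curv_op_second_eq)
      qed
      define C where "C = - \<rho> / (real CARD('a) - 1)"
      have "- ?R i j k l = C * ((if i = k \<and> j = l then 1 else 0) - (if i = l \<and> j = k then 1 else 0))" for i j k l
        unfolding C_def by (rule einstein_curv.pointwise_rigidity[OF neg dim3 N T l])
      hence "?R i j k l = - C * ((if i = k \<and> j = l then 1 else 0) - (if i = l \<and> j = k then 1 else 0))" for i j k l
        by (metis minus_minus mult_minus_left)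
      thus ?thesis by blast
    qed
  qed
  thus ?thesis using curv_form_from_frame[OF x e] by metis
qed

end

section \<open>Parallel transport and holonomy\<close>

text \<open>Induction on the number of subdivision points below \<open>t\<close>, stepping down to
  the nearest one.\<close>

lemma chain_constant_on_subdivision:
  assumes S: "finite S" "{0, 1} \<subseteq> S" "S \<subseteq> {0..1}"
    and F: "\<And>a b. (a, b) \<in> segments S \<Longrightarrow> F a = F b"
  shows "F (0::real) = F 1"
proof -
  have all: "t \<in> S \<Longrightarrow> F t = F 0" for t
  proof (induction "card {s\<in>S. s < t}" arbitrary: t rule: less_induct)
    case less
    show ?case
    proof (cases "t = 0")
      case False
      hence "0 < t" using less.prems S(3) by force
      hence ne: "0 \<in> {s\<in>S. s < t}" using S(2) by simp
      have fin: "finite {s\<in>S. s < t}" using S(1) by simp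
      define a where "a = Max {s\<in>S. s < t}"
      have a: "a \<in> S" "a < t" using Max_in[OF fin] ne by (auto simp: a_def)
      have max: "s \<le> a" if "s \<in> S" "s < t" for s unfolding a_def by (rule Max_ge[OF fin]) (use that in simp)
      have "(a, t) \<in> segments S" using a less.prems max by (force simp: segments_def)
      moreover have "card {s\<in>S. s < a} < card {s\<in>S. s < t}"
        using a by (intro psubset_card_mono fin) auto
      ultimately show ?thesis using less.hyps[of a] a(1) F[of a t] by simp
    qed simp
  qed
  show ?thesis by (rule all[symmetric]) (use S(2) in simp)
qed

text \<open>\<open>Q c\<close> is meaningful while the curve stays in the chart \<open>c\<close>.
  Choosing a chart \<open>C t\<close> at every time gives one function \<open>F\<close> on the whole
  interval; near \<open>t\<close> it agrees with \<open>Q (C t)\<close>, so its derivative on each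
  segment is zero.\<close>

lemma chartwise_constant:
  fixes Q :: "('m::topological_space, 'n::finite) chart \<Rightarrow> real \<Rightarrow> real"
  assumes charts: "\<And>c. c \<in> A \<Longrightarrow> open (fst c)"
    and \<gamma>: "C1_curve_subdiv A S \<gamma>"
    and ind: "\<And>c c' t. c \<in> A \<Longrightarrow> c' \<in> A \<Longrightarrow> t \<in> {0..1} \<Longrightarrow> \<gamma> t \<in> fst c \<Longrightarrow> \<gamma> t \<in> fst c' \<Longrightarrow> Q c t = Q c' t"
    and deriv: "\<And>c a b t. c \<in> A \<Longrightarrow> (a, b) \<in> segments S \<Longrightarrow> t \<in> {a..b} \<Longrightarrow> \<gamma> t \<in> fst c \<Longrightarrow>
      (Q c has_vector_derivative 0) (at t within {a..b})"
    and c: "c \<in> A" "\<gamma> 0 \<in> fst c" and c': "c' \<in> A" "\<gamma> 1 \<in> fst c'"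
  shows "Q c 0 = Q c' 1"
proof -
  have S: "finite S" "{0, 1} \<subseteq> S" "S \<subseteq> {0..1}" and cont: "continuous_on {0..1} \<gamma>"
    and img: "\<And>t. t \<in> {0..1} \<Longrightarrow> \<gamma> t \<in> manifold_carrier A"
    using \<gamma> by (auto simp: C1_curve_subdiv_def path_def path_image_def)
  define C where "C t = (SOME c. c \<in> A \<and> \<gamma> t \<in> fst c)" for t
  have C: "C t \<in> A \<and> \<gamma> t \<in> fst (C t)" if "t \<in> {0..1}" for t
  proof -
    have "\<exists>c. c \<in> A \<and> \<gamma> t \<in> fst c" using img[OF that] by (auto simp: manifold_carrier_def)
    thus ?thesis unfolding C_def by (rule someI_ex)
  qed
  define F where "F t = Q (C t) t" for t
  have "F a = F b" if ab: "(a, b) \<in> segments S" for a b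
  proof -
    have le: "a < b" and sub: "{a..b} \<subseteq> {0..1}" using ab S(3) by (auto simp: segments_def)
    have "(F has_vector_derivative 0) (at t within {a..b})" if t: "t \<in> {a..b}" for t
    proof -
      have t01: "t \<in> {0..1}" using t sub by blast
      obtain T where T: "open T" "t \<in> T" "\<forall>s\<in>{0..1}. s \<in> T \<longrightarrow> \<gamma> s \<in> fst (C t)"
        using cont charts[of "C t"] C[OF t01] t01 unfolding continuous_on_topological by metis
      then obtain d where d: "d > 0" "ball t d \<subseteq> T" using open_contains_ball by blast
      have eq: "Q (C t) s = F s" if "s \<in> {a..b}" "dist s t < d" for s
      proof -
        have s01: "s \<in> {0..1}" using that sub by blast
        have "s \<in> T" using that d(2) by (auto simp: dist_commute)
        hence "\<gamma> s \<in> fst (C t)" using T(3) s01 by blast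
        thus ?thesis unfolding F_def using ind[of "C t" "C s" s] C[OF t01] C[OF s01] s01 by blast
      qed
      show ?thesis
        by (rule has_vector_derivative_transform_within[OF deriv[OF _ ab t] d(1) t eq]) (use C[OF t01] in auto)
    qed
    then obtain k where "\<And>x. x \<in> {a..b} \<Longrightarrow> F x = k"
      using has_vector_derivative_zero_constant[of "{a..b}" F] by (metis convex_real_interval(5))
    thus ?thesis using le by (metis atLeastAtMost_iff order_refl less_imp_le)
  qed
  hence "F 0 = F 1" by (rule chain_constant_on_subdivision[OF S])
  moreover have "F 0 = Q c 0" unfolding F_def using ind[of "C 0" c 0] C[of 0] c by simp
  moreover have "F 1 = Q c' 1" unfolding F_def using ind[of "C 1" c' 1] C[of 1] c' by simp
  ultimately show ?thesis by simp
qed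

section \<open>Holonomy invariance of metric and curvature, and the Einstein condition\<close>

locale symmetric_manifold =
  fixes A :: "('m::topological_space, 'n::finite) chart set" and g :: "('m, 'n) chart \<Rightarrow> 'n metric"
  assumes atlas: "smooth_atlas A" and metric: "riemannian_metric A g" and symmetric: "locally_symmetric A g"
begin

lemma chart: "c \<in> A \<Longrightarrow> is_chart c"
  using atlas by (simp add: smooth_atlas_def)

lemma open_chart: "c \<in> A \<Longrightarrow> open (fst c)"
  using chart by (simp add: is_chart_def)

lemma symmetric_chart: "c \<in> A \<Longrightarrow> symmetric_chart (g c) (snd c ` fst c)"
proof (intro symmetric_chart.intro symmetric_chart_axioms.intro chart_metric.intro)
  assume c: "c \<in> A"
  show "open (snd c ` fst c)" using chart[OF c] by (simp add: is_chart_def)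
  show "smooth_on (snd c ` fst c) (g c)" using metric c by (simp add: riemannian_metric_def)
  show "transpose (g c x) = g c x" if "x \<in> snd c ` fst c" for x
    using metric c that unfolding riemannian_metric_def by blast
  show "0 < inner_at (g c) x v v" if "x \<in> snd c ` fst c" "v \<noteq> 0" for x v
    using metric c that unfolding riemannian_metric_def by blast
  show "nabla_curv (g c) x m i j k l = 0" if "x \<in> snd c ` fst c" for x m i j k l
    using symmetric c that unfolding locally_symmetric_def by blast
qed

lemma inj_chart: "c \<in> A \<Longrightarrow> inj_on (snd c) (fst c)"
  using chart[of c] by (metis is_chart_def homeomorphism_apply1 inj_on_inverseI)

lemma open_chart_image:
  assumes c: "c \<in> A" and T: "open T" "T \<subseteq> fst c"
  shows "open (snd c ` T)"
proof -
  obtain \<psi> where \<psi>: "homeomorphism (fst c) (snd c ` fst c) (snd c) \<psi>" and o: "open (snd c ` fst c)"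
    using chart[OF c] unfolding is_chart_def by (elim conjE exE)
  have "openin (top_of_set (fst c)) T" using T by (simp add: open_subset)
  hence "openin (top_of_set (snd c ` fst c)) (snd c ` T)" by (rule homeomorphism_imp_open_map[OF \<psi>])
  thus ?thesis using o openin_open_trans by blast
qed

lemma transition_apply: "c \<in> A \<Longrightarrow> p \<in> fst c \<Longrightarrow> transition c c' (snd c p) = snd c' p"
  using inj_chart[of c] by (simp add: transition_def)

lemma chart_change:
  assumes c: "c \<in> A" "c' \<in> A"
  shows "chart_change (g c) (snd c ` fst c) (g c') (snd c' ` fst c') (transition c c') (snd c ` (fst c \<inter> fst c'))"
proof (intro chart_change.intro chart_change_axioms.intro)
  show "chart_metric (g c) (snd c ` fst c)" "chart_metric (g c') (snd c' ` fst c')"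
    by (rule symmetric_chart.axioms(1)[OF symmetric_chart], rule c)+
  show "open (snd c ` (fst c \<inter> fst c'))"
    using open_chart_image[OF c(1)] open_chart[OF c(1)] open_chart[OF c(2)] by (simp add: open_Int)
  show "snd c ` (fst c \<inter> fst c') \<subseteq> snd c ` fst c" by blast
  show "transition c c' ` snd c ` (fst c \<inter> fst c') \<subseteq> snd c' ` fst c'"
    using transition_apply[OF c(1), of _ c'] by auto
  show "smooth_on (snd c ` (fst c \<inter> fst c')) (transition c c')"
    using atlas c unfolding smooth_atlas_def by blast
  show "inner_at (g c) x u v = inner_at (g c') (transition c c' x) (frechet_derivative (transition c c') (at x) u)
      (frechet_derivative (transition c c') (at x) v)" if "x \<in> snd c ` (fst c \<inter> fst c')" for x u v
    using metric c that unfolding riemannian_metric_def by blast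
qed

lemma change_of_chart:
  assumes c: "c \<in> A" "c' \<in> A" and p: "p \<in> fst c" "p \<in> fst c'"
  defines "D \<equiv> frechet_derivative (transition c c') (at (snd c p))"
  shows "inner_at (g c) (snd c p) u v = inner_at (g c') (snd c' p) (D u) (D v)"
    and "curv_form (g c) (snd c p) u v w z = curv_form (g c') (snd c' p) (D u) (D v) (D w) (D z)"
proof -
  interpret X: chart_change "g c" "snd c ` fst c" "g c'" "snd c' ` fst c'" "transition c c'" "snd c ` (fst c \<inter> fst c')"
    by (rule chart_change[OF c])
  have x: "snd c p \<in> snd c ` (fst c \<inter> fst c')" using p by blast
  show "inner_at (g c) (snd c p) u v = inner_at (g c') (snd c' p) (D u) (D v)"
    using X.isometry[OF x, of u v] by (simp add: D_def transition_apply[OF c(1) p(1)])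
  show "curv_form (g c) (snd c p) u v w z = curv_form (g c') (snd c' p) (D u) (D v) (D w) (D z)"
    using X.curv_form_transform[OF x, of u v w z] by (simp add: D_def X.J_eq[OF x] transition_apply[OF c(1) p(1)])
qed

lemma parallel_coordinates:
  assumes \<gamma>: "C1_curve_subdiv A S \<gamma>" and c: "c \<in> A" and ab: "(a, b) \<in> segments S" and t: "t \<in> {a..b}" "\<gamma> t \<in> fst c"
  shows "((\<lambda>r. snd c (\<gamma> r)) has_vector_derivative vector_derivative (snd c \<circ> \<gamma>) (at t within {a..b})) (at t within {a..b})"
    and "parallel_along A g S \<gamma> V \<Longrightarrow> (V c has_vector_derivative
      - conn (g c) (snd c (\<gamma> t)) (vector_derivative (snd c \<circ> \<gamma>) (at t within {a..b})) (V c t)) (at t within {a..b})"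
proof -
  have "(snd c \<circ> \<gamma>) differentiable (at t within {a..b})"
    using \<gamma> c ab t unfolding C1_curve_subdiv_def by fastforce
  thus "((\<lambda>r. snd c (\<gamma> r)) has_vector_derivative vector_derivative (snd c \<circ> \<gamma>) (at t within {a..b})) (at t within {a..b})"
    unfolding vector_derivative_works by (simp add: o_def)
next
  let ?d = "vector_derivative (snd c \<circ> \<gamma>) (at t within {a..b})"
  assume "parallel_along A g S \<gamma> V"
  hence "(V c has_vector_derivative (\<chi> k. - (\<Sum>i\<in>UNIV. \<Sum>j\<in>UNIV. christoffel (g c) (snd c (\<gamma> t)) k i j * ?d $ i * V c t $ j))) (at t within {a..b})"
    using c ab t unfolding parallel_along_def by fastforce
  moreover have "(\<chi> k. - (\<Sum>i\<in>UNIV. \<Sum>j\<in>UNIV. christoffel (g c) (snd c (\<gamma> t)) k i j * ?d $ i * V c t $ j)) = - conn (g c) (snd c (\<gamma> t)) ?d (V c t)"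
    by (simp add: conn_def vec_eq_iff)
  ultimately show "(V c has_vector_derivative - conn (g c) (snd c (\<gamma> t)) ?d (V c t)) (at t within {a..b})" by (simp only:)
qed

lemma parallel_change_of_chart:
  assumes "parallel_along A g S \<gamma> V" "c \<in> A" "c' \<in> A" "t \<in> {0..1}" "\<gamma> t \<in> fst c" "\<gamma> t \<in> fst c'"
  shows "V c' t = frechet_derivative (transition c c') (at (snd c (\<gamma> t))) (V c t)"
  using assms unfolding parallel_along_def by blast

lemma parallel_inner_at:
  assumes \<gamma>: "C1_curve_subdiv A S \<gamma>" "\<gamma> 0 = q" "\<gamma> 1 = q" and c: "c \<in> A" "q \<in> fst c"
    and V: "parallel_along A g S \<gamma> V" and W: "parallel_along A g S \<gamma> W"
  shows "inner_at (g c) (snd c q) (V c 0) (W c 0) = inner_at (g c) (snd c q) (V c 1) (W c 1)"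
proof -
  let ?Q = "\<lambda>c t. inner_at (g c) (snd c (\<gamma> t)) (V c t) (W c t)"
  have "?Q c 0 = ?Q c 1"
  proof (rule chartwise_constant[OF open_chart \<gamma>(1), where Q = ?Q])
    fix c c' t assume "c \<in> A" "c' \<in> A" "t \<in> {0..1}" "\<gamma> t \<in> fst c" "\<gamma> t \<in> fst c'"
    thus "?Q c t = ?Q c' t"
      by (simp only: parallel_change_of_chart[OF V, of c c' t] parallel_change_of_chart[OF W, of c c' t]) (rule change_of_chart(1))
  next
    fix c a b t assume c: "c \<in> A" and ab: "(a, b) \<in> segments S" and t: "t \<in> {a..b}" "\<gamma> t \<in> fst c"
    interpret C: symmetric_chart "g c" "snd c ` fst c" by (rule symmetric_chart[OF c])
    show "(?Q c has_vector_derivative 0) (at t within {a..b})"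
      by (rule C.inner_at_parallel[where s = "\<lambda>r. snd c (\<gamma> r)", OF _ parallel_coordinates(1)[OF \<gamma>(1) c ab t]
            parallel_coordinates(2)[OF \<gamma>(1) c ab t V] parallel_coordinates(2)[OF \<gamma>(1) c ab t W]]) (use t in blast)
  qed (use c \<gamma> in auto)
  thus ?thesis by (simp only: \<gamma>)
qed

lemma parallel_curv_form:
  assumes \<gamma>: "C1_curve_subdiv A S \<gamma>" "\<gamma> 0 = q" "\<gamma> 1 = q" and c: "c \<in> A" "q \<in> fst c"
    and V: "\<And>i. parallel_along A g S \<gamma> (V i)"
  shows "curv_form (g c) (snd c q) (V i c 0) (V j c 0) (V k c 0) (V l c 0)
    = curv_form (g c) (snd c q) (V i c 1) (V j c 1) (V k c 1) (V l c 1)"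
proof -
  let ?Q = "\<lambda>c t. curv_form (g c) (snd c (\<gamma> t)) (V i c t) (V j c t) (V k c t) (V l c t)"
  have "?Q c 0 = ?Q c 1"
  proof (rule chartwise_constant[OF open_chart \<gamma>(1), where Q = ?Q])
    fix c c' t assume "c \<in> A" "c' \<in> A" "t \<in> {0..1}" "\<gamma> t \<in> fst c" "\<gamma> t \<in> fst c'"
    thus "?Q c t = ?Q c' t"
      by (simp only: parallel_change_of_chart[OF V, of c c' t]) (rule change_of_chart(2))
  next
    fix c a b t assume c: "c \<in> A" and ab: "(a, b) \<in> segments S" and t: "t \<in> {a..b}" "\<gamma> t \<in> fst c"
    interpret C: symmetric_chart "g c" "snd c ` fst c" by (rule symmetric_chart[OF c])
    show "(?Q c has_vector_derivative 0) (at t within {a..b})"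
      by (rule C.curv_form_parallel[where s = "\<lambda>r. snd c (\<gamma> r)" and V = "\<lambda>i. V i c", OF _ parallel_coordinates(1)[OF \<gamma>(1) c ab t]
            parallel_coordinates(2)[OF \<gamma>(1) c ab t V]]) (use t in blast)
  qed (use c \<gamma> in auto)
  thus ?thesis by (simp only: \<gamma>)
qed

text \<open>The eigenspace \<open>W\<close> of Ric relative to g for one eigenvalue is nonzero and
  preserved by the restricted holonomy, hence the whole tangent space.\<close>

lemma irreducible_einstein:
  assumes irr: "irreducible_manifold A g" and c: "c \<in> A" "q \<in> fst c" and e: "orthonormal_frame (g c) (snd c q) e"
  shows "\<exists>\<rho>. \<forall>i j. (\<Sum>k\<in>UNIV. curv_form (g c) (snd c q) (e i) (e k) (e j) (e k)) = (if i = j then \<rho> else 0)"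
proof -
  let ?x = "snd c q"
  let ?g = "inner_at (g c) ?x" and ?R = "curv_form (g c) ?x"
  interpret C: symmetric_chart "g c" "snd c ` fst c" by (rule symmetric_chart[OF c(1)])
  have x: "?x \<in> snd c ` fst c" using c by blast
  define ric where "ric u v = (\<Sum>k\<in>UNIV. ?R u (e k) v (e k))" for u v
  have lric: "linear (\<lambda>u. ric u v)" "linear (ric u)" for u v
    unfolding ric_def by (intro linear_compose_sum ballI linear_curv_form)+
  have ee: "?g (e i) (e j) = (if i = j then 1 else 0)" for i j using e unfolding orthonormal_frame_def by blast
  define M :: "real^'n^'n" where "M = (\<chi> i j. ric (e i) (e j))"
  have "ric u v = ric v u" for u v unfolding ric_def by (intro sum.cong refl C.curv_form_pair[OF x])
  hence "transpose M = M" by (simp add: M_def transpose_def vec_eq_iff)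
  then obtain b :: "'n \<Rightarrow> real^'n" and s where b: "onb UNIV UNIV b" and s: "\<And>i. M *v b i = s i *\<^sub>R b i"
    by (rule symmetric_eigenbasis) (rule that)
  have bb: "b i \<bullet> b i = 1" for i using onb_D(3)[OF b, of i i] by simp
  \<comment> \<open>\<open>undefined\<close> serves as some index: any eigenvector of the Ricci
    matrix will do.\<close>
  define a where "a = b undefined"
  define \<mu> where "\<mu> = s undefined"
  have a: "M *v a = \<mu> *\<^sub>R a" "a \<noteq> 0" using s[of undefined] bb[of undefined] by (auto simp: a_def \<mu>_def)
  define W where "W = {v. \<forall>w. ric v w = \<mu> * ?g v w}"
  have WI: "v \<in> W" if f: "span (range f) = UNIV" and eq: "\<And>i. ric v (f i) = \<mu> * ?g v (f i)" for v and f :: "'n \<Rightarrow> real^'n"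
  proof -
    have "linear (\<lambda>w. \<mu> *\<^sub>R ?g v w)" by (intro linear_compose_scale_right linear_inner_at)
    hence "ric v w = \<mu> *\<^sub>R ?g v w" for w
      by (rule linear_eq_spanning[OF lric(2) _ f]) (use eq in auto)
    thus ?thesis by (simp add: W_def)
  qed
  have sub: "subspace W"
    unfolding subspace_def W_def
    by (auto simp: linear_add[OF lric(1)] linear_add[OF linear_inner_at(1)] linear_scale[OF lric(1)] linear_scale[OF linear_inner_at(1)]
        linear_0[OF lric(1)] linear_0[OF linear_inner_at(1)] ring_distribs)
  have inv: "P ` W \<subseteq> W" if P: "P \<in> restricted_holonomy A g c q" for P
  proof
    obtain \<gamma> S where \<gamma>: "C1_curve_subdiv A S \<gamma>" "\<gamma> 0 = q" "\<gamma> 1 = q"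
      and "\<forall>v. \<exists>V. parallel_along A g S \<gamma> V \<and> V c 0 = v \<and> V c 1 = P v"
      using P unfolding restricted_holonomy_def pathstart_def pathfinish_def by blast
    then obtain V where V: "parallel_along A g S \<gamma> (V v)" "V v c 0 = v" "V v c 1 = P v" for v by metis
    have Pg: "?g (P u) (P v) = ?g u v" for u v
      using parallel_inner_at[OF \<gamma> c V(1)[of u] V(1)[of v]] by (simp add: V)
    have PR: "?R (P u) (P v) (P w) (P z) = ?R u v w z" for u v w z
      using parallel_curv_form[where V = V and i = u and j = v and k = w and l = z, OF \<gamma> c V(1)] by (simp add: V)
    \<comment> \<open>Preserving g makes the image of the frame under \<open>P\<close> a frame
      again. Testing against this frame proves invariance of \<open>W\<close> from values of
      \<open>P\<close> on vectors, with R preserved.\<close>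
    have f: "orthonormal_frame (g c) ?x (\<lambda>i. P (e i))" unfolding orthonormal_frame_def by (simp add: Pg ee)
    fix v' assume "v' \<in> P ` W"
    then obtain v where v: "v' = P v" "v \<in> W" by blast
    have "ric (P v) (P (e i)) = \<mu> * ?g (P v) (P (e i))" for i
    proof -
      have "ric (P v) (P (e i)) = (\<Sum>k\<in>UNIV. ?R (P v) (P (e k)) (P (e i)) (P (e k)))"
        unfolding ric_def
        by (rule C.frame_trace[OF x e f, where B = "\<lambda>y y'. ?R (P v) y (P (e i)) y'"]) (rule linear_curv_form)+
      also have "\<dots> = ric v (e i)" by (simp only: PR ric_def)
      finally show ?thesis using v(2) by (simp add: W_def Pg)
    qed
    thus "v' \<in> W" unfolding v by (rule WI[OF frame_spanning[OF f]])
  qed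
  have W: "W = {0} \<or> W = UNIV"
    by (rule mp[OF spec[OF bspec[OF bspec[OF irr[unfolded irreducible_manifold_def] c(1)] c(2)]] conjI[OF sub ballI[OF inv]]])
  \<comment> \<open>The eigenvector \<open>a\<close> of the Ricci matrix, turned from frame
    coordinates into a tangent vector.\<close>
  define v where "v = (\<Sum>i\<in>UNIV. a $ i *\<^sub>R e i)"
  have gv: "?g v (e j) = a $ j" for j
    unfolding v_def linear_sum[OF linear_inner_at(1)] linear_scale[OF linear_inner_at(1)] ee
    by (simp add: if_distrib[of "\<lambda>r. _ * r"] cong: if_cong)
  have "ric v (e j) = \<mu> * ?g v (e j)" for j
  proof -
    have "ric v (e j) = (\<Sum>i\<in>UNIV. a $ i * ric (e i) (e j))"
      unfolding v_def linear_sum[OF lric(1)] linear_scale[OF lric(1)] by simp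
    also have "\<dots> = (transpose M *v a) $ j" by (simp add: matrix_vector_mult_def transpose_def M_def mult.commute)
    finally show ?thesis using a(1) \<open>transpose M = M\<close> gv by simp
  qed
  hence "v \<in> W" by (rule WI[OF frame_spanning[OF e]])
  moreover have "v \<noteq> 0"
  proof
    assume "v = 0"
    hence "a $ j = 0" for j using gv[of j] linear_0[OF linear_inner_at(1)] by metis
    thus False using a(2) by (simp add: vec_eq_iff)
  qed
  ultimately have "W = UNIV" using W by blast
  hence "ric (e i) (e j) = \<mu> * ?g (e i) (e j)" for i j unfolding W_def by blast
  hence "(\<Sum>k\<in>UNIV. ?R (e i) (e k) (e j) (e k)) = (if i = j then \<mu> else 0)" for i j by (simp add: ric_def ee)
  thus ?thesis by blast
qed

end

section \<open>Constancy of the sectional curvature\<close>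

text \<open>The vector g(u,u) v - g(u,v) u is an unnormalised Gram--Schmidt step, and its squared
  length is g(u,u) times the Gram determinant.\<close>

lemma (in chart_metric) gram_positive:
  assumes x: "x \<in> U" and uv: "u \<noteq> v" "independent {u, v}"
  shows "0 < inner_at G x u u * inner_at G x v v - (inner_at G x u v)\<^sup>2"
proof -
  let ?g = "inner_at G x"
  have v: "v \<notin> span {u}" and u: "u \<noteq> 0"
    using uv independent_insert[of v "{u}"] dependent_zero[of "{u, v}"] by (auto simp: insert_commute)
  have uu: "?g u u > 0" by (rule pos_G[OF x u])
  have "?g u u *\<^sub>R v - ?g u v *\<^sub>R u \<noteq> 0"
  proof
    assume "?g u u *\<^sub>R v - ?g u v *\<^sub>R u = 0"
    hence "(1 / ?g u u) *\<^sub>R (?g u u *\<^sub>R v) = (1 / ?g u u) *\<^sub>R (?g u v *\<^sub>R u)" by simp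
    hence "v = (?g u v / ?g u u) *\<^sub>R u" using uu by simp
    thus False using v by (metis span_base span_scale singletonI)
  qed
  hence "0 < ?g (?g u u *\<^sub>R v - ?g u v *\<^sub>R u) (?g u u *\<^sub>R v - ?g u v *\<^sub>R u)" by (rule pos_G[OF x])
  also have "\<dots> = ?g u u * (?g u u * ?g v v - (?g u v)\<^sup>2)"
    unfolding linear_diff[OF linear_inner_at(1)] linear_diff[OF linear_inner_at(2)]
      linear_scale[OF linear_inner_at(1)] linear_scale[OF linear_inner_at(2)] inner_at_commute[OF x, of v u]
    by (simp add: algebra_simps power2_eq_square)
  finally show ?thesis using uu by (simp add: zero_less_mult_iff)
qed

text \<open>Takes the place of Schur's lemma and covers dimension two. Where R has the form of
  constant curvature \<kappa>, \<nabla>R = 0 puts the derivatives of numerator and denominator in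
  the ratio \<kappa>, so the quotient is stationary.\<close>

lemma (in symmetric_chart) sectional_curvature_stationary:
  assumes x: "x \<in> U" and uv: "u \<noteq> v" "independent {u, v}"
    and \<kappa>: "\<forall>u v w z. curv_form G x u v w z = \<kappa> * (inner_at G x u w * inner_at G x v z - inner_at G x u z * inner_at G x v w)"
  shows "sectional_curvature G x u v = \<kappa>"
    and "((\<lambda>y. sectional_curvature G y u v) has_derivative (\<lambda>m. 0)) (at x)"
proof -
  define q where "q y = inner_at G y u u * inner_at G y v v - inner_at G y u v * inner_at G y u v" for y
  define d where "d a b m = inner_at G x (conn G x m a) b + inner_at G x a (conn G x m b)" for a b m
  define q' where "q' m = (inner_at G x u u * d v v m + d u u m * inner_at G x v v) - (inner_at G x u v * d u v m + d u v m * inner_at G x u v)" for m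
  have q0: "q x > 0" using gram_positive[OF x uv] by (simp add: q_def power2_eq_square)
  have R: "curv_form G x u v u v = \<kappa> * q x"
    using \<kappa> inner_at_commute[OF x, of v u] by (simp add: q_def)
  thus "sectional_curvature G x u v = \<kappa>"
    using q0 by (simp add: sectional_curvature_def q_def power2_eq_square)
  have q': "(q has_derivative q') (at x)"
    unfolding q_def q'_def d_def by (intro has_derivative_diff has_derivative_mult has_derivative_inner_at[OF x])
  have "cov x u v u v m = \<kappa> * q' m" for m
    unfolding cov_def \<kappa>[rule_format] q'_def d_def
    using inner_at_commute[OF x, of v u] inner_at_commute[OF x, of v "conn G x m v"] inner_at_commute[OF x, of u "conn G x m u"]
      inner_at_commute[OF x, of v "conn G x m u"] inner_at_commute[OF x, of u "conn G x m v"]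
    by (simp add: algebra_simps)
  hence "(\<lambda>m. (cov x u v u v m * q x - curv_form G x u v u v * q' m) / (q x * q x)) = (\<lambda>m. 0)"
    unfolding R by (simp add: fun_eq_iff)
  moreover have "((\<lambda>y. curv_form G y u v u v / q y) has_derivative
      (\<lambda>m. (cov x u v u v m * q x - curv_form G x u v u v * q' m) / (q x * q x))) (at x)"
    using q0 by (intro has_derivative_divide' has_derivative_curv_form[OF x] q') simp
  ultimately show "((\<lambda>y. sectional_curvature G y u v) has_derivative (\<lambda>m. 0)) (at x)"
    by (simp add: sectional_curvature_def q_def power2_eq_square)
qed

context symmetric_manifold
begin

definition curvature_at :: "('m, 'n) chart \<Rightarrow> 'm \<Rightarrow> real \<Rightarrow> bool" where
  "curvature_at c p \<kappa> \<longleftrightarrow> (\<forall>u v w z. curv_form (g c) (snd c p) u v w z =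
     \<kappa> * (inner_at (g c) (snd c p) u w * inner_at (g c) (snd c p) v z - inner_at (g c) (snd c p) u z * inner_at (g c) (snd c p) v w))"

lemma sectional_curvature_eq:
  assumes "c \<in> A" "p \<in> fst c" "curvature_at c p \<kappa>" "u \<noteq> v" "independent {u, v}"
  shows "sectional_curvature (g c) (snd c p) u v = \<kappa>"
  using symmetric_chart.sectional_curvature_stationary(1)[OF symmetric_chart[OF assms(1)] imageI[OF assms(2)] assms(4,5)] assms(3)
  unfolding curvature_at_def by blast

text \<open>The sectional curvature of one coordinate plane measures \<kappa>. It is stationary on a
  ball in a chart and independent of the chart because \<open>curvature_at\<close> is tensorial;
  connectedness then makes it constant.\<close>

lemma constant_curvature_if_pointwise:
  assumes dim: "CARD('n) \<ge> 2" and conn: "connected (manifold_carrier A)"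
    and pt: "\<And>c p. c \<in> A \<Longrightarrow> p \<in> fst c \<Longrightarrow> \<exists>\<kappa>. curvature_at c p \<kappa>"
  shows "constant_curvature A g"
proof -
  obtain a b :: 'n where ab: "a \<noteq> b" using dim by (metis card_2_iff' card_le_Suc0_iff_eq finite UNIV_I not_less_eq_eq numeral_2_eq_2)
  let ?u = "axis a 1 :: real^'n" and ?v = "axis b 1 :: real^'n"
  have uv: "?u \<noteq> ?v" using ab by (simp add: axis_eq_axis)
  have "{?u, ?v} \<subseteq> Basis" by (auto simp: Basis_vec_def)
  hence ind: "independent {?u, ?v}" by (rule independent_mono[OF independent_Basis])
  define k where "k c p = sectional_curvature (g c) (snd c p) ?u ?v" for c p
  have k: "curvature_at c p (k c p)" if c: "c \<in> A" "p \<in> fst c" for c p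
    using pt[OF c] sectional_curvature_eq[OF c _ uv ind] by (auto simp: k_def)
  have k_chart: "k c p = k c' p" if c: "c \<in> A" "c' \<in> A" and p: "p \<in> fst c" "p \<in> fst c'" for c c' p
  proof -
    have "curvature_at c p (k c' p)"
      using k[OF c(2) p(2)] unfolding curvature_at_def change_of_chart[OF c p] by blast
    thus ?thesis using sectional_curvature_eq[OF c(1) p(1) _ uv ind] by (simp add: k_def)
  qed
  define C where "C p = (SOME c. c \<in> A \<and> p \<in> fst c)" for p
  have C: "C p \<in> A \<and> p \<in> fst (C p)" if "p \<in> manifold_carrier A" for p
    unfolding C_def by (rule someI_ex) (use that in \<open>auto simp: manifold_carrier_def\<close>)
  have K: "k (C p) p = k c p" if "c \<in> A" "p \<in> fst c" for c p
  proof -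
    have "p \<in> manifold_carrier A" using that by (auto simp: manifold_carrier_def)
    thus ?thesis using k_chart[of "C p" c p] C that by blast
  qed
  have loc: "\<exists>T. openin (top_of_set (manifold_carrier A)) T \<and> p \<in> T \<and> (\<forall>p'\<in>T. k (C p') p' = k (C p) p)"
    if p: "p \<in> manifold_carrier A" for p
  proof -
    let ?c = "C p"
    have c: "?c \<in> A" "p \<in> fst ?c" using C[OF p] by auto
    interpret S: symmetric_chart "g ?c" "snd ?c ` fst ?c" by (rule symmetric_chart[OF c(1)])
    obtain r where r: "r > 0" "ball (snd ?c p) r \<subseteq> snd ?c ` fst ?c"
      using S.open_U c(2) open_contains_ball by blast
    have stat: "((\<lambda>y. sectional_curvature (g ?c) y ?u ?v) has_derivative (\<lambda>m. 0)) (at y within ball (snd ?c p) r)"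
      if y: "y \<in> ball (snd ?c p) r" for y
    proof -
      obtain p' where p': "p' \<in> fst ?c" "y = snd ?c p'" using y r(2) by blast
      show ?thesis using k[OF c(1) p'(1)] unfolding curvature_at_def p'(2)
        by (rule has_derivative_at_withinI[OF S.sectional_curvature_stationary(2)[OF imageI[OF p'(1)] uv ind]])
    qed
    have "\<exists>\<kappa>. \<forall>y\<in>ball (snd ?c p) r. sectional_curvature (g ?c) y ?u ?v = \<kappa>"
      by (rule has_derivative_zero_constant[OF convex_ball]) (rule stat)
    then obtain \<kappa> where \<kappa>: "\<forall>y\<in>ball (snd ?c p) r. sectional_curvature (g ?c) y ?u ?v = \<kappa>" by (elim exE)
    define T where "T = snd ?c -` ball (snd ?c p) r \<inter> fst ?c"
    have "continuous_on (fst ?c) (snd ?c)" using chart[OF c(1)] unfolding is_chart_def homeomorphism_def by blast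
    hence "open T" unfolding T_def using continuous_on_open_vimage[OF open_chart[OF c(1)]] by blast
    moreover have "T \<subseteq> manifold_carrier A" using c(1) by (auto simp: T_def manifold_carrier_def)
    ultimately have "openin (top_of_set (manifold_carrier A)) T" by (rule open_subset[rotated])
    moreover have "p \<in> T" using c r by (simp add: T_def)
    moreover have "k (C p') p' = k ?c p" if "p' \<in> T" for p'
      using that K[OF c(1), of p'] bspec[OF \<kappa>, of "snd ?c p'"] bspec[OF \<kappa>, of "snd ?c p"] r(1) by (simp add: T_def k_def)
    ultimately show ?thesis by blast
  qed
  have "(\<lambda>p. k (C p) p) constant_on manifold_carrier A" by (rule locally_constant_imp_constant[OF conn loc])
  then obtain \<kappa> where \<kappa>: "\<And>p. p \<in> manifold_carrier A \<Longrightarrow> k (C p) p = \<kappa>" unfolding constant_on_def by blast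
  show ?thesis
    unfolding constant_curvature_def
  proof (intro exI[of _ \<kappa>] ballI allI impI)
    fix c x and u v :: "real^'n"
    assume c: "c \<in> A" and "x \<in> snd c ` fst c" and uv': "u \<noteq> v \<and> independent {u, v}"
    then obtain p where p: "p \<in> fst c" "x = snd c p" by blast
    have "p \<in> manifold_carrier A" using c p(1) by (auto simp: manifold_carrier_def)
    hence "k c p = \<kappa>" using \<kappa> K[OF c p(1)] by simp
    thus "sectional_curvature (g c) x u v = \<kappa>"
      using sectional_curvature_eq[OF c p(1) k[OF c p(1)]] uv' p(2) by simp
  qed
qed

end

theorem mainTheorem3:
  fixes A :: "('m::{t2_space, second_countable_topology}, 'n::finite) chart set"
    and g :: "('m, 'n) chart \<Rightarrow> 'n metric"
    and N :: real
  assumes "CARD('n) \<ge> 2"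
    and "smooth_atlas A"
    and "connected (manifold_carrier A)"
    and "riemannian_metric A g"
    and "irreducible_manifold A g"
    and "locally_symmetric A g"
    and "1 \<le> N" and "N \<le> (real CARD('n) - 1) * (real CARD('n) + 2) / 2"
    and "N < 3 * real CARD('n) / 2 * ((real CARD('n) + 2) / (real CARD('n) + 4))"
    and "second_kind_nonneg N A g \<or> second_kind_nonpos N A g"
  shows "constant_curvature A g"
proof -
  interpret symmetric_manifold A g by (rule symmetric_manifold.intro) fact+
  show ?thesis
  proof (rule constant_curvature_if_pointwise)
    fix c p assume c: "c \<in> A" "p \<in> fst c"
    interpret C: symmetric_chart "g c" "snd c ` fst c" by (rule symmetric_chart[OF c(1)])
    have x: "snd c p \<in> snd c ` fst c" using c by blast
    obtain e where e: "orthonormal_frame (g c) (snd c p) e" using C.orthonormal_frame_exists[OF x] by (elim exE)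
    obtain \<rho> where "\<forall>i j. (\<Sum>k\<in>UNIV. curv_form (g c) (snd c p) (e i) (e k) (e j) (e k)) = (if i = j then \<rho> else 0)"
      using irreducible_einstein[OF assms(5) c e] by (elim exE)
    hence ein: "(\<Sum>k\<in>UNIV. curv_form (g c) (snd c p) (e i) (e k) (e j) (e k)) = (if i = j then \<rho> else 0)" for i j by (elim allE)
    have "lowest_eigenvalue_sum N (eigenvalue_list tracefree_sym (curv_op_second (g c) (snd c p) e)) \<ge> 0 \<or>
      lowest_eigenvalue_sum N (eigenvalue_list tracefree_sym (\<lambda>h. - curv_op_second (g c) (snd c p) e h)) \<ge> 0"
      using assms(10) c(1) x e unfolding second_kind_nonneg_def second_kind_nonpos_def by blast
    from C.pointwise_constant_curvature[OF assms(1) x e ein assms(7,9) this]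
    show "\<exists>\<kappa>. curvature_at c p \<kappa>" unfolding curvature_at_def .
  qed fact+
qed

end
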